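(* Let $\Gamma_1,\Gamma_2$ be two locally perturbed sound-hard surfaces (Neumann boundary condition) with regions $\Omega_j=\{x\in\mathbb R^3: x_3>f_j(\tilde x)\}$, $j=1,2$. Let $d\in\mathbb S^2_-$ and suppose $u^{sc}_{1,\infty}(\hat x;d)=u^{sc}_{2,\infty}(\hat x;d)$ for all $\hat x\in\mathbb S^2_+$. Then $u^{sc}_1(x;d)=u^{sc}_2(x;d)$ for all $x\in\Omega_1\cap\Omega_2$.
   Context: Fix a wave number $k>0$. Write $x=(\tilde x,x_3)\in\mathbb R^3$ with $\tilde x=(x_1,x_2)$, and $\mathbb S^2_\pm=\{x\in\mathbb R^3:|x|=1,\ \pm x_3>0\}$. A locally perturbed surface is $\Gamma=\{(\tilde x,f(\tilde x)):\tilde x\in\mathbb R^2\}$, where $f:\mathbb R^2\to\mathbb R$ is Lipschitz continuous and $f(\tilde x)=0$ for $|\tilde x|>R$ for some $R>\max|f|$; $\Omega=\{x:x_3>f(\tilde x)\}$ is the region above $\Gamma$ and $\nu$ is the unit normal on $\Gamma$ pointing into $\Omega$. For $d=(\alpha,\beta,-\gamma)\in\mathbb S^2_-$ the incident plane wave is $u^{in}(x;d)=e^{ikx\cdot d}$ and its reflected wave from the flat plane $\{x_3=0\}$ is $u^{re}(x;d)=-e^{ik(\alpha x_1+\beta x_2+\gamma x_3)}$ in the Dirichlet case and $u^{re}(x;d)=+e^{ik(\alpha x_1+\beta x_2+\gamma x_3)}$ in the Neumann case. The total field is $u=u^{in}+u^{re}+u^{sc}$, where $u$ satisfies $\Delta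 u+k^2u=0$ in $\Omega$, the boundary condition $u=0$ on $\Gamma$ (sound-soft/Dirichlet) or $\partial_\nu u=0$ on $\Gamma$ (sound-hard/Neumann), and the scattered field $u^{sc}$ satisfies the Sommerfeld radiation condition $\lim_{r\to\infty}r(\partial_ru^{sc}-iku^{sc})=0$, $r=|x|$, $x\in\Omega$; this problem is uniquely solvable. Then $u^{sc}(x;d)=\frac{e^{ik|x|}}{|x|}\{u^{sc}_\infty(\hat x;d)+O(1/|x|)\}$ as $|x|\to\infty$ in $\Omega$, $\hat x=x/|x|\in\mathbb S^2_+$, and $u^{sc}_\infty(\cdot;d)$ is the far-field pattern. Quantities associated with a surface $\Gamma_j=\{x_3=f_j(\tilde x)\}$ carry the index $j$. *)

theory Defs
  imports "HOL-Analysis.Analysis"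
begin

definition horiz :: "real^3 \<Rightarrow> real^2" where
  "horiz x = vector [x$1, x$2]"

definition locally_perturbed :: "(real^2 \<Rightarrow> real) \<Rightarrow> bool" where
  "locally_perturbed f \<longleftrightarrow>
     (\<exists>L. L-lipschitz_on UNIV f) \<and>
     (\<exists>R. (\<forall>y. \<bar>f y\<bar> < R) \<and> (\<forall>y. norm y > R \<longrightarrow> f y = 0))"

definition region :: "(real^2 \<Rightarrow> real) \<Rightarrow> (real^3) set" where
  "region f = {x. x$3 > f (horiz x)}"

definition lower_sphere :: "(real^3) set" where
  "lower_sphere = {d. norm d = 1 \<and> d$3 < 0}"

definition upper_sphere :: "(real^3) set" where
  "upper_sphere = {d. norm d = 1 \<and> d$3 > 0}"

definition u_in :: "real \<Rightarrow> real^3 \<Rightarrow> real^3 \<Rightarrow> complex" where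
  "u_in k d x = exp (\<i> * of_real (k * (x \<bullet> d)))"

text \<open>Reflected wave, Neumann case: + exp(ik(alpha x1 + beta x2 + gamma x3))
  with d = (alpha, beta, -gamma).\<close>
definition u_re_neumann :: "real \<Rightarrow> real^3 \<Rightarrow> real^3 \<Rightarrow> complex" where
  "u_re_neumann k d x = exp (\<i> * of_real (k * (d$1 * x$1 + d$2 * x$2 - d$3 * x$3)))"

definition has_partial_on ::
  "(real^3 \<Rightarrow> 'b::real_normed_vector) \<Rightarrow> 3 \<Rightarrow> (real^3 \<Rightarrow> 'b) \<Rightarrow> (real^3) set \<Rightarrow> bool" where
  "has_partial_on u i g S \<longleftrightarrow>
     (\<forall>x\<in>S. ((\<lambda>t. u (x + t *\<^sub>R axis i 1)) has_vector_derivative g x) (at 0))"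

definition helmholtz_C2 ::
  "real \<Rightarrow> (real^3) set \<Rightarrow> (real^3 \<Rightarrow> complex) \<Rightarrow> (3 \<Rightarrow> real^3 \<Rightarrow> complex) \<Rightarrow> bool" where
  "helmholtz_C2 k S u p \<longleftrightarrow>
     continuous_on S u \<and>
     (\<forall>i. has_partial_on u i (p i) S \<and> continuous_on S (p i)) \<and>
     (\<exists>q. (\<forall>i j. has_partial_on (p i) j (q i j) S \<and> continuous_on S (q i j)) \<and>
          (\<forall>x\<in>S. (\<Sum>i\<in>UNIV. q i i x) + of_real (k^2) * u x = 0))"

definition test_fun :: "(real^3 \<Rightarrow> real) \<Rightarrow> (3 \<Rightarrow> real^3 \<Rightarrow> real) \<Rightarrow> bool" where
  "test_fun \<phi> D\<phi> \<longleftrightarrow>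
     (\<forall>i. has_partial_on \<phi> i (D\<phi> i) UNIV \<and> continuous_on UNIV (D\<phi> i)) \<and>
     bounded {x. \<phi> x \<noteq> 0}"

text \<open>Sound-hard (Neumann) boundary condition on the Lipschitz surface, in the
  standard variational sense: u and grad u are locally square integrable up to the
  boundary, and int_Omega (grad u . grad phi - k^2 u phi) = 0 for all test functions
  phi on R^3 (not required to vanish on the boundary).\<close>
definition weak_neumann ::
  "real \<Rightarrow> (real^3) set \<Rightarrow> (real^3 \<Rightarrow> complex) \<Rightarrow> (3 \<Rightarrow> real^3 \<Rightarrow> complex) \<Rightarrow> bool" where
  "weak_neumann k S u p \<longleftrightarrow>
     (\<forall>r>0. set_integrable lborel (S \<inter> ball 0 r) (\<lambda>x. (cmod (u x))^2) \<and>
            (\<forall>i. set_integrable lborel (S \<inter> ball 0 r) (\<lambda>x. (cmod (p i x))^2))) \<and>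
     (\<forall>\<phi> D\<phi>. test_fun \<phi> D\<phi> \<longrightarrow>
        (let g = (\<lambda>x. (\<Sum>i\<in>UNIV. p i x * of_real (D\<phi> i x)) - of_real (k^2) * u x * of_real (\<phi> x))
         in set_integrable lborel S g \<and> (LINT x:S|lborel. g x) = 0))"

definition radial_deriv :: "(real^3 \<Rightarrow> complex) \<Rightarrow> real^3 \<Rightarrow> complex" where
  "radial_deriv v x = vector_derivative (\<lambda>t. v (t *\<^sub>R sgn x)) (at (norm x))"

definition sommerfeld :: "real \<Rightarrow> (real^3) set \<Rightarrow> (real^3 \<Rightarrow> complex) \<Rightarrow> bool" where
  "sommerfeld k S v \<longleftrightarrow>
     (\<forall>e>0. \<exists>\<rho>. \<forall>x\<in>S. norm x > \<rho> \<longrightarrow>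
        norm x * cmod (radial_deriv v x - \<i> * of_real k * v x) < e)"

definition neumann_scattered ::
  "real \<Rightarrow> (real^2 \<Rightarrow> real) \<Rightarrow> real^3 \<Rightarrow> (real^3 \<Rightarrow> complex) \<Rightarrow> bool" where
  "neumann_scattered k f d usc \<longleftrightarrow>
     (let u = (\<lambda>x. u_in k d x + u_re_neumann k d x + usc x)
      in (\<exists>p. helmholtz_C2 k (region f) u p \<and> weak_neumann k (region f) u p) \<and>
         sommerfeld k (region f) usc)"

text \<open>F is the far-field pattern of v: v(x) = e^{ik|x|}/|x| (F(xhat) + O(1/|x|));
  we record the (implied) directional limit for every xhat in the upper hemisphere.\<close>
definition has_far_field :: "real \<Rightarrow> (real^3 \<Rightarrow> complex) \<Rightarrow> (real^3 \<Rightarrow> complex) \<Rightarrow> bool" where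
  "has_far_field k v F \<longleftrightarrow>
     (\<forall>xh\<in>upper_sphere.
        ((\<lambda>r. of_real r * exp (- \<i> * of_real (k * r)) * v (r *\<^sub>R xh)) \<longlongrightarrow> F xh) at_top)"

end

theory Submission
  imports Defs "HOL-Complex_Analysis.Complex_Analysis"
begin

no_notation fps_nth (infixl "$" 75)

text \<open>
  Outside a large ball the difference \<open>w\<close> of the two fields is a radiating solution of the homogeneous Neumann
  problem in the half space. Conservation of the energy flux and the radiation condition bound the mean square of
  \<open>w\<close> over large shells; hence in Green's formula, with the kernel of a source together with its mirror image,
  the contribution of the outer shell tends to zero, and \<open>w\<close> is represented by its values in a bounded shell.
  It follows that \<open>r exp (- \<i> k r) w (r \<theta>)\<close> extends to a holomorphic function of \<open>1 / r\<close> near \<open>0\<close>.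
  Its value at \<open>0\<close> is the difference of the far-field patterns, and testing the Helmholtz equation with bumps that
  move to infinity shows inductively that all further Taylor coefficients vanish, so \<open>w = 0\<close> far out.
  Green's formula in small balls shows that \<open>w\<close> is analytic along vertical lines. The region above both graphs
  contains the upward ray from each of its points, so \<open>w\<close> vanishes on the whole ray.
\<close>

section \<open>A polynomial smooth step\<close>

text \<open>The usual route through Rellich's lemma is blocked by the form of the data. The far
  field is given only as a limit in each direction separately, without uniformity, and the Neumann
  condition on the plane holds only variationally, so neither traces nor surface integrals are at
  hand. Hence each surface integral is replaced by a volume integral against the gradient of a
  smooth cutoff, and each point source by a C1 source on a thin shell; \<open>kappa\<close> is the
  limiting mass of such a shell. The reflection is applied to the source and not to the solution:
  the solution is extended by zero, and the gradient of the doubled source field is tangential to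
  the plane, which is what the variational condition can absorb. The classical recursion for the
  expansion coefficients uses the spherical Laplacian and would need derivatives of the coefficients
  in the direction. The moving bumps need only continuity in the direction, because the radial
  derivative of a bump is, up to scale, its derivative in the scale parameter.\<close>

definition clamp01 :: "real \<Rightarrow> real" where "clamp01 x = max 0 (min 1 x)"

lemma continuous_clamp01: "continuous_on UNIV clamp01"
  unfolding clamp01_def by (intro continuous_intros)

lemma clamp01_range: "0 \<le> clamp01 x" "clamp01 x \<le> 1"
  by (auto simp: clamp01_def)

lemma clamp01_simps: "x \<le> 0 \<Longrightarrow> clamp01 x = 0" "x \<ge> 1 \<Longrightarrow> clamp01 x = 1"
  "0 \<le> x \<Longrightarrow> x \<le> 1 \<Longrightarrow> clamp01 x = x"
  by (auto simp: clamp01_def)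

text \<open>The clamp has corners at 0 and 1, but a derivative \<open>Q\<close> that vanishes there
  matches the zero slope of the constant pieces. One-sided derivatives are found on three closed
  pieces and glued at the two common endpoints.\<close>

lemma has_real_derivative_clamp01:
  assumes d: "\<And>x. (P has_real_derivative Q x) (at x)" and Q: "Q 0 = 0" "Q 1 = 0"
  shows "((\<lambda>x. P (clamp01 x)) has_real_derivative Q (clamp01 x)) (at x)"
proof -
  have mid: "((\<lambda>x. P (clamp01 x)) has_real_derivative Q (clamp01 x)) (at x within {0..1})"
    if "x \<in> {0..1}" for x
  proof (rule has_field_derivative_transform_within[where f=P and d=1])
    show "(P has_real_derivative Q (clamp01 x)) (at x within {0..1})"
      using has_field_derivative_at_within[OF d[of x]] that by (simp add: clamp01_simps)
  qed (use that in \<open>auto simp: clamp01_simps\<close>)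
  have left: "((\<lambda>x. P (clamp01 x)) has_real_derivative Q (clamp01 x)) (at x within {..0})"
    if "x \<in> {..0}" for x
  proof (rule has_field_derivative_transform_within[where f="\<lambda>x. P 0" and d=1])
    have "clamp01 x = 0" using that by (simp add: clamp01_simps)
    then show "((\<lambda>x. P 0) has_real_derivative Q (clamp01 x)) (at x within {..0})"
      using Q by simp
  qed (use that in \<open>auto simp: clamp01_simps\<close>)
  have right: "((\<lambda>x. P (clamp01 x)) has_real_derivative Q (clamp01 x)) (at x within {1..})"
    if "x \<in> {1..}" for x
  proof (rule has_field_derivative_transform_within[where f="\<lambda>x. P 1" and d=1])
    have "clamp01 x = 1" using that by (simp add: clamp01_simps)
    then show "((\<lambda>x. P 1) has_real_derivative Q (clamp01 x)) (at x within {1..})"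
      using Q by simp
  qed (use that in \<open>auto simp: clamp01_simps\<close>)
  consider "x < 0" | "x = 0" | "0 < x" "x < 1" | "x = 1" | "x > 1" by linarith
  then show ?thesis
  proof cases
    case 1
    then show ?thesis using left[of x] at_within_interior[of x "{..0}"] by auto
  next
    case 2
    have "((\<lambda>x. P (clamp01 x)) has_real_derivative Q (clamp01 x)) (at x within ({..0} \<union> {0..1}))"
      using left[of x] mid[of x] 2 unfolding has_field_derivative_iff
      by (simp add: Lim_within_Un)
    moreover have "{..0::real} \<union> {0..1} = {..1}" by auto
    ultimately show ?thesis using at_within_interior[of x "{..1}"] 2 by auto
  next
    case 3
    then show ?thesis using mid[of x] at_within_interior[of x "{0..1}"] by auto
  next
    case 4
    have "((\<lambda>x. P (clamp01 x)) has_real_derivative Q (clamp01 x)) (at x within ({0..1} \<union> {1..}))"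
      using right[of x] mid[of x] 4 unfolding has_field_derivative_iff
      by (simp add: Lim_within_Un)
    moreover have "{0..1} \<union> {1::real..} = {0..}" by auto
    ultimately show ?thesis using at_within_interior[of x "{0..}"] 4 by auto
  next
    case 5
    then show ?thesis using right[of x] at_within_interior[of x "{1..}"] by auto
  qed
qed

text \<open>The primitive of \<open>140 c^3 (1-c)^3\<close>, normalised to rise from 0 to 1. Degree
  7 is the smallest that leaves three continuous derivatives after clamping; the third enters
  through \<open>src1\<close>, the derivative of a source that already contains two derivatives of
  the cutoff.\<close>

definition step :: "real \<Rightarrow> real" where
  "step x = (let c = clamp01 x in c^4 * (35 - 84*c + 70*c^2 - 20*c^3))"
definition step1 :: "real \<Rightarrow> real" where
  "step1 x = (let c = clamp01 x in 140 * c^3 * (1-c)^3)"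
definition step2 :: "real \<Rightarrow> real" where
  "step2 x = (let c = clamp01 x in 420 * c^2 * (1-c)^2 * (1-2*c))"
definition step3 :: "real \<Rightarrow> real" where
  "step3 x = (let c = clamp01 x in 840 * c * (1-c) * (1 - 5*c + 5*c^2))"

lemma step_derivs:
  "(step has_real_derivative step1 x) (at x)"
  "(step1 has_real_derivative step2 x) (at x)"
  "(step2 has_real_derivative step3 x) (at x)"
proof -
  have "((\<lambda>x. (\<lambda>c. c^4 * (35 - 84*c + 70*c^2 - 20*c^3)) (clamp01 x)) has_real_derivative
     (\<lambda>c. 140 * c^3 * (1-c)^3) (clamp01 x)) (at x)"
    by (rule has_real_derivative_clamp01, (rule derivative_eq_intros refl)+)
      (auto simp: algebra_simps power2_eq_square power3_eq_cube power4_eq_xxxx)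
  then show "(step has_real_derivative step1 x) (at x)"
    by (simp add: step_def[abs_def] step1_def Let_def)
  have "((\<lambda>x. (\<lambda>c. 140 * c^3 * (1-c)^3) (clamp01 x)) has_real_derivative
     (\<lambda>c. 420 * c^2 * (1-c)^2 * (1-2*c)) (clamp01 x)) (at x)"
    by (rule has_real_derivative_clamp01, (rule derivative_eq_intros refl)+)
      (auto simp: algebra_simps power2_eq_square power3_eq_cube power4_eq_xxxx)
  then show "(step1 has_real_derivative step2 x) (at x)"
    by (simp add: step1_def[abs_def] step2_def Let_def)
  have "((\<lambda>x. (\<lambda>c. 420 * c^2 * (1-c)^2 * (1-2*c)) (clamp01 x)) has_real_derivative
     (\<lambda>c. 840 * c * (1-c) * (1 - 5*c + 5*c^2)) (clamp01 x)) (at x)"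
    by (rule has_real_derivative_clamp01, (rule derivative_eq_intros refl)+)
      (auto simp: algebra_simps power2_eq_square power3_eq_cube power4_eq_xxxx)
  then show "(step2 has_real_derivative step3 x) (at x)"
    by (simp add: step2_def[abs_def] step3_def Let_def)
qed

lemma continuous_step: "continuous_on S step" "continuous_on S step1" "continuous_on S step2" "continuous_on S step3"
  unfolding step_def step1_def step2_def step3_def Let_def
  by (intro continuous_intros continuous_on_subset[OF continuous_clamp01] subset_UNIV)+

lemma step_left: "x \<le> 0 \<Longrightarrow> step x = 0" "x \<le> 0 \<Longrightarrow> step1 x = 0" "x \<le> 0 \<Longrightarrow> step2 x = 0" "x \<le> 0 \<Longrightarrow> step3 x = 0"
  by (simp_all add: step_def step1_def step2_def step3_def clamp01_simps)

lemma step_right: "x \<ge> 1 \<Longrightarrow> step x = 1" "x \<ge> 1 \<Longrightarrow> step1 x = 0" "x \<ge> 1 \<Longrightarrow> step2 x = 0" "x \<ge> 1 \<Longrightarrow> step3 x = 0"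
  by (simp_all add: step_def step1_def step2_def step3_def clamp01_simps)

lemma step1_nonneg: "step1 x \<ge> 0"
  using clamp01_range[of x] by (auto simp: step1_def Let_def)

lemma step1_pos: "0 < x \<Longrightarrow> x < 1 \<Longrightarrow> step1 x > 0"
  by (auto simp: step1_def Let_def clamp01_simps)

lemma step1_le: "step1 x \<le> 140"
proof -
  have "clamp01 x ^ 3 * (1 - clamp01 x)^3 \<le> 1 * 1"
    using clamp01_range[of x] by (intro mult_mono power_le_one) auto
  then show ?thesis by (simp add: step1_def Let_def)
qed

lemma step_mono: "x \<le> y \<Longrightarrow> step x \<le> step y"
  by (rule DERIV_nonneg_imp_nondecreasing[of x y step]) (use step_derivs(1) step1_nonneg in blast)+

lemma step_range: "0 \<le> step x" "step x \<le> 1"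
  using step_mono[of "min x 0" x] step_mono[of x "max x 1"] step_left(1)[of "min x 0"] step_right(1)[of "max x 1"]
  by auto

section \<open>Partial derivatives and integration by parts\<close>

text \<open>\<open>has_partial_on\<close> speaks of the parameter value 0 only. Moving the base
  point along the axis gives the derivative at every parameter, as mean value arguments along
  coordinate lines require.\<close>

lemma has_partial_on_line:
  assumes "has_partial_on f i f' S" "x + t *\<^sub>R axis i 1 \<in> S"
  shows "((\<lambda>t. f (x + t *\<^sub>R axis i 1)) has_vector_derivative f' (x + t *\<^sub>R axis i 1)) (at t)"
proof -
  have "((\<lambda>s. f (x + t *\<^sub>R axis i 1 + s *\<^sub>R axis i 1)) has_vector_derivative f' (x + t *\<^sub>R axis i 1)) (at (t - t))"
    using assms unfolding has_partial_on_def by auto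
  then have "(((\<lambda>s. f (x + t *\<^sub>R axis i 1 + s *\<^sub>R axis i 1)) \<circ> (\<lambda>s. s - t)) has_vector_derivative
       1 *\<^sub>R f' (x + t *\<^sub>R axis i 1)) (at t)"
    by (intro vector_diff_chain_at) (auto intro!: derivative_eq_intros)
  moreover have "((\<lambda>s. f (x + t *\<^sub>R axis i 1 + s *\<^sub>R axis i 1)) \<circ> (\<lambda>s. s - t)) = (\<lambda>t. f (x + t *\<^sub>R axis i 1))"
    by (auto simp: fun_eq_iff algebra_simps)
  ultimately show ?thesis by simp
qed

lemma has_partial_on_mult:
  fixes f g :: "real^3 \<Rightarrow> complex"
  assumes "has_partial_on f i f' S" "has_partial_on g i g' S"
  shows "has_partial_on (\<lambda>x. f x * g x) i (\<lambda>x. f' x * g x + f x * g' x) S"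
  using assms unfolding has_partial_on_def
  by (auto intro!: derivative_eq_intros simp: add.commute)

lemma has_partial_on_add:
  assumes "has_partial_on f i f' S" "has_partial_on g i g' S"
  shows "has_partial_on (\<lambda>x. f x + g x) i (\<lambda>x. f' x + g' x) S"
  using assms unfolding has_partial_on_def by (auto intro!: derivative_intros)

lemma has_partial_on_diff:
  assumes "has_partial_on f i f' S" "has_partial_on g i g' S"
  shows "has_partial_on (\<lambda>x. f x - g x) i (\<lambda>x. f' x - g' x) S"
  using assms unfolding has_partial_on_def by (auto intro!: derivative_intros)

lemma has_partial_on_sum:
  assumes "\<And>c. c \<in> X \<Longrightarrow> has_partial_on (f c) i (f' c) S"
  shows "has_partial_on (\<lambda>x. \<Sum>c\<in>X. f c x) i (\<lambda>x. \<Sum>c\<in>X. f' c x) S"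
  using assms unfolding has_partial_on_def by (auto intro!: has_vector_derivative_sum)

lemma has_partial_on_subset: "has_partial_on f i f' S \<Longrightarrow> T \<subseteq> S \<Longrightarrow> has_partial_on f i f' T"
  by (auto simp: has_partial_on_def)

lemma has_partial_on_Un: "has_partial_on f i f' S \<Longrightarrow> has_partial_on f i f' T \<Longrightarrow> has_partial_on f i f' (S \<union> T)"
  by (auto simp: has_partial_on_def)

lemma has_partial_on_cong:
  assumes "open S" "\<And>x. x \<in> S \<Longrightarrow> f x = g x" "\<And>x. x \<in> S \<Longrightarrow> f' x = g' x" "has_partial_on f i f' S"
  shows "has_partial_on g i g' S"
  unfolding has_partial_on_def
proof
  fix x assume x: "x \<in> S"
  have "open ((\<lambda>t. x + t *\<^sub>R axis i 1) -` S)"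
    by (intro open_vimage assms continuous_intros)
  moreover have "((\<lambda>t. f (x + t *\<^sub>R axis i 1)) has_vector_derivative g' x) (at 0)"
    using assms(3,4) x unfolding has_partial_on_def by auto
  ultimately show "((\<lambda>t. g (x + t *\<^sub>R axis i 1)) has_vector_derivative g' x) (at 0)"
    using assms(2) x by (elim has_vector_derivative_transform_within_open) auto
qed

lemma has_partial_on_unique:
  assumes "has_partial_on f i f' S" "has_partial_on f i g' S" "x \<in> S"
  shows "f' x = g' x"
  using assms unfolding has_partial_on_def by (meson vector_derivative_unique_at)

lemma has_partial_on_zero: "has_partial_on (\<lambda>x. 0) i (\<lambda>x. 0) S"
  by (auto simp: has_partial_on_def)

lemma partial_zero_outside:
  assumes "has_partial_on f i f' UNIV" "closed K" "\<And>x. x \<notin> K \<Longrightarrow> f x = 0" "x \<notin> K"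
  shows "f' x = 0"
proof -
  have "has_partial_on f i (\<lambda>x. 0) (-K)"
    by (rule has_partial_on_cong[OF _ _ _ has_partial_on_zero]) (use assms in auto)
  then show ?thesis
    using has_partial_on_unique[OF has_partial_on_subset[OF assms(1)], of "-K"] assms(4) by auto
qed

lemma norm_diff_le_of_vector_derivative:
  fixes f :: "real \<Rightarrow> 'a::real_normed_vector"
  assumes "a \<le> b" "\<And>t. t \<in> {a..b} \<Longrightarrow> (f has_vector_derivative f' t) (at t)"
    "\<And>t. t \<in> {a..b} \<Longrightarrow> norm (f' t) \<le> B"
  shows "norm (f b - f a) \<le> B * (b - a)"
proof (cases "a = b")
  case False
  have "norm (f b - f a) \<le> B * b - B * a"
  proof (rule differentiable_bound_general[where f'=f' and \<phi>'="\<lambda>t. B"])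
    show "continuous_on {a..b} f"
      using assms(2) has_vector_derivative_continuous
      by (intro continuous_at_imp_continuous_on) blast
  qed (use False assms in \<open>auto intro!: continuous_intros derivative_eq_intros\<close>)
  then show ?thesis by (simp add: algebra_simps)
qed auto

lemma integrable_continuous_compact_support:
  fixes h :: "real^3 \<Rightarrow> 'a::euclidean_space"
  assumes "continuous_on UNIV h" "compact K" "\<And>x. x \<notin> K \<Longrightarrow> h x = 0"
  shows "integrable lborel h"
proof -
  have "set_integrable lborel K h"
    using assms unfolding set_integrable_def
    by (intro borel_integrable_compact) (auto intro: continuous_on_subset[OF assms(1)])
  moreover have "(\<lambda>x. indicator K x *\<^sub>R h x) = h" using assms(3) by (auto simp: indicator_def)
  ultimately show ?thesis by (simp add: set_integrable_def)
qed

lemma bounded_continuous_compact_support: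
  fixes h :: "real^3 \<Rightarrow> 'a::real_normed_vector"
  assumes "continuous_on UNIV h" "compact K" "\<And>x. x \<notin> K \<Longrightarrow> h x = 0"
  obtains B where "B > 0" "\<And>x. norm (h x) \<le> B"
proof -
  have "bounded (h ` K)"
    using assms by (intro compact_imp_bounded compact_continuous_image) (auto intro: continuous_on_subset[OF assms(1)])
  then obtain B where "B > 0" "\<forall>x\<in>K. norm (h x) \<le> B" unfolding bounded_pos by auto
  then show ?thesis using that[of B] assms(3) by (metis less_imp_le norm_zero)
qed

section \<open>Translation invariance and integration by parts with compact support\<close>

lemma lborel_integrable_translate:
  fixes h :: "'b::euclidean_space \<Rightarrow> 'a::{banach,second_countable_topology}"
  assumes "integrable lborel h"
  shows "integrable lborel (\<lambda>x. h (x + c))"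
proof -
  have "integrable (distr lborel borel ((+) c)) h"
    using assms by (simp add: lborel_distr_plus)
  then have "integrable lborel (\<lambda>x. h (c + x))"
    by (subst (asm) integrable_distr_eq) (use assms in auto)
  then show ?thesis by (simp add: add.commute)
qed

lemma lborel_integral_translate:
  fixes h :: "'b::euclidean_space \<Rightarrow> 'a::{banach,second_countable_topology}"
  assumes "h \<in> borel_measurable borel"
  shows "(LINT x|lborel. h (x + c)) = (LINT x|lborel. h x)"
proof -
  have "(LINT x|lborel. h x) = (LINT x|distr lborel borel ((+) c). h x)"
    by (simp add: lborel_distr_plus)
  also have "\<dots> = (LINT x|lborel. h (c + x))"
    by (subst integral_distr) (use assms in auto)
  finally show ?thesis by (simp add: add.commute)
qed

lemma has_vector_derivative_difference_quotient:
  fixes f :: "real \<Rightarrow> 'a::real_normed_vector"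
  assumes "((\<lambda>t. f t) has_vector_derivative f') (at 0)"
  shows "((\<lambda>t. (f t - f 0) /\<^sub>R t) \<longlongrightarrow> f') (at 0)"
proof -
  have "((\<lambda>y. norm ((f y - f 0 - y *\<^sub>R f') /\<^sub>R norm y)) \<longlongrightarrow> 0) (at 0)"
    using assms unfolding has_vector_derivative_def has_derivative_at
    by (simp add: divide_inverse_commute)
  then have "((\<lambda>y. (f y - f 0) /\<^sub>R y - f') \<longlongrightarrow> 0) (at 0)"
  proof (rule Lim_transform_eventually[OF _ _, THEN tendsto_norm_zero_cancel])
    show "\<forall>\<^sub>F y in at 0. norm ((f y - f 0 - y *\<^sub>R f') /\<^sub>R norm y) = norm ((f y - f 0) /\<^sub>R y - f')"
      unfolding eventually_at_filter
    proof (intro always_eventually allI impI)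
      fix y :: real assume "y \<noteq> 0"
      have "(f y - f 0) /\<^sub>R y - f' = inverse y *\<^sub>R (f y - f 0 - y *\<^sub>R f')"
        using \<open>y \<noteq> 0\<close> by (simp add: scaleR_diff_right)
      then show "norm ((f y - f 0 - y *\<^sub>R f') /\<^sub>R norm y) = norm ((f y - f 0) /\<^sub>R y - f')"
        by simp
    qed
  qed
  then show ?thesis by (simp add: LIM_zero_iff)
qed

text \<open>Translation invariance makes the integral of every difference quotient zero, and
  dominated convergence passes to the partial derivative; this avoids iterated integrals.\<close>

lemma integral_partial_eq_0:
  fixes h :: "real^3 \<Rightarrow> complex"
  assumes h: "continuous_on UNIV h" "has_partial_on h i h' UNIV" "continuous_on UNIV h'"
    and K: "compact K" "\<And>x. x \<notin> K \<Longrightarrow> h x = 0"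
  shows "(LINT x|lborel. h' x) = 0"
proof -
  define D where "D n x = (real (Suc n)) *\<^sub>R (h (x + (1 / Suc n) *\<^sub>R axis i 1) - h x)" for n x
  have K': "h' x = 0" if "x \<notin> K" for x
    by (rule partial_zero_outside[OF h(2) compact_imp_closed[OF K(1)] K(2) that])
  obtain B where B: "B > 0" "\<And>x. norm (h' x) \<le> B"
    using bounded_continuous_compact_support[OF h(3) K(1) K'] by blast
  obtain r where r: "\<And>x. x \<in> K \<Longrightarrow> norm x \<le> r"
    using compact_imp_bounded[OF K(1)] unfolding bounded_iff by auto
  have hint: "integrable lborel h" by (rule integrable_continuous_compact_support[OF h(1) K])
  have hm[measurable]: "h \<in> borel_measurable borel" using h(1) borel_measurable_continuous_onI by blast
  have hm'[measurable]: "h' \<in> borel_measurable borel" using h(3) borel_measurable_continuous_onI by blast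
  \<comment> \<open>The shifts have length at most 1, so a translate can meet \<open>K\<close> only
    from within radius \<open>r + 1\<close>.\<close>
  have bound: "norm (D n x) \<le> B * indicator (cball 0 (r+1)) x" for n x
  proof (cases "x \<in> cball 0 (r+1)")
    case True
    have "norm (h (x + (1 / Suc n) *\<^sub>R axis i 1) - h (x + 0 *\<^sub>R axis i 1)) \<le> B * (1 / Suc n - 0)"
      by (rule norm_diff_le_of_vector_derivative[OF _ has_partial_on_line[OF h(2)]]) (use B in auto)
    moreover have "norm (D n x) = Suc n * norm (h (x + (1 / Suc n) *\<^sub>R axis i 1) - h x)"
      unfolding D_def norm_scaleR by simp
    ultimately show ?thesis using True by (simp add: pos_le_divide_eq mult.commute del: of_nat_Suc)
  next
    case False
    then have "norm x > r + 1" by simp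
    moreover have "norm x \<le> norm (x + (1 / Suc n) *\<^sub>R axis i (1::real)) + norm ((1 / Suc n) *\<^sub>R axis i (1::real) :: real^3)"
      using norm_triangle_ineq4[of "x + (1 / Suc n) *\<^sub>R axis i (1::real)" "(1 / Suc n) *\<^sub>R axis i (1::real)"] by simp
    moreover have "norm ((1 / Suc n) *\<^sub>R axis i (1::real) :: real^3) \<le> 1" by simp
    ultimately have "norm (x + (1 / Suc n) *\<^sub>R axis i (1::real)) > r" by linarith
    moreover have "norm x > r" using \<open>norm x > r+1\<close> by simp
    ultimately have "h (x + (1 / Suc n) *\<^sub>R axis i 1) = 0" "h x = 0"
      using r K(2) by (meson not_le)+
    then show ?thesis using False by (simp add: D_def)
  qed
  have "(\<lambda>n. LINT x|lborel. D n x) \<longlonglongrightarrow> (LINT x|lborel. h' x)"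
  proof (rule integral_dominated_convergence[where w="\<lambda>x. B * indicator (cball 0 (r+1)) x"])
    show "integrable lborel (\<lambda>x. B * indicator (cball 0 (r + 1)) (x::real^3) :: real)"
      using emeasure_lborel_cball_finite[of "0::real^3" "r+1"]
      by (intro integrable_mult_right integrable_real_indicator) (auto simp: top.not_eq_extremum)
    show "AE x in lborel. (\<lambda>n. D n x) \<longlonglongrightarrow> h' x"
    proof (rule AE_I2)
      fix x
      have "((\<lambda>t. h (x + t *\<^sub>R axis i 1)) has_vector_derivative h' x) (at 0)"
        using h(2) by (auto simp: has_partial_on_def)
      then have "((\<lambda>t. (h (x + t *\<^sub>R axis i 1) - h x) /\<^sub>R t) \<longlongrightarrow> h' x) (at 0)"
        using has_vector_derivative_difference_quotient by fastforce
      moreover have "filterlim (\<lambda>n. 1 / real (Suc n)) (at 0) sequentially"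
        unfolding filterlim_at using LIMSEQ_Suc[OF lim_1_over_n] by (auto simp del: of_nat_Suc)
      ultimately have "(\<lambda>n. (h (x + (1 / real (Suc n)) *\<^sub>R axis i 1) - h x) /\<^sub>R (1 / real (Suc n))) \<longlonglongrightarrow> h' x"
        by (rule filterlim_compose)
      then show "(\<lambda>n. D n x) \<longlonglongrightarrow> h' x" by (simp add: D_def)
    qed
    show "AE x in lborel. norm (D n x) \<le> B * indicator (cball 0 (r + 1)) x" for n
      by (rule AE_I2) (rule bound)
    show "D n \<in> borel_measurable lborel" for n unfolding D_def by measurable
  qed measurable
  moreover have "(LINT x|lborel. D n x) = 0" for n
  proof -
    have "integrable lborel (\<lambda>x. h (x + (1 / Suc n) *\<^sub>R axis i 1))"
      by (rule lborel_integrable_translate[OF hint])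
    then show ?thesis unfolding D_def using hint lborel_integral_translate[OF hm]
      by simp
  qed
  ultimately show ?thesis by (simp add: LIMSEQ_const_iff)
qed

text \<open>\<open>f\<close> may be arbitrary outside \<open>D\<close>. The product with
  \<open>g\<close> is nevertheless C1 on the whole space, because \<open>D\<close> and the
  complement of \<open>K\<close> are open, cover the space, and the product vanishes on the
  second.\<close>

lemma ibp_compact:
  fixes f g :: "real^3 \<Rightarrow> complex"
  assumes D: "open D" and f: "continuous_on D f" "has_partial_on f i f' D" "continuous_on D f'"
    and g: "continuous_on UNIV g" "has_partial_on g i g' UNIV" "continuous_on UNIV g'"
    and K: "compact K" "K \<subseteq> D" "\<And>x. x \<notin> K \<Longrightarrow> g x = 0"
  shows "(LINT x|lborel. f' x * g x + f x * g' x) = 0"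
proof -
  note gD = continuous_on_subset[OF g(1) subset_UNIV, of D] continuous_on_subset[OF g(3) subset_UNIV, of D]
  note cK = compact_imp_closed[OF K(1)]
  have g': "g' x = 0" if "x \<notin> K" for x by (rule partial_zero_outside[OF g(2) cK K(3) that])
  have U: "UNIV = D \<union> - K" using K by auto
  have glue: "continuous_on UNIV h" if "continuous_on D h" "\<And>x. x \<notin> K \<Longrightarrow> h x = 0" for h :: "real^3 \<Rightarrow> complex"
  proof -
    have "continuous_on (-K) h" using that(2) by (intro continuous_on_eq[OF continuous_on_const]) auto
    then show ?thesis unfolding U using that D cK
      by (intro continuous_on_open_Un) (auto simp: open_Compl)
  qed
  show ?thesis
  proof (rule integral_partial_eq_0[OF _ _ _ K(1), of "\<lambda>x. f x * g x" i])
    show "continuous_on UNIV (\<lambda>x. f x * g x)"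
      using f g K by (intro glue continuous_intros gD) auto
    show "continuous_on UNIV (\<lambda>x. f' x * g x + f x * g' x)"
      using f g K g' by (intro glue continuous_intros gD) auto
    show "has_partial_on (\<lambda>x. f x * g x) i (\<lambda>x. f' x * g x + f x * g' x) UNIV"
      unfolding U
    proof (rule has_partial_on_Un)
      show "has_partial_on (\<lambda>x. f x * g x) i (\<lambda>x. f' x * g x + f x * g' x) D"
        by (rule has_partial_on_mult[OF f(2) has_partial_on_subset[OF g(2)]]) auto
      show "has_partial_on (\<lambda>x. f x * g x) i (\<lambda>x. f' x * g x + f x * g' x) (- K)"
        by (rule has_partial_on_cong[OF _ _ _ has_partial_on_zero]) (use cK K g' in auto)
    qed
  qed (use K in auto)
qed

section \<open>The outgoing kernel and its regularisation\<close>

text \<open>The squared distance is a polynomial in the coordinates, hence smooth also at the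
  centre, so partial derivatives of radial functions involve no division by the radius.\<close>

definition dsq :: "real^3 \<Rightarrow> real^3 \<Rightarrow> real" where
  "dsq c y = (norm (y - c))^2"

lemma dsq_nonneg [simp]: "0 \<le> dsq c y"
  by (simp add: dsq_def)

lemma sqrt_dsq: "sqrt (dsq c y) = norm (y - c)"
  by (simp add: dsq_def)

lemma dsq_eq_sum: "dsq c y = (\<Sum>i\<in>UNIV. ((y - c) $ i)^2)"
  unfolding dsq_def power2_norm_eq_inner by (simp add: inner_vec_def power2_eq_square)

lemma continuous_on_dsq [continuous_intros]: "continuous_on S f \<Longrightarrow> continuous_on S (\<lambda>x. dsq c (f x))"
  unfolding dsq_def by (intro continuous_intros)

lemma dsq_line_derivative:
  "((\<lambda>t. dsq c (x + t *\<^sub>R v)) has_real_derivative 2 * ((x - c) \<bullet> v)) (at 0)"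
proof -
  have "dsq c (x + t *\<^sub>R v) = (x - c) \<bullet> (x - c) + 2 * t * ((x - c) \<bullet> v) + t^2 * (v \<bullet> v)" for t
    unfolding dsq_def power2_norm_eq_inner
    by (simp add: inner_add_left inner_add_right inner_diff_left inner_diff_right inner_commute algebra_simps power2_eq_square)
  then show ?thesis by (auto intro!: derivative_eq_intros)
qed

lemma has_partial_on_radial:
  fixes h :: "real \<Rightarrow> complex"
  assumes "\<And>y. y \<in> S \<Longrightarrow> (h has_vector_derivative h1 (dsq c y)) (at (dsq c y))"
  shows "has_partial_on (\<lambda>y. h (dsq c y)) i (\<lambda>y. of_real (2 * (y - c) $ i) * h1 (dsq c y)) S"
  unfolding has_partial_on_def
proof
  fix x assume "x \<in> S"
  have "((\<lambda>t. dsq c (x + t *\<^sub>R axis i 1)) has_vector_derivative 2 * (x - c) $ i) (at 0)"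
    using dsq_line_derivative[of c x "axis i 1"]
    by (simp add: inner_axis has_real_derivative_iff_has_vector_derivative)
  from vector_diff_chain_at[OF this, of h] assms[OF \<open>x \<in> S\<close>]
  show "((\<lambda>t. h (dsq c (x + t *\<^sub>R axis i 1))) has_vector_derivative of_real (2 * (x - c) $ i) * h1 (dsq c x)) (at 0)"
    by (simp add: o_def scaleR_conv_of_real)
qed

lemma has_partial_on_coord:
  "has_partial_on (\<lambda>y. complex_of_real (2 * (y - c) $ i)) j (\<lambda>y. if i = j then 2 else 0) S"
proof -
  have *: "((\<lambda>t. complex_of_real (2 * (x $ i + t * a - c $ i))) has_vector_derivative of_real (2 * a)) (at 0)" for x :: "real^3" and a
    by (auto intro!: derivative_eq_intros simp flip: of_real_mult)
  show ?thesis unfolding has_partial_on_def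
  proof
    fix x :: "real^3"
    show "((\<lambda>t. complex_of_real (2 * (x + t *\<^sub>R axis j 1 - c) $ i)) has_vector_derivative (if i = j then 2 else 0)) (at 0)"
      using *[of x "if i = j then 1 else 0"] by (auto simp: axis_def)
  qed
qed

lemma has_partial_on_radial2:
  fixes h1 :: "real \<Rightarrow> complex"
  assumes "\<And>y. y \<in> S \<Longrightarrow> (h1 has_vector_derivative h2 (dsq c y)) (at (dsq c y))"
  shows "has_partial_on (\<lambda>y. of_real (2 * (y - c) $ i) * h1 (dsq c y)) i
     (\<lambda>y. 2 * h1 (dsq c y) + of_real (4 * ((y - c) $ i)^2) * h2 (dsq c y)) S"
proof -
  have "has_partial_on (\<lambda>y. of_real (2 * (y - c) $ i) * h1 (dsq c y)) i
     (\<lambda>y. (if i = i then 2 else 0) * h1 (dsq c y) + of_real (2 * (y - c) $ i) * (of_real (2 * (y - c) $ i) * h1' (dsq c y))) S"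
    if "h1' = h2" for h1'
    unfolding that by (intro has_partial_on_mult has_partial_on_coord has_partial_on_radial assms)
  from this[OF refl] show ?thesis by (simp add: power2_eq_square algebra_simps)
qed

text \<open>In the variable \<open>s\<close>, the squared radius, the Laplacian of
  \<open>h(s)\<close> in dimension 3 is \<open>6 h' + 4 s h''\<close>; the 6 is twice the
  dimension.\<close>

lemma radial_laplacian:
  "(\<Sum>i\<in>UNIV. 2 * h1 (dsq c y) + of_real (4 * ((y - c) $ i)^2) * h2 (dsq c y))
     = 6 * h1 (dsq c y) + 4 * of_real (dsq c y) * (h2 (dsq c y) :: complex)"
  unfolding dsq_eq_sum[of c y] by (simp add: sum.distrib sum_distrib_right sum_3 algebra_simps)

text \<open>The outgoing wave \<open>exp (i k r) / r\<close> as a function of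
  \<open>s = r^2\<close>, without the usual factor \<open>1 / (4 pi)\<close>; \<open>fund1\<close>
  and \<open>fund2\<close> are its derivatives in \<open>s\<close>. A negative \<open>k\<close>
  gives the incoming wave, which the bump argument uses.\<close>

definition fund :: "real \<Rightarrow> real \<Rightarrow> complex" where
  "fund k s = (let z = of_real (sqrt s) in exp (\<i> * k * z) / z)"
definition fund1 :: "real \<Rightarrow> real \<Rightarrow> complex" where
  "fund1 k s = (let z = of_real (sqrt s) in exp (\<i> * k * z) * (\<i> * k * z - 1) / (2 * z^3))"
definition fund2 :: "real \<Rightarrow> real \<Rightarrow> complex" where
  "fund2 k s = (let z = of_real (sqrt s) in exp (\<i> * k * z) * (3 - 3 * \<i> * k * z - (k * z)^2) / (4 * z^5))"

lemma has_vector_derivative_comp_sqrt: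
  assumes "s > 0" "(F has_field_derivative F' * (2 * of_real (sqrt s))) (at (of_real (sqrt s)))"
  shows "((\<lambda>s. F (complex_of_real (sqrt s))) has_vector_derivative F') (at s)"
proof -
  have "(sqrt has_real_derivative inverse (sqrt s) / 2) (at s)"
    using assms(1) by (rule DERIV_real_sqrt)
  then have "((\<lambda>s. complex_of_real (sqrt s)) has_vector_derivative of_real (inverse (sqrt s) / 2)) (at s)"
    by (rule has_vector_derivative_of_real)
  from field_vector_diff_chain_at[OF this assms(2)] show ?thesis
    using assms(1) by (simp add: o_def mult.left_commute)
qed

lemma fund_deriv:
  assumes "s > 0"
  shows "(fund k has_vector_derivative fund1 k s) (at s)" "(fund1 k has_vector_derivative fund2 k s) (at s)"
proof -
  let ?z = "complex_of_real (sqrt s)"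
  have z: "?z \<noteq> 0" using assms by simp
  show "(fund k has_vector_derivative fund1 k s) (at s)"
    unfolding fund_def[abs_def] fund1_def Let_def using assms z
    by (intro has_vector_derivative_comp_sqrt[where F="\<lambda>z. exp (\<i> * k * z) / z"])
       (auto intro!: derivative_eq_intros simp: divide_simps power2_eq_square power3_eq_cube, auto simp: algebra_simps)
  show "(fund1 k has_vector_derivative fund2 k s) (at s)"
    unfolding fund1_def[abs_def] fund2_def Let_def using assms z
    by (intro has_vector_derivative_comp_sqrt[where F="\<lambda>z. exp (\<i> * k * z) * (\<i> * k * z - 1) / (2 * z^3)"])
       (auto intro!: derivative_eq_intros simp: divide_simps, auto simp: algebra_simps power_numeral_reduce)
qed

text \<open>In the form produced by \<open>radial_laplacian\<close>, this is the Helmholtz equation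
  for a spherical wave away from its centre.\<close>

lemma fund_ode:
  assumes "s > 0"
  shows "6 * fund1 k s + 4 * of_real s * fund2 k s + of_real (k^2) * fund k s = 0"
proof -
  define z where "z = complex_of_real (sqrt s)"
  have z: "z \<noteq> 0" "complex_of_real s = z^2" using assms by (auto simp: z_def simp flip: of_real_power)
  show ?thesis
    unfolding fund_def fund1_def fund2_def Let_def z_def[symmetric] using z(1)
    by (simp add: z(2) divide_simps) (simp add: algebra_simps power_numeral_reduce)
qed

text \<open>Since \<open>2 s d/ds\<close> equals \<open>r d/dr\<close>, this is the radial
  derivative of the wave: the term \<open>i k r\<close> carries the radiation condition, and
  \<open>-1\<close> is the lower-order error.\<close>

lemma fund1_eq: "s > 0 \<Longrightarrow> 2 * of_real s * fund1 k s = fund k s * (\<i> * k * of_real (sqrt s) - 1)"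
proof -
  assume s: "s > 0"
  define z where "z = complex_of_real (sqrt s)"
  have z: "z \<noteq> 0" "complex_of_real s = z^2" using s by (auto simp: z_def simp flip: of_real_power)
  show ?thesis
    unfolding fund_def fund1_def fund2_def Let_def z_def[symmetric] using z(1)
    by (simp add: z(2) divide_simps) (simp add: algebra_simps power_numeral_reduce)
qed

lemma continuous_on_fund: "continuous_on {0<..} (fund k)" "continuous_on {0<..} (fund1 k)" "continuous_on {0<..} (fund2 k)"
  unfolding fund_def fund1_def fund2_def Let_def by (auto intro!: continuous_intros)

text \<open>The cutoff vanishes on a neighbourhood of all \<open>s \<le> 0\<close>, so the product
  is differentiable there however singular \<open>g\<close> is at 0. This turns the truncated
  kernels into functions on the whole line.\<close>

lemma cutoff_mult_deriv:
  fixes f :: "real \<Rightarrow> real" and g :: "real \<Rightarrow> complex"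
  assumes f: "\<And>s. (f has_real_derivative f1 s) (at s)" "\<And>s. s \<le> a \<Longrightarrow> f s = 0" "\<And>s. s \<le> a \<Longrightarrow> f1 s = 0" "a > 0"
    and g: "\<And>s. s > 0 \<Longrightarrow> (g has_vector_derivative g1 s) (at s)"
  shows "((\<lambda>s. of_real (f s) * g s) has_vector_derivative of_real (f1 s) * g s + of_real (f s) * g1 s) (at s)"
proof (cases "s > 0")
  case True
  have "((\<lambda>s. complex_of_real (f s)) has_vector_derivative of_real (f1 s)) (at s)"
    using f(1) by (rule has_vector_derivative_of_real)
  from has_vector_derivative_mult[OF this g[OF True]] show ?thesis by (simp add: add.commute)
next
  case False
  then have s: "s \<in> {..<a}" using f(4) by simp
  have "((\<lambda>s. of_real (f s) * g s) has_vector_derivative 0) (at s)"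
    by (rule has_vector_derivative_transform_within_open[OF has_vector_derivative_const[of 0] _ s])
       (use f(2) in auto)
  then show ?thesis using f(2,3) s by simp
qed

lemma cutoff_mult_continuous:
  fixes f :: "real \<Rightarrow> real" and g :: "real \<Rightarrow> complex"
  assumes f: "continuous_on UNIV f" "\<And>s. s \<le> a \<Longrightarrow> f s = 0" "a > 0" and g: "continuous_on {0<..} g"
  shows "continuous_on UNIV (\<lambda>s. of_real (f s) * g s)"
proof -
  have U: "UNIV = {0<..} \<union> {..<a}" using assms(3) by auto
  have "continuous_on {..<a} (\<lambda>s. of_real (f s) * g s)"
    by (rule continuous_on_eq[OF continuous_on_const[of _ 0]]) (use f(2) in auto)
  moreover have "continuous_on {0<..} (\<lambda>s. of_real (f s) * g s)"
    by (intro continuous_intros g continuous_on_subset[OF f(1)]) auto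
  ultimately show ?thesis unfolding U by (intro continuous_on_open_Un) auto
qed

section \<open>The kernel with its singularity cut out and the resulting source\<close>

definition cutoff :: "real \<Rightarrow> real \<Rightarrow> real" where "cutoff e s = step (s / e^2 - 1)"
definition cutoff1 :: "real \<Rightarrow> real \<Rightarrow> real" where "cutoff1 e s = step1 (s / e^2 - 1) / e^2"
definition cutoff2 :: "real \<Rightarrow> real \<Rightarrow> real" where "cutoff2 e s = step2 (s / e^2 - 1) / e^4"
definition cutoff3 :: "real \<Rightarrow> real \<Rightarrow> real" where "cutoff3 e s = step3 (s / e^2 - 1) / e^6"

lemma cutoff_derivs:
  assumes "e > 0"
  shows "(cutoff e has_real_derivative cutoff1 e s) (at s)" "(cutoff1 e has_real_derivative cutoff2 e s) (at s)"
    "(cutoff2 e has_real_derivative cutoff3 e s) (at s)"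
proof -
  have l: "((\<lambda>s. s / e^2 - 1) has_real_derivative 1 / e^2) (at s)"
    using DERIV_diff[OF DERIV_cdivide[OF DERIV_ident, of "e^2"] DERIV_const[of 1]] by simp
  show "(cutoff e has_real_derivative cutoff1 e s) (at s)"
    unfolding cutoff_def[abs_def] cutoff1_def using DERIV_chain2[OF step_derivs(1) l] by simp
  show "(cutoff1 e has_real_derivative cutoff2 e s) (at s)"
    unfolding cutoff1_def[abs_def] cutoff2_def
    using DERIV_cdivide[OF DERIV_chain2[OF step_derivs(2) l], of "e^2"] by (simp flip: power_add)
  show "(cutoff2 e has_real_derivative cutoff3 e s) (at s)"
    unfolding cutoff2_def[abs_def] cutoff3_def
    using DERIV_cdivide[OF DERIV_chain2[OF step_derivs(3) l], of "e^4"] by (simp flip: power_add)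
qed

lemma cutoff_cont: "e > 0 \<Longrightarrow> continuous_on S (cutoff e)" "e > 0 \<Longrightarrow> continuous_on S (cutoff1 e)"
   "e > 0 \<Longrightarrow> continuous_on S (cutoff2 e)" "e > 0 \<Longrightarrow> continuous_on S (cutoff3 e)"
  unfolding cutoff_def[abs_def] cutoff1_def[abs_def] cutoff2_def[abs_def] cutoff3_def[abs_def]
  by (auto intro!: continuous_intros continuous_on_compose2[OF continuous_step(1)[of UNIV]]
    continuous_on_compose2[OF continuous_step(2)[of UNIV]] continuous_on_compose2[OF continuous_step(3)[of UNIV]]
    continuous_on_compose2[OF continuous_step(4)[of UNIV]])

lemma cutoff_left:
  assumes "e > 0" "s \<le> e^2" shows "cutoff e s = 0" "cutoff1 e s = 0" "cutoff2 e s = 0" "cutoff3 e s = 0"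
proof -
  have "s / e^2 - 1 \<le> 0" using assms by (simp add: field_simps)
  then show "cutoff e s = 0" "cutoff1 e s = 0" "cutoff2 e s = 0" "cutoff3 e s = 0"
    by (simp_all add: cutoff_def cutoff1_def cutoff2_def cutoff3_def step_left)
qed

lemma cutoff_right:
  assumes "e > 0" "s \<ge> 2 * e^2" shows "cutoff e s = 1" "cutoff1 e s = 0" "cutoff2 e s = 0" "cutoff3 e s = 0"
proof -
  have "s / e^2 - 1 \<ge> 1" using assms by (simp add: field_simps)
  then show "cutoff e s = 1" "cutoff1 e s = 0" "cutoff2 e s = 0" "cutoff3 e s = 0"
    by (simp_all add: cutoff_def cutoff1_def cutoff2_def cutoff3_def step_right)
qed

text \<open>The wave with its singularity removed: zero within distance \<open>e\<close> of the
  centre, unchanged beyond distance \<open>sqrt 2 * e\<close>.\<close>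

definition ker :: "real \<Rightarrow> real \<Rightarrow> real \<Rightarrow> complex" where
  "ker k e s = cutoff e s * fund k s"
definition ker1 :: "real \<Rightarrow> real \<Rightarrow> real \<Rightarrow> complex" where
  "ker1 k e s = cutoff1 e s * fund k s + cutoff e s * fund1 k s"
definition ker2 :: "real \<Rightarrow> real \<Rightarrow> real \<Rightarrow> complex" where
  "ker2 k e s = cutoff2 e s * fund k s + cutoff1 e s * fund1 k s + (cutoff1 e s * fund1 k s + cutoff e s * fund2 k s)"
text \<open>The Helmholtz operator applied to the truncated wave. The result is a C1 source on the
  shell between the radii \<open>e\<close> and \<open>sqrt 2 * e\<close>, which stands in for a
  point source at the centre.\<close>

definition src :: "real \<Rightarrow> real \<Rightarrow> real \<Rightarrow> complex" where
  "src k e s = 6 * ker1 k e s + 4 * of_real s * ker2 k e s + of_real (k^2) * ker k e s"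

lemma ker_deriv:
  assumes e: "e > 0"
  shows "(ker k e has_vector_derivative ker1 k e s) (at s)" "(ker1 k e has_vector_derivative ker2 k e s) (at s)"
proof -
  note c = cutoff_derivs[OF e] cutoff_left[OF e]
  have e2: "e^2 > 0" using e by simp
  note m0 = cutoff_mult_deriv[of "cutoff e" "cutoff1 e" "e^2" "fund k" "fund1 k", OF c(1,4,5) e2 fund_deriv(1)]
  note m1 = cutoff_mult_deriv[of "cutoff1 e" "cutoff2 e" "e^2" "fund k" "fund1 k", OF c(2,5,6) e2 fund_deriv(1)]
  note m2 = cutoff_mult_deriv[of "cutoff e" "cutoff1 e" "e^2" "fund1 k" "fund2 k", OF c(1,4,5) e2 fund_deriv(2)]
  show "(ker k e has_vector_derivative ker1 k e s) (at s)"
    unfolding ker_def[abs_def] ker1_def using m0 .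
  show "(ker1 k e has_vector_derivative ker2 k e s) (at s)"
    unfolding ker1_def[abs_def] ker2_def using has_vector_derivative_add[OF m1 m2] .
qed

lemma ker_cont:
  assumes e: "e > 0"
  shows "continuous_on UNIV (ker k e)" "continuous_on UNIV (ker1 k e)" "continuous_on UNIV (ker2 k e)"
  unfolding ker_def[abs_def] ker1_def[abs_def] ker2_def[abs_def]
proof -
  note c = cutoff_cont[OF e, of UNIV] cutoff_left[OF e]
  have e2: "e^2 > 0" using e by simp
  note m = cutoff_mult_continuous[OF _ _ e2]
  show "continuous_on UNIV (\<lambda>s. cutoff e s * fund k s)"
    by (rule m[OF c(1,5) continuous_on_fund(1)])
  show "continuous_on UNIV (\<lambda>s. cutoff1 e s * fund k s + cutoff e s * fund1 k s)"
    by (intro continuous_on_add m[OF c(1,5) continuous_on_fund(2)] m[OF c(2,6) continuous_on_fund(1)])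
  show "continuous_on UNIV (\<lambda>s. cutoff2 e s * fund k s + cutoff1 e s * fund1 k s + (cutoff1 e s * fund1 k s + cutoff e s * fund2 k s))"
    by (intro continuous_on_add m[OF c(1,5) continuous_on_fund(3)] m[OF c(2,6) continuous_on_fund(2)] m[OF c(3,7) continuous_on_fund(1)])
qed

lemma ker_far:
  assumes "e > 0" "s \<ge> 2 * e^2" shows "ker k e s = fund k s" "ker1 k e s = fund1 k s" "ker2 k e s = fund2 k s"
  using cutoff_right[OF assms] by (auto simp: ker_def ker1_def ker2_def)

lemma ker_near:
  assumes "e > 0" "s \<le> e^2" shows "ker k e s = 0" "ker1 k e s = 0" "ker2 k e s = 0"
  using cutoff_left[OF assms] by (auto simp: ker_def ker1_def ker2_def)

text \<open>By \<open>fund_ode\<close> the terms with the undifferentiated cutoff cancel, and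
  \<open>fund1_eq\<close> removes the first derivative of the wave. Every remaining term contains a
  derivative of the cutoff, whence the support in the shell, and the expression can be
  differentiated once more without a third derivative of the wave.\<close>

lemma src_eq:
  assumes e: "e > 0"
  shows "src k e s = of_real (2 * cutoff1 e s + 4 * s * cutoff2 e s) * fund k s + of_real (cutoff1 e s) * (4 * \<i> * k * exp (\<i> * k * of_real (sqrt s)))"
proof (cases "s > 0")
  case True
  have "src k e s = of_real (6 * cutoff1 e s + 4 * s * cutoff2 e s) * fund k s + 4 * of_real (cutoff1 e s) * (2 * of_real s * fund1 k s)
     + of_real (cutoff e s) * (6 * fund1 k s + 4 * of_real s * fund2 k s + of_real (k^2) * fund k s)"
    by (simp add: src_def ker_def ker1_def ker2_def algebra_simps)
  also have "\<dots> = of_real (6 * cutoff1 e s + 4 * s * cutoff2 e s) * fund k s + 4 * of_real (cutoff1 e s) * (fund k s * (\<i> * k * of_real (sqrt s) - 1))"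
    using fund_ode[OF True] fund1_eq[OF True] by simp
  also have "fund k s * (\<i> * k * of_real (sqrt s) - 1) = \<i> * k * exp (\<i> * k * of_real (sqrt s)) - fund k s"
    using True by (simp add: fund_def Let_def right_diff_distrib)
  finally show ?thesis by (simp add: algebra_simps)
next
  case False
  then have "s \<le> e^2" using e by (meson zero_le_power2 not_le order_trans)
  then show ?thesis by (simp add: src_def ker_near e cutoff_left)
qed

lemma src_outside:
  assumes "e > 0" "s \<le> e^2 \<or> s \<ge> 2 * e^2" shows "src k e s = 0"
  using assms cutoff_left[of e s] cutoff_right[of e s] by (auto simp: src_eq)

lemma src_cont: "e > 0 \<Longrightarrow> continuous_on UNIV (src k e)"
  unfolding src_def[abs_def] by (intro continuous_intros ker_cont)

definition src1 :: "real \<Rightarrow> real \<Rightarrow> real \<Rightarrow> complex" where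
  "src1 k e s = of_real (6 * cutoff2 e s + 4 * s * cutoff3 e s) * fund k s + of_real (2 * cutoff1 e s + 4 * s * cutoff2 e s) * fund1 k s
     + (of_real (cutoff2 e s) * (4 * \<i> * k * exp (\<i> * k * of_real (sqrt s)))
     + of_real (cutoff1 e s) * (4 * \<i> * k * (\<i> * k * exp (\<i> * k * of_real (sqrt s)) / (2 * of_real (sqrt s)))))"

lemma src_deriv:
  assumes e: "e > 0" shows "(src k e has_vector_derivative src1 k e s) (at s)"
proof -
  have E: "((\<lambda>s. 4 * \<i> * k * exp (\<i> * k * of_real (sqrt s))) has_vector_derivative
      4 * \<i> * k * (\<i> * k * exp (\<i> * k * of_real (sqrt s)) / (2 * of_real (sqrt s)))) (at s)" if "s > 0" for s
  proof (rule has_vector_derivative_comp_sqrt[OF that])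
    have "((\<lambda>z. 4 * \<i> * k * exp (\<i> * k * z)) has_field_derivative 4 * \<i> * k * (exp (\<i> * k * z) * (\<i> * k))) (at z)" for z
      by (rule derivative_eq_intros refl | simp)+
    from this[of "of_real (sqrt s)"] show "((\<lambda>z. 4 * \<i> * k * exp (\<i> * k * z)) has_field_derivative
      4 * \<i> * k * (\<i> * k * exp (\<i> * k * of_real (sqrt s)) / (2 * of_real (sqrt s))) * (2 * of_real (sqrt s))) (at (of_real (sqrt s)))"
      using that by (simp add: mult_ac)
  qed
  have P: "((\<lambda>s. 2 * cutoff1 e s + 4 * s * cutoff2 e s) has_real_derivative 6 * cutoff2 e s + 4 * s * cutoff3 e s) (at s)" for s
    by (rule derivative_eq_intros cutoff_derivs e refl | simp)+
  have z: "s \<le> e^2 \<Longrightarrow> 2 * cutoff1 e s + 4 * s * cutoff2 e s = 0" "s \<le> e^2 \<Longrightarrow> 6 * cutoff2 e s + 4 * s * cutoff3 e s = 0" for s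
    using cutoff_left[OF e] by auto
  have e2: "e^2 > 0" using e by simp
  show ?thesis
    unfolding src_eq[OF e, abs_def] src1_def
    by (rule has_vector_derivative_add[OF cutoff_mult_deriv[OF P z e2 fund_deriv(1)]
       cutoff_mult_deriv[OF cutoff_derivs(2)[OF e] cutoff_left(2)[OF e] cutoff_left(3)[OF e] e2 E]])
qed

lemma src1_cont:
  assumes e: "e > 0" shows "continuous_on UNIV (src1 k e)"
proof -
  have e2: "e^2 > 0" using e by simp
  note m = cutoff_mult_continuous[OF _ _ e2]
  have z: "s \<le> e^2 \<Longrightarrow> 2 * cutoff1 e s + 4 * s * cutoff2 e s = 0" "s \<le> e^2 \<Longrightarrow> 6 * cutoff2 e s + 4 * s * cutoff3 e s = 0" for s
    using cutoff_left[OF e] by auto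
  have c: "continuous_on UNIV (\<lambda>s. 2 * cutoff1 e s + 4 * s * cutoff2 e s)" "continuous_on UNIV (\<lambda>s. 6 * cutoff2 e s + 4 * s * cutoff3 e s)"
    by (intro continuous_intros cutoff_cont[OF e])+
  have E: "continuous_on {0<..} (\<lambda>s. 4 * \<i> * k * exp (\<i> * k * of_real (sqrt s)))"
    "continuous_on {0<..} (\<lambda>s. 4 * \<i> * k * (\<i> * k * exp (\<i> * k * of_real (sqrt s)) / (2 * of_real (sqrt s))))"
    by (intro continuous_intros; simp)+
  show ?thesis
    unfolding src1_def[abs_def]
    by (intro continuous_on_add m[OF c(2) z(2) continuous_on_fund(1)] m[OF c(1) z(1) continuous_on_fund(2)]
       m[OF cutoff_cont(3)[OF e] cutoff_left(3)[OF e] E(1)] m[OF cutoff_cont(2)[OF e] cutoff_left(2)[OF e] E(2)])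
qed

lemma src1_outside:
  assumes "e > 0" "s \<le> e^2 \<or> s \<ge> 2 * e^2" shows "src1 k e s = 0"
  using assms cutoff_left[of e s] cutoff_right[of e s] by (auto simp: src1_def)

section \<open>The mass of the shell source and its concentration at the centre\<close>

lemma integral_pos_continuous:
  fixes g :: "real^3 \<Rightarrow> real"
  assumes g: "continuous_on UNIV g" "integrable lborel g" "\<And>x. g x \<ge> 0" "g x0 > 0"
  shows "(LINT x|lborel. g x) > 0"
proof -
  have "open {x. g x > g x0 / 2}"
    using g(1) by (intro open_Collect_less continuous_intros)
  then obtain r where r: "r > 0" "ball x0 r \<subseteq> {x. g x > g x0 / 2}"
    using g(4) openE[of "{x. g x > g x0 / 2}" x0] by auto
  have fin: "emeasure lborel (ball x0 r) < \<infinity>" by (rule emeasure_lborel_ball_finite)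
  have "0 < g x0 / 2 * measure lborel (ball x0 r)"
    using g(4) content_ball_pos[OF r(1), of x0] by simp
  also have "\<dots> = (LINT x|lborel. g x0 / 2 * indicator (ball x0 r) x)"
    by simp
  also have "\<dots> \<le> (LINT x|lborel. g x)"
  proof (rule integral_mono)
    show "integrable lborel (\<lambda>x. g x0 / 2 * indicator (ball x0 r) x :: real)"
      using fin by (intro integrable_mult_right integrable_real_indicator) auto
    show "g x0 / 2 * indicator (ball x0 r) x \<le> g x" for x
      using r(2) g(3)[of x] by (auto simp: indicator_def)
  qed (use g in auto)
  finally show ?thesis .
qed

text \<open>The mass of the shell source in the limit of small \<open>e\<close>, where the wave
  number drops out. Its value is \<open>-4 * pi\<close>, the usual constant for the unnormalised
  wave; the proof establishes its sign, so that it can be divided by.\<close>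

definition kappa :: real where
  "kappa = (LINT v|lborel. (2 * step1 (dsq 0 (v::real^3) - 1) + 4 * dsq 0 v * step2 (dsq 0 v - 1)) / sqrt (dsq 0 v))"

lemma continuous_step_div_sqrt:
  fixes g :: "real \<Rightarrow> real"
  assumes "continuous_on UNIV g" "\<And>s. s \<le> 1 \<Longrightarrow> g s = 0"
  shows "continuous_on UNIV (\<lambda>v::real^3. g (dsq 0 v) / sqrt (dsq 0 v))"
proof -
  have U: "UNIV = {v::real^3. dsq 0 v > 0} \<union> {v. dsq 0 v < 1}" by auto
  have o: "open {v::real^3. dsq 0 v > 0}" "open {v::real^3. dsq 0 v < 1}"
    by (intro open_Collect_less continuous_intros)+
  have "continuous_on {v::real^3. dsq 0 v < 1} (\<lambda>v::real^3. g (dsq 0 v) / sqrt (dsq 0 v))"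
    by (rule continuous_on_eq[OF continuous_on_const[of _ 0]]) (use assms(2) in auto)
  moreover have "continuous_on {v::real^3. dsq 0 v > 0} (\<lambda>v::real^3. g (dsq 0 v) / sqrt (dsq 0 v))"
    by (intro continuous_intros continuous_on_compose2[OF assms(1)]) auto
  ultimately show ?thesis unfolding U using o by (intro continuous_on_open_Un)
qed

lemma outside_cball2: "v \<notin> cball 0 2 \<Longrightarrow> dsq 0 v > 2"
proof -
  assume "v \<notin> cball 0 2"
  then have "norm v > 2" by simp
  then have "(norm v)^2 > 2^2" by (intro power_strict_mono) auto
  then show ?thesis by (simp add: dsq_def)
qed

text \<open>The divergence of the compactly supported field \<open>2 v f(|v|^2)\<close> with
  \<open>f(s) = step1 (s - 1) / sqrt s\<close> integrates to zero. This trades the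
  \<open>step2\<close> part of \<open>kappa\<close> for the \<open>step1\<close> part and leaves
  \<open>-2\<close> times the integral of \<open>step1 (|v|^2 - 1) / |v|\<close>, whose integrand is
  nonnegative and positive somewhere.\<close>

lemma kappa_neg: "kappa < 0"
proof -
  define s1 s2 where "s1 v = step1 (dsq 0 v - 1)" and "s2 v = step2 (dsq 0 v - 1)" for v :: "real^3"
  have c1: "continuous_on UNIV (\<lambda>v::real^3. s1 v / sqrt (dsq 0 v))"
    unfolding s1_def by (rule continuous_step_div_sqrt[of "\<lambda>s. step1 (s - 1)"])
      (auto intro!: continuous_on_compose2[OF continuous_step(2)[of UNIV]] continuous_intros simp: step_left)
  have c2: "continuous_on UNIV (\<lambda>v::real^3. s2 v / sqrt (dsq 0 v))"
    unfolding s2_def by (rule continuous_step_div_sqrt[of "\<lambda>s. step2 (s - 1)"])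
      (auto intro!: continuous_on_compose2[OF continuous_step(3)[of UNIV]] continuous_intros simp: step_left)
  have out: "s1 v = 0" "s2 v = 0" if "v \<notin> cball 0 2" for v :: "real^3"
    using outside_cball2[OF that] by (auto simp: s1_def s2_def step_right)
  have i1: "integrable lborel (\<lambda>v::real^3. s1 v / sqrt (dsq 0 v))"
    by (rule integrable_continuous_compact_support[OF c1 compact_cball[of 0 2]]) (use out in auto)
  have i2: "integrable lborel (\<lambda>v::real^3. dsq 0 v * (s2 v / sqrt (dsq 0 v)))"
    by (rule integrable_continuous_compact_support[OF continuous_on_mult[OF continuous_on_dsq c2] compact_cball[of 0 2]])
       (use out in \<open>auto intro!: continuous_intros\<close>)
  define f f' where "f s = complex_of_real (step1 (s - 1)) * of_real (1 / sqrt s)" and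
    "f' s = complex_of_real (step2 (s - 1)) * of_real (1 / sqrt s) + of_real (step1 (s - 1)) * of_real (- (1 / (2 * s * sqrt s)))" for s
  have fd: "(f has_vector_derivative f' s) (at s)" for s
    unfolding f_def f'_def
  proof (rule cutoff_mult_deriv[where a=1])
    show "((\<lambda>s. step1 (s - 1)) has_real_derivative step2 (s - 1)) (at s)" for s
    proof -
      have "((\<lambda>s. s - 1) has_real_derivative 1) (at s)" by (auto intro!: derivative_eq_intros)
      from DERIV_chain2[OF step_derivs(2) this] show ?thesis by simp
    qed
    show "((\<lambda>s. complex_of_real (1 / sqrt s)) has_vector_derivative of_real (- (1 / (2 * s * sqrt s)))) (at s)" if "s > 0" for s
      using that by (intro has_vector_derivative_of_real) (auto intro!: derivative_eq_intros simp: field_simps)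
  qed (auto simp: step_left)
  have f'c: "continuous_on UNIV f'"
    unfolding f'_def
    by (intro continuous_on_add cutoff_mult_continuous[where a=1])
       (auto simp: step_left intro!: continuous_intros continuous_on_compose2[OF continuous_step(2)[of UNIV]]
         continuous_on_compose2[OF continuous_step(3)[of UNIV]])
  have fc: "continuous_on UNIV f"
    by (rule continuous_at_imp_continuous_on) (use fd has_vector_derivative_continuous in blast)
  have "(LINT v|lborel. 2 * f (dsq 0 v) + of_real (4 * ((v - 0) $ i)^2) * f' (dsq 0 v)) = 0" for i
  proof (rule integral_partial_eq_0[OF _ has_partial_on_radial2 _ compact_cball[of 0 2]])
    show "(f has_vector_derivative f' (dsq 0 y)) (at (dsq 0 y))" for y by (rule fd)
    show "complex_of_real (2 * (v - 0) $ i) * f (dsq 0 v) = 0" if "v \<notin> cball 0 2" for v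
      using outside_cball2[OF that] by (simp add: f_def step_right)
    show "continuous_on UNIV (\<lambda>x. complex_of_real (2 * (x - 0) $ i) * f (dsq 0 x))"
      by (intro continuous_intros continuous_on_compose2[OF fc]) auto
    show "continuous_on UNIV (\<lambda>v. 2 * f (dsq 0 v) + complex_of_real (4 * ((v - 0) $ i)\<^sup>2) * f' (dsq 0 v))"
      by (intro continuous_intros continuous_on_compose2[OF fc] continuous_on_compose2[OF f'c]) auto
  qed
  then have "(\<Sum>i\<in>UNIV. (LINT v|lborel. 2 * f (dsq 0 v) + of_real (4 * ((v - 0) $ i)^2) * f' (dsq 0 v))) = 0"
    by simp
  also have "(\<Sum>i\<in>UNIV. (LINT v|lborel. 2 * f (dsq 0 v) + of_real (4 * ((v - 0) $ i)^2) * f' (dsq 0 v)))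
     = (LINT v|lborel. (\<Sum>i\<in>UNIV. 2 * f (dsq 0 v) + of_real (4 * ((v - 0) $ i)^2) * f' (dsq 0 v)))"
  proof (rule Bochner_Integration.integral_sum[symmetric])
    show "integrable lborel (\<lambda>v. 2 * f (dsq 0 v) + of_real (4 * ((v - 0) $ i)^2) * f' (dsq 0 v))" for i
    proof (rule integrable_continuous_compact_support[OF _ compact_cball[of 0 2]])
      show "continuous_on UNIV (\<lambda>v. 2 * f (dsq 0 v) + complex_of_real (4 * ((v - 0) $ i)\<^sup>2) * f' (dsq 0 v))"
        by (intro continuous_intros continuous_on_compose2[OF fc] continuous_on_compose2[OF f'c]) auto
      show "2 * f (dsq 0 v) + complex_of_real (4 * ((v - 0) $ i)\<^sup>2) * f' (dsq 0 v) = 0" if "v \<notin> cball 0 2" for v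
        using outside_cball2[OF that] by (simp add: f_def f'_def step_right)
    qed
  qed
  also have "\<dots> = (LINT v|lborel. complex_of_real (4 * (s1 v / sqrt (dsq 0 v)) + 4 * (dsq 0 v * (s2 v / sqrt (dsq 0 v)))))"
  proof (rule Bochner_Integration.integral_cong[OF refl])
    fix v :: "real^3"
    show "(\<Sum>i\<in>UNIV. 2 * f (dsq 0 v) + of_real (4 * ((v - 0) $ i)^2) * f' (dsq 0 v))
       = complex_of_real (4 * (s1 v / sqrt (dsq 0 v)) + 4 * (dsq 0 v * (s2 v / sqrt (dsq 0 v))))"
      unfolding radial_laplacian
    proof -
      show "6 * f (dsq 0 v) + 4 * of_real (dsq 0 v) * f' (dsq 0 v)
        = complex_of_real (4 * (s1 v / sqrt (dsq 0 v)) + 4 * (dsq 0 v * (s2 v / sqrt (dsq 0 v))))"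
        unfolding f_def f'_def s1_def s2_def by (cases "dsq 0 v = 0") (auto simp: step_left field_simps)
    qed
  qed
  finally have "(LINT v|lborel. 4 * (s1 v / sqrt (dsq 0 v)) + 4 * (dsq 0 v * (s2 v / sqrt (dsq 0 v)))) = 0"
    unfolding integral_complex_of_real by simp
  moreover have lin: "(LINT v|lborel. c * a v + d * b v) = c * (LINT v|lborel. a v) + d * (LINT v|lborel. b v)"
    if "integrable lborel a" "integrable lborel b" for a b :: "real^3 \<Rightarrow> real" and c d :: real using that by simp
  ultimately have 0: "(LINT v|lborel. s1 v / sqrt (dsq 0 v)) + (LINT v|lborel. dsq 0 v * (s2 v / sqrt (dsq 0 v))) = 0"
    using lin[OF i1 i2, of 4 4] by linarith
  have "kappa = (LINT v|lborel. 2 * (s1 v / sqrt (dsq 0 v)) + 4 * (dsq 0 v * (s2 v / sqrt (dsq 0 v))))"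
    unfolding kappa_def s1_def s2_def by (intro Bochner_Integration.integral_cong) (auto simp: add_divide_distrib mult_ac)
  also have "\<dots> = 2 * (LINT v|lborel. s1 v / sqrt (dsq 0 v)) + 4 * (LINT v|lborel. dsq 0 v * (s2 v / sqrt (dsq 0 v)))"
    by (rule lin[OF i1 i2])
  finally have "kappa = - 2 * (LINT v|lborel. s1 v / sqrt (dsq 0 v))" using 0 by linarith
  moreover have "(LINT v|lborel. s1 v / sqrt (dsq 0 v)) > 0"
  proof (rule integral_pos_continuous[OF c1 i1])
    \<comment> \<open>At this point \<open>|v|^2 - 1 = 1/2\<close>, the middle of the step.\<close>
    show "s1 (sqrt (3/2) *\<^sub>R axis 1 1) / sqrt (dsq 0 (sqrt (3/2) *\<^sub>R axis 1 1)) > 0"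
      by (auto simp: s1_def dsq_def intro!: step1_pos divide_pos_pos)
  qed (auto simp: s1_def step1_nonneg)
  ultimately show ?thesis by simp
qed

lemma lborel_integral_affine3:
  fixes F :: "real^3 \<Rightarrow> complex"
  assumes "F \<in> borel_measurable borel" "c > 0"
  shows "(LINT y|lborel. F y) = of_real (c^3) * (LINT v|lborel. F (x + c *\<^sub>R v))"
proof -
  have "(LINT y|lborel. F y) = (LINT y|density (distr lborel borel (\<lambda>v. x + c *\<^sub>R v)) (\<lambda>_. \<bar>c\<bar>^DIM(real^3)). F y)"
    by (subst lborel_affine[of c x, symmetric]) (use assms in auto)
  also have "\<dots> = (LINT y|density (distr lborel borel (\<lambda>v. x + c *\<^sub>R v)) (\<lambda>_. ennreal (c^3)). F y)"
    using assms(2) by simp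
  also have "\<dots> = (LINT v|distr lborel borel (\<lambda>v. x + c *\<^sub>R v). c^3 *\<^sub>R F v)"
    by (rule integral_density) (use assms in auto)
  also have "\<dots> = (LINT v|lborel. c^3 *\<^sub>R F (x + c *\<^sub>R v))"
    by (rule integral_distr) (use assms in auto)
  finally show ?thesis by (simp add: scaleR_conv_of_real)
qed

text \<open>After the substitution \<open>y = x + e v\<close> the Jacobian \<open>e^3\<close>
  cancels the powers of \<open>e\<close> in the leading term exactly, while the second term keeps a
  factor \<open>e\<close> and disappears in the limit.\<close>

lemma src_scaled:
  assumes e: "e > 0"
  shows "of_real (e^3) * src k e (dsq x (x + e *\<^sub>R v)) =
    of_real ((2 * step1 (dsq 0 v - 1) + 4 * dsq 0 v * step2 (dsq 0 v - 1)) / sqrt (dsq 0 v)) * exp (\<i> * of_real (k * e * sqrt (dsq 0 v)))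
    + of_real (e * step1 (dsq 0 v - 1)) * (4 * \<i> * k * exp (\<i> * of_real (k * e * sqrt (dsq 0 v))))"
proof -
  have d: "dsq x (x + e *\<^sub>R v) = e^2 * dsq 0 v" using e by (simp add: dsq_def power_mult_distrib)
  have c: "cutoff1 e (e^2 * dsq 0 v) = step1 (dsq 0 v - 1) / e^2" "cutoff2 e (e^2 * dsq 0 v) = step2 (dsq 0 v - 1) / e^4"
    using e by (auto simp: cutoff1_def cutoff2_def)
  have s: "sqrt (e^2 * dsq 0 v) = e * sqrt (dsq 0 v)" using e by (simp add: real_sqrt_mult)
  have *: "E^3 * ((2 * (a / E^2) + 4 * (E^2 * t) * (b / E^4)) * (X / (E * q)) + a / E^2 * (4 * \<i> * k * X))
      = (2 * a + 4 * t * b) / q * X + E * a * (4 * \<i> * k * X)" if "E \<noteq> 0" for E a b t X q :: complex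
    using that by (cases "q = 0") (auto simp: field_simps power_numeral_reduce)
  show ?thesis
    unfolding d src_eq[OF e] c s fund_def Let_def
    using *[of "of_real e" "of_real (step1 (dsq 0 v - 1))" "of_real (dsq 0 v)" "of_real (step2 (dsq 0 v - 1))"
      "exp (\<i> * of_real (k * e * sqrt (dsq 0 v)))" "of_real (sqrt (dsq 0 v))"] e
    by (simp add: mult.assoc)
qed

text \<open>Rescaling turns the shrinking shells into a fixed one, on which dominated convergence
  applies: the exponentials tend to 1 and \<open>f\<close> to its value at the centre.\<close>

lemma source_limit:
  fixes f :: "real^3 \<Rightarrow> complex"
  assumes f: "continuous_on (ball x r) f" and r: "r > 0"
  shows "(\<lambda>n. LINT y|lborel. f y * src k (r / (4 * Suc n)) (dsq x y)) \<longlonglongrightarrow> of_real kappa * f x"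
proof -
  \<comment> \<open>The factor 4 keeps the outer shell radius \<open>sqrt 2 * e n\<close> below
    \<open>r / 2\<close>, so that only values of \<open>f\<close> on the compact ball
    \<open>cball x (r/2)\<close> matter, where it is bounded.\<close>
  define e where "e n = r / (4 * Suc n)" for n
  have e: "e n > 0" "e n \<le> r/4" for n
    using r by (auto simp: e_def field_simps)
  have e0: "e \<longlonglongrightarrow> 0"
  proof -
    have "e = (\<lambda>n. r / 4 * (1 / real (Suc n)))" by (simp add: e_def fun_eq_iff)
    then show ?thesis using tendsto_mult[OF tendsto_const[of "r/4"] LIMSEQ_Suc[OF lim_1_over_n]] by simp
  qed
  have far: "src k (e n) (dsq x y) = 0" if "y \<notin> cball x (r/2)" for y n
  proof (rule src_outside[OF e(1)])
    have "norm (y - x) > r/2" using that by (simp add: dist_norm norm_minus_commute)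
    then have "dsq x y \<ge> (r/2)^2" unfolding dsq_def using r by (intro power_mono) auto
    moreover have "2 * (e n)^2 \<le> 2 * (r/4)^2" using e[of n] by (intro mult_left_mono power_mono) auto
    moreover have "2 * (r/4)^2 \<le> (r/2)^2" by (simp add: power2_eq_square)
    ultimately show "dsq x y \<le> (e n)\<^sup>2 \<or> 2 * (e n)\<^sup>2 \<le> dsq x y" by linarith
  qed
  have "continuous_on UNIV (\<lambda>y. f y * src k (e n) (dsq x y))" for n
  proof -
    have U: "UNIV = ball x r \<union> - cball x (r/2)" using r by auto
    have "continuous_on (- cball x (r/2)) (\<lambda>y. f y * src k (e n) (dsq x y))"
      by (rule continuous_on_eq[OF continuous_on_const[of _ 0]]) (use far in auto)
    moreover have "continuous_on (ball x r) (\<lambda>y. f y * src k (e n) (dsq x y))"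
      by (intro continuous_intros f continuous_on_compose2[OF src_cont[OF e(1)]]) auto
    ultimately show ?thesis unfolding U by (intro continuous_on_open_Un) (auto simp: open_Compl)
  qed
  then have Fm: "(\<lambda>y. f y * src k (e n) (dsq x y)) \<in> borel_measurable borel" for n
    by (rule borel_measurable_continuous_onI)
  define A B where "A v = (2 * step1 (dsq 0 v - 1) + 4 * dsq 0 v * step2 (dsq 0 v - 1)) / sqrt (dsq 0 v)"
    and "B v = step1 (dsq 0 v - 1)" for v :: "real^3"
  define G where "G n v = f (x + e n *\<^sub>R v) * (of_real (A v) * exp (\<i> * of_real (k * e n * sqrt (dsq 0 v)))
      + of_real (e n * B v) * (4 * \<i> * k * exp (\<i> * of_real (k * e n * sqrt (dsq 0 v)))))" for n v
  have GF: "(LINT y|lborel. f y * src k (e n) (dsq x y)) = (LINT v|lborel. G n v)" for n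
  proof -
    have "(LINT y|lborel. f y * src k (e n) (dsq x y)) = of_real ((e n)^3) * (LINT v|lborel. f (x + e n *\<^sub>R v) * src k (e n) (dsq x (x + e n *\<^sub>R v)))"
      by (rule lborel_integral_affine3[OF Fm e(1)])
    also have "\<dots> = (LINT v|lborel. f (x + e n *\<^sub>R v) * (of_real ((e n)^3) * src k (e n) (dsq x (x + e n *\<^sub>R v))))"
      by (subst integral_mult_right_zero[symmetric]) (simp add: mult_ac)
    also have "\<dots> = (LINT v|lborel. G n v)"
      unfolding G_def A_def B_def by (subst src_scaled[OF e(1)]) simp
    finally show ?thesis .
  qed
  have Gm[measurable]: "G n \<in> borel_measurable borel" for n
  proof -
    have "G n = (\<lambda>v. of_real ((e n)^3) * (f (x + e n *\<^sub>R v) * src k (e n) (dsq x (x + e n *\<^sub>R v))))"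
      unfolding G_def A_def B_def by (subst src_scaled[OF e(1), of _ _ x, symmetric]) (simp add: mult_ac fun_eq_iff)
    moreover have "(\<lambda>v. f (x + e n *\<^sub>R v) * src k (e n) (dsq x (x + e n *\<^sub>R v))) \<in> borel_measurable borel"
      using measurable_compose[of "\<lambda>v. x + e n *\<^sub>R v" borel borel, OF _ Fm[of n]] by simp
    ultimately show ?thesis by simp
  qed
  have Ac: "continuous_on UNIV A"
    unfolding A_def by (rule continuous_step_div_sqrt[of "\<lambda>s. 2 * step1 (s - 1) + 4 * s * step2 (s - 1)"])
       (auto simp: step_left intro!: continuous_intros continuous_on_compose2[OF continuous_step(2)[of UNIV]]
         continuous_on_compose2[OF continuous_step(3)[of UNIV]])
  have out: "A v = 0" "B v = 0" if "v \<notin> cball 0 2" for v :: "real^3"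
    using outside_cball2[OF that] by (auto simp: A_def B_def step_right)
  obtain MA where MA: "MA > 0" "\<And>v. norm (A v) \<le> MA"
    using bounded_continuous_compact_support[OF Ac compact_cball out(1)] by blast
  have "bounded (f ` cball x (r/2))"
    using r by (intro compact_imp_bounded compact_continuous_image continuous_on_subset[OF f]) auto
  then obtain Mf where Mf: "Mf > 0" "\<And>y. y \<in> cball x (r/2) \<Longrightarrow> norm (f y) \<le> Mf" unfolding bounded_pos by auto
  have "(\<lambda>n. LINT v|lborel. G n v) \<longlonglongrightarrow> (LINT v|lborel. f x * of_real (A v))"
  proof (rule integral_dominated_convergence[where w="\<lambda>v. Mf * (MA + r * 140 * (4 * \<bar>k\<bar>)) * indicator (cball 0 2) v"])
    show "integrable lborel (\<lambda>v. Mf * (MA + r * 140 * (4 * \<bar>k\<bar>)) * indicator (cball 0 2) (v::real^3) :: real)"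
      using emeasure_lborel_cball_finite[of "0::real^3" 2] by (intro integrable_mult_right integrable_real_indicator) auto
    show "AE v in lborel. norm (G n v) \<le> Mf * (MA + r * 140 * (4 * \<bar>k\<bar>)) * indicator (cball 0 2) v" for n
    proof (rule AE_I2)
      fix v :: "real^3"
      show "norm (G n v) \<le> Mf * (MA + r * 140 * (4 * \<bar>k\<bar>)) * indicator (cball 0 2) v"
      proof (cases "v \<in> cball 0 2")
        case False then show ?thesis using out[OF False] by (simp add: G_def)
      next
        case True
        have "norm (e n *\<^sub>R v) \<le> r/4 * 2" unfolding norm_scaleR using e[of n] True by (intro mult_mono) auto
        then have "x + e n *\<^sub>R v \<in> cball x (r/2)" by (simp add: dist_norm)
        then have 1: "norm (f (x + e n *\<^sub>R v)) \<le> Mf" by (rule Mf(2))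
        let ?E = "exp (\<i> * of_real (k * e n * sqrt (dsq 0 v)))"
        have E: "norm ?E = 1" by simp
        have "norm (of_real (A v) * ?E + of_real (e n * B v) * (4 * \<i> * k * ?E)) \<le> norm (of_real (A v) * ?E) + norm (of_real (e n * B v) * (4 * \<i> * k * ?E))"
          by (rule norm_triangle_ineq)
        also have "\<dots> = norm (A v) + \<bar>e n\<bar> * B v * (4 * \<bar>k\<bar>)"
          using step1_nonneg by (simp add: norm_mult B_def)
        also have "\<dots> \<le> MA + r * 140 * (4 * \<bar>k\<bar>)"
          using MA(2)[of v] e[of n] step1_le step1_nonneg r by (intro add_mono mult_right_mono mult_mono) (auto simp: B_def)
        finally have "norm (G n v) \<le> Mf * (MA + r * 140 * (4 * \<bar>k\<bar>))"
          unfolding G_def norm_mult using 1 Mf(1) by (intro mult_mono) auto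
        then show ?thesis using True by simp
      qed
    qed
    show "AE v in lborel. (\<lambda>n. G n v) \<longlonglongrightarrow> f x * of_real (A v)"
    proof (rule AE_I2)
      fix v :: "real^3"
      have "isCont f x" using f r by (simp add: continuous_on_eq_continuous_at)
      moreover have "(\<lambda>n. x + e n *\<^sub>R v) \<longlonglongrightarrow> x + 0 *\<^sub>R v" by (intro tendsto_intros e0)
      ultimately have 1: "(\<lambda>n. f (x + e n *\<^sub>R v)) \<longlonglongrightarrow> f x" using isCont_tendsto_compose[of x f] by simp
      have "(\<lambda>n. G n v) \<longlonglongrightarrow> f x * (of_real (A v) * exp (\<i> * of_real (k * 0 * sqrt (dsq 0 v)))
        + of_real (0 * B v) * (4 * \<i> * k * exp (\<i> * of_real (k * 0 * sqrt (dsq 0 v)))))"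
        unfolding G_def by (intro tendsto_intros 1 e0)
      then show "(\<lambda>n. G n v) \<longlonglongrightarrow> f x * of_real (A v)" by simp
    qed
    show "(\<lambda>v. f x * complex_of_real (A v)) \<in> borel_measurable lborel"
      using borel_measurable_continuous_onI[OF Ac] by simp
  qed simp
  also have "(LINT v|lborel. f x * of_real (A v)) = of_real kappa * f x"
  proof -
    have "kappa = (LINT v|lborel. A v)" by (simp add: kappa_def A_def)
    then show ?thesis by simp
  qed
  finally show ?thesis using GF unfolding e_def by simp
qed

section \<open>Weak solutions and their representation\<close>

definition C1_fun :: "(real^3 \<Rightarrow> complex) \<Rightarrow> (3 \<Rightarrow> real^3 \<Rightarrow> complex) \<Rightarrow> bool" where
  "C1_fun f Df \<longleftrightarrow> continuous_on UNIV f \<and> (\<forall>i. has_partial_on f i (Df i) UNIV \<and> continuous_on UNIV (Df i))"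

lemma C1_funD:
  assumes "C1_fun f Df"
  shows "continuous_on UNIV f" "has_partial_on f i (Df i) UNIV" "continuous_on UNIV (Df i)"
  using assms by (auto simp: C1_fun_def)

lemma C1_fun_mult:
  assumes "C1_fun f Df" "C1_fun g Dg"
  shows "C1_fun (\<lambda>x. f x * g x) (\<lambda>i x. Df i x * g x + f x * Dg i x)"
  unfolding C1_fun_def using C1_funD[OF assms(1)] C1_funD[OF assms(2)]
  by (auto intro!: has_partial_on_mult continuous_intros)

lemma C1_fun_radial:
  assumes "\<And>s. (h has_vector_derivative h1 s) (at s)" "continuous_on UNIV h1"
  shows "C1_fun (\<lambda>y. h (dsq c y)) (\<lambda>i y. of_real (2 * (y - c) $ i) * h1 (dsq c y))"
  unfolding C1_fun_def
proof (intro conjI allI)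
  have "continuous_on UNIV h"
    by (rule continuous_at_imp_continuous_on) (use assms(1) has_vector_derivative_continuous in blast)
  then show "continuous_on UNIV (\<lambda>y. h (dsq c y))"
    by (rule continuous_on_compose2[OF _ continuous_on_dsq[OF continuous_on_id]]) auto
  show "continuous_on UNIV (\<lambda>y. of_real (2 * (y - c) $ i) * h1 (dsq c y))" for i
    by (intro continuous_intros continuous_on_compose2[OF assms(2)]) auto
qed (intro has_partial_on_radial assms)

lemma C1_fun_sum:
  assumes "\<And>c. c \<in> X \<Longrightarrow> C1_fun (f c) (Df c)"
  shows "C1_fun (\<lambda>y. \<Sum>c\<in>X. f c y) (\<lambda>i y. \<Sum>c\<in>X. Df c i y)"
  unfolding C1_fun_def using C1_funD[OF assms] by (auto intro!: has_partial_on_sum continuous_intros)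

lemma C1_fun_zero_outside:
  assumes "C1_fun f Df" "closed K" "\<And>x. x \<notin> K \<Longrightarrow> f x = 0" "x \<notin> K"
  shows "Df i x = 0"
  using partial_zero_outside[OF C1_funD(2)[OF assms(1)] assms(2-4)] .

lemma integrable_mult_compact_support:
  fixes f g :: "real^3 \<Rightarrow> complex"
  assumes f: "set_integrable lborel K f" and g: "continuous_on UNIV g" "compact K" "\<And>x. x \<notin> K \<Longrightarrow> g x = 0"
  shows "integrable lborel (\<lambda>x. f x * g x)"
proof -
  obtain B where B: "B > 0" "\<And>x. norm (g x) \<le> B" using bounded_continuous_compact_support[OF g] by blast
  let ?f = "\<lambda>x. indicator K x *\<^sub>R f x"
  have fi: "integrable lborel ?f" using f by (simp add: set_integrable_def)
  have eq: "(\<lambda>x. f x * g x) = (\<lambda>x. ?f x * g x)" using g(3) by (auto simp: indicator_def)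
  have gm: "g \<in> borel_measurable lborel" using borel_measurable_continuous_onI[OF g(1)] by simp
  show ?thesis unfolding eq
  proof (rule Bochner_Integration.integrable_bound)
    show "integrable lborel (\<lambda>x. B * norm (?f x))" using fi by (intro integrable_mult_right integrable_norm)
    show "(\<lambda>x. ?f x * g x) \<in> borel_measurable lborel" using borel_measurable_integrable[OF fi] gm by (rule borel_measurable_times)
    show "AE x in lborel. norm (?f x * g x) \<le> norm (B * norm (?f x))"
    proof (rule AE_I2)
      fix x
      have "norm (?f x) * norm (g x) \<le> norm (?f x) * B" by (intro mult_left_mono B(2)) simp
      then show "norm (?f x * g x) \<le> norm (B * norm (?f x))" using B(1) by (simp add: norm_mult mult_ac)
    qed
  qed
qed

text \<open>
  \<open>w\<close> and \<open>p\<close> are meant to be extended by zero outside the domain of the solution. In the symmetric case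
  this domain is a half space in the region \<open>D\<close>, test functions need not vanish on its boundary,
  and the bound on the third component says that a vector field is tangential there.
\<close>

locale weak_helmholtz =
  fixes k :: real and D :: "(real^3) set" and w :: "real^3 \<Rightarrow> complex" and p :: "3 \<Rightarrow> real^3 \<Rightarrow> complex" and symm :: bool
  assumes w_int: "compact K \<Longrightarrow> K \<subseteq> D \<Longrightarrow> set_integrable lborel K w"
    and p_int: "compact K \<Longrightarrow> K \<subseteq> D \<Longrightarrow> set_integrable lborel K (p i)"
    and weak: "C1_fun \<phi> D\<phi> \<Longrightarrow> compact K \<Longrightarrow> K \<subseteq> D \<Longrightarrow> (\<And>x. x \<notin> K \<Longrightarrow> \<phi> x = 0) \<Longrightarrow>
       (LINT x|lborel. (\<Sum>i\<in>UNIV. p i x * D\<phi> i x) - of_real (k^2) * w x * \<phi> x) = 0"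
    and ibp: "(\<And>i. continuous_on UNIV (g i)) \<Longrightarrow> (\<And>i. has_partial_on (g i) i (Dg i) UNIV) \<Longrightarrow> (\<And>i. continuous_on UNIV (Dg i)) \<Longrightarrow>
       compact K \<Longrightarrow> K \<subseteq> D \<Longrightarrow> (\<And>i x. x \<notin> K \<Longrightarrow> g i x = 0) \<Longrightarrow>
       (symm \<Longrightarrow> \<exists>C. \<forall>x. cmod (g 3 x) \<le> C * \<bar>x $ 3\<bar>) \<Longrightarrow>
       (LINT x|lborel. (\<Sum>i\<in>UNIV. p i x * g i x + w x * Dg i x)) = 0"
begin

text \<open>Second Green formula with the boundary terms spread out: test the equation with the
  product of \<open>\<eta>\<close> and \<open>e\<close>, integrate by parts with
  \<open>\<eta>\<close> times the gradient of \<open>e\<close>, and subtract. The products of the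
  gradients of \<open>w\<close> and \<open>e\<close> cancel, and what would be boundary terms
  appears as an integral against the derivatives of \<open>\<eta>\<close>.\<close>

lemma green:
  assumes \<eta>: "C1_fun \<eta> D\<eta>" "compact K" "K \<subseteq> D" "\<And>x. x \<notin> K \<Longrightarrow> \<eta> x = 0"
    and e: "C1_fun e De" "\<And>i. has_partial_on (De i) i (DDe i) UNIV" "\<And>i. continuous_on UNIV (DDe i)"
    and s: "symm \<Longrightarrow> \<exists>C. \<forall>x. cmod (\<eta> x * De 3 x) \<le> C * \<bar>x $ 3\<bar>"
  shows "(LINT x|lborel. (\<Sum>i\<in>UNIV. (e x * p i x - w x * De i x) * D\<eta> i x))
       = (LINT x|lborel. w x * (\<eta> x * ((\<Sum>i\<in>UNIV. DDe i x) + of_real (k^2) * e x)))"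
proof -
  note cK = compact_imp_closed[OF \<eta>(2)]
  note D0 = C1_fun_zero_outside[OF \<eta>(1) cK \<eta>(4)]
  note wi = w_int[OF \<eta>(2,3)] and pi = p_int[OF \<eta>(2,3)]
  note c = C1_funD[OF \<eta>(1)] C1_funD[OF e(1)] e(3)
  have i1: "integrable lborel (\<lambda>x. p i x * (D\<eta> i x * e x + \<eta> x * De i x))" for i
    by (rule integrable_mult_compact_support[OF pi _ \<eta>(2)]) (use c \<eta>(4) D0 in \<open>auto intro!: continuous_intros\<close>)
  have i2: "integrable lborel (\<lambda>x. w x * (\<eta> x * e x))"
    by (rule integrable_mult_compact_support[OF wi _ \<eta>(2)]) (use c \<eta>(4) D0 in \<open>auto intro!: continuous_intros\<close>)
  have i3: "integrable lborel (\<lambda>x. p i x * (\<eta> x * De i x))" for i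
    by (rule integrable_mult_compact_support[OF pi _ \<eta>(2)]) (use c \<eta>(4) D0 in \<open>auto intro!: continuous_intros\<close>)
  have i4: "integrable lborel (\<lambda>x. w x * (D\<eta> i x * De i x + \<eta> x * DDe i x))" for i
    by (rule integrable_mult_compact_support[OF wi _ \<eta>(2)]) (use c \<eta>(4) D0 in \<open>auto intro!: continuous_intros\<close>)
  have i5: "integrable lborel (\<lambda>x. w x * (\<eta> x * ((\<Sum>i\<in>UNIV. DDe i x) + of_real (k^2) * e x)))"
    by (rule integrable_mult_compact_support[OF wi _ \<eta>(2)]) (use c \<eta>(4) D0 in \<open>auto intro!: continuous_intros\<close>)
  have 1: "(LINT x|lborel. (\<Sum>i\<in>UNIV. p i x * (D\<eta> i x * e x + \<eta> x * De i x)) - of_real (k^2) * w x * (\<eta> x * e x)) = 0"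
    by (rule weak[OF C1_fun_mult[OF \<eta>(1) e(1)] \<eta>(2,3)]) (simp add: \<eta>(4))
  have 2: "(LINT x|lborel. (\<Sum>i\<in>UNIV. p i x * (\<eta> x * De i x) + w x * (D\<eta> i x * De i x + \<eta> x * DDe i x))) = 0"
    by (rule ibp[OF _ _ _ \<eta>(2,3)]) (use c e(2) \<eta>(4) s in \<open>auto intro!: continuous_intros has_partial_on_mult\<close>)
  have j1: "integrable lborel (\<lambda>x. (\<Sum>i\<in>UNIV. p i x * (D\<eta> i x * e x + \<eta> x * De i x)) - of_real (k^2) * w x * (\<eta> x * e x))"
    using i1 i2 by (intro Bochner_Integration.integrable_diff Bochner_Integration.integrable_sum) (auto simp: mult.assoc)
  have j2: "integrable lborel (\<lambda>x. (\<Sum>i\<in>UNIV. p i x * (\<eta> x * De i x) + w x * (D\<eta> i x * De i x + \<eta> x * DDe i x)))"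
    using i3 i4 by (intro Bochner_Integration.integrable_add Bochner_Integration.integrable_sum)
  have "(LINT x|lborel. (\<Sum>i\<in>UNIV. (e x * p i x - w x * De i x) * D\<eta> i x))
     = (LINT x|lborel. ((\<Sum>i\<in>UNIV. p i x * (D\<eta> i x * e x + \<eta> x * De i x)) - of_real (k^2) * w x * (\<eta> x * e x))
        - (\<Sum>i\<in>UNIV. p i x * (\<eta> x * De i x) + w x * (D\<eta> i x * De i x + \<eta> x * DDe i x))
        + w x * (\<eta> x * ((\<Sum>i\<in>UNIV. DDe i x) + of_real (k^2) * e x)))"
    by (rule Bochner_Integration.integral_cong) (simp_all add: sum_3 algebra_simps)
  also have "\<dots> = (LINT x|lborel. w x * (\<eta> x * ((\<Sum>i\<in>UNIV. DDe i x) + of_real (k^2) * e x)))"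
    using j1 j2 i5 1 2 by simp
  finally show ?thesis .
qed

text \<open>Distributional form of the equation. In the symmetric case the support of
  \<open>e\<close> may cross the plane, at the price of a normal derivative that vanishes there at a
  linear rate.\<close>

lemma weak_laplacian:
  assumes K: "compact K" "K \<subseteq> D" "\<And>x. x \<notin> K \<Longrightarrow> e x = 0"
    and e: "C1_fun e De" "\<And>i. has_partial_on (De i) i (DDe i) UNIV" "\<And>i. continuous_on UNIV (DDe i)"
    and s: "symm \<Longrightarrow> \<exists>C. \<forall>x. cmod (De 3 x) \<le> C * \<bar>x $ 3\<bar>"
  shows "(LINT x|lborel. w x * ((\<Sum>i\<in>UNIV. DDe i x) + of_real (k^2) * e x)) = 0"
proof -
  note cK = compact_imp_closed[OF K(1)]
  have D0: "De i x = 0" if "x \<notin> K" for x i using C1_fun_zero_outside[OF e(1) cK K(3)] that by blast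
  have DD0: "DDe i x = 0" if "x \<notin> K" for x i using partial_zero_outside[OF e(2) cK D0] that by blast
  note wi = w_int[OF K(1,2)] and pi = p_int[OF K(1,2)]
  note c = C1_funD[OF e(1)] e(3)
  have i1: "integrable lborel (\<lambda>x. p i x * De i x)" for i
    by (rule integrable_mult_compact_support[OF pi _ K(1)]) (use c D0 in auto)
  have i2: "integrable lborel (\<lambda>x. w x * e x)"
    by (rule integrable_mult_compact_support[OF wi _ K(1)]) (use c K(3) in auto)
  have i3: "integrable lborel (\<lambda>x. w x * DDe i x)" for i
    by (rule integrable_mult_compact_support[OF wi _ K(1)]) (use c DD0 in auto)
  have 1: "(LINT x|lborel. (\<Sum>i\<in>UNIV. p i x * De i x) - of_real (k^2) * w x * e x) = 0"
    by (rule weak[OF e(1) K])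
  have 2: "(LINT x|lborel. (\<Sum>i\<in>UNIV. p i x * De i x + w x * DDe i x)) = 0"
    by (rule ibp[OF _ _ _ K(1,2)]) (use c e D0 s in auto)
  have j1: "integrable lborel (\<lambda>x. (\<Sum>i\<in>UNIV. p i x * De i x) - of_real (k^2) * w x * e x)"
    using i1 i2 by (intro Bochner_Integration.integrable_diff Bochner_Integration.integrable_sum) (auto simp: mult.assoc)
  have j2: "integrable lborel (\<lambda>x. (\<Sum>i\<in>UNIV. p i x * De i x + w x * DDe i x))"
    using i3 i1 by (intro Bochner_Integration.integrable_add Bochner_Integration.integrable_sum)
  have "(LINT x|lborel. w x * ((\<Sum>i\<in>UNIV. DDe i x) + of_real (k^2) * e x))
     = (LINT x|lborel. (\<Sum>i\<in>UNIV. p i x * De i x + w x * DDe i x) -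
        ((\<Sum>i\<in>UNIV. p i x * De i x) - of_real (k^2) * w x * e x))"
    by (rule Bochner_Integration.integral_cong) (simp_all add: sum_3 algebra_simps)
  also have "\<dots> = 0" using j1 j2 1 2 by simp
  finally show ?thesis .
qed

end

section \<open>Reflection in the plane and image sources\<close>

definition refl3 :: "real^3 \<Rightarrow> real^3" where
  "refl3 x = (\<chi> i. if i = 3 then - x $ i else x $ i)"

lemma refl3_nth [simp]: "refl3 x $ 1 = x $ 1" "refl3 x $ 2 = x $ 2" "refl3 x $ 3 = - x $ 3"
  by (auto simp: refl3_def)

lemma dsq_refl3: "dsq (refl3 c) y = dsq c (refl3 y)"
  by (simp add: dsq_eq_sum sum_3 power2_eq_square algebra_simps)

lemma refl3_plane: "y $ 3 = 0 \<Longrightarrow> refl3 y = y"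
  by (auto simp: refl3_def vec_eq_iff)

lemma norm_refl3: "norm (refl3 x) = norm x"
  unfolding norm_eq_sqrt_inner by (simp add: inner_vec_def sum_3)

text \<open>Method of images: in the symmetric case the source is doubled by its mirror point, which
  makes the normal derivative of the summed radial fields vanish on the plane. A sum over this set
  counts a point of the plane only once, whence the hypotheses that \<open>x $ 3\<close> is
  nonzero.\<close>

definition sources :: "bool \<Rightarrow> real^3 \<Rightarrow> (real^3) set" where
  "sources symm x = (if symm then {x, refl3 x} else {x})"

lemma finite_sources [simp]: "finite (sources s x)" "x \<in> sources s x"
  by (auto simp: sources_def)

text \<open>On the plane the two distances agree while the vertical offsets have opposite
  signs.\<close>

lemma sources_radial_odd:
  fixes h1 :: "real \<Rightarrow> complex"
  assumes "x $ 3 \<noteq> 0" "y $ 3 = 0"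
  shows "(\<Sum>c\<in>sources True x. of_real (2 * (y - c) $ 3) * h1 (dsq c y)) = 0"
proof -
  have "x \<noteq> refl3 x"
  proof
    assume "x = refl3 x"
    then have "x $ 3 = - x $ 3" by (metis refl3_nth(3))
    then show False using assms(1) by simp
  qed
  then show ?thesis using assms by (simp add: sources_def dsq_refl3 refl3_plane)
qed

text \<open>Mean value estimate along the vertical segment from the foot point on the plane. It
  turns vanishing on the plane into the linear bound by which \<open>weak_helmholtz\<close>
  expresses tangential fields.\<close>

lemma vanishing_on_plane_bound:
  fixes m :: "real^3 \<Rightarrow> complex"
  assumes "has_partial_on m 3 m' UNIV" "continuous_on UNIV m'" "\<And>y. y $ 3 = 0 \<Longrightarrow> m y = 0"
  obtains C where "C > 0" "\<And>y. norm y \<le> r \<Longrightarrow> cmod (m y) \<le> C * \<bar>y $ 3\<bar>"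
proof -
  have "bounded (m' ` cball 0 (2 * \<bar>r\<bar>))"
    by (intro compact_imp_bounded compact_continuous_image continuous_on_subset[OF assms(2)]) auto
  then obtain C where C: "C > 0" "\<And>y. norm y \<le> 2 * \<bar>r\<bar> \<Longrightarrow> cmod (m' y) \<le> C" unfolding bounded_pos by auto
  have "cmod (m y) \<le> C * \<bar>y $ 3\<bar>" if y: "norm y \<le> r" for y
  proof -
    define z where "z = y - (y $ 3) *\<^sub>R axis 3 1"
    have z3: "z $ 3 = 0" by (simp add: z_def)
    have ny: "\<bar>y $ 3\<bar> \<le> r" using component_le_norm_cart[of y 3] y by linarith
    have nz: "norm (z + t *\<^sub>R axis 3 1) \<le> 2 * \<bar>r\<bar>" if "\<bar>t\<bar> \<le> \<bar>y $ 3\<bar>" for t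
    proof -
      have "norm (z + t *\<^sub>R axis 3 1) \<le> norm (y + (t - y $ 3) *\<^sub>R axis 3 1)" by (simp add: z_def algebra_simps)
      also have "\<dots> \<le> norm y"
        using that by (intro norm_le_componentwise_cart) (auto simp: axis_def)
      finally show ?thesis using y by simp
    qed
    have yz: "y = z + (y $ 3) *\<^sub>R axis 3 1" by (simp add: z_def)
    have d: "((\<lambda>t. m (z + t *\<^sub>R axis 3 1)) has_vector_derivative m' (z + t *\<^sub>R axis 3 1)) (at t)" for t
      by (rule has_partial_on_line[OF assms(1)]) simp
    show ?thesis
    proof (cases "y $ 3 \<ge> 0")
      case True
      have "norm (m (z + (y $ 3) *\<^sub>R axis 3 1) - m (z + 0 *\<^sub>R axis 3 1)) \<le> C * (y $ 3 - 0)"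
        by (rule norm_diff_le_of_vector_derivative[OF True d]) (use True in \<open>auto intro!: C(2) nz\<close>)
      then show ?thesis using assms(3)[OF z3] True yz[symmetric] by simp
    next
      case False
      then have F: "y $ 3 \<le> 0" by simp
      have "norm (m (z + 0 *\<^sub>R axis 3 1) - m (z + (y $ 3) *\<^sub>R axis 3 1)) \<le> C * (0 - y $ 3)"
        by (rule norm_diff_le_of_vector_derivative[OF F d]) (use F in \<open>auto intro!: C(2) nz\<close>)
      then show ?thesis using assms(3)[OF z3] False yz[symmetric] by simp
    qed
  qed
  then show ?thesis using that[of C] C(1) by blast
qed

lemma radial_sum:
  fixes h h1 h2 :: "real \<Rightarrow> complex" and X :: "(real^3) set"
  assumes h: "\<And>s. (h has_vector_derivative h1 s) (at s)" "\<And>s. (h1 has_vector_derivative h2 s) (at s)" "continuous_on UNIV h2"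
  defines "De \<equiv> (\<lambda>i y. \<Sum>c\<in>X. of_real (2 * (y - c) $ i) * h1 (dsq c y))"
    and "DDe \<equiv> (\<lambda>i y. \<Sum>c\<in>X. 2 * h1 (dsq c y) + of_real (4 * ((y - c) $ i)^2) * h2 (dsq c y))"
  shows "C1_fun (\<lambda>y. \<Sum>c\<in>X. h (dsq c y)) De" "has_partial_on (De i) i (DDe i) UNIV" "continuous_on UNIV (DDe i)"
    "(\<Sum>i\<in>UNIV. DDe i y) = (\<Sum>c\<in>X. 6 * h1 (dsq c y) + 4 * of_real (dsq c y) * h2 (dsq c y))"
proof -
  have c1: "continuous_on UNIV h1"
    by (rule continuous_at_imp_continuous_on) (use h(2) has_vector_derivative_continuous in blast)
  show "C1_fun (\<lambda>y. \<Sum>c\<in>X. h (dsq c y)) De"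
    unfolding De_def by (intro C1_fun_sum C1_fun_radial h c1)
  show "has_partial_on (De i) i (DDe i) UNIV"
    unfolding De_def DDe_def by (intro has_partial_on_sum has_partial_on_radial2 h)
  show "continuous_on UNIV (DDe i)"
    unfolding DDe_def by (intro continuous_intros continuous_on_compose2[OF c1] continuous_on_compose2[OF h(3)]) auto
  show "(\<Sum>i\<in>UNIV. DDe i y) = (\<Sum>c\<in>X. 6 * h1 (dsq c y) + 4 * of_real (dsq c y) * h2 (dsq c y))"
    unfolding DDe_def by (subst sum.swap) (simp only: radial_laplacian)
qed

lemma dsq_le_iff_dist: "r \<ge> 0 \<Longrightarrow> dsq c y \<le> r^2 \<longleftrightarrow> y \<in> cball c r"
  by (simp add: dsq_def dist_norm norm_minus_commute abs_le_square_iff[symmetric])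

lemma dsq_less_iff_dist: "r \<ge> 0 \<Longrightarrow> dsq c y < r^2 \<longleftrightarrow> y \<in> ball c r"
  using abs_le_square_iff[of r "norm (y - c)"] by (auto simp: dsq_def dist_norm norm_minus_commute not_le[symmetric])

context weak_helmholtz
begin

text \<open>The linear bound near the plane is only locally uniform; the compactly supported factor
  makes it global.\<close>

lemma radial_sum_sym_bound:
  fixes h h1 h2 :: "real \<Rightarrow> complex"
  assumes h: "\<And>s. (h has_vector_derivative h1 s) (at s)" "\<And>s. (h1 has_vector_derivative h2 s) (at s)" "continuous_on UNIV h2"
    and x: "x $ 3 \<noteq> 0" and \<eta>: "continuous_on UNIV \<eta>" "compact K" "\<And>x. x \<notin> K \<Longrightarrow> \<eta> x = 0"
  shows "\<exists>C. \<forall>y. cmod (\<eta> y * (\<Sum>c\<in>sources True x. of_real (2 * (y - c) $ 3) * h1 (dsq c y))) \<le> C * \<bar>y $ 3\<bar>"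
proof -
  obtain R where R: "\<And>x. x \<in> K \<Longrightarrow> norm x \<le> R"
    using compact_imp_bounded[OF \<eta>(2)] unfolding bounded_iff by auto
  obtain B where B: "B > 0" "\<And>x. cmod (\<eta> x) \<le> B" using bounded_continuous_compact_support[OF \<eta>] by blast
  note m = radial_sum[OF h, where X="sources True x"]
  obtain C where C: "C > 0" "\<And>y. norm y \<le> R \<Longrightarrow> cmod (\<Sum>c\<in>sources True x. of_real (2 * (y - c) $ 3) * h1 (dsq c y)) \<le> C * \<bar>y $ 3\<bar>"
    using vanishing_on_plane_bound[OF m(2) m(3) sources_radial_odd[OF x]] by blast
  have "cmod (\<eta> y * (\<Sum>c\<in>sources True x. of_real (2 * (y - c) $ 3) * h1 (dsq c y))) \<le> (B * C) * \<bar>y $ 3\<bar>" for y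
  proof (cases "y \<in> K")
    case True
    then have "cmod (\<eta> y * (\<Sum>c\<in>sources True x. of_real (2 * (y - c) $ 3) * h1 (dsq c y))) \<le> B * (C * \<bar>y $ 3\<bar>)"
      unfolding norm_mult using B C R by (intro mult_mono) auto
    then show ?thesis by (simp add: mult_ac)
  qed (use \<eta>(3) B C in auto)
  then show ?thesis by blast
qed

text \<open>Green's formula for the singular kernel itself. Replacing it by a truncated kernel
  leaves the integrand unchanged: near \<open>x\<close> the derivatives of \<open>\<eta>\<close>
  vanish, and near the mirror point \<open>w\<close> and \<open>p\<close> vanish. Then
  \<open>green\<close> applies, only the shell around \<open>x\<close> contributes, and its radius
  is sent to 0.\<close>

lemma representation:
  assumes r: "r > 0" and x3: "symm \<Longrightarrow> x $ 3 \<noteq> 0" and w: "continuous_on (ball x r) w"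
    and X: "\<And>c y. c \<in> sources symm x \<Longrightarrow> c \<noteq> x \<Longrightarrow> y \<in> ball c r \<Longrightarrow> w y = 0"
       "\<And>c y i. c \<in> sources symm x \<Longrightarrow> c \<noteq> x \<Longrightarrow> y \<in> ball c r \<Longrightarrow> p i y = 0"
    and \<eta>: "C1_fun \<eta> D\<eta>" "compact K" "K \<subseteq> D" "\<And>x. x \<notin> K \<Longrightarrow> \<eta> x = 0" "\<And>y. y \<in> ball x r \<Longrightarrow> \<eta> y = 1"
  shows "of_real kappa * w x = (LINT y|lborel. (\<Sum>i\<in>UNIV.
      ((\<Sum>c\<in>sources symm x. fund k (dsq c y)) * p i y
        - w y * (\<Sum>c\<in>sources symm x. of_real (2 * (y - c) $ i) * fund1 k (dsq c y))) * D\<eta> i y))" (is "_ = ?I")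
proof -
  define e where "e n = r / (4 * Suc n)" for n
  have e: "e n > 0" "e n \<le> r/4" for n
    using r by (auto simp: e_def field_simps)
  have e2: "2 * (e n)^2 \<le> r^2" for n
  proof -
    have "2 * (e n)^2 \<le> 2 * (r/4)^2" using e[of n] by (intro mult_left_mono power_mono) auto
    also have "\<dots> \<le> r^2" by (simp add: power2_eq_square)
    finally show ?thesis .
  qed
  have D\<eta>0: "D\<eta> i y = 0" if y: "y \<in> ball x r" for i y
  proof -
    have "has_partial_on \<eta> i (\<lambda>x. 0) (ball x r)"
      by (rule has_partial_on_cong[where f="\<lambda>x. 1"]) (use \<eta>(5) in \<open>auto simp: has_partial_on_def\<close>)
    then show ?thesis
      using has_partial_on_unique[OF has_partial_on_subset[OF C1_funD(2)[OF \<eta>(1)]], of "ball x r"] y by blast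
  qed
  have near: "dsq c y < r^2 \<longleftrightarrow> y \<in> ball c r" for c y using r by (simp add: dsq_less_iff_dist)
  have "?I = (LINT y|lborel. w y * src k (e n) (dsq x y))" for n
  proof -
    note m = radial_sum[OF ker_deriv[OF e(1)[of n], of k] ker_cont(3)[OF e(1)[of n]], where X="sources symm x"]
    have "?I = (LINT y|lborel. (\<Sum>i\<in>UNIV. ((\<Sum>c\<in>sources symm x. ker k (e n) (dsq c y)) * p i y
        - w y * (\<Sum>c\<in>sources symm x. of_real (2 * (y - c) $ i) * ker1 k (e n) (dsq c y))) * D\<eta> i y))"
    proof (rule Bochner_Integration.integral_cong[OF refl], rule sum.cong[OF refl])
      fix y :: "real^3" and i :: 3
      show "((\<Sum>c\<in>sources symm x. fund k (dsq c y)) * p i y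
        - w y * (\<Sum>c\<in>sources symm x. of_real (2 * (y - c) $ i) * fund1 k (dsq c y))) * D\<eta> i y
        = ((\<Sum>c\<in>sources symm x. ker k (e n) (dsq c y)) * p i y
        - w y * (\<Sum>c\<in>sources symm x. of_real (2 * (y - c) $ i) * ker1 k (e n) (dsq c y))) * D\<eta> i y"
      proof (cases "\<exists>c\<in>sources symm x. y \<in> ball c r")
        case True
        then obtain c where c: "c \<in> sources symm x" "y \<in> ball c r" by blast
        show ?thesis
        proof (cases "c = x")
          case True
          then have "D\<eta> i y = 0" using D\<eta>0 c(2) by simp
          then show ?thesis by simp
        next
          case False
          then have "w y = 0" "p i y = 0" using X c by blast+
          then show ?thesis by simp
        qed
      next
        case False
        then have "ker k (e n) (dsq c y) = fund k (dsq c y)" "ker1 k (e n) (dsq c y) = fund1 k (dsq c y)" if "c \<in> sources symm x" for c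
          using that near[of c y] e2[of n] by (auto intro!: ker_far[OF e(1)])
        then show ?thesis by (simp cong: sum.cong)
      qed
    qed
    also have "\<dots> = (LINT y|lborel. w y * (\<eta> y * ((\<Sum>i\<in>UNIV. (\<Sum>c\<in>sources symm x. 2 * ker1 k (e n) (dsq c y) + of_real (4 * ((y - c) $ i)^2) * ker2 k (e n) (dsq c y)))
          + of_real (k^2) * (\<Sum>c\<in>sources symm x. ker k (e n) (dsq c y)))))"
    proof (rule green[OF \<eta>(1-4) m(1-3)])
      assume symm
      then show "\<exists>C. \<forall>y. cmod (\<eta> y * (\<Sum>c\<in>sources symm x. of_real (2 * (y - c) $ 3) * ker1 k (e n) (dsq c y))) \<le> C * \<bar>y $ 3\<bar>"
        using radial_sum_sym_bound[OF ker_deriv[OF e(1)[of n], of k] ker_cont(3)[OF e(1)[of n]] x3 C1_funD(1)[OF \<eta>(1)] \<eta>(2,4)] by simp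
    qed
    also have "\<dots> = (LINT y|lborel. w y * (\<eta> y * (\<Sum>c\<in>sources symm x. src k (e n) (dsq c y))))"
      unfolding m(4) src_def by (simp add: sum.distrib sum_distrib_left)
    also have "\<dots> = (LINT y|lborel. w y * src k (e n) (dsq x y))"
    proof (rule Bochner_Integration.integral_cong[OF refl])
      fix y :: "real^3"
      have 0: "src k (e n) (dsq c y) = 0" if "y \<notin> ball c r" for c
        using that near[of c y] e2[of n] by (auto intro!: src_outside[OF e(1)])
      have 1: "w y * src k (e n) (dsq c y) = 0" if "c \<in> sources symm x - {x}" for c
        using that 0[of c] X(1)[of c y] by auto
      have "w y * (\<Sum>c\<in>sources symm x. src k (e n) (dsq c y)) = w y * src k (e n) (dsq x y) + (\<Sum>c\<in>sources symm x - {x}. w y * src k (e n) (dsq c y))"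
        by (subst sum.remove[of _ x]) (auto simp: sum_distrib_left distrib_left)
      also have "(\<Sum>c\<in>sources symm x - {x}. w y * src k (e n) (dsq c y)) = 0" by (rule sum.neutral) (use 1 in blast)
      finally show "w y * (\<eta> y * (\<Sum>c\<in>sources symm x. src k (e n) (dsq c y))) = w y * src k (e n) (dsq x y)"
        using \<eta>(5)[of y] 0[of x] by (cases "y \<in> ball x r") (auto simp: mult_ac)
    qed
    finally show ?thesis .
  qed
  then have "(\<lambda>n. LINT y|lborel. w y * src k (e n) (dsq x y)) \<longlonglongrightarrow> ?I" by simp
  moreover have "(\<lambda>n. LINT y|lborel. w y * src k (e n) (dsq x y)) \<longlonglongrightarrow> of_real kappa * w x"
    unfolding e_def by (rule source_limit[OF w r])
  ultimately show ?thesis by (rule LIMSEQ_unique[symmetric])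
qed

text \<open>Shell sources of different radius around the same centres differ by the Helmholtz
  operator applied to a compactly supported function, the difference of two truncated kernels. By
  \<open>weak_laplacian\<close> the weighted mean of \<open>w\<close> is therefore independent of
  the radius, and small radii recover the value at \<open>x\<close>. This expresses \<open>w\<close>
  through a fixed C1 kernel.\<close>

lemma mean_value:
  assumes r: "r > 0" "r \<le> \<delta>" and x3: "symm \<Longrightarrow> x $ 3 \<noteq> 0" and w: "continuous_on (ball x r) w"
    and X: "\<And>c y. c \<in> sources symm x \<Longrightarrow> c \<noteq> x \<Longrightarrow> y \<in> ball c r \<Longrightarrow> w y = 0"
    and D: "\<And>c. c \<in> sources symm x \<Longrightarrow> cball c (2 * \<delta>) \<subseteq> D"
  shows "of_real kappa * w x = (LINT y|lborel. w y * (\<Sum>c\<in>sources symm x. src k \<delta> (dsq c y)))" (is "_ = ?I")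
proof -
  define e where "e n = r / (4 * Suc n)" for n
  have e: "e n > 0" "e n \<le> r/4" for n
    using r by (auto simp: e_def field_simps)
  have \<delta>: "\<delta> > 0" using r by simp
  have e2: "2 * (e n)^2 \<le> r^2" for n
  proof -
    have "2 * (e n)^2 \<le> 2 * (r/4)^2" using e[of n] by (intro mult_left_mono power_mono) auto
    also have "\<dots> \<le> r^2" by (simp add: power2_eq_square)
    finally show ?thesis .
  qed
  have r\<delta>: "r^2 \<le> \<delta>^2" using r by (intro power_mono) auto
  have near: "dsq c y < r^2 \<longleftrightarrow> y \<in> ball c r" for c y using r by (simp add: dsq_less_iff_dist)
  \<comment> \<open>The radius \<open>2 * \<delta>\<close> exceeds \<open>sqrt 2 * \<delta>\<close>,
    beyond which the two truncated kernels agree.\<close>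
  define K where "K = (\<Union>c\<in>sources symm x. cball c (2 * \<delta>))"
  have K: "compact K" "K \<subseteq> D" unfolding K_def using D by (auto intro!: compact_UN)
  have out: "dsq c y \<ge> 2 * \<delta>^2" if "c \<in> sources symm x" "y \<notin> K" for c y
  proof -
    have "\<not> dsq c y \<le> (2*\<delta>)^2" using that \<delta> unfolding K_def by (subst dsq_le_iff_dist) auto
    then have "dsq c y > 4 * \<delta>^2" by (simp add: power_mult_distrib)
    then show ?thesis using zero_le_power2[of \<delta>] by linarith
  qed
  have i: "integrable lborel (\<lambda>y. w y * (\<Sum>c\<in>sources symm x. src k a (dsq c y)))" if a: "a > 0" "a \<le> \<delta>" for a
  proof (rule integrable_mult_compact_support[OF w_int[OF K] _ K(1)])
    show "continuous_on UNIV (\<lambda>y. \<Sum>c\<in>sources symm x. src k a (dsq c y))"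
      by (intro continuous_intros continuous_on_compose2[OF src_cont[OF a(1)]]) auto
    have "a^2 \<le> \<delta>^2" using a by (intro power_mono) auto
    then show "(\<Sum>c\<in>sources symm x. src k a (dsq c y)) = 0" if "y \<notin> K" for y
      using out[OF _ that] by (intro sum.neutral ballI src_outside[OF a(1)]) force
  qed
  have "?I = (LINT y|lborel. w y * src k (e n) (dsq x y))" for n
  proof -
    define h h1 h2 where "h s = ker k (e n) s - ker k \<delta> s" and "h1 s = ker1 k (e n) s - ker1 k \<delta> s"
      and "h2 s = ker2 k (e n) s - ker2 k \<delta> s" for s
    have h: "(h has_vector_derivative h1 s) (at s)" "(h1 has_vector_derivative h2 s) (at s)" "continuous_on UNIV h2" for s
      unfolding h_def[abs_def] h1_def[abs_def] h2_def[abs_def]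
      by (intro has_vector_derivative_diff continuous_intros ker_deriv ker_cont e \<delta>)+
    note m = radial_sum[OF h, where X="sources symm x"]
    have h0: "(\<Sum>c\<in>sources symm x. h (dsq c y)) = 0" if "y \<notin> K" for y
    proof (intro sum.neutral ballI)
      fix c assume "c \<in> sources symm x"
      from out[OF this that] have a: "dsq c y \<ge> 2 * \<delta>^2" .
      then have "dsq c y \<ge> 2 * (e n)^2" using e2[of n] r\<delta> zero_le_power2[of \<delta>] by linarith
      then show "h (dsq c y) = 0" using a ker_far(1)[OF e(1)] ker_far(1)[OF \<delta>] by (simp add: h_def)
    qed
    have "(LINT y|lborel. w y * ((\<Sum>i\<in>UNIV. (\<Sum>c\<in>sources symm x. 2 * h1 (dsq c y) + of_real (4 * ((y - c) $ i)^2) * h2 (dsq c y)))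
        + of_real (k^2) * (\<Sum>c\<in>sources symm x. h (dsq c y)))) = 0"
    proof (rule weak_laplacian[OF K h0 m(1-3)])
      assume s: symm
      obtain R where R: "R > 0" "\<And>x. x \<in> K \<Longrightarrow> norm x \<le> R"
        using compact_imp_bounded[OF K(1)] unfolding bounded_pos by auto
      \<comment> \<open>An auxiliary cutoff equal to 1 on \<open>K\<close>, supplied because
        \<open>radial_sum_sym_bound\<close> works with a compactly supported factor; outside
        \<open>K\<close> the summed gradient is zero anyway.\<close>
      define \<eta> where "\<eta> y = complex_of_real (1 - cutoff R (dsq 0 y))" for y
      have c\<eta>: "continuous_on UNIV \<eta>" unfolding \<eta>_def
        by (intro continuous_intros continuous_on_compose2[OF cutoff_cont(1)[OF R(1)]]) auto
      have \<eta>0: "\<eta> y = 0" if "y \<notin> cball 0 (2*R)" for y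
      proof -
        have "\<not> dsq 0 y \<le> (2*R)^2" using that R(1) by (subst dsq_le_iff_dist) auto
        then have "dsq 0 y > 4 * R^2" by (simp add: power_mult_distrib)
        then have "dsq 0 y \<ge> 2 * R^2" using zero_le_power2[of R] by linarith
        then show ?thesis unfolding \<eta>_def using cutoff_right[OF R(1)] by simp
      qed
      obtain C where C: "\<And>y. cmod (\<eta> y * (\<Sum>c\<in>sources True x. of_real (2 * (y - c) $ 3) * h1 (dsq c y))) \<le> C * \<bar>y $ 3\<bar>"
        using radial_sum_sym_bound[OF h x3[OF s] c\<eta> compact_cball \<eta>0] by blast
      have "cmod (\<Sum>c\<in>sources symm x. of_real (2 * (y - c) $ 3) * h1 (dsq c y)) \<le> C * \<bar>y $ 3\<bar>" for y
      proof (cases "y \<in> K")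
        case True
        then have "dsq 0 y \<le> R^2" using R by (subst dsq_le_iff_dist) auto
        then have "\<eta> y = 1" unfolding \<eta>_def using cutoff_left[OF R(1)] by simp
        then show ?thesis using C[of y] s by simp
      next
        case False
        then have "(\<Sum>c\<in>sources symm x. of_real (2 * (y - c) $ 3) * h1 (dsq c y)) = 0"
          using C1_fun_zero_outside[OF m(1) compact_imp_closed[OF K(1)] h0, of y 3] by simp
        then show ?thesis using C[of y] by (simp add: order_trans[OF norm_ge_zero])
      qed
      then show "\<exists>C. \<forall>y. cmod (\<Sum>c\<in>sources symm x. of_real (2 * (y - c) $ 3) * h1 (dsq c y)) \<le> C * \<bar>y $ 3\<bar>" by blast
    qed
    also have "(LINT y|lborel. w y * ((\<Sum>i\<in>UNIV. (\<Sum>c\<in>sources symm x. 2 * h1 (dsq c y) + of_real (4 * ((y - c) $ i)^2) * h2 (dsq c y)))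
        + of_real (k^2) * (\<Sum>c\<in>sources symm x. h (dsq c y))))
       = (LINT y|lborel. w y * (\<Sum>c\<in>sources symm x. src k (e n) (dsq c y)) - w y * (\<Sum>c\<in>sources symm x. src k \<delta> (dsq c y)))"
      unfolding m(4) unfolding src_def h_def h1_def h2_def
      by (simp add: sum.distrib sum_distrib_left sum_subtractf algebra_simps)
    also have "\<dots> = (LINT y|lborel. w y * (\<Sum>c\<in>sources symm x. src k (e n) (dsq c y))) - ?I"
      using e[of n] r by (intro Bochner_Integration.integral_diff i \<delta>) auto
    also have "(LINT y|lborel. w y * (\<Sum>c\<in>sources symm x. src k (e n) (dsq c y))) = (LINT y|lborel. w y * src k (e n) (dsq x y))"
    proof (rule Bochner_Integration.integral_cong[OF refl])
      fix y :: "real^3"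
      have 0: "src k (e n) (dsq c y) = 0" if "y \<notin> ball c r" for c
        using that near[of c y] e2[of n] by (auto intro!: src_outside[OF e(1)])
      have 1: "w y * src k (e n) (dsq c y) = 0" if "c \<in> sources symm x - {x}" for c
        using that 0[of c] X(1)[of c y] by auto
      have "w y * (\<Sum>c\<in>sources symm x. src k (e n) (dsq c y)) = w y * src k (e n) (dsq x y) + (\<Sum>c\<in>sources symm x - {x}. w y * src k (e n) (dsq c y))"
        by (subst sum.remove[of _ x]) (auto simp: sum_distrib_left distrib_left)
      also have "(\<Sum>c\<in>sources symm x - {x}. w y * src k (e n) (dsq c y)) = 0" by (rule sum.neutral) (use 1 in blast)
      finally show "w y * (\<Sum>c\<in>sources symm x. src k (e n) (dsq c y)) = w y * src k (e n) (dsq x y)" by simp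
    qed
    finally show ?thesis by simp
  qed
  then have "(\<lambda>n. LINT y|lborel. w y * src k (e n) (dsq x y)) \<longlonglongrightarrow> ?I" by simp
  moreover have "(\<lambda>n. LINT y|lborel. w y * src k (e n) (dsq x y)) \<longlonglongrightarrow> of_real kappa * w x"
    unfolding e_def by (rule source_limit[OF w r(1)])
  ultimately show ?thesis by (rule LIMSEQ_unique[symmetric])
qed

end

section \<open>Classical solutions and Neumann solutions in a half space as weak solutions\<close>

lemma set_integrable_continuous_compact:
  fixes f :: "real^3 \<Rightarrow> complex"
  assumes "continuous_on S f" "compact K" "K \<subseteq> S"
  shows "set_integrable lborel K f"
  unfolding set_integrable_def
  by (rule borel_integrable_compact[OF assms(2) continuous_on_subset[OF assms(1,3)]])

text \<open>The interior case, for the later study of the difference inside the intersection of the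
  two regions: compact sets in \<open>D\<close> stay away from the boundary, so ordinary integration
  by parts suffices.\<close>

lemma weak_helmholtz_classical:
  assumes D: "open D" and h: "helmholtz_C2 k D w p"
  shows "weak_helmholtz k D w p False"
proof -
  from h obtain q where w: "continuous_on D w" "\<And>i. has_partial_on w i (p i) D" "\<And>i. continuous_on D (p i)"
    and q: "\<And>i j. has_partial_on (p i) j (q i j) D" "\<And>i j. continuous_on D (q i j)"
       "\<And>x. x \<in> D \<Longrightarrow> (\<Sum>i\<in>UNIV. q i i x) + of_real (k^2) * w x = 0"
    unfolding helmholtz_C2_def by blast
  show ?thesis
  proof
    show "set_integrable lborel K w" "set_integrable lborel K (p i)" if "compact K" "K \<subseteq> D" for K i
      using set_integrable_continuous_compact w that by blast+
  next
    fix \<phi> D\<phi> K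
    assume a: "C1_fun \<phi> D\<phi>" "compact K" "K \<subseteq> D" "\<And>x. x \<notin> K \<Longrightarrow> \<phi> x = 0"
    note c = C1_funD[OF a(1)]
    have D0: "D\<phi> i x = 0" if "x \<notin> K" for i x using C1_fun_zero_outside[OF a(1) compact_imp_closed[OF a(2)] a(4)] that by blast
    have i1: "integrable lborel (\<lambda>x. q i i x * \<phi> x)" for i
      by (rule integrable_mult_compact_support[OF set_integrable_continuous_compact[OF q(2) a(2,3)] c(1) a(2,4)])
    have i2: "integrable lborel (\<lambda>x. p i x * D\<phi> i x)" for i
      by (rule integrable_mult_compact_support[OF set_integrable_continuous_compact[OF w(3) a(2,3)] c(3) a(2)]) (use D0 in auto)
    have "(LINT x|lborel. q i i x * \<phi> x + p i x * D\<phi> i x) = 0" for i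
      by (rule ibp_compact[OF D w(3) q(1) q(2) c a(2-4)])
    then have "0 = (\<Sum>i\<in>UNIV. (LINT x|lborel. q i i x * \<phi> x + p i x * D\<phi> i x))" by simp
    also have "\<dots> = (LINT x|lborel. (\<Sum>i\<in>UNIV. q i i x * \<phi> x + p i x * D\<phi> i x))"
      using i1 i2 by (intro Bochner_Integration.integral_sum[symmetric] Bochner_Integration.integrable_add)
    also have "\<dots> = (LINT x|lborel. (\<Sum>i\<in>UNIV. p i x * D\<phi> i x) - of_real (k^2) * w x * \<phi> x)"
    proof (rule Bochner_Integration.integral_cong[OF refl])
      fix x
      have "(\<Sum>i\<in>UNIV. q i i x * \<phi> x + p i x * D\<phi> i x) = (\<Sum>i\<in>UNIV. q i i x) * \<phi> x + (\<Sum>i\<in>UNIV. p i x * D\<phi> i x)"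
        by (simp add: sum.distrib sum_distrib_right)
      also have "(\<Sum>i\<in>UNIV. q i i x) * \<phi> x = - of_real (k^2) * w x * \<phi> x"
      proof (cases "x \<in> K")
        case True
        then have "(\<Sum>i\<in>UNIV. q i i x) = - (of_real (k^2) * w x)"
          using q(3)[of x] a(3) by (simp only: eq_neg_iff_add_eq_0) blast
        then show ?thesis by simp
      qed (simp add: a(4))
      finally show "(\<Sum>i\<in>UNIV. q i i x * \<phi> x + p i x * D\<phi> i x) = (\<Sum>i\<in>UNIV. p i x * D\<phi> i x) - of_real (k^2) * w x * \<phi> x"
        by simp
    qed
    finally show "(LINT x|lborel. (\<Sum>i\<in>UNIV. p i x * D\<phi> i x) - of_real (k^2) * w x * \<phi> x) = 0" by simp
  next
    fix g Dg K
    assume g: "\<And>i. continuous_on UNIV (g i)" "\<And>i. has_partial_on (g i) i (Dg i) UNIV" "\<And>i. continuous_on UNIV (Dg i)"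
      and K: "compact K" "K \<subseteq> D" "\<And>(i::3) x. x \<notin> K \<Longrightarrow> g i x = (0::complex)"
    have D0: "Dg i x = 0" if "x \<notin> K" for i x
      using partial_zero_outside[OF g(2) compact_imp_closed[OF K(1)] K(3)] that by blast
    have i1: "integrable lborel (\<lambda>x. p i x * g i x)" for i
      by (rule integrable_mult_compact_support[OF set_integrable_continuous_compact[OF w(3) K(1,2)] g(1) K(1,3)])
    have i2: "integrable lborel (\<lambda>x. w x * Dg i x)" for i
      by (rule integrable_mult_compact_support[OF set_integrable_continuous_compact[OF w(1) K(1,2)] g(3) K(1) D0])
    have "(LINT x|lborel. (\<Sum>i\<in>UNIV. p i x * g i x + w x * Dg i x)) = (\<Sum>i\<in>UNIV. (LINT x|lborel. p i x * g i x + w x * Dg i x))"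
      using i1 i2 by (intro Bochner_Integration.integral_sum Bochner_Integration.integrable_add)
    also have "\<dots> = 0"
      using ibp_compact[OF D w(1) w(2) w(3) g(1) g(2) g(3) K] by simp
    finally show "(LINT x|lborel. (\<Sum>i\<in>UNIV. p i x * g i x + w x * Dg i x)) = 0" .
  qed
qed

text \<open>On a set of finite measure square integrability gives integrability through
  \<open>|f| \<le> 1 + |f|^2\<close>.\<close>

lemma set_integrable_of_square:
  fixes f :: "real^3 \<Rightarrow> complex"
  assumes U: "open U" "continuous_on U f" "\<And>x. x \<notin> U \<Longrightarrow> x \<in> K \<Longrightarrow> f x = 0" and K: "compact K" "K \<subseteq> ball 0 r"
    and f: "set_integrable lborel (U \<inter> ball 0 r) (\<lambda>x. (cmod (f x))^2)"
  shows "set_integrable lborel K f"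
  unfolding set_integrable_def
proof (rule Bochner_Integration.integrable_bound)
  have Kf: "emeasure lborel K < \<infinity>" by (rule emeasure_bounded_finite[OF compact_imp_bounded[OF K(1)]])
  show "integrable lborel (\<lambda>x. indicator K x + indicator (U \<inter> ball 0 r) x *\<^sub>R (cmod (f x))^2 :: real)"
    using f Kf K(1) unfolding set_integrable_def
    by (intro Bochner_Integration.integrable_add integrable_real_indicator) (auto simp: borel_compact)
  have Um: "(\<lambda>x. indicator U x *\<^sub>R f x) \<in> borel_measurable borel"
    using borel_measurable_continuous_on_indicator[OF _ U(2)] U(1) by simp
  have "(\<lambda>x. indicator K x *\<^sub>R f x) = (\<lambda>x. indicator K x *\<^sub>R (indicator U x *\<^sub>R f x))"
    using U(3) by (intro ext) (auto simp: indicator_def)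
  moreover have "K \<in> sets borel" using K(1) by (simp add: borel_compact)
  ultimately show "(\<lambda>x. indicator K x *\<^sub>R f x) \<in> borel_measurable lborel"
    using borel_measurable_scaleR[OF borel_measurable_indicator Um] by (metis measurable_lborel2)
  show "AE x in lborel. norm (indicator K x *\<^sub>R f x) \<le> norm (indicator K x + indicator (U \<inter> ball 0 r) x *\<^sub>R (cmod (f x))^2 :: real)"
  proof (rule AE_I2)
    fix x
    have "cmod (f x) \<le> 1 + (cmod (f x))^2"
    proof (cases "cmod (f x) \<le> 1")
      case False
      then have "cmod (f x) * 1 \<le> cmod (f x) * cmod (f x)" by (intro mult_left_mono) auto
      then show ?thesis by (simp add: power2_eq_square)
    qed (simp add: add_increasing2)
    then show "norm (indicator K x *\<^sub>R f x) \<le> norm (indicator K x + indicator (U \<inter> ball 0 r) x *\<^sub>R (cmod (f x))^2 :: real)"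
      using U(3)[of x] K(2) by (auto simp: indicator_def)
  qed
qed

definition upper_half :: "(real^3) set" where "upper_half = {x. x $ 3 > 0}"

lemma open_upper_half: "open upper_half"
  unfolding upper_half_def by (intro open_Collect_less continuous_intros)

lemma has_partial_on_height:
  assumes "\<And>s. (f has_real_derivative f1 s) (at s)"
  shows "has_partial_on (\<lambda>y. complex_of_real (f (n * y $ 3 - 1))) i (\<lambda>y. if i = 3 then of_real (n * f1 (n * y $ 3 - 1)) else 0) S"
  unfolding has_partial_on_def
proof
  fix x :: "real^3"
  have "((\<lambda>t. f (n * (x + t *\<^sub>R axis i 1) $ 3 - 1)) has_real_derivative (if i = 3 then n * f1 (n * x $ 3 - 1) else 0)) (at 0)"
  proof (cases "i = 3")
    case True
    have l: "((\<lambda>t. n * (x $ 3 + t) - 1) has_real_derivative n) (at 0)" by (auto intro!: derivative_eq_intros)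
    show ?thesis using DERIV_chain2[OF assms l] True by (simp add: mult.commute)
  next
    case False
    then show ?thesis by (simp add: axis_def)
  qed
  from has_vector_derivative_of_real[OF this, where 'a=complex]
  show "((\<lambda>t. complex_of_real (f (n * (x + t *\<^sub>R axis i 1) $ 3 - 1))) has_vector_derivative
     (if i = 3 then of_real (n * f1 (n * x $ 3 - 1)) else 0)) (at 0)"
    by (cases "i = 3") auto
qed

text \<open>Up to the plane only square integrability is available. Integration by parts is
  therefore done first for the field multiplied by a cutoff in the height that vanishes near the
  plane. The derivative of that cutoff grows like \<open>n\<close> on a strip of height about
  \<open>1 / n\<close>, but there the third component of a tangential field is of order
  \<open>1 / n\<close>, so the error term stays bounded and dominated convergence removes
  it.\<close>

lemma weak_helmholtz_half_space:
  fixes u :: "real^3 \<Rightarrow> complex" and q :: "3 \<Rightarrow> real^3 \<Rightarrow> complex"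
  assumes D: "open D"
    and u: "continuous_on (upper_half \<inter> D) u" "\<And>i. has_partial_on u i (q i) (upper_half \<inter> D)" "\<And>i. continuous_on (upper_half \<inter> D) (q i)"
    and w: "\<And>x. w x = (if x \<in> upper_half then u x else 0)" "\<And>i x. p i x = (if x \<in> upper_half then q i x else 0)"
    and L2: "\<And>r. r > 0 \<Longrightarrow> set_integrable lborel (upper_half \<inter> D \<inter> ball 0 r) (\<lambda>x. (cmod (u x))^2)"
       "\<And>r i. r > 0 \<Longrightarrow> set_integrable lborel (upper_half \<inter> D \<inter> ball 0 r) (\<lambda>x. (cmod (q i x))^2)"
    and weak: "\<And>\<phi> D\<phi> K. test_fun \<phi> D\<phi> \<Longrightarrow> compact K \<Longrightarrow> K \<subseteq> D \<Longrightarrow> (\<And>x. x \<notin> K \<Longrightarrow> \<phi> x = 0) \<Longrightarrow>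
       (LINT x|lborel. (\<Sum>i\<in>UNIV. p i x * of_real (D\<phi> i x)) - of_real (k^2) * w x * of_real (\<phi> x)) = 0"
  shows "weak_helmholtz k D w p True"
proof
  have HD: "open (upper_half \<inter> D)" using D open_upper_half by auto
  have int: "set_integrable lborel K v"
    if K: "compact K" "K \<subseteq> D" and v: "\<And>x. v x = (if x \<in> upper_half then f x else 0)" "continuous_on (upper_half \<inter> D) f"
     "\<And>r. r > 0 \<Longrightarrow> set_integrable lborel (upper_half \<inter> D \<inter> ball 0 r) (\<lambda>x. (cmod (f x))^2)" for K v and f :: "real^3 \<Rightarrow> complex"
  proof -
    obtain r where r: "r > 0" "K \<subseteq> ball 0 r"
      using bounded_subset_ballD[OF compact_imp_bounded[OF K(1)], of 0] by blast
    show ?thesis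
    proof (rule set_integrable_of_square[OF HD _ _ K(1) r(2)])
      show "continuous_on (upper_half \<inter> D) v" by (rule continuous_on_eq[OF v(2)]) (simp add: v(1))
      show "set_integrable lborel (upper_half \<inter> D \<inter> ball 0 r) (\<lambda>x. (cmod (v x))\<^sup>2)"
      proof -
        have "(\<lambda>x. indicator (upper_half \<inter> D \<inter> ball 0 r) x *\<^sub>R (cmod (v x))\<^sup>2) = (\<lambda>x. indicator (upper_half \<inter> D \<inter> ball 0 r) x *\<^sub>R (cmod (f x))\<^sup>2)"
          by (intro ext) (auto simp: v(1) indicator_def)
        then show ?thesis using v(3)[OF r(1)] by (simp add: set_integrable_def)
      qed
      show "v x = 0" if "x \<notin> upper_half \<inter> D" "x \<in> K" for x using that K v(1) by auto
    qed
  qed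
  show wi: "set_integrable lborel K w" if "compact K" "K \<subseteq> D" for K
    by (rule int[OF that w(1) u(1) L2(1)])
  show pi: "set_integrable lborel K (p i)" if "compact K" "K \<subseteq> D" for K i
    by (rule int[OF that w(2) u(3) L2(2)])
  {
    fix \<phi> D\<phi> K
    assume a: "C1_fun \<phi> D\<phi>" "compact K" "K \<subseteq> D" "\<And>x. x \<notin> K \<Longrightarrow> \<phi> x = 0"
    note c = C1_funD[OF a(1)]
    have D0: "D\<phi> i x = 0" if "x \<notin> K" for i x using C1_fun_zero_outside[OF a(1) compact_imp_closed[OF a(2)] a(4)] that by blast
    have bd: "bounded {x. f (\<phi> x) \<noteq> (0::real)}" if "f 0 = 0" for f
      by (rule bounded_subset[OF compact_imp_bounded[OF a(2)]]) (use a(4) that in force)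
    \<comment> \<open>The variational condition is formulated with real test functions; a complex
      one is split into its real and imaginary parts.\<close>
    have tR: "test_fun (\<lambda>x. Re (\<phi> x)) (\<lambda>i x. Re (D\<phi> i x))" "test_fun (\<lambda>x. Im (\<phi> x)) (\<lambda>i x. Im (D\<phi> i x))"
      unfolding test_fun_def has_partial_on_def using c(2)[unfolded has_partial_on_def] c(3) bd[of Re] bd[of Im]
      by (auto intro!: continuous_intros bounded_linear.has_vector_derivative[OF bounded_linear_Re] bounded_linear.has_vector_derivative[OF bounded_linear_Im])
    have i: "integrable lborel (\<lambda>x. (\<Sum>i\<in>UNIV. p i x * of_real (f (D\<phi> i x))) - of_real (k^2) * w x * of_real (f (\<phi> x)))"
      if f: "continuous_on UNIV f" "f 0 = 0" for f :: "complex \<Rightarrow> real"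
    proof -
      have "integrable lborel (\<lambda>x. p i x * complex_of_real (f (D\<phi> i x)))" for i
        by (rule integrable_mult_compact_support[OF pi[OF a(2,3)] _ a(2)])
           (use c(3) f D0 in \<open>auto intro!: continuous_intros continuous_on_compose2[OF f(1)]\<close>)
      moreover have "integrable lborel (\<lambda>x. w x * complex_of_real (f (\<phi> x)))"
        by (rule integrable_mult_compact_support[OF wi[OF a(2,3)] _ a(2)])
           (use c(1) f a(4) in \<open>auto intro!: continuous_intros continuous_on_compose2[OF f(1)]\<close>)
      ultimately show ?thesis
        by (intro Bochner_Integration.integrable_diff Bochner_Integration.integrable_sum) (auto simp: mult.assoc)
    qed
    have "(LINT x|lborel. (\<Sum>i\<in>UNIV. p i x * D\<phi> i x) - of_real (k^2) * w x * \<phi> x)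
      = (LINT x|lborel. ((\<Sum>i\<in>UNIV. p i x * of_real (Re (D\<phi> i x))) - of_real (k^2) * w x * of_real (Re (\<phi> x)))
        + \<i> * ((\<Sum>i\<in>UNIV. p i x * of_real (Im (D\<phi> i x))) - of_real (k^2) * w x * of_real (Im (\<phi> x))))"
    proof (rule Bochner_Integration.integral_cong[OF refl])
      fix x
      have e: "D\<phi> i x = of_real (Re (D\<phi> i x)) + \<i> * of_real (Im (D\<phi> i x))" "\<phi> x = of_real (Re (\<phi> x)) + \<i> * of_real (Im (\<phi> x))" for i
        by (simp_all add: complex_eq_iff)
      show "(\<Sum>i\<in>UNIV. p i x * D\<phi> i x) - of_real (k^2) * w x * \<phi> x
         = ((\<Sum>i\<in>UNIV. p i x * of_real (Re (D\<phi> i x))) - of_real (k^2) * w x * of_real (Re (\<phi> x)))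
        + \<i> * ((\<Sum>i\<in>UNIV. p i x * of_real (Im (D\<phi> i x))) - of_real (k^2) * w x * of_real (Im (\<phi> x)))"
        by (subst e(1), subst e(2)) (simp add: sum_3 algebra_simps)
    qed
    also have "\<dots> = (LINT x|lborel. ((\<Sum>i\<in>UNIV. p i x * of_real (Re (D\<phi> i x))) - of_real (k^2) * w x * of_real (Re (\<phi> x))))
        + \<i> * (LINT x|lborel. ((\<Sum>i\<in>UNIV. p i x * of_real (Im (D\<phi> i x))) - of_real (k^2) * w x * of_real (Im (\<phi> x))))"
    proof -
      have c: "continuous_on UNIV Re" "continuous_on UNIV Im" by (intro continuous_intros)+
      show ?thesis using i[OF c(1)] i[OF c(2)]
        by (subst Bochner_Integration.integral_add) (auto intro!: integrable_mult_right)
    qed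
    also have "\<dots> = 0"
      using weak[OF tR(1) a(2,3)] weak[OF tR(2) a(2,3)] a(4) by simp
    finally show "(LINT x|lborel. (\<Sum>i\<in>UNIV. p i x * D\<phi> i x) - of_real (k^2) * w x * \<phi> x) = 0" .
  next
    fix g Dg K
    assume g: "\<And>i. continuous_on UNIV (g i)" "\<And>i. has_partial_on (g i) i (Dg i) UNIV" "\<And>i. continuous_on UNIV (Dg i)"
      and K: "compact K" "K \<subseteq> D" "\<And>(i::3) x. x \<notin> K \<Longrightarrow> g i x = (0::complex)"
      and "True \<Longrightarrow> \<exists>C. \<forall>x. cmod (g 3 x) \<le> C * \<bar>x $ 3\<bar>"
    then obtain C where C: "\<And>x. cmod (g 3 x) \<le> C * \<bar>x $ 3\<bar>" by blast
    have C0: "C \<ge> 0" using order_trans[OF norm_ge_zero C[of "axis 3 1"]] by simp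
    have D0: "Dg i x = 0" if "x \<notin> K" for i x
      using partial_zero_outside[OF g(2) compact_imp_closed[OF K(1)] K(3)] that by blast
    \<comment> \<open>Height cutoff: 0 below \<open>1 / (n + 1)\<close> and 1 above
      \<open>2 / (n + 1)\<close>.\<close>
    define th th1 where "th n y = complex_of_real (step (real (Suc n) * y $ 3 - 1))"
      and "th1 n y = complex_of_real (real (Suc n) * step1 (real (Suc n) * y $ 3 - 1))" for n and y :: "real^3"
    define F where "F y = (\<Sum>i\<in>UNIV. p i y * g i y + w y * Dg i y)" for y
    define G where "G n y = th n y * F y + w y * (th1 n y * g 3 y)" for n y
    have thc: "continuous_on UNIV (th n)" "continuous_on UNIV (th1 n)" for n
      unfolding th_def th1_def
      by (intro continuous_intros continuous_on_compose2[OF continuous_step(1)[of UNIV]] continuous_on_compose2[OF continuous_step(2)[of UNIV]]; simp)+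
    have thz: "th n y = 0" "th1 n y = 0" if "y $ 3 \<le> 1 / Suc n" for n y
    proof -
      have "real (Suc n) * y $ 3 - 1 \<le> 0" using that by (simp add: field_simps)
      then show "th n y = 0" "th1 n y = 0" unfolding th_def th1_def by (simp_all only: step_left) simp_all
    qed
    have th3: "th1 n y * g 3 y = 0" if "y $ 3 \<ge> 2 / Suc n" for n y
    proof -
      have "real (Suc n) * y $ 3 - 1 \<ge> 1" using that by (simp add: field_simps)
      then show ?thesis unfolding th1_def by (simp only: step_right) simp
    qed
    have th4: "th n y = 1" if "y $ 3 \<ge> 2 / Suc n" for n y
    proof -
      have "real (Suc n) * y $ 3 - 1 \<ge> 1" using that by (simp add: field_simps)
      then show ?thesis unfolding th_def by (simp only: step_right) simp
    qed
    have pg: "integrable lborel (\<lambda>x. p i x * g i x)" for i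
      by (rule integrable_mult_compact_support[OF pi[OF K(1,2)] g(1) K(1,3)])
    have wg: "integrable lborel (\<lambda>x. w x * Dg i x)" for i
      by (rule integrable_mult_compact_support[OF wi[OF K(1,2)] g(3) K(1) D0])
    have Fi: "integrable lborel F" unfolding F_def using pg wg
      by (intro Bochner_Integration.integrable_sum Bochner_Integration.integrable_add)
    have G0: "(LINT y|lborel. G n y) = 0" for n
    proof -
      define Kn where "Kn = K \<inter> {y. y $ 3 \<ge> 1 / Suc n}"
      have "closed {y::real^3. y $ 3 \<ge> 1 / Suc n}" by (intro closed_Collect_le continuous_intros)
      then have Kn: "compact Kn" "Kn \<subseteq> upper_half \<inter> D" using K
        by (auto simp: Kn_def upper_half_def compact_Int_closed intro: less_le_trans[of 0 "1 / (1 + real n)"])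
      define gn Dgn where "gn i y = th n y * g i y" and "Dgn i y = (if i = 3 then th1 n y else 0) * g i y + th n y * Dg i y" for i y
      have gp: "has_partial_on (gn i) i (Dgn i) UNIV" for i
      proof -
        have "has_partial_on (th n) i (\<lambda>y. if i = 3 then th1 n y else 0) UNIV"
          unfolding th_def th1_def by (rule has_partial_on_height[OF step_derivs(1)])
        from has_partial_on_mult[OF this g(2)] show ?thesis unfolding gn_def Dgn_def .
      qed
      have gc: "continuous_on UNIV (gn i)" "continuous_on UNIV (Dgn i)" for i
        unfolding gn_def Dgn_def by (cases "i = 3"; auto intro!: continuous_intros thc g)+
      have g0: "gn i y = 0" if "y \<notin> Kn" for i y
        using that K(3)[of y i] thz(1)[of y n] by (auto simp: Kn_def gn_def not_le)
      have Dgn0: "Dgn i y = 0" if "y \<notin> Kn" for i y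
        using partial_zero_outside[OF gp compact_imp_closed[OF Kn(1)] g0] that by blast
      have "(LINT y|lborel. q i y * gn i y + u y * Dgn i y) = 0" for i
        by (rule ibp_compact[OF HD u(1,2,3) gc(1) gp gc(2) Kn g0])
      moreover have "(\<lambda>y. q i y * gn i y + u y * Dgn i y) = (\<lambda>y. p i y * gn i y + w y * Dgn i y)" for i
      proof
        fix y
        show "q i y * gn i y + u y * Dgn i y = p i y * gn i y + w y * Dgn i y"
          using Kn(2) g0[of y i] Dgn0[of y i] by (cases "y \<in> Kn") (auto simp: w)
      qed
      ultimately have z: "(LINT y|lborel. p i y * gn i y + w y * Dgn i y) = 0" for i by simp
      have KnD: "Kn \<subseteq> D" using Kn by auto
      have ii: "integrable lborel (\<lambda>y. p i y * gn i y + w y * Dgn i y)" for i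
        by (intro Bochner_Integration.integrable_add integrable_mult_compact_support[OF pi[OF Kn(1) KnD] gc(1) Kn(1) g0]
          integrable_mult_compact_support[OF wi[OF Kn(1) KnD] gc(2) Kn(1) Dgn0])
      have "(LINT y|lborel. G n y) = (LINT y|lborel. (\<Sum>i\<in>UNIV. p i y * gn i y + w y * Dgn i y))"
        unfolding G_def F_def gn_def Dgn_def by (rule Bochner_Integration.integral_cong) (simp_all add: sum_3 algebra_simps)
      also have "\<dots> = 0" using ii z by (subst Bochner_Integration.integral_sum) auto
      finally show ?thesis .
    qed
    \<comment> \<open>The number 280 comes from \<open>140 * (n + 1)\<close>, the bound for
      \<open>th1\<close>, times \<open>C * 2 / (n + 1)\<close>, the bound for the third component on
      the strip.\<close>
    let ?B = "\<lambda>y. norm (F y) + norm (indicator K y *\<^sub>R w y) * (280 * C)"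
    have wK: "integrable lborel (\<lambda>y. indicator K y *\<^sub>R w y)" using wi[OF K(1,2)] by (simp add: set_integrable_def)
    have "(\<lambda>n. LINT y|lborel. G n y) \<longlonglongrightarrow> (LINT y|lborel. F y)"
    proof (rule integral_dominated_convergence[where w="?B"])
      show "integrable lborel ?B" using Fi wK
        by (intro Bochner_Integration.integrable_add integrable_norm integrable_mult_left) auto
      show "F \<in> borel_measurable lborel" using Fi by simp
      have Wm: "(\<lambda>y. (indicator K y *\<^sub>R w y) * (th1 n y * g 3 y)) \<in> borel_measurable lborel" for n
        using borel_measurable_integrable[OF wK] borel_measurable_continuous_onI[OF thc(2)[of n]] borel_measurable_continuous_onI[OF g(1)[of 3]]
        by (intro borel_measurable_times) simp_all
      have "(\<lambda>y. (indicator K y *\<^sub>R w y) * (th1 n y * g 3 y)) = (\<lambda>y. w y * (th1 n y * g 3 y))" for n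
        using K(3) by (intro ext) (auto simp: indicator_def)
      then show "G n \<in> borel_measurable lborel" for n
        unfolding G_def using Wm[of n] borel_measurable_integrable[OF Fi] borel_measurable_continuous_onI[OF thc(1)[of n]]
        by (intro borel_measurable_add borel_measurable_times[of "th n"]) simp_all
      show "AE y in lborel. norm (G n y) \<le> ?B y" for n
      proof (rule AE_I2)
        fix y
        have 1: "norm (th n y * F y) \<le> norm (F y)"
          using step_range by (simp add: th_def norm_mult mult_left_le_one_le)
        have "cmod (th1 n y * g 3 y) \<le> 280 * C"
        proof (cases "1 / Suc n \<le> y $ 3 \<and> y $ 3 \<le> 2 / Suc n")
          case True
          then have y0: "y $ 3 \<ge> 0" by (meson order_trans divide_nonneg_nonneg of_nat_0_le_iff zero_le_one)
          have "cmod (th1 n y) \<le> real (Suc n) * 140"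
            unfolding th1_def norm_of_real abs_mult using step1_le step1_nonneg by (intro mult_mono) auto
          moreover have "cmod (g 3 y) \<le> C * (2 / Suc n)"
            using C[of y] True y0 C0 mult_left_mono[of "y $ 3" "2 / Suc n" C] by simp
          ultimately have "cmod (th1 n y * g 3 y) \<le> (real (Suc n) * 140) * (C * (2 / Suc n))"
            unfolding norm_mult by (intro mult_mono) auto
          also have "\<dots> = 280 * C" by (simp add: field_simps del: of_nat_Suc)
          finally show ?thesis .
        next
          case False
          then show ?thesis using thz(2)[of y n] th3[of n y] C0 by (cases "y $ 3 \<le> 1 / Suc n") auto
        qed
        then have "norm (w y * (th1 n y * g 3 y)) \<le> norm (indicator K y *\<^sub>R w y) * (280 * C)"
          using K(3)[of y 3] C0 by (cases "y \<in> K") (auto simp: norm_mult intro!: mult_left_mono)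
        then show "norm (G n y) \<le> ?B y" unfolding G_def
          using 1 norm_triangle_ineq[of "th n y * F y" "w y * (th1 n y * g 3 y)"] by linarith
      qed
      show "AE y in lborel. (\<lambda>n. G n y) \<longlonglongrightarrow> F y"
      proof (rule AE_I2)
        fix y :: "real^3"
        show "(\<lambda>n. G n y) \<longlonglongrightarrow> F y"
        proof (cases "y \<in> upper_half")
          case False
          then have "G n y = F y" for n by (simp add: G_def F_def w)
          then show ?thesis by simp
        next
          case True
          then have "y $ 3 > 0" by (simp add: upper_half_def)
          then obtain N where N: "inverse (real (Suc N)) < y $ 3 / 2" using reals_Archimedean[of "y $ 3 / 2"] by auto
          have "G n y = F y" if "n \<ge> N" for n
          proof -
            have "2 / real (Suc n) \<le> 2 / real (Suc N)" using that by (intro divide_left_mono) auto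
            moreover have "2 / real (Suc N) < y $ 3" using N by (simp add: inverse_eq_divide)
            ultimately have "2 / Suc n \<le> y $ 3" by linarith
            then show ?thesis using th3[of n y] th4[of n y] by (simp add: G_def)
          qed
          then show ?thesis by (intro tendsto_eventually) (auto simp: eventually_sequentially)
        qed
      qed
    qed
    then show "(LINT x|lborel. (\<Sum>i\<in>UNIV. p i x * g i x + w x * Dg i x)) = 0"
      using G0 unfolding F_def by (simp add: LIMSEQ_const_iff)
  }
qed

section \<open>Energy flux and boundedness of the mean square\<close>

lemma has_vector_derivative_of_quotient:
  fixes f :: "real \<Rightarrow> 'a::real_normed_vector"
  assumes "((\<lambda>t. (f t - f 0) /\<^sub>R t) \<longlongrightarrow> f') (at 0)"
  shows "(f has_vector_derivative f') (at 0)"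
  unfolding has_vector_derivative_def has_derivative_at
proof
  show "bounded_linear (\<lambda>x. x *\<^sub>R f')" by (rule bounded_linear_scaleR_left)
  have "((\<lambda>t. norm ((f t - f 0) /\<^sub>R t - f')) \<longlongrightarrow> 0) (at 0)"
    using assms by (simp add: LIM_zero_iff tendsto_norm_zero_iff)
  then show "(\<lambda>h. norm (f (0 + h) - f 0 - h *\<^sub>R f') / norm h) \<midarrow>0\<rightarrow> 0"
  proof (rule Lim_transform_eventually)
    show "\<forall>\<^sub>F t in at 0. norm ((f t - f 0) /\<^sub>R t - f') = norm (f (0 + t) - f 0 - t *\<^sub>R f') / norm t"
      unfolding eventually_at_filter
    proof (intro always_eventually allI impI)
      fix t :: real assume t: "t \<noteq> 0"
      have "(f t - f 0) /\<^sub>R t - f' = inverse t *\<^sub>R (f t - f 0 - t *\<^sub>R f')"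
        using t by (simp add: scaleR_diff_right)
      then show "norm ((f t - f 0) /\<^sub>R t - f') = norm (f (0 + t) - f 0 - t *\<^sub>R f') / norm t"
        by (simp add: divide_inverse_commute)
    qed
  qed
qed

text \<open>The bound on the derivatives of the kernel bounds all its difference quotients by
  \<open>B\<close>, which supplies the dominating function \<open>B * norm (f y)\<close>.\<close>

lemma C1_fun_integral:
  fixes f :: "real^3 \<Rightarrow> complex" and K :: "real^3 \<Rightarrow> real^3 \<Rightarrow> complex"
  assumes f: "integrable lborel f"
    and K: "\<And>y. C1_fun (K y) (DK y)" "\<And>x. (\<lambda>y. K y x) \<in> borel_measurable borel" "\<And>i x. (\<lambda>y. DK y i x) \<in> borel_measurable borel"
    and B: "\<And>x y. cmod (K y x) \<le> B" "\<And>x y i. cmod (DK y i x) \<le> B"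
  shows "C1_fun (\<lambda>x. LINT y|lborel. f y * K y x) (\<lambda>i x. LINT y|lborel. f y * DK y i x)"
proof -
  have fm: "f \<in> borel_measurable lborel" using f by simp
  have bd: "norm (f y * z) \<le> B * norm (f y)" if "cmod z \<le> B" for y z
    using mult_right_mono[OF that norm_ge_zero[of "f y"]] by (simp add: norm_mult mult.commute)
  have cont: "continuous_on UNIV (\<lambda>x. LINT y|lborel. f y * H y x)"
    if H: "\<And>y. continuous_on UNIV (H y)" "\<And>x. (\<lambda>y. H y x) \<in> borel_measurable borel" "\<And>x y. cmod (H y x) \<le> B" for H :: "real^3 \<Rightarrow> real^3 \<Rightarrow> complex"
  proof (rule continuous_on_sequentiallyI)
    fix x :: "real^3" and X assume X: "X \<longlonglongrightarrow> x"
    show "(\<lambda>n. LINT y|lborel. f y * H y (X n)) \<longlonglongrightarrow> (LINT y|lborel. f y * H y x)"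
    proof (rule integral_dominated_convergence[where w="\<lambda>y. B * norm (f y)"])
      show "(\<lambda>y. f y * H y x) \<in> borel_measurable lborel" "(\<lambda>y. f y * H y (X n)) \<in> borel_measurable lborel" for n
        using fm H(2) by (auto intro!: borel_measurable_times)
      show "integrable lborel (\<lambda>y. B * norm (f y))" using f by (intro integrable_mult_right integrable_norm)
      show "AE y in lborel. (\<lambda>n. f y * H y (X n)) \<longlonglongrightarrow> f y * H y x"
      proof (rule AE_I2)
        fix y
        have "isCont (H y) x" using H(1)[of y] by (simp add: continuous_on_eq_continuous_at)
        from isCont_tendsto_compose[OF this X] show "(\<lambda>n. f y * H y (X n)) \<longlonglongrightarrow> f y * H y x"
          by (intro tendsto_intros)
      qed
      show "AE y in lborel. norm (f y * H y (X n)) \<le> B * norm (f y)" for n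
        by (intro AE_I2 bd H(3))
    qed
  qed
  have int: "integrable lborel (\<lambda>y. f y * K y x)" for x
  proof (rule Bochner_Integration.integrable_bound)
    show "integrable lborel (\<lambda>y. B * norm (f y))" using f by (intro integrable_mult_right integrable_norm)
    show "(\<lambda>y. f y * K y x) \<in> borel_measurable lborel" using fm K(2) by (auto intro!: borel_measurable_times)
    have "B \<ge> 0" using order_trans[OF norm_ge_zero B(1)] by blast
    then show "AE y in lborel. norm (f y * K y x) \<le> norm (B * norm (f y))"
      using bd[OF B(1)] by (intro AE_I2) (simp add: abs_mult)
  qed
  have partial: "has_partial_on (\<lambda>x. LINT y|lborel. f y * K y x) i (\<lambda>x. LINT y|lborel. f y * DK y i x) UNIV" for i
    unfolding has_partial_on_def
  proof
    fix x :: "real^3"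
    let ?e = "\<lambda>t. x + t *\<^sub>R axis i (1::real)"
    define Q where "Q y t = (K y (?e t) - K y x) /\<^sub>R t" for y t
    have QB: "cmod (Q y t) \<le> B" if "t \<noteq> 0" for y t
    proof -
      have d: "((\<lambda>t. K y (?e t)) has_vector_derivative DK y i (?e t)) (at t)" for t
        by (rule has_partial_on_line[OF C1_funD(2)[OF K(1)]]) simp
      have "norm (K y (?e t) - K y (?e 0)) \<le> B * \<bar>t\<bar>"
      proof (cases "t \<ge> 0")
        case True
        then show ?thesis using norm_diff_le_of_vector_derivative[OF True d, of B] B(2) by simp
      next
        case False
        then have "t \<le> 0" by simp
        from norm_diff_le_of_vector_derivative[OF this d, of B] show ?thesis
          using B(2) False by (simp add: norm_minus_commute)
      qed
      then show ?thesis using that by (simp add: Q_def divide_inverse_commute[symmetric] pos_divide_le_eq)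
    qed
    have Qm: "(\<lambda>y. Q y t) \<in> borel_measurable borel" for t
      unfolding Q_def by (intro borel_measurable_scaleR borel_measurable_diff K(2)) auto
    have "((\<lambda>t. ((LINT y|lborel. f y * K y (?e t)) - (LINT y|lborel. f y * K y (?e 0))) /\<^sub>R t) \<longlongrightarrow> (LINT y|lborel. f y * DK y i x)) (at 0)"
      unfolding tendsto_at_iff_sequentially
    proof (intro allI impI)
      fix T :: "nat \<Rightarrow> real" assume T0: "\<forall>n. T n \<in> UNIV - {0}" and T: "T \<longlonglongrightarrow> 0"
      have "(\<lambda>n. LINT y|lborel. f y * Q y (T n)) \<longlonglongrightarrow> (LINT y|lborel. f y * DK y i x)"
      proof (rule integral_dominated_convergence[where w="\<lambda>y. B * norm (f y)"])
        show "(\<lambda>y. f y * DK y i x) \<in> borel_measurable lborel" "(\<lambda>y. f y * Q y (T n)) \<in> borel_measurable lborel" for n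
          using fm K(3) Qm by (auto intro!: borel_measurable_times)
        show "integrable lborel (\<lambda>y. B * norm (f y))" using f by (intro integrable_mult_right integrable_norm)
        show "AE y in lborel. norm (f y * Q y (T n)) \<le> B * norm (f y)" for n
          using QB[of "T n"] T0 by (intro AE_I2 bd) auto
        show "AE y in lborel. (\<lambda>n. f y * Q y (T n)) \<longlonglongrightarrow> f y * DK y i x"
        proof (rule AE_I2)
          fix y
          have "((\<lambda>t. K y (?e t)) has_vector_derivative DK y i x) (at 0)"
            using C1_funD(2)[OF K(1)[of y], of i] unfolding has_partial_on_def by blast
          from has_vector_derivative_difference_quotient[OF this]
          have "((\<lambda>t. Q y t) \<longlongrightarrow> DK y i x) (at 0)" by (simp add: Q_def)
          then have "(\<lambda>n. Q y (T n)) \<longlonglongrightarrow> DK y i x"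
            using T0 T unfolding tendsto_at_iff_sequentially by (auto simp: o_def)
          then show "(\<lambda>n. f y * Q y (T n)) \<longlonglongrightarrow> f y * DK y i x" by (intro tendsto_intros)
        qed
      qed
      moreover have "(LINT y|lborel. f y * Q y t) = ((LINT y|lborel. f y * K y (?e t)) - (LINT y|lborel. f y * K y (?e 0))) /\<^sub>R t" for t
      proof -
        have "(LINT y|lborel. f y * Q y t) = (LINT y|lborel. inverse t *\<^sub>R (f y * K y (?e t) - f y * K y (?e 0)))"
          unfolding Q_def by (rule Bochner_Integration.integral_cong) (auto simp: algebra_simps)
        also have "\<dots> = inverse t *\<^sub>R (LINT y|lborel. (f y * K y (?e t) - f y * K y (?e 0)))"
          by (rule integral_scaleR_right)
        also have "(LINT y|lborel. (f y * K y (?e t) - f y * K y (?e 0))) = (LINT y|lborel. f y * K y (?e t)) - (LINT y|lborel. f y * K y (?e 0))"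
          by (rule Bochner_Integration.integral_diff[OF int int])
        finally show ?thesis .
      qed
      ultimately show "((\<lambda>t. ((LINT y|lborel. f y * K y (?e t)) - (LINT y|lborel. f y * K y (?e 0))) /\<^sub>R t) \<circ> T) \<longlonglongrightarrow> (LINT y|lborel. f y * DK y i x)"
        by (simp add: o_def)
    qed
    then show "((\<lambda>t. LINT y|lborel. f y * K y (?e t)) has_vector_derivative (LINT y|lborel. f y * DK y i x)) (at 0)"
      by (rule has_vector_derivative_of_quotient)
  qed
  show ?thesis unfolding C1_fun_def
    using cont[of K, OF C1_funD(1)[OF K(1)] K(2) B(1)] cont[of "\<lambda>y. DK y i" for i, OF C1_funD(3)[OF K(1)] K(3) B(2)] partial by blast
qed

section \<open>Radiating solutions outside a ball and their smooth extension\<close>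

lemma dsq_commute: "dsq x y = dsq y x"
  by (simp add: dsq_def norm_minus_commute)

lemma dsq_zero: "dsq 0 y = (norm y)^2"
  by (simp add: dsq_def)

lemma bounded_radial_src:
  obtains B where "B > 0" "\<And>c y. cmod (src k 1 (dsq c y)) \<le> B" "\<And>c y i. cmod (of_real (2 * (y - c) $ i) * src1 k 1 (dsq c y)) \<le> B"
proof -
  have out: "src k 1 (dsq 0 v) = 0" "src1 k 1 (dsq 0 v) = 0" if "v \<notin> cball 0 2" for v
    using outside_cball2[OF that] by (auto intro!: src_outside src1_outside)
  have c0: "continuous_on UNIV (\<lambda>v. src k 1 (dsq 0 v))"
    by (intro continuous_on_compose2[OF src_cont] continuous_intros) auto
  have c1: "continuous_on UNIV (\<lambda>v. complex_of_real (2 * (norm v)) * src1 k 1 (dsq 0 v))"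
    by (intro continuous_intros continuous_on_compose2[OF src1_cont]) auto
  obtain B0 where B0: "B0 > 0" "\<And>v. cmod (src k 1 (dsq 0 v)) \<le> B0"
    using bounded_continuous_compact_support[OF c0 compact_cball[of 0 2]] out by blast
  obtain B1 where B1: "B1 > 0" "\<And>v. cmod (complex_of_real (2 * (norm v)) * src1 k 1 (dsq 0 v)) \<le> B1"
    using bounded_continuous_compact_support[OF c1 compact_cball[of 0 2]] out by (metis mult_zero_right)
  have sh: "dsq c y = dsq 0 (y - c)" for c y by (simp add: dsq_def)
  show ?thesis
  proof
    show "max B0 B1 > 0" using B0 by simp
    show "cmod (src k 1 (dsq c y)) \<le> max B0 B1" for c y using B0(2)[of "y - c"] sh[of c y] by simp
    show "cmod (of_real (2 * (y - c) $ i) * src1 k 1 (dsq c y)) \<le> max B0 B1" for c y i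
    proof -
      have "cmod (of_real (2 * (y - c) $ i) * src1 k 1 (dsq c y)) \<le> cmod (complex_of_real (2 * (norm (y - c))) * src1 k 1 (dsq 0 (y - c)))"
        unfolding norm_mult[where 'a=complex] norm_of_real sh[of c y]
        using component_le_norm_cart[of "y - c" i] by (intro mult_right_mono) (simp_all add: abs_mult)
      also have "\<dots> \<le> B1" by (rule B1(2))
      finally show ?thesis by simp
    qed
  qed
qed

lemma set_integrable_mult_of_squares:
  fixes f g :: "real^3 \<Rightarrow> complex"
  assumes "set_integrable lborel K f" "set_integrable lborel K g"
    "set_integrable lborel K (\<lambda>x. (cmod (f x))^2)" "set_integrable lborel K (\<lambda>x. (cmod (g x))^2)"
  shows "set_integrable lborel K (\<lambda>x. f x * cnj (g x))"
  unfolding set_integrable_def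
proof (rule Bochner_Integration.integrable_bound)
  show "integrable lborel (\<lambda>x. indicator K x *\<^sub>R (cmod (f x))^2 + indicator K x *\<^sub>R (cmod (g x))^2)"
    using assms(3,4) unfolding set_integrable_def by (rule Bochner_Integration.integrable_add)
  have "(\<lambda>x. (indicator K x *\<^sub>R f x) * cnj (indicator K x *\<^sub>R g x)) \<in> borel_measurable lborel"
    using assms(1,2) unfolding set_integrable_def
    by (intro borel_measurable_times borel_measurable_integrable) (auto simp: integrable_cnj simp del: complex_cnj_scaleR)
  moreover have "(\<lambda>x. (indicator K x *\<^sub>R f x) * cnj (indicator K x *\<^sub>R g x)) = (\<lambda>x. indicator K x *\<^sub>R (f x * cnj (g x)))"
    by (intro ext) (auto simp: indicator_def)
  ultimately show "(\<lambda>x. indicator K x *\<^sub>R (f x * cnj (g x))) \<in> borel_measurable lborel" by simp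
  show "AE x in lborel. norm (indicator K x *\<^sub>R (f x * cnj (g x))) \<le> norm (indicator K x *\<^sub>R (cmod (f x))^2 + indicator K x *\<^sub>R (cmod (g x))^2)"
  proof (rule AE_I2)
    fix x
    have "2 * (cmod (f x) * cmod (g x)) \<le> (cmod (f x))^2 + (cmod (g x))^2"
      using zero_le_power2[of "cmod (f x) - cmod (g x)"] by (simp add: power2_diff)
    moreover have "cmod (f x) * cmod (g x) \<ge> 0" by simp
    ultimately have "cmod (f x) * cmod (g x) \<le> (cmod (f x))^2 + (cmod (g x))^2" by linarith
    then show "norm (indicator K x *\<^sub>R (f x * cnj (g x))) \<le> norm (indicator K x *\<^sub>R (cmod (f x))^2 + indicator K x *\<^sub>R (cmod (g x))^2)"
      by (auto simp: indicator_def norm_mult)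
  qed
qed

text \<open>The setting for the difference of two total fields, extended by zero below the plane and
  studied beyond a radius at which both surfaces are flat. The radiation condition is multiplied by
  the radius, expressed by partial derivatives, and uniform in the direction.\<close>

locale half_exterior = weak_helmholtz k "{x. norm x > R}" w p True
  for k R :: real and w :: "real^3 \<Rightarrow> complex" and p :: "3 \<Rightarrow> real^3 \<Rightarrow> complex" +
  assumes k: "k > 0" and R: "R > 0"
    and w_C1: "continuous_on (upper_half \<inter> {x. norm x > R}) w" "\<And>i. has_partial_on w i (p i) (upper_half \<inter> {x. norm x > R})"
      "\<And>i. continuous_on (upper_half \<inter> {x. norm x > R}) (p i)"
    and w_zero: "\<And>x. x \<notin> upper_half \<Longrightarrow> w x = 0" "\<And>i x. x \<notin> upper_half \<Longrightarrow> p i x = 0"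
    and w_sq: "\<And>K. compact K \<Longrightarrow> K \<subseteq> {x. norm x > R} \<Longrightarrow> set_integrable lborel K (\<lambda>x. (cmod (w x))^2)"
    and p_sq: "\<And>K i. compact K \<Longrightarrow> K \<subseteq> {x. norm x > R} \<Longrightarrow> set_integrable lborel K (\<lambda>x. (cmod (p i x))^2)"
    and radiation: "\<And>e. e > 0 \<Longrightarrow> \<exists>\<rho>. \<forall>x\<in>upper_half. norm x > \<rho> \<longrightarrow>
       cmod ((\<Sum>i\<in>UNIV. of_real (x $ i) * p i x) - \<i> * of_real (k * norm x) * w x) < e"
begin

text \<open>The radius times the radial derivative of \<open>w\<close>.\<close>

abbreviation "radial x \<equiv> (\<Sum>i\<in>UNIV. of_real (x $ i) * p i x)"

lemma ball_upper_half: "y \<in> ball x r \<Longrightarrow> r \<le> x $ 3 \<Longrightarrow> y \<in> upper_half"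
  using component_le_norm_cart[of "y - x" 3] by (auto simp: upper_half_def dist_norm norm_minus_commute)

lemma ball_lower_half: "y \<in> ball (refl3 x) r \<Longrightarrow> r \<le> x $ 3 \<Longrightarrow> y \<notin> upper_half"
  using component_le_norm_cart[of "y - refl3 x" 3] by (auto simp: upper_half_def dist_norm norm_minus_commute)

lemma source_zero:
  assumes "x \<in> upper_half" "c \<in> sources True x" "c \<noteq> x" "y \<in> ball c r" "r \<le> x $ 3"
  shows "w y = 0" "p i y = 0"
  using assms ball_lower_half[of y x r] by (auto simp: sources_def intro!: w_zero)

lemma norm_source: "c \<in> sources True x \<Longrightarrow> norm c = norm x"
  by (auto simp: sources_def norm_refl3)

text \<open>The energy identity tests the equation with the conjugate of \<open>w\<close>, but
  nothing is known about the smoothness of \<open>w\<close> at the plane. The mean value formula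
  with unit shells represents \<open>w\<close> by an integral against a C1 kernel, and that integral
  is a C1 function on the whole space.\<close>

lemma smooth_extension:
  obtains v Dv where "C1_fun v Dv" "\<And>x. x \<in> upper_half \<Longrightarrow> R + 3 < norm x \<Longrightarrow> norm x < \<rho> \<Longrightarrow> v x = w x"
    "\<And>i x. x \<in> upper_half \<Longrightarrow> R + 3 < norm x \<Longrightarrow> norm x < \<rho> \<Longrightarrow> Dv i x = p i x"
proof -
  \<comment> \<open>Unit shells reach less than distance 2. For
    \<open>R + 3 < norm x < \<rho>\<close> every contributing point therefore lies in
    \<open>K\<close>, which stays at distance 1 from the ball of radius \<open>R\<close>.\<close>
  define K :: "(real^3) set" where "K = cball 0 (\<rho> + 2) - ball 0 (R + 1)"
  have K: "compact K" "K \<subseteq> {x. norm x > R}" by (auto simp: K_def compact_diff)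
  define f where "f y = indicator K y *\<^sub>R w y / of_real kappa" for y
  have fi: "integrable lborel f"
    using w_int[OF K] unfolding f_def set_integrable_def by simp
  \<comment> \<open>The reflection is moved from \<open>x\<close> to \<open>y\<close>, which does
    not change the distance; as a function of \<open>x\<close> the kernel is then a sum of two
    radial functions.\<close>
  define H DH where "H y x = src k 1 (dsq y x) + src k 1 (dsq (refl3 y) x)"
    and "DH y i x = of_real (2 * (x - y) $ i) * src1 k 1 (dsq y x) + of_real (2 * (x - refl3 y) $ i) * src1 k 1 (dsq (refl3 y) x)" for y i x
  obtain B where B: "B > 0" "\<And>c y. cmod (src k 1 (dsq c y)) \<le> B" "\<And>c y i. cmod (of_real (2 * (y - c) $ i) * src1 k 1 (dsq c y)) \<le> B"
    using bounded_radial_src by blast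
  have HC1: "C1_fun (H y) (DH y)" for y
  proof -
    note r = C1_fun_radial[OF src_deriv src1_cont, OF zero_less_one zero_less_one, of k]
    show ?thesis
      using r[of y] r[of "refl3 y"] unfolding C1_fun_def H_def DH_def
      by (auto intro!: continuous_on_add has_partial_on_add)
  qed
  have rc: "continuous_on UNIV refl3"
  proof -
    have "continuous_on UNIV (\<lambda>x::real^3. if i = 3 then - x $ i else x $ i)" for i
      by (cases "i = 3") (auto intro!: continuous_intros)
    then show ?thesis unfolding refl3_def[abs_def] by (rule continuous_on_vec_lambda)
  qed
  have d1: "continuous_on UNIV (\<lambda>y. dsq y x)" "continuous_on UNIV (\<lambda>y. dsq (refl3 y) x)" for x
    unfolding dsq_def by (intro continuous_intros rc)+
  have Hm: "(\<lambda>y. H y x) \<in> borel_measurable borel" for x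
    unfolding H_def by (intro borel_measurable_continuous_onI continuous_on_add continuous_on_compose2[OF src_cont] d1) auto
  have DHm: "(\<lambda>y. DH y i x) \<in> borel_measurable borel" for x i
    unfolding DH_def by (intro borel_measurable_continuous_onI continuous_intros rc continuous_on_compose2[OF src1_cont] d1) auto
  have HB: "cmod (H y x) \<le> 2 * B" "cmod (DH y i x) \<le> 2 * B" for x y i
    using norm_triangle_mono[OF B(2)[of y x] B(2)[of "refl3 y" x]] norm_triangle_mono[OF B(3)[of x y i] B(3)[of x "refl3 y" i]]
    unfolding H_def DH_def by auto
  define v Dv where "v x = (LINT y|lborel. f y * H y x)" and "Dv i x = (LINT y|lborel. f y * DH y i x)" for x i
  have vC1: "C1_fun v Dv" unfolding v_def Dv_def by (rule C1_fun_integral[OF fi HC1 Hm DHm HB])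
  have vw: "v x = w x" if x: "x \<in> upper_half" "R + 3 < norm x" "norm x < \<rho>" for x
  proof -
    define r where "r = min 1 (x $ 3)"
    have r: "r > 0" "r \<le> 1" "r \<le> x $ 3" using x by (auto simp: r_def upper_half_def)
    have x3: "x $ 3 \<noteq> 0" using x by (auto simp: upper_half_def)
    have xr: "x \<noteq> refl3 x"
    proof
      assume "x = refl3 x" then have "x $ 3 = - x $ 3" by (metis refl3_nth(3))
      then show False using x3 by simp
    qed
    have inD: "norm y > R" if "y \<in> cball c 2" "c \<in> sources True x" for y c
      using that norm_source[OF that(2)] x(2) norm_triangle_ineq2[of c y] by (auto simp: dist_norm)
    have "of_real kappa * w x = (LINT y|lborel. w y * (\<Sum>c\<in>sources True x. src k 1 (dsq c y)))"
    proof (rule mean_value[OF r(1,2)])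
      show "continuous_on (ball x r) w"
      proof (rule continuous_on_subset[OF w_C1(1)])
        have "norm y > R" if "y \<in> ball x r" for y using inD[of y x] that r by auto
        then show "ball x r \<subseteq> upper_half \<inter> {x. R < norm x}" using ball_upper_half[of _ x r] r by blast
      qed
    qed (use x3 source_zero[OF x(1) _ _ _ r(3)] inD in auto)
    also have "\<dots> = (LINT y|lborel. of_real kappa * (f y * H y x))"
    proof (rule Bochner_Integration.integral_cong[OF refl])
      fix y :: "real^3"
      have s: "(\<Sum>c\<in>sources True x. src k 1 (dsq c y)) = H y x"
        using xr unfolding H_def sources_def by (simp add: dsq_refl3 dsq_commute[of x])
      have "H y x = 0" if "y \<notin> K"
      proof -
        have "dsq c y \<ge> 2 * 1^2" if "c \<in> sources True x" for c
        proof -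
          have "norm (y - c) \<ge> 2"
            using \<open>y \<notin> K\<close> norm_source[OF that] x norm_triangle_ineq2[of y c] norm_triangle_ineq3[of c y]
            by (auto simp: K_def norm_minus_commute)
          then have "(norm (y - c))^2 \<ge> 2^2" by (intro power_mono) auto
          then show ?thesis by (simp add: dsq_def)
        qed
        then have "(\<Sum>c\<in>sources True x. src k 1 (dsq c y)) = 0"
          by (intro sum.neutral ballI src_outside) auto
        then show ?thesis using s by simp
      qed
      then show "w y * (\<Sum>c\<in>sources True x. src k 1 (dsq c y)) = of_real kappa * (f y * H y x)"
        unfolding s f_def using kappa_neg by (cases "y \<in> K") auto
    qed
    also have "\<dots> = of_real kappa * v x" unfolding v_def by simp
    finally show ?thesis using kappa_neg by simp
  qed
  have Dvp: "Dv i x = p i x" if x: "x \<in> upper_half" "R + 3 < norm x" "norm x < \<rho>" for x i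
  proof -
    define U where "U = upper_half \<inter> {x. R + 3 < norm x} \<inter> {x. norm x < \<rho>}"
    have U: "open U" unfolding U_def using open_upper_half
      by (intro open_Int open_Collect_less continuous_intros) auto
    have "has_partial_on v i (p i) U"
      by (rule has_partial_on_cong[where f=w and f'="p i", OF U _ _ has_partial_on_subset[OF w_C1(2)]]) (use R in \<open>auto simp: U_def vw\<close>)
    then show ?thesis
      using has_partial_on_unique[OF has_partial_on_subset[OF C1_funD(2)[OF vC1]], of U] x by (auto simp: U_def)
  qed
  show ?thesis using that[OF vC1 vw Dvp] by blast
qed

end

section \<open>Smooth averages over shells and the energy flux\<close>

lemma C1_fun_cnj: "C1_fun f Df \<Longrightarrow> C1_fun (\<lambda>x. cnj (f x)) (\<lambda>i x. cnj (Df i x))"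
  unfolding C1_fun_def has_partial_on_def
  by (auto intro!: continuous_intros has_vector_derivative_cnj)

definition annulus :: "real \<Rightarrow> real \<Rightarrow> (real^3) set" where
  "annulus a b = cball 0 b - ball 0 a"

lemma compact_annulus: "compact (annulus a b)"
  by (simp add: annulus_def compact_diff)

lemma annulus_iff: "y \<in> annulus a b \<longleftrightarrow> a \<le> norm y \<and> norm y \<le> b"
  by (auto simp: annulus_def)

text \<open>The transition ends already at radius \<open>sqrt 2 * \<rho>\<close>; the rounder
  \<open>2 * \<rho>\<close> is used throughout for the outer radius.\<close>

lemma cutoff_norm:
  assumes "\<rho> > 0"
  shows "norm y \<le> \<rho> \<Longrightarrow> cutoff \<rho> (dsq 0 y) = 0" "norm y \<le> \<rho> \<Longrightarrow> cutoff1 \<rho> (dsq 0 y) = 0"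
    "norm y \<ge> 2 * \<rho> \<Longrightarrow> cutoff \<rho> (dsq 0 y) = 1" "norm y \<ge> 2 * \<rho> \<Longrightarrow> cutoff1 \<rho> (dsq 0 y) = 0"
proof -
  have "norm y \<le> \<rho> \<Longrightarrow> dsq 0 y \<le> \<rho>^2" unfolding dsq_zero by (intro power_mono) auto
  then show "norm y \<le> \<rho> \<Longrightarrow> cutoff \<rho> (dsq 0 y) = 0" "norm y \<le> \<rho> \<Longrightarrow> cutoff1 \<rho> (dsq 0 y) = 0"
    using cutoff_left[OF assms] by auto
  have "norm y \<ge> 2 * \<rho> \<Longrightarrow> dsq 0 y \<ge> (2 * \<rho>)^2" unfolding dsq_zero using assms by (intro power_mono) auto
  moreover have "(2 * \<rho>)^2 \<ge> 2 * \<rho>^2" unfolding power_mult_distrib using zero_le_power2[of \<rho>] by simp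
  ultimately have "norm y \<ge> 2 * \<rho> \<Longrightarrow> dsq 0 y \<ge> 2 * \<rho>^2" by linarith
  then show "norm y \<ge> 2 * \<rho> \<Longrightarrow> cutoff \<rho> (dsq 0 y) = 1" "norm y \<ge> 2 * \<rho> \<Longrightarrow> cutoff1 \<rho> (dsq 0 y) = 0"
    using cutoff_right[OF assms] by auto
qed

lemma cutoff1_zero_outside: "\<rho> > 0 \<Longrightarrow> y \<notin> annulus \<rho> (2 * \<rho>) \<Longrightarrow> cutoff1 \<rho> (dsq 0 y) = 0"
  using cutoff_norm[of \<rho> y] by (auto simp: annulus_iff)

lemma cutoff1_nonneg: "cutoff1 \<rho> s \<ge> 0"
  by (simp add: cutoff1_def step1_nonneg)

lemma continuous_cutoff1_dsq: "\<rho> > 0 \<Longrightarrow> continuous_on S (\<lambda>y. cutoff1 \<rho> (dsq c y))"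
  by (rule continuous_on_compose2[OF cutoff_cont(2)[of \<rho> UNIV] continuous_on_dsq[OF continuous_on_id]]) auto

text \<open>The factor 1120 is \<open>140 * 8\<close>: the bound \<open>140 / \<rho>^2\<close> for
  \<open>cutoff1\<close> times the volume of the ball of radius \<open>2 * \<rho>\<close>, which is
  \<open>8 * \<rho>^3\<close> times that of the unit ball.\<close>

definition ball_const :: real where "ball_const = 1120 * measure lborel (cball (0::real^3) 1)"

lemma ball_const_nonneg: "ball_const \<ge> 0"
  by (simp add: ball_const_def)

text \<open>The weight has size \<open>1 / \<rho>^2\<close> on a set of volume of order
  \<open>\<rho>^3\<close>, so integrating against it costs one factor \<open>\<rho>\<close>.\<close>

lemma cutoff1_moment:
  assumes "\<rho> > 0"
  shows "integrable lborel (\<lambda>y::real^3. cutoff1 \<rho> (dsq 0 y) / norm y ^ m)"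
    "(LINT y|lborel. cutoff1 \<rho> (dsq 0 (y::real^3)) / norm y ^ m) \<le> ball_const * \<rho> / \<rho> ^ m"
proof -
  let ?g = "\<lambda>y::real^3. 140 / \<rho>^2 / \<rho>^m * indicator (cball 0 (2 * \<rho>)) y :: real"
  have gi: "integrable lborel ?g"
    using emeasure_lborel_cball_finite[of "0::real^3" "2 * \<rho>"] by (intro integrable_mult_right integrable_real_indicator) auto
  have b: "cutoff1 \<rho> (dsq 0 y) / norm y ^ m \<le> ?g y" for y
  proof (cases "y \<in> annulus \<rho> (2 * \<rho>)")
    case True
    then have "\<rho> ^ m \<le> norm y ^ m" using assms by (intro power_mono) (auto simp: annulus_iff)
    moreover have "cutoff1 \<rho> (dsq 0 y) \<le> 140 / \<rho>^2"
      unfolding cutoff1_def using step1_le assms by (intro divide_right_mono) auto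
    ultimately have "cutoff1 \<rho> (dsq 0 y) / norm y ^ m \<le> 140 / \<rho>^2 / \<rho>^m"
      using assms cutoff1_nonneg by (intro frac_le) auto
    then show ?thesis using True by (simp add: annulus_iff)
  qed (use cutoff1_zero_outside[OF assms] assms in auto)
  have nn: "0 \<le> cutoff1 \<rho> (dsq 0 y) / norm y ^ m" for y :: "real^3" using cutoff1_nonneg by simp
  have meas: "(\<lambda>y::real^3. cutoff1 \<rho> (dsq 0 y) / norm y ^ m) \<in> borel_measurable lborel"
    using borel_measurable_continuous_onI[OF continuous_cutoff1_dsq[OF assms]] by simp
  show i: "integrable lborel (\<lambda>y::real^3. cutoff1 \<rho> (dsq 0 y) / norm y ^ m)"
  proof (rule Bochner_Integration.integrable_bound[OF gi meas], rule AE_I2)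
    fix y :: "real^3"
    show "norm (cutoff1 \<rho> (dsq 0 y) / norm y ^ m) \<le> norm (?g y)"
      using b[of y] nn[of y] by (metis abs_of_nonneg order_trans real_norm_def)
  qed
  have "(LINT y|lborel. cutoff1 \<rho> (dsq 0 (y::real^3)) / norm y ^ m) \<le> (LINT y|lborel. ?g y)"
    by (rule integral_mono[OF i gi b])
  also have "\<dots> = 140 / \<rho>^2 / \<rho>^m * measure lborel (cball (0::real^3) (2 * \<rho>))"
    by simp
  also have "measure lborel (cball (0::real^3) (2 * \<rho>)) = measure lborel (cball (0::real^3) 1) * (8 * \<rho>^3)"
    using assms content_cball[of "2 * \<rho>" "0::real^3"] content_cball[of 1 "0::real^3"] by (simp add: power_mult_distrib)
  also have "140 / \<rho>^2 / \<rho>^m * (measure lborel (cball (0::real^3) 1) * (8 * \<rho>^3)) = ball_const * \<rho> / \<rho> ^ m"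
    using assms by (simp add: ball_const_def power2_eq_square power3_eq_cube)
  finally show "(LINT y|lborel. cutoff1 \<rho> (dsq 0 (y::real^3)) / norm y ^ m) \<le> ball_const * \<rho> / \<rho> ^ m" .
qed

context half_exterior
begin

text \<open>Up to the factor 1/2, the energy flux through spheres averaged over the radii between
  \<open>\<rho>\<close> and \<open>2 * \<rho>\<close> with the weight given by
  \<open>cutoff1\<close>.\<close>

definition flux :: "real \<Rightarrow> real" where
  "flux \<rho> = (LINT y|lborel. cutoff1 \<rho> (dsq 0 y) * Im (radial y * cnj (w y)))"

lemma annulus_exterior: "a > R \<Longrightarrow> annulus a b \<subseteq> {x. norm x > R}"
  by (auto simp: annulus_iff)

lemma products_integrable:
  assumes "compact K" "K \<subseteq> {x. norm x > R}"
  shows "set_integrable lborel K (\<lambda>y. p i y * cnj (w y))" "set_integrable lborel K (\<lambda>y. p i y * cnj (p i y))"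
    "set_integrable lborel K (\<lambda>y. w y * cnj (w y))"
  by (intro set_integrable_mult_of_squares w_int p_int w_sq p_sq assms)+

lemma flux_integrable:
  assumes "\<rho> > R"
  shows "integrable lborel (\<lambda>y. cutoff1 \<rho> (dsq 0 y) * Im (radial y * cnj (w y)))"
proof -
  have \<rho>: "\<rho> > 0" using assms R by simp
  have "integrable lborel (\<lambda>y. \<Sum>i\<in>UNIV. (p i y * cnj (w y)) * of_real (y $ i * cutoff1 \<rho> (dsq 0 y)))"
    by (intro Bochner_Integration.integrable_sum integrable_mult_compact_support[OF products_integrable(1)[OF compact_annulus annulus_exterior[OF assms, of "2 * \<rho>"]] _ compact_annulus])
       (auto intro!: continuous_intros continuous_cutoff1_dsq \<rho> simp: cutoff1_zero_outside[OF \<rho>])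
  moreover have "Im (\<Sum>i\<in>UNIV. (p i y * cnj (w y)) * of_real (y $ i * cutoff1 \<rho> (dsq 0 y)))
     = cutoff1 \<rho> (dsq 0 y) * Im (radial y * cnj (w y))" for y
    by (simp add: sum_3 algebra_simps)
  ultimately show ?thesis using integrable_Im by fastforce
qed

text \<open>Test the equation with the conjugate of \<open>w\<close> times the difference of the two
  cutoffs. The terms with the squared gradient and with the square of \<open>w\<close> are real, so
  the imaginary part retains only the derivatives of the cutoffs, that is, the difference of the
  fluxes.\<close>

lemma flux_const:
  assumes "R + 3 < a" "a \<le> b"
  shows "flux a = flux b"
proof -
  have a: "a > 0" "b > 0" "a > R" "b > R" using assms R by auto
  define h h1 where "h s = complex_of_real (cutoff a s - cutoff b s)" and "h1 s = complex_of_real (cutoff1 a s - cutoff1 b s)" for s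
  have hd: "(h has_vector_derivative h1 s) (at s)" for s
    unfolding h_def[abs_def] h1_def by (intro has_vector_derivative_of_real DERIV_diff cutoff_derivs a)
  have h1c: "continuous_on UNIV h1"
    unfolding h1_def[abs_def] by (intro continuous_intros cutoff_cont a)
  define D\<eta> where "D\<eta> i y = of_real (2 * (y - 0) $ i) * h1 (dsq 0 y)" for i and y :: "real^3"
  have \<eta>: "C1_fun (\<lambda>y. h (dsq 0 y)) D\<eta>" unfolding D\<eta>_def by (rule C1_fun_radial[OF hd h1c])
  \<comment> \<open>\<open>v\<close> serves as an admissible test function in place of
    \<open>w\<close>. The two agree on the part of the annulus above the plane; elsewhere in the
    annulus the factors \<open>w\<close> and \<open>p\<close> of the integrand vanish.\<close>
  obtain v Dv where v: "C1_fun v Dv" "\<And>x. x \<in> upper_half \<Longrightarrow> R + 3 < norm x \<Longrightarrow> norm x < 3 * b \<Longrightarrow> v x = w x"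
    "\<And>i x. x \<in> upper_half \<Longrightarrow> R + 3 < norm x \<Longrightarrow> norm x < 3 * b \<Longrightarrow> Dv i x = p i x"
    using smooth_extension[of "3 * b"] by blast
  let ?K = "annulus a (2 * b)"
  have K: "compact ?K" "?K \<subseteq> {x. norm x > R}" using compact_annulus annulus_exterior[OF a(3)] by auto
  have h0: "h (dsq 0 y) = 0" "h1 (dsq 0 y) = 0" if "y \<notin> ?K" for y
  proof -
    have "norm y \<le> a \<and> norm y \<le> b \<or> norm y \<ge> 2 * a \<and> norm y \<ge> 2 * b"
      using that assms by (auto simp: annulus_iff)
    then show "h (dsq 0 y) = 0" "h1 (dsq 0 y) = 0"
      unfolding h_def h1_def using cutoff_norm[OF a(1), of y] cutoff_norm[OF a(2), of y] by auto
  qed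
  define X where "X y = (\<Sum>i\<in>UNIV. (p i y * cnj (w y)) * D\<eta> i y) + ((\<Sum>i\<in>UNIV. (p i y * cnj (p i y)) * h (dsq 0 y)) - of_real (k^2) * ((w y * cnj (w y)) * h (dsq 0 y)))" for y
  have "(LINT y|lborel. (\<Sum>i\<in>UNIV. p i y * (D\<eta> i y * cnj (v y) + h (dsq 0 y) * cnj (Dv i y))) - of_real (k^2) * w y * (h (dsq 0 y) * cnj (v y))) = 0"
    by (rule weak[OF C1_fun_mult[OF \<eta> C1_fun_cnj[OF v(1)]] K]) (simp add: h0)
  also have "(\<lambda>y. (\<Sum>i\<in>UNIV. p i y * (D\<eta> i y * cnj (v y) + h (dsq 0 y) * cnj (Dv i y))) - of_real (k^2) * w y * (h (dsq 0 y) * cnj (v y))) = X"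
  proof
    fix y
    show "(\<Sum>i\<in>UNIV. p i y * (D\<eta> i y * cnj (v y) + h (dsq 0 y) * cnj (Dv i y))) - of_real (k^2) * w y * (h (dsq 0 y) * cnj (v y)) = X y"
    proof (cases "y \<in> ?K \<and> y \<in> upper_half")
      case True
      then have "R + 3 < norm y" "norm y < 3 * b" using assms a by (auto simp: annulus_iff)
      then have "v y = w y" "Dv i y = p i y" for i using v(2,3) True by auto
      then show ?thesis unfolding X_def by (simp add: sum_3 algebra_simps)
    next
      case False
      then show ?thesis
      proof (cases "y \<in> ?K")
        case True
        then have "w y = 0" "p i y = 0" for i using False w_zero by auto
        then show ?thesis by (simp add: X_def)
      qed (simp add: X_def h0 D\<eta>_def)
    qed
  qed
  finally have X0: "(LINT y|lborel. X y) = 0" .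
  have hc: "continuous_on UNIV (\<lambda>y::real^3. h (dsq 0 y))" using C1_funD(1)[OF \<eta>] .
  have Xi: "integrable lborel X" unfolding X_def
    by (intro Bochner_Integration.integrable_add Bochner_Integration.integrable_diff Bochner_Integration.integrable_sum integrable_mult_right
      integrable_mult_compact_support[OF products_integrable(1)[OF K] C1_funD(3)[OF \<eta>] K(1)]
      integrable_mult_compact_support[OF products_integrable(2)[OF K] hc K(1)]
      integrable_mult_compact_support[OF products_integrable(3)[OF K] hc K(1)]) (auto simp: h0 D\<eta>_def)
  have "0 = (LINT y|lborel. Im (X y))" using X0 integral_Im[OF Xi] by simp
  also have "\<dots> = (LINT y|lborel. 2 * (cutoff1 a (dsq 0 y) * Im (radial y * cnj (w y))) - 2 * (cutoff1 b (dsq 0 y) * Im (radial y * cnj (w y))))"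
  proof (rule Bochner_Integration.integral_cong[OF refl])
    fix y
    have cc: "Im (z * cnj z * complex_of_real c) = 0" for z c by (simp add: complex_mult_cnj)
    have "Im ((\<Sum>i\<in>UNIV. (p i y * cnj (p i y)) * h (dsq 0 y)) - of_real (k^2) * ((w y * cnj (w y)) * h (dsq 0 y))) = 0"
      unfolding h_def minus_complex.sel Im_sum cc Im_complex_of_real Im_divide_of_real times_complex.sel(2)[of "of_real (k^2)"] by (simp add: cc del: of_real_diff)
    then have "Im (X y) = Im (\<Sum>i\<in>UNIV. (p i y * cnj (w y)) * D\<eta> i y)" unfolding X_def by simp
    also have "(\<Sum>i\<in>UNIV. (p i y * cnj (w y)) * D\<eta> i y) = complex_of_real (2 * (cutoff1 a (dsq 0 y) - cutoff1 b (dsq 0 y))) * (radial y * cnj (w y))"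
      unfolding D\<eta>_def h1_def by (simp add: sum_3 algebra_simps)
    also have "Im \<dots> = 2 * (cutoff1 a (dsq 0 y) - cutoff1 b (dsq 0 y)) * Im (radial y * cnj (w y))"
      by (simp only: Im_complex_of_real times_complex.sel Re_complex_of_real mult_zero_left add_0_right)
    finally show "Im (X y) = 2 * (cutoff1 a (dsq 0 y) * Im (radial y * cnj (w y))) - 2 * (cutoff1 b (dsq 0 y) * Im (radial y * cnj (w y)))"
      by (simp only: left_diff_distrib right_diff_distrib mult.assoc)
  qed
  also have "\<dots> = 2 * flux a - 2 * flux b"
    unfolding flux_def using flux_integrable[OF a(3)] flux_integrable[OF a(4)] by simp
  finally show ?thesis by simp
qed

lemma mean_square_integrable:
  assumes "\<rho> > R"
  shows "integrable lborel (\<lambda>y. cutoff1 \<rho> (dsq 0 y) * (norm y * (cmod (w y))^2))"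
proof -
  have \<rho>: "\<rho> > 0" using assms R by simp
  have i: "integrable lborel (\<lambda>y. (w y * cnj (w y)) * complex_of_real (cutoff1 \<rho> (dsq 0 y) * norm y))"
    by (intro integrable_mult_compact_support[OF products_integrable(3)[OF compact_annulus annulus_exterior[OF assms, of "2 * \<rho>"]] _ compact_annulus])
       (auto intro!: continuous_intros continuous_cutoff1_dsq \<rho> simp: cutoff1_zero_outside[OF \<rho>])
  have eq: "Re ((w y * cnj (w y)) * complex_of_real (cutoff1 \<rho> (dsq 0 y) * norm y))
      = cutoff1 \<rho> (dsq 0 y) * (norm y * (cmod (w y))^2)" for y
    unfolding complex_norm_square[symmetric] of_real_mult[symmetric] by (simp only: Re_complex_of_real mult_ac)
  show ?thesis using integrable_Re[OF i] unfolding eq .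
qed

text \<open>With \<open>A = radial y\<close> and \<open>t = k * norm y\<close>, the square in the
  radiation condition expands to \<open>|A|^2 + t^2 |w|^2 - 2 t Im (A cnj w)\<close>. Dropping
  \<open>|A|^2\<close> bounds the mean square by the flux, which does not depend on the shell, plus
  a moment of \<open>cutoff1\<close>. This is an a priori bound: no decay of \<open>w\<close> is
  assumed.\<close>

lemma mean_square_bounded:
  obtains M \<rho>0 where "\<rho>0 > R" "M \<ge> 0" "\<And>\<rho>. \<rho> \<ge> \<rho>0 \<Longrightarrow> (LINT y|lborel. cutoff1 \<rho> (dsq 0 y) * (norm y * (cmod (w y))^2)) \<le> M"
proof -
  obtain \<rho>1 where \<rho>1: "\<And>x. x \<in> upper_half \<Longrightarrow> norm x > \<rho>1 \<Longrightarrow> cmod (radial x - \<i> * of_real (k * norm x) * w x) < 1"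
    using radiation[of 1] by auto
  define \<rho>0 where "\<rho>0 = max (R + 4) (\<rho>1 + 1)"
  have \<rho>0: "\<rho>0 > R + 3" "\<rho>0 > \<rho>1" by (auto simp: \<rho>0_def)
  have "(LINT y|lborel. cutoff1 \<rho> (dsq 0 y) * (norm y * (cmod (w y))^2)) \<le> (ball_const + 2 * k * flux \<rho>0) / k^2" if "\<rho> \<ge> \<rho>0" for \<rho>
  proof -
    have \<rho>: "\<rho> > 0" "\<rho> > R" using that \<rho>0 R by auto
    have pt: "k^2 * (cutoff1 \<rho> (dsq 0 y) * (norm y * (cmod (w y))^2)) \<le> cutoff1 \<rho> (dsq 0 y) / norm y ^ 1 + 2 * k * (cutoff1 \<rho> (dsq 0 y) * Im (radial y * cnj (w y)))" for y
    proof (cases "y \<in> annulus \<rho> (2 * \<rho>) \<and> y \<in> upper_half")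
      case True
      then have ny: "norm y \<ge> \<rho>" "norm y > \<rho>1" using that \<rho>0 by (auto simp: annulus_iff)
      have "(cmod (radial y - \<i> * of_real (k * norm y) * w y))^2 \<le> 1"
        using \<rho>1[of y] True ny by (simp add: power_le_one)
      moreover have "(cmod (A - \<i> * of_real t * z))^2 = (cmod A)^2 + t^2 * (cmod z)^2 - 2 * t * Im (A * cnj z)" for A z :: complex and t :: real
        unfolding cmod_power2 by (simp add: power2_eq_square algebra_simps)
      ultimately have "(cmod (radial y))^2 + (k * norm y)^2 * (cmod (w y))^2 - 2 * (k * norm y) * Im (radial y * cnj (w y)) \<le> 1" by metis
      then have "(k * norm y)^2 * (cmod (w y))^2 \<le> 1 + 2 * (k * norm y) * Im (radial y * cnj (w y))"
        using zero_le_power2[of "cmod (radial y)"] by linarith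
      then have "norm y * (k^2 * (norm y * (cmod (w y))^2)) \<le> norm y * (1 / norm y + 2 * k * Im (radial y * cnj (w y)))"
        using ny \<rho> by (simp add: power_mult_distrib power2_eq_square algebra_simps)
      then have "k^2 * (norm y * (cmod (w y))^2) \<le> 1 / norm y + 2 * k * Im (radial y * cnj (w y))"
        using ny \<rho> by (subst (asm) mult_le_cancel_left_pos) auto
      from mult_left_mono[OF this cutoff1_nonneg[of \<rho> "dsq 0 y"]] show ?thesis by (simp add: algebra_simps)
    next
      case False
      then show ?thesis using cutoff1_zero_outside[OF \<rho>(1), of y] w_zero(1)[of y] cutoff1_nonneg by (cases "y \<in> upper_half") auto
    qed
    have "k^2 * (LINT y|lborel. cutoff1 \<rho> (dsq 0 y) * (norm y * (cmod (w y))^2)) = (LINT y|lborel. k^2 * (cutoff1 \<rho> (dsq 0 y) * (norm y * (cmod (w y))^2)))"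
      by simp
    also have "\<dots> \<le> (LINT y|lborel. cutoff1 \<rho> (dsq 0 y) / norm y ^ 1 + 2 * k * (cutoff1 \<rho> (dsq 0 y) * Im (radial y * cnj (w y))))"
      using mean_square_integrable[OF \<rho>(2)] cutoff1_moment(1)[OF \<rho>(1), of 1] flux_integrable[OF \<rho>(2)] pt
      by (intro integral_mono Bochner_Integration.integrable_add integrable_mult_right) auto
    also have "\<dots> = (LINT y|lborel. cutoff1 \<rho> (dsq 0 (y::real^3)) / norm y ^ 1) + 2 * k * flux \<rho>"
      unfolding flux_def using cutoff1_moment(1)[OF \<rho>(1), of 1] flux_integrable[OF \<rho>(2)]
      by (subst Bochner_Integration.integral_add) auto
    also have "\<dots> \<le> ball_const + 2 * k * flux \<rho>0"
      using cutoff1_moment(2)[OF \<rho>(1), of 1] flux_const[OF \<rho>0(1) that] \<rho> by simp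
    finally show ?thesis using k by (simp add: pos_le_divide_eq mult.commute)
  qed
  then have "(LINT y|lborel. cutoff1 \<rho> (dsq 0 y) * (norm y * (cmod (w y))^2)) \<le> \<bar>(ball_const + 2 * k * flux \<rho>0) / k^2\<bar>" if "\<rho> \<ge> \<rho>0" for \<rho>
    using that abs_ge_self order_trans by blast
  moreover have "\<rho>0 > R" using \<rho>0(1) by simp
  ultimately show ?thesis using that[of \<rho>0 "\<bar>(ball_const + 2 * k * flux \<rho>0) / k^2\<bar>"] by simp
qed

end

section \<open>Representation of a radiating solution\<close>

lemma norm_fund: "cmod (fund k (dsq c y)) = 1 / norm (y - c)"
  unfolding fund_def Let_def sqrt_dsq by (simp add: norm_divide)

text \<open>The radiation condition for a wave centred at \<open>c\<close>, with an error of order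
  \<open>1 / norm y\<close>: the distances to \<open>c\<close> and to 0 differ by at most
  \<open>norm c\<close>, as do the projected directions, which costs \<open>2 k norm c\<close>, and
  the decaying amplitude costs 2.\<close>

lemma kernel_radial:
  assumes "k > 0" "y \<noteq> 0" "norm y \<ge> 2 * norm c"
  shows "cmod (fund k (dsq c y)) \<le> 2 / norm y"
    "cmod ((\<Sum>i\<in>UNIV. of_real (y $ i) * (of_real (2 * (y - c) $ i) * fund1 k (dsq c y))) - \<i> * of_real (k * norm y) * fund k (dsq c y))
       \<le> 2 / norm y * (2 * k * norm c + 2)"
proof -
  define q where "q = norm (y - c)"
  have q: "q \<ge> norm y / 2" using norm_triangle_ineq2[of y c] assms(3) by (simp add: q_def)
  then have q0: "q > 0" using assms(2) by (meson less_le_trans half_gt_zero zero_less_norm_iff)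
  show 1: "cmod (fund k (dsq c y)) \<le> 2 / norm y"
    unfolding norm_fund q_def[symmetric] using q q0 assms(2) by (simp add: field_simps)
  define d where "d = y \<bullet> (y - c)"
  have dsq: "dsq c y = q^2" by (simp add: dsq_def q_def)
  have "(\<Sum>i\<in>UNIV. of_real (y $ i) * (of_real (2 * (y - c) $ i) * fund1 k (dsq c y))) = of_real d * (2 * fund1 k (dsq c y))"
    unfolding d_def inner_vec_def by (simp add: sum_3 algebra_simps)
  also have "2 * fund1 k (dsq c y) = fund k (dsq c y) * (\<i> * k * of_real q - 1) / of_real (q^2)"
    using fund1_eq[of "dsq c y" k] q0 unfolding dsq by (simp add: field_simps)
  finally have s1: "(\<Sum>i\<in>UNIV. of_real (y $ i) * (of_real (2 * (y - c) $ i) * fund1 k (dsq c y))) = of_real d * (fund k (dsq c y) * (\<i> * k * of_real q - 1) / of_real (q^2))" .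
  have "(\<Sum>i\<in>UNIV. of_real (y $ i) * (of_real (2 * (y - c) $ i) * fund1 k (dsq c y))) - \<i> * of_real (k * norm y) * fund k (dsq c y)
     = fund k (dsq c y) * (\<i> * of_real (k * (d / q - norm y)) - of_real (d / q^2))"
    unfolding s1 using q0 by (simp add: field_simps power2_eq_square)
  then have "cmod ((\<Sum>i\<in>UNIV. of_real (y $ i) * (of_real (2 * (y - c) $ i) * fund1 k (dsq c y))) - \<i> * of_real (k * norm y) * fund k (dsq c y))
     = cmod (fund k (dsq c y)) * cmod (\<i> * of_real (k * (d / q - norm y)) - of_real (d / q^2))"
    by (simp only: norm_mult)
  also have "\<dots> \<le> 2 / norm y * (2 * k * norm c + 2)"
  proof (rule mult_mono[OF 1])
    have "d = q^2 + c \<bullet> (y - c)" unfolding d_def q_def power2_norm_eq_inner by (simp add: inner_diff_left)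
    then have dq: "d / q = q + (c \<bullet> (y - c)) / q" using q0 by (simp add: field_simps power2_eq_square)
    have "\<bar>(c \<bullet> (y - c)) / q\<bar> \<le> norm c"
      using Cauchy_Schwarz_ineq2[of c "y - c"] q0 by (simp add: q_def pos_divide_le_eq)
    moreover have "\<bar>q - norm y\<bar> \<le> norm c" using norm_triangle_ineq3[of "y - c" y] by (simp add: q_def)
    ultimately have a: "\<bar>d / q - norm y\<bar> \<le> 2 * norm c" unfolding dq by linarith
    have "\<bar>d\<bar> \<le> norm y * q" unfolding d_def q_def by (rule Cauchy_Schwarz_ineq2)
    also have "\<dots> \<le> (2 * q) * q" using q q0 by (intro mult_right_mono) auto
    finally have b: "\<bar>d / q^2\<bar> \<le> 2" using q0 by (simp add: pos_divide_le_eq power2_eq_square)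
    have "cmod (\<i> * of_real (k * (d / q - norm y)) - of_real (d / q^2)) \<le> cmod (\<i> * of_real (k * (d / q - norm y))) + cmod (of_real (d / q^2))"
      by (rule norm_triangle_ineq4)
    also have "\<dots> = k * \<bar>d / q - norm y\<bar> + \<bar>d / q^2\<bar>"
      using assms(1) by (simp add: norm_mult abs_mult del: of_real_mult of_real_diff of_real_divide)
    also have "\<dots> \<le> k * (2 * norm c) + 2" using a b assms(1) by (intro add_mono mult_left_mono) auto
    finally show "cmod (\<i> * of_real (k * (d / q - norm y)) - of_real (d / q^2)) \<le> 2 * k * norm c + 2" by simp
  qed auto
  finally show "cmod ((\<Sum>i\<in>UNIV. of_real (y $ i) * (of_real (2 * (y - c) $ i) * fund1 k (dsq c y))) - \<i> * of_real (k * norm y) * fund k (dsq c y))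
       \<le> 2 / norm y * (2 * k * norm c + 2)" .
qed

context half_exterior
begin

text \<open>The smoothed boundary term of Green's formula at radius about \<open>\<rho>\<close>; the
  factor \<open>2 * cutoff1\<close> together with \<open>y\<close> is the gradient of the
  cutoff.\<close>

definition shell :: "real \<Rightarrow> real^3 \<Rightarrow> real^3 \<Rightarrow> complex" where
  "shell \<rho> x y = of_real (2 * cutoff1 \<rho> (dsq 0 y)) *
     ((\<Sum>c\<in>sources True x. fund k (dsq c y)) * radial y
       - w y * (\<Sum>c\<in>sources True x. \<Sum>i\<in>UNIV. of_real (y $ i) * (of_real (2 * (y - c) $ i) * fund1 k (dsq c y))))"

text \<open>The sources keep a positive distance from the shell, so the singular kernel may be
  replaced by a truncated one, which is continuous everywhere.\<close>

lemma shell_integrable: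
  assumes \<rho>: "\<rho> > R" and e: "e > 0" "\<And>c y. c \<in> sources True x \<Longrightarrow> y \<in> annulus \<rho> (2 * \<rho>) \<Longrightarrow> dsq c y \<ge> 2 * e^2"
  shows "integrable lborel (shell \<rho> x)"
proof -
  have r0: "\<rho> > 0" using \<rho> R by simp
  let ?X = "sources True x"
  define A where "A y = (\<Sum>i\<in>UNIV. p i y * (of_real (2 * cutoff1 \<rho> (dsq 0 y) * y $ i) * (\<Sum>c\<in>?X. ker k e (dsq c y))))" for y
  define B where "B y = w y * (of_real (2 * cutoff1 \<rho> (dsq 0 y)) * (\<Sum>c\<in>?X. \<Sum>i\<in>UNIV. of_real (y $ i) * (of_real (2 * (y - c) $ i) * ker1 k e (dsq c y))))" for y
  have K: "annulus \<rho> (2 * \<rho>) \<subseteq> {x. norm x > R}" by (rule annulus_exterior[OF \<rho>])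
  have c: "continuous_on UNIV (\<lambda>y. ker k e (dsq c y))" "continuous_on UNIV (\<lambda>y. ker1 k e (dsq c y))" for c
    by (intro continuous_on_compose2[OF ker_cont(1)[OF e(1)]] continuous_on_compose2[OF ker_cont(2)[OF e(1)]] continuous_intros; simp)+
  have "integrable lborel A" unfolding A_def
    by (intro Bochner_Integration.integrable_sum integrable_mult_compact_support[OF p_int[OF compact_annulus K] _ compact_annulus])
       (auto intro!: continuous_intros c continuous_cutoff1_dsq r0 simp: cutoff1_zero_outside[OF r0])
  moreover have "integrable lborel B" unfolding B_def
    by (intro integrable_mult_compact_support[OF w_int[OF compact_annulus K] _ compact_annulus])
       (auto intro!: continuous_intros c continuous_cutoff1_dsq r0 simp: cutoff1_zero_outside[OF r0])
  moreover have "shell \<rho> x y = A y - B y" for y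
  proof (cases "y \<in> annulus \<rho> (2 * \<rho>)")
    case True
    then have "ker k e (dsq c y) = fund k (dsq c y)" "ker1 k e (dsq c y) = fund1 k (dsq c y)" if "c \<in> ?X" for c
      using ker_far[OF e(1) e(2)[OF that True]] by auto
    then show ?thesis unfolding shell_def A_def B_def
      by (simp add: right_diff_distrib sum_3 algebra_simps cong: sum.cong)
  next
    case False
    then show ?thesis unfolding shell_def A_def B_def by (simp add: cutoff1_zero_outside[OF r0])
  qed
  ultimately show ?thesis by (metis (no_types, lifting) Bochner_Integration.integrable_cong Bochner_Integration.integrable_diff)
qed

text \<open>Subtracting \<open>i k norm y\<close> times the kernel times \<open>w\<close> from both
  products brings in the two radiation errors. The first is small because \<open>w\<close> radiates.
  In the second the kernel error is of order \<open>1 / norm y\<close>, while \<open>w\<close> is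
  controlled only in mean square; the inequality between arithmetic and geometric mean makes that
  enough.\<close>

lemma shell_tendsto_0:
  assumes "\<epsilon> > 0"
  obtains \<rho>0 where "\<And>\<rho>. \<rho> \<ge> \<rho>0 \<Longrightarrow> cmod (LINT y|lborel. shell \<rho> x y) \<le> \<epsilon>"
proof -
  obtain M \<rho>1 where M: "\<rho>1 > R" "M \<ge> 0" "\<And>\<rho>. \<rho> \<ge> \<rho>1 \<Longrightarrow> (LINT y|lborel. cutoff1 \<rho> (dsq 0 y) * (norm y * (cmod (w y))^2)) \<le> M"
    using mean_square_bounded by blast
  \<comment> \<open>Chosen so that the first error, \<open>8 * e * ball_const\<close>, is at most
    \<open>\<epsilon> / 2\<close>; the summand 1 is there because only
    \<open>ball_const \<ge> 0\<close> is known.\<close>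
  define e where "e = \<epsilon> / (16 * (ball_const + 1))"
  have e: "e > 0" using assms ball_const_nonneg by (simp add: e_def)
  obtain \<rho>2 where \<rho>2: "\<And>x. x \<in> upper_half \<Longrightarrow> norm x > \<rho>2 \<Longrightarrow> cmod (radial x - \<i> * of_real (k * norm x) * w x) < e"
    using radiation[OF e] by blast
  \<comment> \<open>Twice the kernel error of \<open>kernel_radial\<close>, for the two sources,
    multiplied by \<open>norm y\<close>; the mirror source has the same norm as
    \<open>x\<close>.\<close>
  define C where "C = 8 * k * norm x + 8"
  have C: "C > 0" using k by (simp add: C_def add_nonneg_pos)
  define \<rho>0 where "\<rho>0 = Max {\<rho>1, \<rho>2 + 1, 2 * norm x, 2 * C * (M + ball_const + 1) / \<epsilon>, 1}"
  have \<rho>0: "\<rho>0 \<ge> \<rho>1" "\<rho>0 > \<rho>2" "\<rho>0 \<ge> 2 * norm x" "\<rho>0 \<ge> 2 * C * (M + ball_const + 1) / \<epsilon>" "\<rho>0 \<ge> 1"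
    by (auto simp: \<rho>0_def less_max_iff_disj)
  have "cmod (LINT y|lborel. shell \<rho> x y) \<le> \<epsilon>" if "\<rho> \<ge> \<rho>0" for \<rho>
  proof -
    have r: "\<rho> > 0" "\<rho> > R" "\<rho> \<ge> \<rho>1" "\<rho> > \<rho>2" "\<rho> \<ge> 2 * norm x" using that \<rho>0 M(1) by auto
    let ?m = "\<lambda>y. cutoff1 \<rho> (dsq 0 (y::real^3))"
    let ?g = "\<lambda>y. 8 * e * (?m y / norm y ^ 1) + C / \<rho> * (?m y * (norm y * (cmod (w y))^2)) + C * \<rho> * (?m y / norm y ^ 3)"
    have gi: "integrable lborel ?g"
      using cutoff1_moment(1)[OF r(1)] mean_square_integrable[OF r(2)]
      by (intro Bochner_Integration.integrable_add integrable_mult_right)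
    have b: "norm (shell \<rho> x y) \<le> ?g y" for y
    proof (cases "y \<in> annulus \<rho> (2 * \<rho>) \<and> y \<in> upper_half")
      case True
      then have ny: "norm y \<ge> \<rho>" "norm y > \<rho>2" using r by (auto simp: annulus_iff)
      have y0: "norm y > 0" "y \<noteq> 0" using ny r by auto
      let ?X = "sources True x"
      have card: "card ?X \<le> 2" unfolding sources_def by (simp add: card_insert_if)
      have nc: "norm y \<ge> 2 * norm c" if "c \<in> ?X" for c using norm_source[OF that] ny r by simp
      let ?P = "\<Sum>c\<in>?X. fund k (dsq c y)"
      let ?Q = "\<lambda>c. \<Sum>i\<in>UNIV. of_real (y $ i) * (of_real (2 * (y - c) $ i) * fund1 k (dsq c y))"
      have P: "cmod ?P \<le> 4 / norm y"
      proof -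
        have "cmod ?P \<le> (\<Sum>c\<in>?X. 2 / norm y)" by (rule sum_norm_le) (use kernel_radial(1)[OF k y0(2) nc] in auto)
        also have "\<dots> = real (card ?X) * (2 / norm y)" by simp
        also have "\<dots> \<le> 2 * (2 / norm y)" using card by (intro mult_right_mono) auto
        finally show ?thesis by simp
      qed
      have Q: "cmod ((\<Sum>c\<in>?X. ?Q c) - \<i> * of_real (k * norm y) * ?P) \<le> C / norm y"
      proof -
        have "(\<Sum>c\<in>?X. ?Q c) - \<i> * of_real (k * norm y) * ?P = (\<Sum>c\<in>?X. ?Q c - \<i> * of_real (k * norm y) * fund k (dsq c y))"
          by (simp only: sum_subtractf sum_distrib_left)
        also have "cmod \<dots> \<le> (\<Sum>c\<in>?X. 2 / norm y * (2 * k * norm x + 2))"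
        proof (rule sum_norm_le)
          fix c assume c: "c \<in> ?X"
          show "cmod (?Q c - \<i> * of_real (k * norm y) * fund k (dsq c y)) \<le> 2 / norm y * (2 * k * norm x + 2)"
            using kernel_radial(2)[OF k y0(2) nc[OF c]] unfolding norm_source[OF c] .
        qed
        also have "\<dots> = real (card ?X) * (2 / norm y * (2 * k * norm x + 2))" by simp
        also have "\<dots> \<le> 2 * (2 / norm y * (2 * k * norm x + 2))" using card k by (intro mult_right_mono) auto
        also have "\<dots> = C / norm y" by (simp add: C_def field_simps)
        finally show ?thesis .
      qed
      have gen: "cmod (a * b - c * d) \<le> cmod a * cmod b + cmod c * cmod d" for a b c d :: complex
        using norm_triangle_ineq4[of "a * b" "c * d"] by (simp add: norm_mult)
      have id: "?P * radial y - w y * (\<Sum>c\<in>?X. ?Q c) = ?P * (radial y - \<i> * of_real (k * norm y) * w y) - w y * ((\<Sum>c\<in>?X. ?Q c) - \<i> * of_real (k * norm y) * ?P)"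
        by (simp add: algebra_simps)
      have "cmod (?P * radial y - w y * (\<Sum>c\<in>?X. ?Q c)) \<le> cmod ?P * cmod (radial y - \<i> * of_real (k * norm y) * w y)
           + cmod (w y) * cmod ((\<Sum>c\<in>?X. ?Q c) - \<i> * of_real (k * norm y) * ?P)"
        unfolding id by (rule gen)
      also have "\<dots> \<le> 4 / norm y * e + cmod (w y) * (C / norm y)"
        using P Q \<rho>2[of y] True ny by (intro add_mono mult_mono mult_left_mono) auto
      also have "\<dots> = 4 / norm y * e + C * (cmod (w y) / norm y)" by simp
      finally have 1: "cmod (?P * radial y - w y * (\<Sum>c\<in>?X. ?Q c)) \<le> 4 / norm y * e + C * (cmod (w y) / norm y)" .
      \<comment> \<open>The weight \<open>\<rho>\<close> balances the two sides: after integration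
        both are of order \<open>1 / \<rho>\<close>, the first by the bounded mean square and the
        second by the third moment of \<open>cutoff1\<close>.\<close>
      have "2 * (cmod (w y) / norm y) \<le> norm y * (cmod (w y))^2 / \<rho> + \<rho> / norm y ^ 3"
      proof -
        have "0 \<le> (cmod (w y) * norm y / \<rho> - 1 / norm y)^2 * (\<rho> / norm y)" using r y0 by simp
        also have "\<dots> = norm y * (cmod (w y))^2 / \<rho> + \<rho> / norm y ^ 3 - 2 * (cmod (w y) / norm y)"
          using r y0 by (simp add: power2_eq_square power3_eq_cube field_simps)
        finally show ?thesis by simp
      qed
      then have "C * (2 * (cmod (w y) / norm y)) \<le> C * (norm y * (cmod (w y))^2 / \<rho> + \<rho> / norm y ^ 3)"
        using C by (intro mult_left_mono) auto
      moreover have "2 * z \<le> 8 * e * (1 / norm y) + b" if "z \<le> 4 / norm y * e + C * a" "C * (2 * a) \<le> b" for z a b :: real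
      proof -
        have "8 * e * (1 / norm y) = 2 * (4 / norm y * e)" by simp
        moreover have "C * (2 * a) = 2 * (C * a)" by simp
        ultimately show ?thesis using that by linarith
      qed
      ultimately have 2: "2 * cmod (?P * radial y - w y * (\<Sum>c\<in>?X. ?Q c)) \<le> 8 * e * (1 / norm y) + C * (norm y * (cmod (w y))^2 / \<rho> + \<rho> / norm y ^ 3)"
        using 1 by blast
      have "norm (shell \<rho> x y) = ?m y * (2 * cmod (?P * radial y - w y * (\<Sum>c\<in>?X. ?Q c)))"
        unfolding shell_def norm_mult[where 'a=complex] norm_of_real using cutoff1_nonneg[of \<rho> "dsq 0 y"] by (simp only: abs_mult abs_of_nonneg)
      also have "\<dots> \<le> ?m y * (8 * e * (1 / norm y) + C * (norm y * (cmod (w y))^2 / \<rho> + \<rho> / norm y ^ 3))"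
        by (rule mult_left_mono[OF 2 cutoff1_nonneg])
      also have "\<dots> = ?g y" by (simp add: algebra_simps)
      finally show ?thesis .
    next
      case False
      have "shell \<rho> x y = 0"
      proof (cases "y \<in> upper_half")
        case True
        then show ?thesis using False cutoff1_zero_outside[OF r(1), of y] by (simp add: shell_def)
      next
        case False
        then show ?thesis using w_zero by (simp add: shell_def)
      qed
      moreover have "?g y \<ge> 0" using e C r cutoff1_nonneg[of \<rho> "dsq 0 y"] by (intro add_nonneg_nonneg mult_nonneg_nonneg) auto
      ultimately show ?thesis by simp
    qed
    have "cmod (LINT y|lborel. shell \<rho> x y) \<le> (LINT y|lborel. norm (shell \<rho> x y))" by (rule integral_norm_bound)
    also have "\<dots> \<le> (LINT y|lborel. ?g y)"
      by (rule integral_mono'[OF gi b]) (use order_trans[OF norm_ge_zero b] in auto)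
    also have "\<dots> = 8 * e * (LINT y|lborel. ?m y / norm y ^ 1) + C / \<rho> * (LINT y|lborel. ?m y * (norm y * (cmod (w y))^2)) + C * \<rho> * (LINT y|lborel. ?m y / norm y ^ 3)"
      using cutoff1_moment(1)[OF r(1), of 1] cutoff1_moment(1)[OF r(1), of 3] mean_square_integrable[OF r(2)]
      by (simp only: Bochner_Integration.integral_add Bochner_Integration.integrable_add integrable_mult_right integral_mult_right_zero)
    also have "\<dots> \<le> 8 * e * (ball_const * \<rho> / \<rho> ^ 1) + C / \<rho> * M + C * \<rho> * (ball_const * \<rho> / \<rho> ^ 3)"
      using M(3)[OF r(3)] e C r by (intro add_mono mult_left_mono cutoff1_moment(2)[OF r(1)]) simp_all
    also have "\<dots> = 8 * e * ball_const + C * (M + ball_const) / \<rho>"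
      using r by (simp add: field_simps power3_eq_cube)
    also have "\<dots> \<le> \<epsilon> / 2 + \<epsilon> / 2"
    proof (rule add_mono)
      have "8 * e * ball_const \<le> 8 * e * (ball_const + 1)" using e by (intro mult_left_mono) auto
      also have "\<dots> = \<epsilon> / 2" using ball_const_nonneg by (simp add: e_def field_simps)
      finally show "8 * e * ball_const \<le> \<epsilon> / 2" .
      have "2 * C * (M + ball_const + 1) / \<epsilon> \<le> \<rho>" using that \<rho>0 by simp
      then have "2 * C * (M + ball_const + 1) \<le> \<rho> * \<epsilon>" using assms by (simp add: pos_divide_le_eq)
      moreover have "C * (M + ball_const) \<le> C * (M + ball_const + 1)" using C by (intro mult_left_mono) auto
      ultimately have "C * (M + ball_const) \<le> \<epsilon> / 2 * \<rho>" by (simp add: algebra_simps)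
      then show "C * (M + ball_const) / \<rho> \<le> \<epsilon> / 2" using r by (simp add: pos_divide_le_eq)
    qed
    finally show ?thesis by simp
  qed
  then show ?thesis using that by blast
qed

text \<open>Green's formula between the shells at \<open>R1\<close> and \<open>\<rho>\<close>.
  Neither the left side nor the inner term depends on \<open>\<rho>\<close>, and the outer term
  tends to zero.\<close>

lemma exterior_representation:
  assumes x: "x \<in> upper_half" "norm x > 2 * R1" and R1: "R1 > R"
  shows "of_real kappa * w x = (LINT y|lborel. shell R1 x y)"
proof -
  have R10: "R1 > 0" using R R1 by simp
  \<comment> \<open>Small enough that the ball around \<open>x\<close> lies above the plane, the
    mirrored ball below it, and both beyond the inner shell.\<close>
  define r where "r = min (x $ 3) (norm x - 2 * R1)"
  have r: "r > 0" "r \<le> x $ 3" "r \<le> norm x - 2 * R1" using x by (auto simp: r_def upper_half_def)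
  have x3: "x $ 3 \<noteq> 0" using x by (auto simp: upper_half_def)
  have nc: "norm y \<le> 2 * R1 \<Longrightarrow> c \<in> sources True x \<Longrightarrow> norm (y - c) \<ge> r" for y c
    using norm_source[of c x] norm_triangle_ineq3[of c y] r by (auto simp: norm_minus_commute)
  have in_int: "integrable lborel (shell R1 x)"
  proof (rule shell_integrable[OF R1, of "r/2"])
    show "dsq c y \<ge> 2 * (r/2)^2" if "c \<in> sources True x" "y \<in> annulus R1 (2 * R1)" for c y
    proof -
      have "r^2 \<le> dsq c y" unfolding dsq_def using nc[of y c] that r by (intro power_mono) (auto simp: annulus_iff)
      moreover have "2 * (r/2)^2 \<le> r^2" by (simp add: power2_eq_square)
      ultimately show ?thesis by linarith
    qed
  qed (use r in auto)
  have eq: "of_real kappa * w x = (LINT y|lborel. shell R1 x y) - (LINT y|lborel. shell \<rho> x y)" if \<rho>: "\<rho> \<ge> 2 * norm x" for \<rho>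
  proof -
    have r0: "\<rho> > 0" "\<rho> > R" "\<rho> > R1" using \<rho> x R10 R1 by auto
    have nc2: "norm y \<ge> \<rho> \<Longrightarrow> c \<in> sources True x \<Longrightarrow> norm (y - c) \<ge> norm x" for y c
      using norm_source[of c x] norm_triangle_ineq2[of y c] \<rho> by auto
    have xn: "norm x > 0" using x R10 by auto
    have out_int: "integrable lborel (shell \<rho> x)"
    proof (rule shell_integrable[OF r0(2), of "norm x/2"])
      show "dsq c y \<ge> 2 * (norm x/2)^2" if "c \<in> sources True x" "y \<in> annulus \<rho> (2 * \<rho>)" for c y
      proof -
        have "(norm x)^2 \<le> dsq c y" unfolding dsq_def using nc2[of y c] that by (intro power_mono) (auto simp: annulus_iff)
        moreover have "2 * (norm x/2)^2 \<le> (norm x)^2" by (simp add: power2_eq_square)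
        ultimately show ?thesis by linarith
      qed
    qed (use xn in auto)
    define h h1 where "h s = complex_of_real (cutoff R1 s - cutoff \<rho> s)" and "h1 s = complex_of_real (cutoff1 R1 s - cutoff1 \<rho> s)" for s
    have hd: "(h has_vector_derivative h1 s) (at s)" for s
      unfolding h_def[abs_def] h1_def by (intro has_vector_derivative_of_real DERIV_diff cutoff_derivs r0 R10)
    have h1c: "continuous_on UNIV h1"
      unfolding h1_def[abs_def] by (intro continuous_intros cutoff_cont r0 R10)
    define D\<eta> where "D\<eta> i y = of_real (2 * (y - 0) $ i) * h1 (dsq 0 y)" for i and y :: "real^3"
    have \<eta>: "C1_fun (\<lambda>y. h (dsq 0 y)) D\<eta>" unfolding D\<eta>_def by (rule C1_fun_radial[OF hd h1c])
    have "of_real kappa * w x = (LINT y|lborel. (\<Sum>i\<in>UNIV.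
      ((\<Sum>c\<in>sources True x. fund k (dsq c y)) * p i y
        - w y * (\<Sum>c\<in>sources True x. of_real (2 * (y - c) $ i) * fund1 k (dsq c y))) * D\<eta> i y))"
    proof (rule representation[OF r(1) _ _ _ _ \<eta> compact_annulus[of R1 "2 * \<rho>"] annulus_exterior[OF R1]])
      show "x $ 3 \<noteq> 0" by (rule x3)
      have nb: "norm y > 2 * R1" "norm y < 2 * norm x" if "y \<in> ball x r" for y
        using that r norm_triangle_ineq2[of x y] norm_triangle_ineq2[of y x] R10 by (auto simp: dist_norm norm_minus_commute)
      show "continuous_on (ball x r) w"
      proof (rule continuous_on_subset[OF w_C1(1)], rule subsetI)
        fix y assume "y \<in> ball x r"
        then show "y \<in> upper_half \<inter> {x. R < norm x}" using ball_upper_half[of y x r] r nb(1)[of y] R10 R1 by auto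
      qed
      show "h (dsq 0 y) = 1" if "y \<in> ball x r" for y
        unfolding h_def using nb[OF that] cutoff_norm(3)[OF R10, of y] cutoff_norm(1)[OF r0(1), of y] \<rho> by simp
      show "h (dsq 0 y) = 0" if "y \<notin> annulus R1 (2 * \<rho>)" for y
      proof -
        have "norm y \<le> R1 \<and> norm y \<le> \<rho> \<or> norm y \<ge> 2 * R1 \<and> norm y \<ge> 2 * \<rho>" using that r0 by (auto simp: annulus_iff)
        then show ?thesis unfolding h_def using cutoff_norm[OF R10, of y] cutoff_norm[OF r0(1), of y] by auto
      qed
    qed (use source_zero[OF x(1) _ _ _ r(2)] in auto)
    also have "\<dots> = (LINT y|lborel. shell R1 x y - shell \<rho> x y)"
    proof (rule Bochner_Integration.integral_cong[OF refl])
      fix y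
      have sw: "(\<Sum>c\<in>sources True x. \<Sum>i\<in>UNIV. of_real (y $ i) * (of_real (2 * (y - c) $ i) * fund1 k (dsq c y)))
         = (\<Sum>i\<in>UNIV. of_real (y $ i) * (\<Sum>c\<in>sources True x. of_real (2 * (y - c) $ i) * fund1 k (dsq c y)))"
        by (subst sum.swap) (simp only: sum_distrib_left)
      show "(\<Sum>i\<in>UNIV. ((\<Sum>c\<in>sources True x. fund k (dsq c y)) * p i y
        - w y * (\<Sum>c\<in>sources True x. of_real (2 * (y - c) $ i) * fund1 k (dsq c y))) * D\<eta> i y) = shell R1 x y - shell \<rho> x y"
        unfolding shell_def sw D\<eta>_def h1_def by (simp add: sum_3 algebra_simps)
    qed
    also have "\<dots> = (LINT y|lborel. shell R1 x y) - (LINT y|lborel. shell \<rho> x y)"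
      by (rule Bochner_Integration.integral_diff[OF in_int out_int])
    finally show ?thesis .
  qed
  have "cmod (of_real kappa * w x - (LINT y|lborel. shell R1 x y)) \<le> \<epsilon>" if \<epsilon>: "\<epsilon> > 0" for \<epsilon>
  proof -
    obtain \<rho>0 where "\<And>\<rho>. \<rho> \<ge> \<rho>0 \<Longrightarrow> cmod (LINT y|lborel. shell \<rho> x y) \<le> \<epsilon>" using shell_tendsto_0[OF \<epsilon>] by blast
    then show ?thesis using eq[of "max \<rho>0 (2 * norm x)"] by simp
  qed
  from this[of "cmod (of_real kappa * w x - (LINT y|lborel. shell R1 x y)) / 2"]
  have "\<not> cmod (of_real kappa * w x - (LINT y|lborel. shell R1 x y)) > 0" by linarith
  then show ?thesis by simp
qed

end

section \<open>Expansion at infinity\<close>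

text \<open>The Cauchy inequality turns the pointwise bound \<open>g\<close> into the Lipschitz
  bound \<open>g / s\<close> on a smaller disc, and this dominates the complex difference
  quotients.\<close>

lemma holomorphic_integral:
  fixes f :: "complex \<Rightarrow> real^3 \<Rightarrow> complex" and g :: "real^3 \<Rightarrow> real"
  assumes g: "integrable lborel g"
    and f: "\<And>z. z \<in> ball 0 r \<Longrightarrow> f z \<in> borel_measurable lborel" "\<And>y. (\<lambda>z. f z y) holomorphic_on ball 0 r"
      "\<And>z y. z \<in> ball 0 r \<Longrightarrow> cmod (f z y) \<le> g y"
  shows "(\<lambda>z. LINT y|lborel. f z y) holomorphic_on ball 0 r"
    "\<And>z. z \<in> ball 0 r \<Longrightarrow> cmod (LINT y|lborel. f z y) \<le> (LINT y|lborel. g y)"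
proof -
  have int: "integrable lborel (f z)" if "z \<in> ball 0 r" for z
    by (rule Bochner_Integration.integrable_bound[OF g f(1)[OF that]])
       (use f(3)[OF that] in \<open>auto intro!: AE_I2 order_trans[OF f(3)[OF that]]\<close>)
  show "cmod (LINT y|lborel. f z y) \<le> (LINT y|lborel. g y)" if "z \<in> ball 0 r" for z
    using order_trans[OF integral_norm_bound integral_mono[OF integrable_norm[OF int[OF that]] g f(3)[OF that]]] .
  show "(\<lambda>z. LINT y|lborel. f z y) holomorphic_on ball 0 r"
    unfolding holomorphic_on_open[OF open_ball]
  proof (intro ballI exI)
    fix a :: complex assume a: "a \<in> ball 0 r"
    \<comment> \<open>A third of the distance to the boundary: discs of radius \<open>s\<close>
      about points within \<open>s\<close> of \<open>a\<close> stay inside.\<close>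
    define s where "s = (r - norm a) / 3"
    have s: "s > 0" "norm a + 2 * s < r" using a by (auto simp: s_def field_simps)
    have sub: "cball u s \<subseteq> ball 0 r" if "u \<in> ball a s" for u
    proof
      fix v assume "v \<in> cball u s"
      then have "norm v \<le> norm a + dist a u + dist u v"
        using norm_triangle_ineq[of a "u - a"] norm_triangle_ineq[of u "v - u"] by (simp add: dist_norm norm_minus_commute)
      then show "v \<in> ball 0 r" using \<open>v \<in> cball u s\<close> that s by simp
    qed
    have sub': "ball a s \<subseteq> ball 0 r" using sub s by (meson centre_in_cball less_imp_le subset_iff)
    have lip: "cmod (f u y - f a y) \<le> g y / s * cmod (u - a)" if "u \<in> ball a s" for u y
    proof (rule field_differentiable_bound[OF convex_ball _ _ that])
      show "((\<lambda>z. f z y) has_field_derivative deriv (\<lambda>z. f z y) v) (at v within ball a s)" if "v \<in> ball a s" for v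
        using holomorphic_derivI[OF f(2) open_ball, of v] that sub' has_field_derivative_at_within by blast
      show "cmod (deriv (\<lambda>z. f z y) v) \<le> g y / s" if "v \<in> ball a s" for v
      proof -
        have "cmod ((deriv ^^ 1) (\<lambda>z. f z y) v) \<le> fact 1 * g y / s ^ 1"
        proof (rule Cauchy_inequality[OF _ _ s(1)])
          show "(\<lambda>z. f z y) holomorphic_on ball v s"
            using holomorphic_on_subset[OF f(2)] sub[OF that] ball_subset_cball by blast
          show "continuous_on (cball v s) (\<lambda>z. f z y)"
            using continuous_on_subset[OF holomorphic_on_imp_continuous_on[OF f(2)] sub[OF that]] .
          show "cmod (f x y) \<le> g y" if "cmod (v - x) = s" for x
            using f(3) sub[OF \<open>v \<in> ball a s\<close>] that by (auto simp: dist_norm subset_iff)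
        qed
        then show ?thesis by simp
      qed
    qed (use s in auto)
    have der: "((\<lambda>u. (f u y - f a y) / (u - a)) \<longlongrightarrow> deriv (\<lambda>z. f z y) a) (at a within ball a s)" for y
      using has_field_derivative_at_within[OF holomorphic_derivI[OF f(2) open_ball a, of y]] unfolding has_field_derivative_iff .
    have "((\<lambda>u. ((LINT y|lborel. f u y) - (LINT y|lborel. f a y)) / (u - a)) \<longlongrightarrow> (LINT y|lborel. deriv (\<lambda>z. f z y) a)) (at a within ball a s)"
      unfolding tendsto_at_iff_sequentially
    proof (intro allI impI)
      fix U assume U: "\<forall>n. U n \<in> ball a s - {a}" "U \<longlonglongrightarrow> a"
      define Q where "Q n y = (f (U n) y - f a y) / (U n - a)" for n y
      have Ub: "U n \<in> ball 0 r" for n using U(1) sub' by blast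
      have Qm: "Q n \<in> borel_measurable lborel" for n
        unfolding Q_def using f(1)[OF Ub[of n]] f(1)[OF a] by (intro borel_measurable_divide borel_measurable_diff) auto
      have Ql: "(\<lambda>n. Q n y) \<longlonglongrightarrow> deriv (\<lambda>z. f z y) a" for y
        using der[of y] U unfolding tendsto_at_iff_sequentially by (auto simp: o_def Q_def)
      have "(\<lambda>n. LINT y|lborel. Q n y) \<longlonglongrightarrow> (LINT y|lborel. deriv (\<lambda>z. f z y) a)"
      proof (rule integral_dominated_convergence[where w="\<lambda>y. g y / s"])
        show "(\<lambda>y. deriv (\<lambda>z. f z y) a) \<in> borel_measurable lborel" by (rule borel_measurable_LIMSEQ_metric[OF Qm Ql])
        show "AE y in lborel. norm (Q n y) \<le> g y / s" for n
        proof (rule AE_I2)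
          fix y
          have "U n - a \<noteq> 0" using U(1) by auto
          then show "norm (Q n y) \<le> g y / s" unfolding Q_def norm_divide
            using lip[of "U n" y] U(1) by (simp add: pos_divide_le_eq)
        qed
      qed (use g Qm Ql in auto)
      moreover have "(LINT y|lborel. Q n y) = ((LINT y|lborel. f (U n) y) - (LINT y|lborel. f a y)) / (U n - a)" for n
        unfolding Q_def using int[OF Ub[of n]] int[OF a] by simp
      ultimately show "((\<lambda>u. ((LINT y|lborel. f u y) - (LINT y|lborel. f a y)) / (u - a)) \<circ> U) \<longlonglongrightarrow> (LINT y|lborel. deriv (\<lambda>z. f z y) a)"
        by (simp add: o_def)
    qed
    then show "((\<lambda>z. LINT y|lborel. f z y) has_field_derivative (LINT y|lborel. deriv (\<lambda>z. f z y) a)) (at a)"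
      using s unfolding has_field_derivative_iff by (simp add: at_within_open[OF _ open_ball])
  qed
qed

text \<open>For real \<open>z > 0\<close> this is \<open>z^2\<close> times the squared distance from
  \<open>y\<close> to \<open>\<tau> / z\<close>. As a polynomial in \<open>z\<close> it makes sense
  also at 0, where it equals 1.\<close>

definition wq :: "complex \<Rightarrow> real^3 \<Rightarrow> real^3 \<Rightarrow> complex" where
  "wq z \<tau> y = 1 - 2 * z * of_real (\<tau> \<bullet> y) + z^2 * of_real ((norm y)^2)"

definition wH :: "real \<Rightarrow> complex \<Rightarrow> real^3 \<Rightarrow> real^3 \<Rightarrow> complex" where
  "wH k z \<tau> y = exp (\<i> * k * (- 2 * of_real (\<tau> \<bullet> y) + z * of_real ((norm y)^2)) / (csqrt (wq z \<tau> y) + 1)) / csqrt (wq z \<tau> y)"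

definition wM :: "real \<Rightarrow> complex \<Rightarrow> real^3 \<Rightarrow> real^3 \<Rightarrow> complex" where
  "wM k z \<tau> y = wH k z \<tau> y * (\<i> * k * csqrt (wq z \<tau> y) - z) * (z * of_real ((norm y)^2) - of_real (\<tau> \<bullet> y)) / wq z \<tau> y"

text \<open>
  The kernels \<open>wH\<close> and \<open>wM\<close> are \<open>fund\<close> and its radial derivative for a source at \<open>\<tau> / z\<close>,
  multiplied by \<open>exp (- \<i> k / z) / z\<close>; in this form they make sense for complex \<open>z\<close> near \<open>0\<close>.
\<close>

lemma wq_bounds:
  assumes "norm \<tau> = 1" "norm y \<le> a" "norm z < 1 / (4 * a)" "a > 0"
  shows "cmod (wq z \<tau> y - 1) \<le> 9/16" "Re (wq z \<tau> y) > 0" "wq z \<tau> y \<noteq> 0" "wq z \<tau> y \<notin> \<real>\<^sub>\<le>\<^sub>0"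
    "cmod (csqrt (wq z \<tau> y)) \<ge> 1/2" "cmod (csqrt (wq z \<tau> y)) \<le> 2" "cmod (csqrt (wq z \<tau> y) + 1) \<ge> 1"
    "csqrt (wq z \<tau> y) + 1 \<noteq> 0" "cmod z * norm y \<le> 1/4" "\<bar>\<tau> \<bullet> y\<bar> \<le> norm y"
proof -
  have "cmod z * norm y \<le> (1 / (4 * a)) * a" using assms by (intro mult_mono) auto
  then show zy: "cmod z * norm y \<le> 1/4" using assms by simp
  show ty: "\<bar>\<tau> \<bullet> y\<bar> \<le> norm y" using Cauchy_Schwarz_ineq2[of \<tau> y] assms by simp
  have "cmod (wq z \<tau> y - 1) = cmod (z^2 * of_real ((norm y)^2) - 2 * z * of_real (\<tau> \<bullet> y))" by (simp add: wq_def algebra_simps)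
  also have "\<dots> \<le> cmod (z^2 * of_real ((norm y)^2)) + cmod (2 * z * of_real (\<tau> \<bullet> y))" by (rule norm_triangle_ineq4)
  also have "\<dots> = (cmod z * norm y)^2 + 2 * (cmod z * \<bar>\<tau> \<bullet> y\<bar>)" by (simp add: norm_mult norm_power power_mult_distrib)
  also have "\<dots> \<le> (1/4)^2 + 2 * (1/4)"
  proof (intro add_mono mult_left_mono power_mono zy)
    show "cmod z * \<bar>\<tau> \<bullet> y\<bar> \<le> 1/4" using order_trans[OF mult_left_mono[OF ty norm_ge_zero] zy] .
  qed auto
  finally show 1: "cmod (wq z \<tau> y - 1) \<le> 9/16" by (simp add: power2_eq_square)
  have "\<bar>Re (wq z \<tau> y - 1)\<bar> \<le> 9/16" using order_trans[OF abs_Re_le_cmod 1] .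
  then have "- (9/16) \<le> Re (wq z \<tau> y - 1)" by linarith
  then show re: "Re (wq z \<tau> y) > 0" by simp
  then show "wq z \<tau> y \<noteq> 0" "wq z \<tau> y \<notin> \<real>\<^sub>\<le>\<^sub>0" by (auto simp: complex_nonpos_Reals_iff)
  have n: "cmod (wq z \<tau> y) \<ge> 1/4" "cmod (wq z \<tau> y) \<le> 4"
    using 1 norm_triangle_ineq2[of 1 "1 - wq z \<tau> y"] norm_triangle_ineq2[of "wq z \<tau> y" 1] by (auto simp: norm_minus_commute)
  have sq: "(cmod (csqrt (wq z \<tau> y)))^2 = cmod (wq z \<tau> y)" by (metis norm_power power2_csqrt)
  show "cmod (csqrt (wq z \<tau> y)) \<ge> 1/2"
    by (rule power2_le_imp_le) (use n sq in \<open>auto simp: power2_eq_square\<close>)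
  show "cmod (csqrt (wq z \<tau> y)) \<le> 2"
    by (rule power2_le_imp_le) (use n sq in \<open>auto simp: power2_eq_square\<close>)
  have "Re (csqrt (wq z \<tau> y) + 1) \<ge> 1" using csqrt_principal[of "wq z \<tau> y"] by auto
  then show s1: "cmod (csqrt (wq z \<tau> y) + 1) \<ge> 1" using order_trans[OF _ complex_Re_le_cmod] by blast
  then show "csqrt (wq z \<tau> y) + 1 \<noteq> 0" by auto
qed

lemma wH_wM_bounds:
  assumes k: "k > 0" and a: "norm \<tau> = 1" "norm y \<le> a" "norm z < 1 / (4 * a)" "a > 0"
  defines "B \<equiv> 2 * exp (3 * k * a) * (1 + (2 * k + 1 / a) * (8 * a))"
  shows "cmod (wH k z \<tau> y) \<le> B" "cmod (wM k z \<tau> y) \<le> B"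
proof -
  note b = wq_bounds[OF a]
  let ?s = "csqrt (wq z \<tau> y)"
  let ?E = "\<i> * k * (- 2 * of_real (\<tau> \<bullet> y) + z * of_real ((norm y)^2)) / (?s + 1)"
  have zyy: "cmod z * (norm y)^2 \<le> a / 4"
  proof -
    have "(cmod z * norm y) * norm y \<le> 1/4 * a" using b(9) a by (intro mult_mono) auto
    then show ?thesis by (simp add: power2_eq_square mult_ac)
  qed
  have "cmod (- 2 * of_real (\<tau> \<bullet> y) + z * of_real ((norm y)^2)) \<le> 2 * \<bar>\<tau> \<bullet> y\<bar> + cmod z * (norm y)^2"
    using norm_triangle_ineq[of "- 2 * complex_of_real (\<tau> \<bullet> y)" "z * of_real ((norm y)^2)"] by (simp add: norm_mult norm_power)
  also have "\<dots> \<le> 2 * a + a / 4" using b(10) zyy a by simp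
  also have "\<dots> \<le> 3 * a" using a by simp
  finally have 1: "cmod (- 2 * of_real (\<tau> \<bullet> y) + z * of_real ((norm y)^2)) \<le> 3 * a" .
  have "cmod ?E = k * cmod (- 2 * of_real (\<tau> \<bullet> y) + z * of_real ((norm y)^2)) / cmod (?s + 1)"
    using k by (simp add: norm_divide norm_mult)
  also have "\<dots> \<le> k * (3 * a) / 1" using 1 k b(7) a by (intro frac_le mult_left_mono) auto
  finally have E: "cmod ?E \<le> 3 * k * a" by simp
  have "cmod (exp ?E) \<le> exp (cmod ?E)" by (rule norm_exp)
  also have "\<dots> \<le> exp (3 * k * a)" using E by (simp only: exp_le_cancel_iff)
  finally have "cmod (exp ?E) \<le> exp (3 * k * a)" .
  then have "cmod (wH k z \<tau> y) \<le> exp (3 * k * a) / (1/2)"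
    unfolding wH_def norm_divide using b(5) by (intro frac_le) auto
  then have H: "cmod (wH k z \<tau> y) \<le> 2 * exp (3 * k * a)" by simp
  have "1 * 1 \<le> 1 + (2 * k + 1 / a) * (8 * a)" using k a by simp
  then have "2 * exp (3 * k * a) * 1 \<le> B" unfolding B_def by (intro mult_left_mono) auto
  then show "cmod (wH k z \<tau> y) \<le> B" using H by simp
  have "cmod (\<i> * k * ?s - z) \<le> cmod (\<i> * k * ?s) + cmod z" by (rule norm_triangle_ineq4)
  also have "\<dots> \<le> k * 2 + 1 / a"
  proof (rule add_mono)
    show "cmod (\<i> * k * ?s) \<le> k * 2" using b(6) k by (simp add: norm_mult)
    have "1 / (4 * a) \<le> 1 / a" using a by (intro frac_le) auto
    then show "cmod z \<le> 1 / a" using a(3) by simp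
  qed
  finally have 2: "cmod (\<i> * k * ?s - z) \<le> 2 * k + 1 / a" by simp
  have "cmod (z * of_real ((norm y)^2) - of_real (\<tau> \<bullet> y)) \<le> cmod z * (norm y)^2 + \<bar>\<tau> \<bullet> y\<bar>"
    using norm_triangle_ineq4[of "z * of_real ((norm y)^2)" "complex_of_real (\<tau> \<bullet> y)"] by (simp add: norm_mult norm_power)
  also have "\<dots> \<le> 2 * a" using zyy b(10) a by simp
  finally have 3: "cmod (z * of_real ((norm y)^2) - of_real (\<tau> \<bullet> y)) \<le> 2 * a" .
  have 4: "cmod (wq z \<tau> y) \<ge> 1/4"
    using b(1) norm_triangle_ineq2[of 1 "1 - wq z \<tau> y"] by (simp add: norm_minus_commute)
  \<comment> \<open>The factor \<open>8 * a\<close> in \<open>B\<close> is \<open>2 * a\<close>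
    divided by the lower bound \<open>1/4\<close> for \<open>cmod (wq z \<tau> y)\<close>.\<close>
  have "cmod (wM k z \<tau> y) \<le> 2 * exp (3 * k * a) * (2 * k + 1 / a) * (2 * a) / (1/4)"
    unfolding wM_def norm_divide norm_mult using H 2 3 4 k a by (intro frac_le mult_mono) (auto intro!: mult_nonneg_nonneg)
  also have "\<dots> = 2 * exp (3 * k * a) * ((2 * k + 1 / a) * (8 * a))" by simp
  also have "\<dots> \<le> B" unfolding B_def by (intro mult_left_mono) auto
  finally show "cmod (wM k z \<tau> y) \<le> B" .
qed

lemma wH_wM_holomorphic:
  assumes "norm \<tau> = 1" "norm y \<le> a" "a > 0"
  shows "(\<lambda>z. wH k z \<tau> y) holomorphic_on ball 0 (1 / (4 * a))" "(\<lambda>z. wM k z \<tau> y) holomorphic_on ball 0 (1 / (4 * a))"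
proof -
  have b: "wq z \<tau> y \<notin> \<real>\<^sub>\<le>\<^sub>0" "csqrt (wq z \<tau> y) + 1 \<noteq> 0" "wq z \<tau> y \<noteq> 0" if "z \<in> ball 0 (1 / (4 * a))" for z
    using wq_bounds[OF assms(1,2) _ assms(3), of z] that by auto
  have q: "(\<lambda>z. wq z \<tau> y) holomorphic_on ball 0 (1 / (4 * a))" unfolding wq_def by (intro holomorphic_intros)
  have s: "(\<lambda>z. csqrt (wq z \<tau> y)) holomorphic_on ball 0 (1 / (4 * a))"
  proof -
    have "(\<lambda>z. wq z \<tau> y) ` ball 0 (1 / (4 * a)) \<subseteq> - \<real>\<^sub>\<le>\<^sub>0" using b(1) by blast
    from holomorphic_on_compose_gen[OF q holomorphic_on_csqrt this] show ?thesis by (simp add: o_def)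
  qed
  show H: "(\<lambda>z. wH k z \<tau> y) holomorphic_on ball 0 (1 / (4 * a))"
    unfolding wH_def using b by (intro holomorphic_intros s) auto
  show "(\<lambda>z. wM k z \<tau> y) holomorphic_on ball 0 (1 / (4 * a))"
    unfolding wM_def using b by (intro holomorphic_intros s H q) auto
qed

lemma wH_wM_continuous:
  assumes "norm \<tau> = 1" "z \<in> ball 0 (1 / (4 * a))" "a > 0"
  shows "continuous_on (cball 0 a) (\<lambda>y. wH k z \<tau> y)" "continuous_on (cball 0 a) (\<lambda>y. wM k z \<tau> y)"
proof -
  have b: "wq z \<tau> y \<notin> \<real>\<^sub>\<le>\<^sub>0" "csqrt (wq z \<tau> y) + 1 \<noteq> 0" "wq z \<tau> y \<noteq> 0" if "y \<in> cball 0 a" for y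
    using wq_bounds[OF assms(1) _ _ assms(3), of y z] that assms(2) by auto
  have q: "continuous_on (cball 0 a) (\<lambda>y. wq z \<tau> y)" unfolding wq_def by (intro continuous_intros)
  have s: "continuous_on (cball 0 a) (\<lambda>y. csqrt (wq z \<tau> y))"
    by (rule continuous_on_compose2[of "- \<real>\<^sub>\<le>\<^sub>0" csqrt, OF _ q]) (use b(1) in \<open>auto intro: continuous_on_csqrt\<close>)
  show H: "continuous_on (cball 0 a) (\<lambda>y. wH k z \<tau> y)"
    unfolding wH_def using b by (intro continuous_intros s) auto
  show "continuous_on (cball 0 a) (\<lambda>y. wM k z \<tau> y)"
    unfolding wM_def using b by (intro continuous_intros s H q) auto
qed

lemma wH_wM_real:
  assumes t: "norm \<tau> = 1" "norm y \<le> a" "0 < t" "t < 1 / (4 * a)" "a > 0"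
  shows "of_real (1 / t) * exp (- \<i> * of_real (k / t)) * fund k (dsq ((1 / t) *\<^sub>R \<tau>) y) = wH k (of_real t) \<tau> y"
    "of_real (1 / t) * exp (- \<i> * of_real (k / t)) * (\<Sum>i\<in>UNIV. of_real (y $ i) * (of_real (2 * (y - (1 / t) *\<^sub>R \<tau>) $ i) * fund1 k (dsq ((1 / t) *\<^sub>R \<tau>) y)))
      = wM k (of_real t) \<tau> y"
proof -
  have nt: "norm (complex_of_real t) < 1 / (4 * a)" using t by simp
  note b = wq_bounds[OF t(1,2) nt t(5)]
  define Q where "Q = 1 - 2 * t * (\<tau> \<bullet> y) + t^2 * (norm y)^2"
  have wq: "wq (of_real t) \<tau> y = of_real Q" by (simp add: wq_def Q_def)
  have Q: "Q > 0" using b(2) unfolding wq by simp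
  define s where "s = sqrt Q"
  have s: "s > 0" "s^2 = Q" using Q by (auto simp: s_def)
  have cs: "csqrt (wq (of_real t) \<tau> y) = of_real s" unfolding wq s_def using Q by (simp add: csqrt_of_real_nonneg)
  have d: "dsq ((1 / t) *\<^sub>R \<tau>) y = (s / t)^2"
  proof -
    have "\<tau> \<bullet> \<tau> = 1" using t(1) by (simp add: norm_eq_1)
    then have "dsq ((1 / t) *\<^sub>R \<tau>) y = (norm y)^2 - 2 / t * (\<tau> \<bullet> y) + 1 / t^2"
      unfolding dsq_def power2_norm_eq_inner using t(3)
      by (simp add: inner_diff_left inner_diff_right inner_commute power2_eq_square algebra_simps)
    also have "\<dots> = Q / t^2" using t(3) by (simp add: Q_def field_simps power2_eq_square)
    finally show ?thesis using s by (simp add: power_divide)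
  qed
  have sd: "sqrt ((s / t)^2) = s / t" using s t by (simp add: real_sqrt_unique)
  \<comment> \<open>The phase \<open>(s - 1) / t\<close> is rationalised to
    \<open>(s^2 - 1) / (t (s + 1))\<close>, and \<open>s^2 - 1\<close> contains a factor
    \<open>t\<close>. This is the origin of the exponent in \<open>wH\<close>, which has no division
    by \<open>z\<close>.\<close>
  have ex: "exp (- \<i> * of_real (k / t)) * exp (\<i> * k * of_real (s / t))
     = exp (\<i> * k * (- 2 * of_real (\<tau> \<bullet> y) + of_real t * of_real ((norm y)^2)) / (of_real s + 1))"
  proof -
    have "s * s = 1 - 2 * t * (\<tau> \<bullet> y) + t * t * (norm y * norm y)" using s(2) by (simp add: Q_def power2_eq_square)
    then have "(s - 1) / t = (- 2 * (\<tau> \<bullet> y) + t * (norm y)^2) / (s + 1)"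
      using s(1) t(3) by (simp add: field_simps power2_eq_square)
    then have r: "k * (s / t) - k / t = k * ((- 2 * (\<tau> \<bullet> y) + t * (norm y)^2) / (s + 1))"
      by (metis right_diff_distrib diff_divide_distrib mult.right_neutral times_divide_eq_right)
    have "exp (- \<i> * of_real (k / t)) * exp (\<i> * k * of_real (s / t)) = exp (\<i> * of_real (k * (s / t) - k / t))"
      by (simp add: exp_add[symmetric] algebra_simps)
    also have "\<dots> = exp (\<i> * k * (- 2 * of_real (\<tau> \<bullet> y) + of_real t * of_real ((norm y)^2)) / (of_real s + 1))"
      unfolding r by (simp add: mult.assoc)
    finally show ?thesis .
  qed
  show 1: "of_real (1 / t) * exp (- \<i> * of_real (k / t)) * fund k (dsq ((1 / t) *\<^sub>R \<tau>) y) = wH k (of_real t) \<tau> y"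
    unfolding wH_def cs ex[symmetric] d fund_def Let_def sd using t(3) s(1) by (simp add: field_simps)
  have "(\<Sum>i\<in>UNIV. of_real (y $ i) * (of_real (2 * (y - (1 / t) *\<^sub>R \<tau>) $ i) * fund1 k (dsq ((1 / t) *\<^sub>R \<tau>) y)))
     = of_real (y \<bullet> (y - (1 / t) *\<^sub>R \<tau>)) * (2 * fund1 k (dsq ((1 / t) *\<^sub>R \<tau>) y))"
    unfolding inner_vec_def by (simp add: sum_3 algebra_simps)
  also have "y \<bullet> (y - (1 / t) *\<^sub>R \<tau>) = (t * (norm y)^2 - \<tau> \<bullet> y) / t"
    using t(3) by (simp add: inner_diff_right power2_norm_eq_inner inner_commute field_simps)
  also have "2 * fund1 k (dsq ((1 / t) *\<^sub>R \<tau>) y) = fund k (dsq ((1 / t) *\<^sub>R \<tau>) y) * (\<i> * k * of_real (s / t) - 1) / of_real ((s / t)^2)"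
  proof -
    have S: "(s / t)^2 > 0" using s t by simp
    from fund1_eq[OF S, of k]
    have e: "2 * of_real ((s / t)^2) * fund1 k ((s / t)^2) = fund k ((s / t)^2) * (\<i> * k * of_real (s / t) - 1)" unfolding sd .
    have "of_real ((s / t)^2) \<noteq> (0::complex)" using S by simp
    then show ?thesis unfolding d e[symmetric] by (simp del: of_real_power)
  qed
  finally have 2: "(\<Sum>i\<in>UNIV. of_real (y $ i) * (of_real (2 * (y - (1 / t) *\<^sub>R \<tau>) $ i) * fund1 k (dsq ((1 / t) *\<^sub>R \<tau>) y)))
     = of_real ((t * (norm y)^2 - \<tau> \<bullet> y) / t) * (fund k (dsq ((1 / t) *\<^sub>R \<tau>) y) * (\<i> * k * of_real (s / t) - 1) / of_real ((s / t)^2))" .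
  have 3: "of_real ((t * n - b) / t) * (F * (\<i> * k * of_real (s / t) - 1) / of_real ((s / t)^2))
      = F * (\<i> * k * of_real s - of_real t) * (of_real t * of_real n - of_real b) / of_real (s^2)" for n b :: real and F :: complex
    using t(3) s(1) by (simp add: field_simps power2_eq_square)
  show "of_real (1 / t) * exp (- \<i> * of_real (k / t)) * (\<Sum>i\<in>UNIV. of_real (y $ i) * (of_real (2 * (y - (1 / t) *\<^sub>R \<tau>) $ i) * fund1 k (dsq ((1 / t) *\<^sub>R \<tau>) y)))
      = wM k (of_real t) \<tau> y"
    unfolding 2 3 wM_def cs 1[symmetric] wq s(2)[symmetric] using s(1) by (simp add: mult_ac)
qed

lemma refl3_scaleR: "refl3 (a *\<^sub>R x) = a *\<^sub>R refl3 x"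
  by (simp add: refl3_def vec_eq_iff)

lemma sum_sources:
  assumes "x $ 3 \<noteq> 0"
  shows "(\<Sum>c\<in>sources True x. F c) = F x + F (refl3 x)"
proof -
  have "x \<noteq> refl3 x"
  proof
    assume "x = refl3 x"
    then have "x $ 3 = - x $ 3" by (metis refl3_nth(3))
    then show False using assms by simp
  qed
  then show ?thesis by (simp add: sources_def)
qed

context half_exterior
begin

text \<open>The shell in the representation is bounded, so the renormalised kernels are holomorphic
  in \<open>1 / r\<close> on a disc that depends on its outer radius \<open>a\<close> only. The
  radius \<open>r0\<close> and the bound \<open>M\<close> are uniform in the direction, which later
  makes the Taylor remainders uniform.\<close>

lemma far_expansion:
  obtains r0 M G where "r0 > 0" "\<And>\<theta>. \<theta> \<in> upper_sphere \<Longrightarrow> G \<theta> holomorphic_on ball 0 r0"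
    "\<And>\<theta> z. \<theta> \<in> upper_sphere \<Longrightarrow> z \<in> ball 0 r0 \<Longrightarrow> cmod (G \<theta> z) \<le> M"
    "\<And>\<theta> t. \<theta> \<in> upper_sphere \<Longrightarrow> 0 < t \<Longrightarrow> t < r0 \<Longrightarrow>
       G \<theta> (complex_of_real t) = of_real (1 / t) * exp (- \<i> * of_real (k / t)) * w ((1 / t) *\<^sub>R \<theta>)"
    "r0 < 1 / R"
proof -
  define R1 where "R1 = R + 1"
  have R1: "R1 > R" "R1 > 0" using R by (auto simp: R1_def)
  define a where "a = 2 * R1"
  have a: "a > 0" using R1 by (simp add: a_def)
  define r0 where "r0 = 1 / (4 * a)"
  have r0: "r0 > 0" using a by (simp add: r0_def)
  let ?K = "annulus R1 a"
  have K: "compact ?K" "?K \<subseteq> {x. norm x > R}" using compact_annulus annulus_exterior[OF R1(1)] by auto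
  have Ka: "norm y \<le> a" if "y \<in> ?K" for y using that by (simp add: annulus_iff)
  define A where "A y = of_real (2 * cutoff1 R1 (dsq 0 y)) * radial y" for y
  define Bw where "Bw y = of_real (2 * cutoff1 R1 (dsq 0 y)) * w y" for y
  have zero: "cutoff1 R1 (dsq 0 y) = 0" if "y \<notin> ?K" for y
    using cutoff1_zero_outside[OF R1(2)] that by (simp add: a_def)
  have Ai: "integrable lborel A"
  proof -
    have "integrable lborel (\<lambda>y. \<Sum>i\<in>UNIV. p i y * of_real (2 * cutoff1 R1 (dsq 0 y) * y $ i))"
      by (intro Bochner_Integration.integrable_sum integrable_mult_compact_support[OF p_int[OF K] _ K(1)])
         (auto intro!: continuous_intros continuous_cutoff1_dsq R1 simp: zero)
    moreover have "(\<lambda>y. \<Sum>i\<in>UNIV. p i y * of_real (2 * cutoff1 R1 (dsq 0 y) * y $ i)) = A"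
      unfolding A_def by (intro ext) (simp add: sum_3 algebra_simps)
    ultimately show ?thesis by simp
  qed
  have Bi: "integrable lborel Bw"
  proof -
    have "integrable lborel (\<lambda>y. w y * of_real (2 * cutoff1 R1 (dsq 0 y)))"
      by (intro integrable_mult_compact_support[OF w_int[OF K] _ K(1)])
         (auto intro!: continuous_intros continuous_cutoff1_dsq R1 simp: zero)
    then show ?thesis unfolding Bw_def by (simp add: mult_ac)
  qed
  define B where "B = 2 * exp (3 * k * a) * (1 + (2 * k + 1 / a) * (8 * a))"
  define HH where "HH z \<tau> y = indicator ?K y *\<^sub>R wH k z \<tau> y" for z \<tau> y
  define MM where "MM z \<tau> y = indicator ?K y *\<^sub>R wM k z \<tau> y" for z \<tau> y
  have B0: "B \<ge> 0" unfolding B_def using k a by simp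
  have HB: "cmod (HH z \<tau> y) \<le> B" "cmod (MM z \<tau> y) \<le> B" if "z \<in> ball 0 r0" "norm \<tau> = 1" for z \<tau> y
    using wH_wM_bounds[OF k that(2) Ka _ a, of y z] that(1) B0 unfolding HH_def MM_def B_def r0_def
    by (auto simp: indicator_def)
  have Hm: "HH z \<tau> \<in> borel_measurable lborel" "MM z \<tau> \<in> borel_measurable lborel" if "z \<in> ball 0 r0" "norm \<tau> = 1" for z \<tau>
  proof -
    have z: "z \<in> ball 0 (1 / (4 * a))" using that(1) by (simp add: r0_def)
    have sub: "?K \<subseteq> cball 0 a" using Ka by auto
    have sK: "?K \<in> sets borel" using K(1) by (simp add: borel_compact)
    show "HH z \<tau> \<in> borel_measurable lborel" "MM z \<tau> \<in> borel_measurable lborel"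
      unfolding HH_def MM_def measurable_lborel2
      using borel_measurable_continuous_on_indicator[OF sK continuous_on_subset[OF wH_wM_continuous(1)[OF that(2) z a] sub]]
        borel_measurable_continuous_on_indicator[OF sK continuous_on_subset[OF wH_wM_continuous(2)[OF that(2) z a] sub]] by auto
  qed
  have Hh: "(\<lambda>z. HH z \<tau> y) holomorphic_on ball 0 r0" "(\<lambda>z. MM z \<tau> y) holomorphic_on ball 0 r0" if "norm \<tau> = 1" for \<tau> y
    using wH_wM_holomorphic[OF that Ka a, of y] unfolding HH_def MM_def r0_def by (cases "y \<in> ?K"; simp)+
  define f where "f \<theta> z y = (HH z \<theta> y + HH z (refl3 \<theta>) y) * A y - Bw y * (MM z \<theta> y + MM z (refl3 \<theta>) y)" for \<theta> z y
  define g where "g y = 2 * B * cmod (A y) + 2 * B * cmod (Bw y)" for y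
  have gi: "integrable lborel g" unfolding g_def using Ai Bi
    by (intro Bochner_Integration.integrable_add integrable_mult_right integrable_norm)
  define G where "G \<theta> z = (LINT y|lborel. f \<theta> z y) / of_real kappa" for \<theta> z
  have us: "norm \<theta> = 1" "norm (refl3 \<theta>) = 1" "\<theta> $ 3 > 0" if "\<theta> \<in> upper_sphere" for \<theta>
    using that by (auto simp: upper_sphere_def norm_refl3)
  have fm: "f \<theta> z \<in> borel_measurable lborel" if "\<theta> \<in> upper_sphere" "z \<in> ball 0 r0" for \<theta> z
    unfolding f_def using Hm[OF that(2) us(1)[OF that(1)]] Hm[OF that(2) us(2)[OF that(1)]]
      borel_measurable_integrable[OF Ai] borel_measurable_integrable[OF Bi]
    by (intro borel_measurable_diff borel_measurable_times borel_measurable_add)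
  have fh: "(\<lambda>z. f \<theta> z y) holomorphic_on ball 0 r0" if "\<theta> \<in> upper_sphere" for \<theta> y
    unfolding f_def by (intro holomorphic_intros Hh us[OF that])
  have fb: "cmod (f \<theta> z y) \<le> g y" if "\<theta> \<in> upper_sphere" "z \<in> ball 0 r0" for \<theta> z y
  proof -
    have 1: "cmod (HH z \<theta> y + HH z (refl3 \<theta>) y) \<le> B + B" "cmod (MM z \<theta> y + MM z (refl3 \<theta>) y) \<le> B + B"
      by (intro norm_triangle_mono HB that us[OF that(1)])+
    have "cmod (f \<theta> z y) \<le> cmod (HH z \<theta> y + HH z (refl3 \<theta>) y) * cmod (A y) + cmod (Bw y) * cmod (MM z \<theta> y + MM z (refl3 \<theta>) y)"
      unfolding f_def using norm_triangle_ineq4[of "(HH z \<theta> y + HH z (refl3 \<theta>) y) * A y" "Bw y * (MM z \<theta> y + MM z (refl3 \<theta>) y)"]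
      by (simp only: norm_mult)
    also have "\<dots> \<le> (B + B) * cmod (A y) + cmod (Bw y) * (B + B)"
      using 1 by (intro add_mono mult_right_mono mult_left_mono) auto
    finally show ?thesis by (simp add: g_def algebra_simps)
  qed
  have hol: "(\<lambda>z. LINT y|lborel. f \<theta> z y) holomorphic_on ball 0 r0" "\<And>z. z \<in> ball 0 r0 \<Longrightarrow> cmod (LINT y|lborel. f \<theta> z y) \<le> (LINT y|lborel. g y)"
    if "\<theta> \<in> upper_sphere" for \<theta>
    by (rule holomorphic_integral[OF gi fm[OF that] fh[OF that] fb[OF that]]; assumption)+
  have 1: "G \<theta> holomorphic_on ball 0 r0" if "\<theta> \<in> upper_sphere" for \<theta>
    unfolding G_def using kappa_neg by (intro holomorphic_intros hol(1)[OF that]) auto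
  have 2: "cmod (G \<theta> z) \<le> (LINT y|lborel. g y) / \<bar>kappa\<bar>" if "\<theta> \<in> upper_sphere" "z \<in> ball 0 r0" for \<theta> z
    unfolding G_def norm_divide norm_of_real using hol(2)[OF that] by (intro divide_right_mono) auto
  have 3: "G \<theta> (complex_of_real t) = of_real (1 / t) * exp (- \<i> * of_real (k / t)) * w ((1 / t) *\<^sub>R \<theta>)"
    if \<theta>: "\<theta> \<in> upper_sphere" and t: "0 < t" "t < r0" for \<theta> t
  proof -
    let ?x = "(1 / t) *\<^sub>R \<theta>" and ?e = "of_real (1 / t) * exp (- \<i> * of_real (k / t))"
    have x3: "?x $ 3 > 0" using us(3)[OF \<theta>] t by simp
    have "norm ?x = 1 / t" using us(1)[OF \<theta>] t by simp
    moreover have "1 / t > 4 * a" using t a unfolding r0_def by (simp add: field_simps)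
    ultimately have nx: "norm ?x > 2 * R1" using R1 by (simp add: a_def)
    have "of_real kappa * w ?x = (LINT y|lborel. shell R1 ?x y)"
      by (rule exterior_representation[OF _ nx R1(1)]) (use x3 in \<open>simp add: upper_half_def\<close>)
    then have "of_real kappa * (?e * w ?x) = (LINT y|lborel. ?e * shell R1 ?x y)"
      by (simp add: mult.left_commute)
    also have "(\<lambda>y. ?e * shell R1 ?x y) = f \<theta> (of_real t)"
    proof
      fix y
      show "?e * shell R1 ?x y = f \<theta> (of_real t) y"
      proof (cases "y \<in> ?K")
        case False
        then show ?thesis by (simp add: shell_def f_def A_def Bw_def zero)
      next
        case True
        have t': "t < 1 / (4 * a)" using t by (simp add: r0_def)
        note m1 = wH_wM_real[OF us(1)[OF \<theta>] Ka[OF True] t(1) t' a, of k, symmetric]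
        note m2 = wH_wM_real[OF us(2)[OF \<theta>] Ka[OF True] t(1) t' a, of k, symmetric]
        have x30: "?x $ 3 \<noteq> 0" using x3 by (metis order_less_irrefl)
        have gen: "E * (m * ((P + P') * r - v * (Q + Q'))) = (E * P + E * P') * (m * r) - (m * v) * (E * Q + E * Q')"
          for E m P P' r v Q Q' :: complex by (simp add: algebra_simps)
        show ?thesis
          unfolding shell_def sum_sources[OF x30] f_def A_def Bw_def HH_def MM_def
          unfolding gen using True m1 m2 by (simp only: indicator_simps scaleR_one refl3_scaleR)
      qed
    qed
    finally have E: "of_real kappa * (?e * w ?x) = (LINT y|lborel. f \<theta> (of_real t) y)" .
    show ?thesis unfolding G_def E[symmetric] using kappa_neg by simp
  qed
  have "r0 < 1 / R" unfolding r0_def a_def R1_def using R by (intro divide_strict_left_mono) auto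
  then show ?thesis using that[OF r0 1 2 3] by blast
qed

end

section \<open>Vanishing of the expansion coefficients\<close>

text \<open>Cauchy estimates on the circle of radius \<open>r / 2\<close> majorise the series by a
  geometric one with ratio at most 1/2, whence the factors 2.\<close>

lemma taylor_remainder_bound:
  assumes f: "f holomorphic_on ball 0 r" "\<And>z. z \<in> ball 0 r \<Longrightarrow> cmod (f z) \<le> M" "r > 0"
    and m: "\<And>j. j < m \<Longrightarrow> (deriv ^^ j) f 0 = 0" and z: "cmod z \<le> r / 4"
  shows "cmod (f z - (deriv ^^ m) f 0 / fact m * z ^ m) \<le> 2 * M * (2 * cmod z / r) ^ (m + 1)"
    "cmod (f z) \<le> 2 * M * (2 * cmod z / r) ^ m"
proof -
  define a where "a n = (deriv ^^ n) f 0 / fact n" for n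
  define q where "q = 2 * cmod z / r"
  have q: "0 \<le> q" "q \<le> 1/2" using z f(3) by (auto simp: q_def field_simps)
  have M: "M \<ge> 0" using order_trans[OF norm_ge_zero f(2)[of 0]] f(3) by simp
  have ab: "cmod (a n) \<le> M / (r / 2) ^ n" for n
  proof -
    have "cmod ((deriv ^^ n) f 0) \<le> fact n * M / (r / 2) ^ n"
    proof (rule Cauchy_inequality)
      show "f holomorphic_on ball 0 (r / 2)" using holomorphic_on_subset[OF f(1)] f(3) by (simp add: subset_ball)
      have "cball 0 (r / 2) \<subseteq> ball (0::complex) r" using f(3) by auto
      then show "continuous_on (cball 0 (r / 2)) f"
        using continuous_on_subset[OF holomorphic_on_imp_continuous_on[OF f(1)]] by blast
    qed (use f in auto)
    then have "cmod ((deriv ^^ n) f 0) / fact n \<le> (fact n * M / (r / 2) ^ n) / fact n" by (intro divide_right_mono) auto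
    then show ?thesis by (simp add: a_def norm_divide)
  qed
  have az: "cmod (a n * z ^ n) \<le> M * q ^ n" for n
  proof -
    have "cmod (a n * z ^ n) \<le> M / (r / 2) ^ n * cmod z ^ n"
      unfolding norm_mult norm_power by (intro mult_right_mono ab) simp
    also have "\<dots> = M * q ^ n" by (simp add: q_def power_divide power_mult_distrib)
    finally show ?thesis .
  qed
  have "(\<lambda>n. a n * z ^ n) sums f z"
    using holomorphic_power_series[OF f(1), of z] z f(3) by (simp add: a_def)
  then have s: "(\<lambda>n. a (n + (m + 1)) * z ^ (n + (m + 1))) sums (f z - (\<Sum>j<m+1. a j * z ^ j))"
    by (rule sums_split_initial_segment)
  have "(\<Sum>j<m. a j * z ^ j) = 0" using m by (intro sum.neutral) (auto simp: a_def)
  then have s': "(\<lambda>n. a (n + (m + 1)) * z ^ (n + (m + 1))) sums (f z - a m * z ^ m)" using s by simp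
  have g: "(\<lambda>n. M * q ^ (m + 1) * q ^ n) sums (M * q ^ (m + 1) * (1 / (1 - q)))"
    using q by (intro sums_mult geometric_sums) auto
  have "cmod (f z - a m * z ^ m) \<le> M * q ^ (m + 1) * (1 / (1 - q))"
  proof (rule norm_sums_le[OF s' g])
    show "cmod (a (n + (m + 1)) * z ^ (n + (m + 1))) \<le> M * q ^ (m + 1) * q ^ n" for n
      using az[of "n + (m + 1)"] by (simp add: power_add mult_ac)
  qed
  also have "\<dots> \<le> M * q ^ (m + 1) * 2"
    using q M by (intro mult_left_mono) (auto simp: field_simps)
  finally show 1: "cmod (f z - (deriv ^^ m) f 0 / fact m * z ^ m) \<le> 2 * M * (2 * cmod z / r) ^ (m + 1)"
    by (simp add: a_def q_def mult_ac)
  have "cmod (f z) \<le> cmod (a m * z ^ m) + cmod (f z - a m * z ^ m)"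
    using norm_triangle_ineq[of "a m * z ^ m" "f z - a m * z ^ m"] by simp
  also have "\<dots> \<le> M * q ^ m + 2 * M * q ^ (m + 1)"
    using az[of m] 1 unfolding a_def q_def by (intro add_mono)
  also have "\<dots> = M * q ^ m * (1 + 2 * q)" by (simp add: algebra_simps)
  also have "\<dots> \<le> M * q ^ m * 2" using q M by (intro mult_left_mono) auto
  finally show "cmod (f z) \<le> 2 * M * (2 * cmod z / r) ^ m" by (simp add: q_def mult_ac)
qed

lemma has_vector_derivative_integral:
  fixes K :: "real \<Rightarrow> real^3 \<Rightarrow> complex"
  assumes d: "d > 0" and int: "\<And>t. \<bar>t - t0\<bar> < d \<Longrightarrow> integrable lborel (K t)" and g: "integrable lborel g"
    and lip: "\<And>t y. \<bar>t - t0\<bar> < d \<Longrightarrow> cmod (K t y - K t0 y) \<le> \<bar>t - t0\<bar> * g y"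
    and der: "\<And>y. ((\<lambda>t. K t y) has_vector_derivative K' y) (at t0)"
  shows "((\<lambda>t. LINT y|lborel. K t y) has_vector_derivative (LINT y|lborel. K' y)) (at t0)"
proof -
  define Q where "Q s y = (K (t0 + s) y - K t0 y) /\<^sub>R s" for s y
  have der': "((\<lambda>s. Q s y) \<longlongrightarrow> K' y) (at 0)" for y
  proof -
    have "((\<lambda>s. K (t0 + s) y) has_vector_derivative 1 *\<^sub>R K' y) (at 0)"
    proof -
      have "((\<lambda>s. t0 + s) has_vector_derivative 1) (at 0)" by (rule derivative_eq_intros refl | simp)+
      from vector_diff_chain_at[OF this, of "\<lambda>t. K t y" "K' y"] der[of y] show ?thesis by (simp add: o_def)
    qed
    from has_vector_derivative_difference_quotient[OF this] show ?thesis by (simp add: Q_def)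
  qed
  have t00: "integrable lborel (K t0)" using int d by simp
  have "((\<lambda>s. ((LINT y|lborel. K (t0 + s) y) - (LINT y|lborel. K (t0 + 0) y)) /\<^sub>R s) \<longlongrightarrow> (LINT y|lborel. K' y)) (at 0 within ball 0 d)"
    unfolding tendsto_at_iff_sequentially
  proof (intro allI impI)
    fix T :: "nat \<Rightarrow> real" assume T: "\<forall>n. T n \<in> ball 0 d - {0}" "T \<longlonglongrightarrow> 0"
    have Tb: "\<bar>t0 + T n - t0\<bar> < d" "T n \<noteq> 0" for n using T(1) by auto
    have Qi: "integrable lborel (Q (T n))" for n
      unfolding Q_def using int[OF Tb(1)] t00 by (intro integrable_scaleR_right Bochner_Integration.integrable_diff)
    have Ql: "(\<lambda>n. Q (T n) y) \<longlonglongrightarrow> K' y" for y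
      using der'[of y] T unfolding tendsto_at_iff_sequentially by (auto simp: o_def)
    have "(\<lambda>n. LINT y|lborel. Q (T n) y) \<longlonglongrightarrow> (LINT y|lborel. K' y)"
    proof (rule integral_dominated_convergence[where w=g])
      show "K' \<in> borel_measurable lborel" by (rule borel_measurable_LIMSEQ_metric[OF borel_measurable_integrable[OF Qi] Ql])
      show "AE y in lborel. norm (Q (T n) y) \<le> g y" for n
      proof (rule AE_I2)
        fix y
        have "cmod (K (t0 + T n) y - K t0 y) \<le> \<bar>T n\<bar> * g y" using lip[OF Tb(1)[of n], of y] by simp
        then show "norm (Q (T n) y) \<le> g y" unfolding Q_def using Tb(2)[of n]
          by (simp add: divide_inverse_commute[symmetric] pos_divide_le_eq mult.commute)
      qed
    qed (use g Qi Ql in auto)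
    moreover have "(LINT y|lborel. Q (T n) y) = ((LINT y|lborel. K (t0 + T n) y) - (LINT y|lborel. K (t0 + 0) y)) /\<^sub>R T n" for n
      unfolding Q_def using int[OF Tb(1)[of n]] t00 by simp
    ultimately show "((\<lambda>s. ((LINT y|lborel. K (t0 + s) y) - (LINT y|lborel. K (t0 + 0) y)) /\<^sub>R s) \<circ> T) \<longlonglongrightarrow> (LINT y|lborel. K' y)"
      by (simp add: o_def)
  qed
  then have "((\<lambda>s. LINT y|lborel. K (t0 + s) y) has_vector_derivative (LINT y|lborel. K' y)) (at 0)"
    using d by (intro has_vector_derivative_of_quotient) (simp add: at_within_open[OF _ open_ball])
  then have "((\<lambda>s. LINT y|lborel. K (t0 + s) y) has_vector_derivative (LINT y|lborel. K' y)) (at (t0 - t0))" by simp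
  moreover have "((\<lambda>t. t - t0) has_vector_derivative 1) (at t0)" by (rule derivative_eq_intros refl | simp)+
  ultimately show ?thesis using vector_diff_chain_at[of "\<lambda>t. t - t0" 1 t0] by (fastforce simp: o_def)
qed

lemma integrable_continuous_open:
  fixes h :: "real^3 \<Rightarrow> complex"
  assumes "continuous_on U h" "compact K" "K \<subseteq> U" "\<And>x. x \<notin> K \<Longrightarrow> h x = 0"
  shows "integrable lborel h"
proof -
  have "(\<lambda>x. indicator K x *\<^sub>R h x) = h" using assms(4) by (auto simp: indicator_def fun_eq_iff)
  then show ?thesis using set_integrable_continuous_compact[OF assms(1-3)] by (simp add: set_integrable_def)
qed

context half_exterior
begin

text \<open>A compact support inside the open half space has a positive least height, so the
  tangential bound holds with the supremum of the derivative divided by that height.\<close>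

lemma weak_laplacian_upper:
  assumes K: "compact K" "K \<subseteq> upper_half \<inter> {x. norm x > R}" "\<And>x. x \<notin> K \<Longrightarrow> e x = 0"
    and e: "C1_fun e De" "\<And>i. has_partial_on (De i) i (DDe i) UNIV" "\<And>i. continuous_on UNIV (DDe i)"
  shows "(LINT x|lborel. w x * ((\<Sum>i\<in>UNIV. DDe i x) + of_real (k^2) * e x)) = 0"
proof (rule weak_laplacian[OF K(1) _ K(3) e])
  show "K \<subseteq> {x. norm x > R}" using K(2) by auto
  have D0: "De i x = 0" if "x \<notin> K" for x i using C1_fun_zero_outside[OF e(1) compact_imp_closed[OF K(1)] K(3)] that by blast
  obtain B where B: "B > 0" "\<And>x. cmod (De 3 x) \<le> B"
    using bounded_continuous_compact_support[OF C1_funD(3)[OF e(1)] K(1) D0, of 3] by blast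
  show "\<exists>C. \<forall>x. cmod (De 3 x) \<le> C * \<bar>x $ 3\<bar>"
  proof (cases "K = {}")
    case True
    then show ?thesis using D0 by (intro exI[of _ 0]) auto
  next
    case False
    have "\<exists>x0\<in>K. \<forall>y\<in>K. x0 $ 3 \<le> y $ 3"
      by (rule continuous_attains_inf[OF K(1) False]) (intro continuous_intros)
    then obtain x0 where x0: "x0 \<in> K" "\<And>y. y \<in> K \<Longrightarrow> x0 $ 3 \<le> y $ 3" by blast
    have p: "x0 $ 3 > 0" using x0(1) K(2) by (auto simp: upper_half_def)
    have "cmod (De 3 x) \<le> B / (x0 $ 3) * \<bar>x $ 3\<bar>" for x
    proof (cases "x \<in> K")
      case True
      then have "B * (x0 $ 3) \<le> B * \<bar>x $ 3\<bar>" using x0(2)[of x] B p by (intro mult_left_mono) auto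
      then have "B \<le> B / (x0 $ 3) * \<bar>x $ 3\<bar>" using p by (simp add: field_simps)
      then show ?thesis using B(2)[of x] by simp
    qed (use D0 B p in auto)
    then show ?thesis by blast
  qed
qed

end

text \<open>
  A point \<open>y\<close> is in the support of the bump at scale \<open>t\<close> if \<open>t y\<close> is close to the fixed unit vector \<open>x1\<close>;
  letting \<open>t\<close> tend to \<open>0\<close> therefore moves the bump to infinity in the direction \<open>x1\<close>.
\<close>

definition bump_supp :: "real \<Rightarrow> real^3 \<Rightarrow> real \<Rightarrow> (real^3) set" where
  "bump_supp \<epsilon> x1 t = {y. dsq x1 (t *\<^sub>R y) \<le> (2 * \<epsilon>)^2}"

text \<open>After scaling by \<open>t\<close> the support has radius \<open>2 * \<epsilon>\<close>
  around \<open>x1\<close>: \<open>\<epsilon> \<le> 1/8\<close> confines the norm to between 3/4 and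
  5/4, and \<open>4 * \<epsilon> \<le> x1 $ 3\<close> leaves a height of at least
  \<open>2 * \<epsilon>\<close>.\<close>

lemma bump_suppD:
  assumes "y \<in> bump_supp \<epsilon> x1 t" "norm x1 = 1" "0 < \<epsilon>" "\<epsilon> \<le> 1/8" "4 * \<epsilon> \<le> x1 $ 3" "t > 0"
  shows "norm (t *\<^sub>R y - x1) \<le> 2 * \<epsilon>" "3/4 \<le> t * norm y" "t * norm y \<le> 5/4" "t * y $ 3 \<ge> 2 * \<epsilon>" "y \<in> upper_half"
    "norm y > 0" "norm y \<ge> 3 / 4 / t" "norm y \<le> 5 / 4 / t"
proof -
  show 1: "norm (t *\<^sub>R y - x1) \<le> 2 * \<epsilon>"
    using assms(1,3) dsq_le_iff_dist[of "2 * \<epsilon>" x1 "t *\<^sub>R y"] by (simp add: bump_supp_def dist_norm norm_minus_commute)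
  have "\<bar>norm (t *\<^sub>R y) - norm x1\<bar> \<le> 2 * \<epsilon>" using order_trans[OF norm_triangle_ineq3 1] .
  then show 2: "3/4 \<le> t * norm y" and 3: "t * norm y \<le> 5/4" using assms by auto
  have "\<bar>(t *\<^sub>R y - x1) $ 3\<bar> \<le> 2 * \<epsilon>" using order_trans[OF component_le_norm_cart 1] .
  then show 4: "t * y $ 3 \<ge> 2 * \<epsilon>" using assms by auto
  then have "t * y $ 3 > 0" using assms by linarith
  then show "y \<in> upper_half" using assms by (simp add: upper_half_def zero_less_mult_iff)
  show "norm y > 0" using 2 by (cases "y = 0") auto
  show "norm y \<ge> 3 / 4 / t" "norm y \<le> 5 / 4 / t" using 2 3 assms by (auto simp: field_simps)
qed

lemma compact_bump_supp: "t > 0 \<Longrightarrow> compact (bump_supp \<epsilon> x1 t)"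
proof -
  assume t: "t > 0"
  have "closed (bump_supp \<epsilon> x1 t)"
    unfolding bump_supp_def by (intro closed_Collect_le continuous_intros)
  moreover have "bump_supp \<epsilon> x1 t \<subseteq> cball 0 ((norm x1 + 2 * \<bar>\<epsilon>\<bar>) / t)"
  proof
    fix y assume "y \<in> bump_supp \<epsilon> x1 t"
    then have "dsq x1 (t *\<^sub>R y) \<le> (2 * \<bar>\<epsilon>\<bar>)^2" by (simp add: bump_supp_def power_mult_distrib)
    then have "norm (t *\<^sub>R y - x1) \<le> 2 * \<bar>\<epsilon>\<bar>" by (subst (asm) dsq_le_iff_dist) (auto simp: dist_norm norm_minus_commute)
    then have "norm (t *\<^sub>R y) \<le> norm x1 + 2 * \<bar>\<epsilon>\<bar>" using norm_triangle_ineq2[of "t *\<^sub>R y" x1] by linarith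
    then show "y \<in> cball 0 ((norm x1 + 2 * \<bar>\<epsilon>\<bar>) / t)" using t by (simp add: field_simps)
  qed
  ultimately show ?thesis by (meson bounded_cball bounded_subset compact_eq_bounded_closed)
qed

lemma bump_outside:
  assumes "y \<notin> bump_supp \<epsilon> x1 t" "\<epsilon> > 0"
  shows "cutoff \<epsilon> (dsq x1 (t *\<^sub>R y)) = 1" "cutoff1 \<epsilon> (dsq x1 (t *\<^sub>R y)) = 0" "cutoff2 \<epsilon> (dsq x1 (t *\<^sub>R y)) = 0"
proof -
  have "dsq x1 (t *\<^sub>R y) > 4 * \<epsilon>^2" using assms(1) by (simp add: bump_supp_def power_mult_distrib)
  then have "dsq x1 (t *\<^sub>R y) \<ge> 2 * \<epsilon>^2" using zero_le_power2[of \<epsilon>] by linarith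
  then show "cutoff \<epsilon> (dsq x1 (t *\<^sub>R y)) = 1" "cutoff1 \<epsilon> (dsq x1 (t *\<^sub>R y)) = 0" "cutoff2 \<epsilon> (dsq x1 (t *\<^sub>R y)) = 0"
    using cutoff_right[OF assms(2)] by auto
qed

lemma cutoff_scale:
  assumes "t > 0"
  shows "cutoff (\<epsilon> / t) (dsq ((1 / t) *\<^sub>R x1) y) = cutoff \<epsilon> (dsq x1 (t *\<^sub>R y))"
    "cutoff1 (\<epsilon> / t) (dsq ((1 / t) *\<^sub>R x1) y) = t^2 * cutoff1 \<epsilon> (dsq x1 (t *\<^sub>R y))"
    "cutoff2 (\<epsilon> / t) (dsq ((1 / t) *\<^sub>R x1) y) = t^4 * cutoff2 \<epsilon> (dsq x1 (t *\<^sub>R y))"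
    "dsq x1 (t *\<^sub>R y) = t^2 * dsq ((1 / t) *\<^sub>R x1) y"
proof -
  have "t *\<^sub>R y - x1 = t *\<^sub>R (y - (1 / t) *\<^sub>R x1)" using assms by (simp add: scaleR_diff_right)
  then show d: "dsq x1 (t *\<^sub>R y) = t^2 * dsq ((1 / t) *\<^sub>R x1) y" by (simp add: dsq_def power_mult_distrib)
  have e: "dsq ((1 / t) *\<^sub>R x1) y / (\<epsilon> / t)^2 = dsq x1 (t *\<^sub>R y) / \<epsilon>^2" unfolding d using assms by (simp add: power_divide)
  show "cutoff (\<epsilon> / t) (dsq ((1 / t) *\<^sub>R x1) y) = cutoff \<epsilon> (dsq x1 (t *\<^sub>R y))"
    "cutoff1 (\<epsilon> / t) (dsq ((1 / t) *\<^sub>R x1) y) = t^2 * cutoff1 \<epsilon> (dsq x1 (t *\<^sub>R y))"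
    "cutoff2 (\<epsilon> / t) (dsq ((1 / t) *\<^sub>R x1) y) = t^4 * cutoff2 \<epsilon> (dsq x1 (t *\<^sub>R y))"
    unfolding cutoff_def cutoff1_def cutoff2_def e by (auto simp: power_divide)
qed

context half_exterior
begin

text \<open>The incoming wave centred at the origin. Multiplication by it removes the oscillation of
  \<open>w\<close>, which behaves like an outgoing wave.\<close>

definition ff :: "real^3 \<Rightarrow> complex" where "ff y = fund (- k) (dsq 0 y)"

lemma norm_ff: "cmod (ff y) = 1 / norm y"
  unfolding ff_def norm_fund by simp

lemma continuous_on_ff: "continuous_on (upper_half \<inter> {x. norm x > R}) ff"
  unfolding ff_def
  by (rule continuous_on_compose2[OF continuous_on_fund(1) continuous_on_dsq[OF continuous_on_id]])
     (use R in \<open>auto simp: dsq_zero\<close>)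

text \<open>Test the equation with the incoming wave times the bump. The wave itself solves the
  Helmholtz equation, so only terms with derivatives of the bump remain. The largest pairs the
  factor \<open>-i k\<close> from the gradient of the wave with the radial derivative of the bump;
  it is isolated on the right, where it equals \<open>-2 i k\<close> times the derivative of
  \<open>bump_integral\<close> in \<open>t\<close>. The weights on the left are smaller by one power
  of \<open>t\<close>.\<close>

lemma bump_identity:
  assumes x1: "norm x1 = 1" "0 < \<epsilon>" "\<epsilon> \<le> 1/8" "4 * \<epsilon> \<le> x1 $ 3" and t: "0 < t" "t < 1 / (2 * R)"
  shows "(LINT y|lborel. w y * ff y * of_real (t * (6 * cutoff1 \<epsilon> (dsq x1 (t *\<^sub>R y)) + 4 * dsq x1 (t *\<^sub>R y) * cutoff2 \<epsilon> (dsq x1 (t *\<^sub>R y)))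
        - 4 * cutoff1 \<epsilon> (dsq x1 (t *\<^sub>R y)) * (y \<bullet> (t *\<^sub>R y - x1)) / (norm y)^2))
    = 2 * \<i> * k * (LINT y|lborel. w y * ff y / of_real (norm y) * of_real (2 * cutoff1 \<epsilon> (dsq x1 (t *\<^sub>R y)) * (y \<bullet> (t *\<^sub>R y - x1))))"
proof -
  define c where "c = (1 / t) *\<^sub>R x1"
  define \<delta> where "\<delta> = \<epsilon> / t"
  have \<delta>: "\<delta> > 0" using x1 t by (simp add: \<delta>_def)
  let ?K = "bump_supp \<epsilon> x1 t" and ?U = "upper_half \<inter> {x. norm x > R}"
  have KR: "norm y > R" if "y \<in> ?K" for y
  proof -
    have "R < 3 / 4 / t" using t R by (simp add: field_simps)
    then show ?thesis using bump_suppD(7)[OF that x1 t(1)] by simp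
  qed
  have K: "compact ?K" "?K \<subseteq> ?U" using compact_bump_supp[OF t(1)] KR bump_suppD(5)[OF _ x1 t(1)] by auto
  define C1 where "C1 y = cutoff1 \<epsilon> (dsq x1 (t *\<^sub>R y))" for y
  define C2 where "C2 y = cutoff2 \<epsilon> (dsq x1 (t *\<^sub>R y))" for y
  have C0: "C1 y = 0" "C2 y = 0" if "y \<notin> ?K" for y using bump_outside[OF that x1(2)] by (auto simp: C1_def C2_def)
  have Cc: "continuous_on S C1" "continuous_on S C2" for S
    unfolding C1_def C2_def using x1(2)
    by (auto intro!: continuous_on_compose2[OF cutoff_cont(2)[of \<epsilon> UNIV]] continuous_on_compose2[OF cutoff_cont(3)[of \<epsilon> UNIV]] continuous_intros)
  define h h1 h2 where "h s = complex_of_real (1 - cutoff \<delta> s)" and "h1 s = complex_of_real (- cutoff1 \<delta> s)" and "h2 s = complex_of_real (- cutoff2 \<delta> s)" for s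
  have hd: "(h has_vector_derivative h1 s) (at s)" "(h1 has_vector_derivative h2 s) (at s)" for s
    unfolding h_def[abs_def] h1_def[abs_def] h2_def
    by (intro has_vector_derivative_of_real, use cutoff_derivs[OF \<delta>] in \<open>auto intro!: derivative_eq_intros\<close>)+
  have hc: "continuous_on UNIV h1" "continuous_on UNIV h2"
    unfolding h1_def[abs_def] h2_def[abs_def] by (intro continuous_intros cutoff_cont \<delta>)+
  \<comment> \<open>The test function must be C1 on the whole space, so the incoming wave is
    truncated too; with this radius the truncation is invisible where
    \<open>norm y > R\<close>.\<close>
  define e0 where "e0 = R / 2"
  have e0: "e0 > 0" using R by (simp add: e0_def)
  have far: "dsq 0 y \<ge> 2 * e0^2" if "norm y > R" for y
  proof -
    have "R^2 \<le> dsq 0 y" unfolding dsq_zero using that R by (intro power_mono) auto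
    moreover have "2 * e0^2 \<le> R^2" unfolding e0_def by (simp add: power2_eq_square)
    ultimately show ?thesis by linarith
  qed
  define g De DDe where "g y = ker (- k) e0 (dsq 0 y)" and "De i y = of_real (2 * (y - 0) $ i) * ker1 (- k) e0 (dsq 0 y)"
    and "DDe i y = 2 * ker1 (- k) e0 (dsq 0 y) + of_real (4 * ((y - 0) $ i)^2) * ker2 (- k) e0 (dsq 0 y)" for i and y :: "real^3"
  define Z DZ DDZ where "Z y = h (dsq c y)" and "DZ i y = of_real (2 * (y - c) $ i) * h1 (dsq c y)"
    and "DDZ i y = 2 * h1 (dsq c y) + of_real (4 * ((y - c) $ i)^2) * h2 (dsq c y)" for i y
  have gC: "C1_fun g De" unfolding g_def De_def by (rule C1_fun_radial[OF ker_deriv(1)[OF e0] ker_cont(2)[OF e0]])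
  have gD: "has_partial_on (De i) i (DDe i) UNIV" "continuous_on UNIV (DDe i)" for i
    unfolding De_def DDe_def
    by (intro has_partial_on_radial2 ker_deriv(2)[OF e0])
       (intro continuous_intros continuous_on_compose2[OF ker_cont(2)[OF e0]] continuous_on_compose2[OF ker_cont(3)[OF e0]]; simp)
  have ZC: "C1_fun Z DZ" unfolding Z_def DZ_def by (rule C1_fun_radial[OF hd(1) hc(1)])
  have ZD: "has_partial_on (DZ i) i (DDZ i) UNIV" "continuous_on UNIV (DDZ i)" for i
    unfolding DZ_def DDZ_def
    by (intro has_partial_on_radial2 hd(2))
       (intro continuous_intros continuous_on_compose2[OF hc(1)] continuous_on_compose2[OF hc(2)]; simp)
  have sc: "cutoff \<delta> (dsq c y) = cutoff \<epsilon> (dsq x1 (t *\<^sub>R y))" "cutoff1 \<delta> (dsq c y) = t^2 * C1 y"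
    "cutoff2 \<delta> (dsq c y) = t^4 * C2 y" "dsq x1 (t *\<^sub>R y) = t^2 * dsq c y" for y
    using cutoff_scale(1-3)[OF t(1), of \<epsilon> x1 y] cutoff_scale(4)[OF t(1), of x1 y] by (auto simp: \<delta>_def c_def C1_def C2_def)
  have Z0: "Z y = 0" if "y \<notin> ?K" for y using bump_outside(1)[OF that x1(2)] by (simp add: Z_def h_def sc(1))
  have "(LINT y|lborel. w y * ((\<Sum>i\<in>UNIV. (DDe i y * Z y + De i y * DZ i y) + (De i y * DZ i y + g y * DDZ i y)) + of_real (k^2) * (g y * Z y))) = 0"
  proof (rule weak_laplacian_upper[OF K _ C1_fun_mult[OF gC ZC]])
    show "g y * Z y = 0" if "y \<notin> ?K" for y using Z0[OF that] by simp
    show "has_partial_on (\<lambda>y. De i y * Z y + g y * DZ i y) i (\<lambda>y. (DDe i y * Z y + De i y * DZ i y) + (De i y * DZ i y + g y * DDZ i y)) UNIV" for i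
      by (intro has_partial_on_add has_partial_on_mult gD ZD C1_funD(2)[OF gC] C1_funD(2)[OF ZC])
    show "continuous_on UNIV (\<lambda>y. (DDe i y * Z y + De i y * DZ i y) + (De i y * DZ i y + g y * DDZ i y))" for i
      by (intro continuous_intros gD ZD C1_funD[OF gC] C1_funD[OF ZC])
  qed
  also have "(\<lambda>y. w y * ((\<Sum>i\<in>UNIV. (DDe i y * Z y + De i y * DZ i y) + (De i y * DZ i y + g y * DDZ i y)) + of_real (k^2) * (g y * Z y)))
     = (\<lambda>y. - of_real t * (w y * ff y * of_real (t * (6 * C1 y + 4 * dsq x1 (t *\<^sub>R y) * C2 y) - 4 * C1 y * (y \<bullet> (t *\<^sub>R y - x1)) / (norm y)^2)
        - 2 * \<i> * k * (w y * ff y / of_real (norm y) * of_real (2 * C1 y * (y \<bullet> (t *\<^sub>R y - x1))))))"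
  proof
    fix y
    show "w y * ((\<Sum>i\<in>UNIV. (DDe i y * Z y + De i y * DZ i y) + (De i y * DZ i y + g y * DDZ i y)) + of_real (k^2) * (g y * Z y))
     = - of_real t * (w y * ff y * of_real (t * (6 * C1 y + 4 * dsq x1 (t *\<^sub>R y) * C2 y) - 4 * C1 y * (y \<bullet> (t *\<^sub>R y - x1)) / (norm y)^2)
        - 2 * \<i> * k * (w y * ff y / of_real (norm y) * of_real (2 * C1 y * (y \<bullet> (t *\<^sub>R y - x1)))))"
    proof (cases "y \<in> ?K")
      case False
      have "DZ i y = 0" "DDZ i y = 0" for i unfolding DZ_def DDZ_def h1_def h2_def sc C0[OF False] by simp_all
      then show ?thesis using Z0[OF False] C0[OF False] by simp
    next
      case True
      define n where "n = norm y"
      have n: "n > 0" using bump_suppD(6)[OF True x1 t(1)] by (simp add: n_def)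
      define F where "F = ff y"
      have d0: "dsq 0 y = n^2" by (simp add: n_def dsq_zero)
      have fr: "dsq 0 y \<ge> 2 * e0^2" using far[OF KR[OF True]] .
      have gF: "g y = F" unfolding g_def F_def ff_def using ker_far(1)[OF e0 fr] .
      define F1 where "F1 = fund1 (- k) (dsq 0 y)"
      have k1: "ker1 (- k) e0 (dsq 0 y) = F1" unfolding F1_def using ker_far(2)[OF e0 fr] .
      have n2: "n^2 > 0" using n by simp
      have F1eq: "F1 = F * (- \<i> * k * of_real n - 1) / of_real (2 * n^2)"
        using fund1_eq[OF n2, of "- k"] n unfolding F1_def F_def ff_def d0 by (simp add: field_simps)
      define d where "d = y \<bullet> (t *\<^sub>R y - x1)"
      have "y - c = (1 / t) *\<^sub>R (t *\<^sub>R y - x1)" using t by (simp add: c_def scaleR_diff_right)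
      then have yc: "y \<bullet> (y - c) = d / t" by (simp add: d_def)
      have S1: "(\<Sum>i\<in>UNIV. DDe i y) + of_real (k^2) * g y = 0"
      proof -
        have "(\<Sum>i\<in>UNIV. DDe i y) + of_real (k^2) * g y = src (- k) e0 (dsq 0 y)"
          unfolding DDe_def g_def src_def radial_laplacian by simp
        then show ?thesis using src_outside[OF e0] fr by simp
      qed
      have S2: "(\<Sum>i\<in>UNIV. De i y * DZ i y) = of_real (4 * (d / t)) * F1 * h1 (dsq c y)"
      proof -
        have "(\<Sum>i\<in>UNIV. De i y * DZ i y) = of_real (4 * (y \<bullet> (y - c))) * F1 * h1 (dsq c y)"
          unfolding De_def DZ_def k1 inner_vec_def by (simp add: sum_3 algebra_simps)
        then show ?thesis by (simp only: yc)
      qed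
      have S3: "(\<Sum>i\<in>UNIV. DDZ i y) = 6 * h1 (dsq c y) + 4 * of_real (dsq c y) * h2 (dsq c y)"
        unfolding DDZ_def by (rule radial_laplacian)
      have "(\<Sum>i\<in>UNIV. (DDe i y * Z y + De i y * DZ i y) + (De i y * DZ i y + g y * DDZ i y)) + of_real (k^2) * (g y * Z y)
        = ((\<Sum>i\<in>UNIV. DDe i y) + of_real (k^2) * g y) * Z y + 2 * (\<Sum>i\<in>UNIV. De i y * DZ i y) + g y * (\<Sum>i\<in>UNIV. DDZ i y)"
        by (simp add: sum_3 algebra_simps)
      also have "\<dots> = 2 * (of_real (4 * (d / t)) * F1 * of_real (- (t^2 * C1 y))) + F * (6 * of_real (- (t^2 * C1 y)) + 4 * of_real (dsq c y) * of_real (- (t^4 * C2 y)))"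
        unfolding S1 S2 S3 unfolding gF h1_def h2_def sc(2,3) by simp
      also have "\<dots> = - of_real t * (F * of_real (t * (6 * C1 y + 4 * (t^2 * dsq c y) * C2 y) - 4 * C1 y * d / n^2)
         - 2 * \<i> * k * (F / of_real n * of_real (2 * C1 y * d)))"
        unfolding F1eq using n t by (simp add: field_simps power2_eq_square power4_eq_xxxx)
      finally show ?thesis
        unfolding sc(4) n_def[symmetric] d_def[symmetric] F_def[symmetric] by (simp only:) (simp add: algebra_simps)
    qed
  qed
  finally have z: "(LINT y|lborel. - of_real t * (w y * ff y * of_real (t * (6 * C1 y + 4 * dsq x1 (t *\<^sub>R y) * C2 y) - 4 * C1 y * (y \<bullet> (t *\<^sub>R y - x1)) / (norm y)^2)
        - 2 * \<i> * k * (w y * ff y / of_real (norm y) * of_real (2 * C1 y * (y \<bullet> (t *\<^sub>R y - x1)))))) = 0" .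
  have nz: "norm y \<noteq> 0" if "y \<in> ?U" for y using that R by auto
  have i1: "integrable lborel (\<lambda>y. w y * ff y * of_real (t * (6 * C1 y + 4 * dsq x1 (t *\<^sub>R y) * C2 y) - 4 * C1 y * (y \<bullet> (t *\<^sub>R y - x1)) / (norm y)^2))"
    by (rule integrable_continuous_open[OF _ K]) (use nz C0 in \<open>auto intro!: continuous_intros w_C1(1) continuous_on_ff Cc\<close>)
  have i2: "integrable lborel (\<lambda>y. w y * ff y / of_real (norm y) * of_real (2 * C1 y * (y \<bullet> (t *\<^sub>R y - x1))))"
    by (rule integrable_continuous_open[OF _ K]) (use nz C0 in \<open>auto intro!: continuous_intros w_C1(1) continuous_on_ff Cc\<close>)
  have i3: "integrable lborel (\<lambda>y. 2 * \<i> * k * (w y * ff y / of_real (norm y) * of_real (2 * C1 y * (y \<bullet> (t *\<^sub>R y - x1)))))"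
    by (rule integrable_mult_right[OF i2])
  have "- of_real t * ((LINT y|lborel. w y * ff y * of_real (t * (6 * C1 y + 4 * dsq x1 (t *\<^sub>R y) * C2 y) - 4 * C1 y * (y \<bullet> (t *\<^sub>R y - x1)) / (norm y)^2))
       - 2 * \<i> * k * (LINT y|lborel. w y * ff y / of_real (norm y) * of_real (2 * C1 y * (y \<bullet> (t *\<^sub>R y - x1))))) = 0"
    using z unfolding integral_mult_right_zero Bochner_Integration.integral_diff[OF i1 i3] .
  then show ?thesis using t(1) unfolding C1_def C2_def by simp
qed

end

section \<open>Two-sided estimates for the bump integrals\<close>

lemma step2_bound: "\<bar>step2 x\<bar> \<le> 420"
proof -
  have c: "0 \<le> clamp01 x" "clamp01 x \<le> 1" using clamp01_range by auto
  have "(clamp01 x)^2 * (1 - clamp01 x)^2 \<le> 1 * 1" using c by (intro mult_mono power_le_one) auto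
  then have "\<bar>(clamp01 x)^2 * (1 - clamp01 x)^2\<bar> * \<bar>1 - 2 * clamp01 x\<bar> \<le> 1 * 1" using c by (intro mult_mono) auto
  then have "\<bar>(clamp01 x)^2 * (1 - clamp01 x)^2 * (1 - 2 * clamp01 x)\<bar> \<le> 1" by (simp add: abs_mult)
  then show ?thesis unfolding step2_def Let_def by (simp add: mult.assoc abs_mult)
qed

lemma cutoff_bounds:
  assumes "\<epsilon> > 0"
  shows "\<bar>cutoff1 \<epsilon> s\<bar> \<le> 140 / \<epsilon>^2" "\<bar>cutoff2 \<epsilon> s\<bar> \<le> 420 / \<epsilon>^4" "0 \<le> 1 - cutoff \<epsilon> s" "1 - cutoff \<epsilon> s \<le> 1"
  using step1_le step1_nonneg step2_bound step_range assms
  by (auto simp: cutoff_def cutoff1_def cutoff2_def intro!: divide_right_mono)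

lemma integral_bound_cball:
  fixes h :: "real^3 \<Rightarrow> complex"
  assumes "\<And>y. cmod (h y) \<le> A * indicator (cball 0 \<rho>) y" "A \<ge> 0" "\<rho> \<ge> 0"
  shows "cmod (LINT y|lborel. h y) \<le> A * measure lborel (cball (0::real^3) 1) * \<rho>^3"
proof -
  have gi: "integrable lborel (\<lambda>y. A * indicator (cball 0 \<rho>) (y::real^3) :: real)"
    using emeasure_lborel_cball_finite[of "0::real^3" \<rho>] by (intro integrable_mult_right integrable_real_indicator) auto
  have "cmod (LINT y|lborel. h y) \<le> (LINT y|lborel. cmod (h y))" by (rule integral_norm_bound)
  also have "\<dots> \<le> (LINT y|lborel. A * indicator (cball 0 \<rho>) (y::real^3))"
    by (rule integral_mono'[OF gi assms(1)]) (use assms(2) in auto)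
  also have "\<dots> = A * measure lborel (cball (0::real^3) \<rho>)" by simp
  also have "\<dots> = A * measure lborel (cball (0::real^3) 1) * \<rho>^3"
    using assms(3) content_cball[of \<rho> "0::real^3"] content_cball[of 1 "0::real^3"] by simp
  finally show ?thesis .
qed

lemma vol1_pos: "measure lborel (cball (0::real^3) 1) > 0"
  using content_cball_pos[of 1 "0::real^3"] by simp

context half_exterior
begin

text \<open>The weight \<open>1 / norm y\<close> is chosen so that the derivative in
  \<open>t\<close> is, up to a constant factor, the right side of
  \<open>bump_identity\<close>.\<close>

definition bump_integral :: "real \<Rightarrow> real^3 \<Rightarrow> real \<Rightarrow> complex" where
  "bump_integral \<epsilon> x1 t = (LINT y|lborel. w y * ff y / of_real (norm y) * of_real (1 - cutoff \<epsilon> (dsq x1 (t *\<^sub>R y))))"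

lemma bump_supp_exterior:
  assumes x1: "norm x1 = 1" "0 < \<epsilon>" "\<epsilon> \<le> 1/8" "4 * \<epsilon> \<le> x1 $ 3" and t: "0 < t" "t < 1 / (2 * R)"
  shows "bump_supp \<epsilon> x1 t \<subseteq> upper_half \<inter> {x. norm x > R}"
proof
  fix y assume y: "y \<in> bump_supp \<epsilon> x1 t"
  have "R < 3 / 4 / t" using t R by (simp add: field_simps)
  then show "y \<in> upper_half \<inter> {x. norm x > R}" using bump_suppD(5,7)[OF y x1 t(1)] by simp
qed

lemma continuous_on_weight: "continuous_on (upper_half \<inter> {x. norm x > R}) (\<lambda>y. w y * ff y / of_real (norm y))"
  using R by (intro continuous_intros w_C1(1) continuous_on_ff) auto

lemma bump_integrable:
  assumes x1: "norm x1 = 1" "0 < \<epsilon>" "\<epsilon> \<le> 1/8" "4 * \<epsilon> \<le> x1 $ 3" and t: "0 < t" "t < 1 / (2 * R)"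
  shows "integrable lborel (\<lambda>y. w y * ff y / of_real (norm y) * of_real (1 - cutoff \<epsilon> (dsq x1 (t *\<^sub>R y))))"
proof (rule integrable_continuous_open[OF _ compact_bump_supp[OF t(1)] bump_supp_exterior[OF x1 t]])
  show "continuous_on (upper_half \<inter> {x. R < norm x}) (\<lambda>y. w y * ff y / of_real (norm y) * of_real (1 - cutoff \<epsilon> (dsq x1 (t *\<^sub>R y))))"
    by (intro continuous_on_mult[OF continuous_on_weight] continuous_intros continuous_on_compose2[OF cutoff_cont(1)[OF x1(2), of UNIV]]) auto
qed (use bump_outside(1)[OF _ x1(2)] in auto)

lemma bump_deriv_pointwise:
  assumes "\<epsilon> > 0"
  shows "((\<lambda>t. 1 - cutoff \<epsilon> (dsq x1 (t *\<^sub>R y))) has_real_derivative - (2 * cutoff1 \<epsilon> (dsq x1 (t *\<^sub>R y)) * (y \<bullet> (t *\<^sub>R y - x1)))) (at t)"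
proof -
  have "dsq x1 (s *\<^sub>R y) = s^2 * (y \<bullet> y) - 2 * s * (y \<bullet> x1) + x1 \<bullet> x1" for s
    unfolding dsq_def power2_norm_eq_inner by (simp add: inner_diff_left inner_diff_right inner_commute power2_eq_square algebra_simps)
  then have eq: "(\<lambda>s. dsq x1 (s *\<^sub>R y)) = (\<lambda>s. s^2 * (y \<bullet> y) - 2 * s * (y \<bullet> x1) + x1 \<bullet> x1)" by (rule ext)
  have d: "((\<lambda>s. dsq x1 (s *\<^sub>R y)) has_real_derivative 2 * (y \<bullet> (t *\<^sub>R y - x1))) (at t)"
    unfolding eq by (auto intro!: derivative_eq_intros simp: inner_diff_right algebra_simps)
  have "((\<lambda>s. cutoff \<epsilon> (dsq x1 (s *\<^sub>R y))) has_real_derivative cutoff1 \<epsilon> (dsq x1 (t *\<^sub>R y)) * (2 * (y \<bullet> (t *\<^sub>R y - x1)))) (at t)"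
    by (rule DERIV_chain2[OF cutoff_derivs(1)[OF assms] d])
  from DERIV_diff[OF DERIV_const[of 1] this] show ?thesis by (simp add: mult_ac)
qed

lemma bump_deriv_bound:
  assumes x1: "norm x1 = 1" "0 < \<epsilon>" "\<epsilon> \<le> 1/8" "4 * \<epsilon> \<le> x1 $ 3" and t: "0 < t"
  shows "\<bar>2 * cutoff1 \<epsilon> (dsq x1 (t *\<^sub>R y)) * (y \<bullet> (t *\<^sub>R y - x1))\<bar> \<le> 560 / \<epsilon> * norm y"
proof (cases "y \<in> bump_supp \<epsilon> x1 t")
  case True
  have "\<bar>y \<bullet> (t *\<^sub>R y - x1)\<bar> \<le> norm y * norm (t *\<^sub>R y - x1)" by (rule Cauchy_Schwarz_ineq2)
  also have "\<dots> \<le> norm y * (2 * \<epsilon>)" using bump_suppD(1)[OF True x1 t] by (intro mult_left_mono) auto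
  finally have "\<bar>cutoff1 \<epsilon> (dsq x1 (t *\<^sub>R y))\<bar> * \<bar>y \<bullet> (t *\<^sub>R y - x1)\<bar> \<le> 140 / \<epsilon>^2 * (norm y * (2 * \<epsilon>))"
    using cutoff_bounds(1)[OF x1(2)] by (intro mult_mono) auto
  also have "\<dots> = 280 / \<epsilon> * norm y" using x1(2) by (simp add: power2_eq_square)
  finally show ?thesis by (simp add: abs_mult)
qed (use bump_outside(2)[OF _ x1(2)] x1(2) in auto)

lemma bump_integral_deriv:
  assumes x1: "norm x1 = 1" "0 < \<epsilon>" "\<epsilon> \<le> 1/8" "4 * \<epsilon> \<le> x1 $ 3" and t: "0 < t" "t < 1 / (4 * R)"
  shows "(bump_integral \<epsilon> x1 has_vector_derivative
     - (LINT y|lborel. w y * ff y / of_real (norm y) * of_real (2 * cutoff1 \<epsilon> (dsq x1 (t *\<^sub>R y)) * (y \<bullet> (t *\<^sub>R y - x1))))) (at t)"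
proof -
  define d where "d = t / 2"
  have d: "d > 0" using t by (simp add: d_def)
  have rng: "0 < s" "s < 1 / (2 * R)" "s > t / 2" "s < 2 * t" if "\<bar>s - t\<bar> < d" for s
  proof -
    have "2 * t < 1 / (2 * R)" using t R by (simp add: field_simps)
    moreover have "s - t < t / 2" "t - s < t / 2" using that unfolding d_def by linarith+
    ultimately show "0 < s" "s < 1 / (2 * R)" "s > t / 2" "s < 2 * t" using t by linarith+
  qed
  \<comment> \<open>A common compact set for all bumps with \<open>t / 2 < s < 2 * t\<close>; it
    still lies in the exterior upper half because \<open>t < 1 / (4 * R)\<close>.\<close>
  define K :: "(real^3) set" where "K = cball 0 (5 / 2 / t) \<inter> {y. norm y \<ge> 3 / 8 / t} \<inter> {y. y $ 3 \<ge> \<epsilon> / t}"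
  have cl: "closed {y::real^3. norm y \<ge> 3 / 8 / t}" "closed {y::real^3. y $ 3 \<ge> \<epsilon> / t}"
    by (intro closed_Collect_le continuous_intros)+
  have Kc: "compact K" unfolding K_def by (intro compact_Int_closed compact_cball cl)
  have "R < 3 / 8 / t" using t R by (simp add: field_simps)
  moreover have "\<epsilon> / t > 0" using x1 t by simp
  ultimately have KU: "K \<subseteq> upper_half \<inter> {x. norm x > R}" by (auto simp: K_def upper_half_def)
  have sub: "bump_supp \<epsilon> x1 s \<subseteq> K" if s: "\<bar>s - t\<bar> < d" for s
  proof
    fix y assume y: "y \<in> bump_supp \<epsilon> x1 s"
    note b = bump_suppD[OF y x1 rng(1)[OF s]]
    have "5 / 4 / s \<le> 5 / 4 / (t / 2)" using rng[OF s] t by (intro divide_left_mono) auto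
    then have 1: "norm y \<le> 5 / 2 / t" using b(8) by simp
    have "3 / 4 / (2 * t) \<le> 3 / 4 / s" using rng[OF s] t by (intro divide_left_mono) auto
    then have 2: "norm y \<ge> 3 / 8 / t" using b(7) by simp
    have "2 * \<epsilon> \<le> s * y $ 3" by (rule b(4))
    also have "\<dots> \<le> (2 * t) * y $ 3" using rng[OF s] b(5) by (intro mult_right_mono) (auto simp: upper_half_def)
    finally have 3: "y $ 3 \<ge> \<epsilon> / t" using t by (simp add: field_simps)
    show "y \<in> K" unfolding K_def using 1 2 3 by simp
  qed
  let ?W = "\<lambda>y. w y * ff y / of_real (norm y)"
  define g where "g y = indicator K y * cmod (?W y) * (560 / \<epsilon> * (5 / 2 / t))" for y
  have "integrable lborel (\<lambda>y. indicator K y *\<^sub>R ?W y)"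
    using set_integrable_continuous_compact[OF continuous_on_weight Kc KU] by (simp add: set_integrable_def)
  from integrable_norm[OF this] have "integrable lborel (\<lambda>y. indicator K y * cmod (?W y))" by simp
  then have gi: "integrable lborel g" unfolding g_def by (rule integrable_mult_left)
  let ?\<psi> = "\<lambda>s y. 1 - cutoff \<epsilon> (dsq x1 (s *\<^sub>R y))"
  have lip: "cmod (?W y * of_real (?\<psi> s y) - ?W y * of_real (?\<psi> t y)) \<le> \<bar>s - t\<bar> * g y" if s: "\<bar>s - t\<bar> < d" for s y
  proof (cases "y \<in> K")
    case False
    then have "y \<notin> bump_supp \<epsilon> x1 s" "y \<notin> bump_supp \<epsilon> x1 t" using sub[OF s] sub[of t] d by auto
    then have "?\<psi> s y = 0" "?\<psi> t y = 0" using bump_outside(1)[OF _ x1(2)] by simp_all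
    then show ?thesis using False by (simp add: g_def)
  next
    case True
    have "\<bar>?\<psi> s y - ?\<psi> t y\<bar> \<le> (560 / \<epsilon> * norm y) * \<bar>s - t\<bar>"
    proof -
      have "norm (?\<psi> s y - ?\<psi> t y) \<le> (560 / \<epsilon> * norm y) * norm (s - t)"
      proof (rule field_differentiable_bound[of "{0<..}"])
        show "(( \<lambda>s. ?\<psi> s y) has_field_derivative - (2 * cutoff1 \<epsilon> (dsq x1 (z *\<^sub>R y)) * (y \<bullet> (z *\<^sub>R y - x1)))) (at z within {0<..})" for z
          by (rule has_field_derivative_at_within[OF bump_deriv_pointwise[OF x1(2)]])
        show "norm (- (2 * cutoff1 \<epsilon> (dsq x1 (z *\<^sub>R y)) * (y \<bullet> (z *\<^sub>R y - x1)))) \<le> 560 / \<epsilon> * norm y" if "z \<in> {0<..}" for z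
          using bump_deriv_bound[OF x1, of z y] that by simp
      qed (use rng[OF s] t in auto)
      then show ?thesis by simp
    qed
    also have "\<dots> \<le> (560 / \<epsilon> * (5 / 2 / t)) * \<bar>s - t\<bar>"
      using True x1 by (intro mult_right_mono mult_left_mono) (auto simp: K_def)
    finally have "cmod (?W y) * \<bar>?\<psi> s y - ?\<psi> t y\<bar> \<le> cmod (?W y) * ((560 / \<epsilon> * (5 / 2 / t)) * \<bar>s - t\<bar>)"
      by (intro mult_left_mono) auto
    moreover have "cmod (?W y * of_real (?\<psi> s y) - ?W y * of_real (?\<psi> t y)) = cmod (?W y) * \<bar>?\<psi> s y - ?\<psi> t y\<bar>"
      unfolding right_diff_distrib[symmetric] of_real_diff[symmetric] norm_mult norm_of_real by simp
    ultimately show ?thesis using True by (simp add: g_def mult_ac)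
  qed
  have der: "((\<lambda>s. ?W y * of_real (?\<psi> s y)) has_vector_derivative - (?W y * of_real (2 * cutoff1 \<epsilon> (dsq x1 (t *\<^sub>R y)) * (y \<bullet> (t *\<^sub>R y - x1))))) (at t)" for y
  proof -
    have "((\<lambda>s. complex_of_real (?\<psi> s y)) has_vector_derivative of_real (- (2 * cutoff1 \<epsilon> (dsq x1 (t *\<^sub>R y)) * (y \<bullet> (t *\<^sub>R y - x1))))) (at t)"
      by (rule has_vector_derivative_of_real[OF bump_deriv_pointwise[OF x1(2)]])
    from has_vector_derivative_mult_right[OF this, of "?W y"] show ?thesis by simp
  qed
  have int: "integrable lborel (\<lambda>y. ?W y * of_real (?\<psi> s y))" if "\<bar>s - t\<bar> < d" for s
    using bump_integrable[OF x1 rng(1,2)[OF that]] .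
  from has_vector_derivative_integral[OF d int gi lip der]
  show ?thesis unfolding bump_integral_def[abs_def] by simp
qed

text \<open>If \<open>w\<close> decays with the power \<open>m + 1\<close> of the distance, then
  \<open>bump_integral\<close> is trivially of order \<open>t^m\<close>. By
  \<open>bump_identity\<close> its derivative is also of order \<open>t^m\<close>, although
  differentiating under the integral would only suggest \<open>t^(m-1)\<close>. Integrating the
  derivative from a much smaller \<open>s\<close> up to \<open>t\<close> therefore gains one
  power.\<close>

lemma bump_integral_small:
  assumes x1: "norm x1 = 1" "0 < \<epsilon>" "\<epsilon> \<le> 1/8" "4 * \<epsilon> \<le> x1 $ 3" and m: "m \<ge> 1" and L: "L > 0" and D: "D \<ge> 0"
    and decay: "\<And>y. y \<in> upper_half \<Longrightarrow> norm y \<ge> L \<Longrightarrow> norm y * cmod (w y) \<le> D / norm y ^ m"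
  obtains C T where "T > 0" "\<And>t. 0 < t \<Longrightarrow> t < T \<Longrightarrow> cmod (bump_integral \<epsilon> x1 t) \<le> C * t ^ (m + 1)"
proof -
  define v1 where "v1 = measure lborel (cball (0::real^3) 1)"
  have v1: "v1 > 0" using vol1_pos by (simp add: v1_def)
  define T where "T = min 1 (min (1 / (4 * R)) (3 / 4 / L))"
  have T: "T > 0" "T \<le> 1" "T \<le> 1 / (4 * R)" "T \<le> 3 / 4 / L" using R L by (auto simp: T_def)
  define E where "E = D * (4/3) ^ (m + 2)"
  have E: "E \<ge> 0" using D by (simp add: E_def)
  have wff: "cmod (w y * ff y) \<le> E * t ^ (m + 2)" if y: "y \<in> bump_supp \<epsilon> x1 t" and t: "0 < t" "t < T" for y t
  proof -
    note b = bump_suppD[OF y x1 t(1)]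
    have "t \<le> 3 / 4 / L" using t T by linarith
    then have "L \<le> 3 / 4 / t" using L t(1) by (simp add: field_simps)
    then have "norm y * cmod (w y) \<le> D / norm y ^ m" using decay[OF b(5)] b(7) by simp
    then have "cmod (w y) \<le> D / norm y ^ m / norm y" using b(6) by (subst pos_le_divide_eq) (simp_all only: mult.commute)
    then have "cmod (w y * ff y) \<le> D / norm y ^ m / norm y * (1 / norm y)"
      unfolding norm_mult norm_ff by (intro mult_right_mono) auto
    also have "\<dots> = D / norm y ^ (m + 2)" by (simp add: power2_eq_square)
    also have "\<dots> \<le> D / (3 / 4 / t) ^ (m + 2)"
      using b(6,7) D t by (intro divide_left_mono power_mono mult_pos_pos zero_less_power) auto
    also have "\<dots> = E * t ^ (m + 2)" unfolding E_def by (simp add: power_divide)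
    finally show ?thesis .
  qed
  have inb: "norm y \<le> 5 / 4 / t" if "y \<in> bump_supp \<epsilon> x1 t" "0 < t" for y t using bump_suppD(8)[OF that(1) x1 that(2)] .
  define C1 where "C1 = E * (4/3) * v1 * (5/4)^3"
  have J0: "cmod (bump_integral \<epsilon> x1 t) \<le> C1 * t ^ m" if t: "0 < t" "t < T" for t
  proof -
    have "cmod (bump_integral \<epsilon> x1 t) \<le> E * t ^ (m + 2) * (4/3 * t) * v1 * (5 / 4 / t)^3"
      unfolding bump_integral_def v1_def
    proof (rule integral_bound_cball)
      fix y
      show "cmod (w y * ff y / of_real (norm y) * of_real (1 - cutoff \<epsilon> (dsq x1 (t *\<^sub>R y)))) \<le> E * t ^ (m + 2) * (4/3 * t) * indicator (cball 0 (5 / 4 / t)) y"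
      proof (cases "y \<in> bump_supp \<epsilon> x1 t")
        case True
        note b = bump_suppD[OF True x1 t(1)]
        have i: "1 / norm y \<le> 4/3 * t" using b(2,6) by (simp add: field_simps)
        have "cmod (w y * ff y / of_real (norm y) * of_real (1 - cutoff \<epsilon> (dsq x1 (t *\<^sub>R y)))) = cmod (w y * ff y) * (1 / norm y) * (1 - cutoff \<epsilon> (dsq x1 (t *\<^sub>R y)))"
          using cutoff_bounds(3)[OF x1(2)] by (simp add: norm_mult norm_divide del: of_real_diff)
        also have "\<dots> \<le> (E * t ^ (m + 2)) * (4/3 * t) * 1"
          using wff[OF True t] i E t cutoff_bounds(3,4)[OF x1(2)] by (intro mult_mono) auto
        finally show ?thesis using inb[OF True t(1)] by simp
      qed (use bump_outside(1)[OF _ x1(2)] E t in auto)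
    qed (use E t in auto)
    also have "\<dots> = C1 * t ^ m" using t unfolding C1_def by (simp add: power_divide power_add power2_eq_square power3_eq_cube)
    finally show ?thesis .
  qed
  define B where "B = (840 / \<epsilon>^2 + 1680 / \<epsilon>^4) + 1120 / \<epsilon> * (4/3)"
  have B: "B \<ge> 0" using x1(2) by (simp add: B_def)
  define C2 where "C2 = E * B * v1 * (5/4)^3 / (2 * k)"
  have C2: "C2 \<ge> 0" using E B v1 k by (simp add: C2_def)
  define J' where "J' t = (LINT y|lborel. w y * ff y / of_real (norm y) * of_real (2 * cutoff1 \<epsilon> (dsq x1 (t *\<^sub>R y)) * (y \<bullet> (t *\<^sub>R y - x1))))" for t
  have J1: "cmod (J' t) \<le> C2 * t ^ m" if t: "0 < t" "t < T" for t
  proof -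
    have t2: "t < 1 / (2 * R)"
    proof -
      have "1 / (4 * R) \<le> 1 / (2 * R)" using R by (intro divide_left_mono) auto
      then show ?thesis using t T by linarith
    qed
    have "cmod (2 * \<i> * k * J' t) \<le> (E * t ^ (m + 2)) * (B * t) * v1 * (5 / 4 / t)^3"
      unfolding J'_def bump_identity[OF x1 t(1) t2, symmetric] v1_def
    proof (rule integral_bound_cball)
      fix y
      let ?c1 = "cutoff1 \<epsilon> (dsq x1 (t *\<^sub>R y))" and ?c2 = "cutoff2 \<epsilon> (dsq x1 (t *\<^sub>R y))" and ?\<sigma> = "dsq x1 (t *\<^sub>R y)"
      show "cmod (w y * ff y * of_real (t * (6 * ?c1 + 4 * ?\<sigma> * ?c2) - 4 * ?c1 * (y \<bullet> (t *\<^sub>R y - x1)) / (norm y)^2)) \<le> (E * t ^ (m + 2)) * (B * t) * indicator (cball 0 (5 / 4 / t)) y"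
      proof (cases "y \<in> bump_supp \<epsilon> x1 t")
        case False
        then show ?thesis using bump_outside[OF False x1(2)] E B t by simp
      next
        case True
        note b = bump_suppD[OF True x1 t(1)]
        have i: "1 / norm y \<le> 4/3 * t" using b(2,6) by (simp add: field_simps)
        have "?\<sigma> \<le> (2 * \<epsilon>)^2" using True by (simp add: bump_supp_def)
        also have "\<dots> \<le> 1^2" using x1 by (intro power_mono) auto
        finally have \<sigma>: "\<bar>?\<sigma>\<bar> \<le> 1" by simp
        have "\<bar>6 * ?c1 + 4 * ?\<sigma> * ?c2\<bar> \<le> 6 * \<bar>?c1\<bar> + 4 * (\<bar>?\<sigma>\<bar> * \<bar>?c2\<bar>)"
          using abs_triangle_ineq[of "6 * ?c1" "4 * ?\<sigma> * ?c2"] by (simp add: abs_mult)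
        also have "\<dots> \<le> 6 * (140 / \<epsilon>^2) + 4 * (1 * (420 / \<epsilon>^4))"
          using cutoff_bounds[OF x1(2)] \<sigma> by (intro add_mono mult_left_mono mult_mono) auto
        finally have 1: "\<bar>t * (6 * ?c1 + 4 * ?\<sigma> * ?c2)\<bar> \<le> t * (840 / \<epsilon>^2 + 1680 / \<epsilon>^4)"
          using t by (simp add: abs_mult)
        have "\<bar>4 * ?c1 * (y \<bullet> (t *\<^sub>R y - x1)) / (norm y)^2\<bar> = 2 * \<bar>2 * ?c1 * (y \<bullet> (t *\<^sub>R y - x1))\<bar> / (norm y)^2"
          by (simp add: abs_mult)
        also have "\<dots> \<le> 2 * (560 / \<epsilon> * norm y) / (norm y)^2"
          using bump_deriv_bound[OF x1 t(1), of y] by (intro divide_right_mono mult_left_mono) auto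
        also have "\<dots> = 1120 / \<epsilon> * (1 / norm y)" using b(6) by (simp add: power2_eq_square)
        also have "\<dots> \<le> 1120 / \<epsilon> * (4/3 * t)" using i x1(2) by (intro mult_left_mono) auto
        finally have 2: "\<bar>4 * ?c1 * (y \<bullet> (t *\<^sub>R y - x1)) / (norm y)^2\<bar> \<le> t * (1120 / \<epsilon> * (4/3))" by (simp add: mult_ac)
        have "\<bar>t * (6 * ?c1 + 4 * ?\<sigma> * ?c2) - 4 * ?c1 * (y \<bullet> (t *\<^sub>R y - x1)) / (norm y)^2\<bar> \<le> t * (840 / \<epsilon>^2 + 1680 / \<epsilon>^4) + t * (1120 / \<epsilon> * (4/3))"
          using abs_triangle_ineq4[of "t * (6 * ?c1 + 4 * ?\<sigma> * ?c2)" "4 * ?c1 * (y \<bullet> (t *\<^sub>R y - x1)) / (norm y)^2"] 1 2 by linarith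
        also have "\<dots> = B * t" unfolding B_def by (simp only: distrib_left[symmetric] mult.commute)
        finally have 3: "\<bar>t * (6 * ?c1 + 4 * ?\<sigma> * ?c2) - 4 * ?c1 * (y \<bullet> (t *\<^sub>R y - x1)) / (norm y)^2\<bar> \<le> B * t" .
        have "cmod (w y * ff y * of_real (t * (6 * ?c1 + 4 * ?\<sigma> * ?c2) - 4 * ?c1 * (y \<bullet> (t *\<^sub>R y - x1)) / (norm y)^2))
           = cmod (w y * ff y) * \<bar>t * (6 * ?c1 + 4 * ?\<sigma> * ?c2) - 4 * ?c1 * (y \<bullet> (t *\<^sub>R y - x1)) / (norm y)^2\<bar>"
          by (simp only: norm_mult norm_of_real)
        also have "\<dots> \<le> (E * t ^ (m + 2)) * (B * t)" using wff[OF True t] 3 E t by (intro mult_mono) auto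
        finally show ?thesis using inb[OF True t(1)] by simp
      qed
    qed (use E B t in auto)
    also have "\<dots> = C2 * t ^ m * (2 * k)"
      using t k unfolding C2_def by (simp add: power_divide power_add power2_eq_square power3_eq_cube)
    finally have "cmod (J' t) * (2 * k) \<le> C2 * t ^ m * (2 * k)" using k by (simp add: norm_mult mult_ac)
    then show ?thesis using k by simp
  qed
  have C1: "C1 \<ge> 0" using E v1 by (simp add: C1_def)
  have "cmod (bump_integral \<epsilon> x1 t) \<le> (C1 + C2) * t ^ (m + 1)" if t: "0 < t" "t < T" for t
  proof -
    \<comment> \<open>The starting point of the integration: the trivial bound there,
      \<open>C1 * s^m \<le> C1 * s\<close>, is already of order \<open>t^(m+1)\<close>. This is
      where \<open>m \<ge> 1\<close> enters; the coefficient of order 0 comes from the far field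
      instead.\<close>
    define s where "s = t ^ (m + 1)"
    have t1: "t < 1" using t T by simp
    have "t ^ (m + 1) \<le> t ^ 1" using t t1 by (intro power_decreasing) auto
    then have "s \<le> t" "0 < s" using t by (simp_all add: s_def)
    then have s: "0 < s" "s \<le> t" "s \<le> 1" using t1 by auto
    have sT: "s < T" using s t by simp
    have "norm (bump_integral \<epsilon> x1 t - bump_integral \<epsilon> x1 s) \<le> (C2 * t ^ m) * (t - s)"
    proof (rule norm_diff_le_of_vector_derivative[OF s(2)])
      fix u assume u: "u \<in> {s..t}"
      then have u': "0 < u" "u < T" "u < 1 / (4 * R)" using s t T by auto
      show "(bump_integral \<epsilon> x1 has_vector_derivative - J' u) (at u)"
        unfolding J'_def by (rule bump_integral_deriv[OF x1 u'(1,3)])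
      have "cmod (J' u) \<le> C2 * u ^ m" by (rule J1[OF u'(1,2)])
      also have "\<dots> \<le> C2 * t ^ m" using u u' C2 by (intro mult_left_mono power_mono) auto
      finally show "norm (- J' u) \<le> C2 * t ^ m" by simp
    qed
    also have "\<dots> \<le> (C2 * t ^ m) * t" using s t C2 by (intro mult_left_mono) auto
    finally have 1: "norm (bump_integral \<epsilon> x1 t - bump_integral \<epsilon> x1 s) \<le> C2 * t ^ (m + 1)" by (simp add: mult_ac)
    have "cmod (bump_integral \<epsilon> x1 s) \<le> C1 * s ^ m" by (rule J0[OF s(1) sT])
    also have "\<dots> \<le> C1 * s ^ 1" using s m C1 by (intro mult_left_mono power_decreasing) auto
    finally have "cmod (bump_integral \<epsilon> x1 s) \<le> C1 * t ^ (m + 1)" by (simp add: s_def)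
    with 1 have "cmod (bump_integral \<epsilon> x1 t) \<le> C2 * t ^ (m + 1) + C1 * t ^ (m + 1)"
      using norm_triangle_ineq2[of "bump_integral \<epsilon> x1 t" "bump_integral \<epsilon> x1 s"] by linarith
    then show ?thesis by (simp add: algebra_simps)
  qed
  then show ?thesis using that[OF T(1)] by blast
qed

end

text \<open>Direction and length each contribute one \<open>norm (x - x1)\<close>, and dividing by
  \<open>norm x \<ge> 3/4\<close> gives the factor 8/3, rounded up to 3.\<close>

lemma norm_sgn_diff_le:
  fixes x x1 :: "real^3"
  assumes "norm x1 = 1" "norm (x - x1) \<le> 1/4"
  shows "norm (sgn x - x1) \<le> 3 * norm (x - x1)"
proof -
  have n: "\<bar>norm x - 1\<bar> \<le> norm (x - x1)" using norm_triangle_ineq3[of x x1] assms(1) by simp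
  then have nx: "norm x \<ge> 3/4" using assms(2) by linarith
  have "sgn x - x1 = (1 / norm x) *\<^sub>R ((x - x1) + (1 - norm x) *\<^sub>R x1)"
  proof -
    have "(x - x1) + (1 - norm x) *\<^sub>R x1 = x - norm x *\<^sub>R x1" by (simp add: scaleR_diff_left)
    moreover have "norm x \<noteq> 0" using nx by linarith
    ultimately show ?thesis by (simp only: scaleR_diff_right scaleR_scaleR sgn_div_norm) (simp add: inverse_eq_divide)
  qed
  then have "norm (sgn x - x1) = 1 / norm x * norm ((x - x1) + (1 - norm x) *\<^sub>R x1)" by simp
  also have "\<dots> \<le> 4/3 * (2 * norm (x - x1))"
  proof (rule mult_mono)
    have "norm x > 0" using nx by linarith
    then show "1 / norm x \<le> 4/3" using nx by (subst pos_divide_le_eq) auto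
    show "norm ((x - x1) + (1 - norm x) *\<^sub>R x1) \<le> 2 * norm (x - x1)"
      using norm_triangle_ineq[of "x - x1" "(1 - norm x) *\<^sub>R x1"] assms(1) n by simp
  qed auto
  also have "\<dots> \<le> 3 * norm (x - x1)" by simp
  finally show ?thesis .
qed

context half_exterior
begin

text \<open>A weight that is nearly the constant \<open>t^(m+3) c\<close> on the bump leaves no room
  for cancellation. The bump equals 1 on a ball of radius \<open>\<epsilon> / t\<close>, whose
  volume turns \<open>t^(m+3)\<close> into \<open>t^m\<close>.\<close>

lemma bump_integral_large:
  assumes x1: "norm x1 = 1" "0 < \<epsilon>" "\<epsilon> \<le> 1/8" "4 * \<epsilon> \<le> x1 $ 3" and t: "0 < t" "t < 1 / (2 * R)"
    and c: "\<And>y. y \<in> bump_supp \<epsilon> x1 t \<Longrightarrow> cmod (w y * ff y / of_real (norm y) - of_real (t ^ (m + 3)) * c) \<le> t ^ (m + 3) * (cmod c / 2)"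
  shows "cmod (bump_integral \<epsilon> x1 t) \<ge> t ^ m * (cmod c / 2) * (measure lborel (cball (0::real^3) 1) * \<epsilon>^3)"
proof -
  let ?\<psi> = "\<lambda>y. 1 - cutoff \<epsilon> (dsq x1 (t *\<^sub>R y))"
  have \<psi>c: "continuous_on UNIV ?\<psi>"
    by (intro continuous_intros continuous_on_compose2[OF cutoff_cont(1)[OF x1(2), of UNIV]]) auto
  have \<psi>i: "integrable lborel ?\<psi>"
    by (rule integrable_continuous_compact_support[OF \<psi>c compact_bump_supp[OF t(1), of \<epsilon> x1]]) (use bump_outside(1)[OF _ x1(2)] in simp)
  define I where "I = (LINT y|lborel. ?\<psi> y)"
  have I: "measure lborel (cball (0::real^3) 1) * (\<epsilon> / t)^3 \<le> I"
  proof -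
    have e: "\<epsilon> / t > 0" using x1 t by simp
    have "measure lborel (cball (0::real^3) 1) * (\<epsilon> / t)^3 = measure lborel (cball ((1 / t) *\<^sub>R x1) (\<epsilon> / t))"
      using e content_cball[of "\<epsilon> / t" "(1 / t) *\<^sub>R x1"] content_cball[of 1 "0::real^3"] by simp
    also have "\<dots> = (LINT y|lborel. indicator (cball ((1 / t) *\<^sub>R x1) (\<epsilon> / t)) y)" by simp
    also have "\<dots> \<le> I" unfolding I_def
    proof (rule integral_mono[OF _ \<psi>i])
      show "integrable lborel (indicat_real (cball ((1 / t) *\<^sub>R x1) (\<epsilon> / t)))"
        using emeasure_lborel_cball_finite[of "(1 / t) *\<^sub>R x1" "\<epsilon> / t"] by (intro integrable_real_indicator) auto
      show "indicat_real (cball ((1 / t) *\<^sub>R x1) (\<epsilon> / t)) y \<le> ?\<psi> y" for y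
      proof (cases "y \<in> cball ((1 / t) *\<^sub>R x1) (\<epsilon> / t)")
        case True
        then have "dsq ((1 / t) *\<^sub>R x1) y \<le> (\<epsilon> / t)^2" using e by (subst dsq_le_iff_dist) auto
        then have "cutoff \<epsilon> (dsq x1 (t *\<^sub>R y)) = 0"
          using cutoff_left(1)[OF e] cutoff_scale(1)[OF t(1), of \<epsilon> x1 y] by simp
        then show ?thesis using True by simp
      qed (use cutoff_bounds(3)[OF x1(2)] in simp)
    qed
    finally show ?thesis .
  qed
  have I0: "I \<ge> 0" using I vol1_pos x1 t by (meson order_trans mult_nonneg_nonneg less_imp_le zero_le_power divide_nonneg_nonneg)
  let ?W = "\<lambda>y. w y * ff y / of_real (norm y)"
  have \<psi>ci: "integrable lborel (\<lambda>y. of_real (t ^ (m + 3)) * c * complex_of_real (?\<psi> y))"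
    by (intro integrable_mult_right integrable_of_real \<psi>i)
  have "cmod (bump_integral \<epsilon> x1 t - of_real (t ^ (m + 3)) * c * of_real I) = cmod (LINT y|lborel. ?W y * of_real (?\<psi> y) - of_real (t ^ (m + 3)) * c * of_real (?\<psi> y))"
    unfolding bump_integral_def Bochner_Integration.integral_diff[OF bump_integrable[OF x1 t] \<psi>ci] I_def
    by (simp only: integral_mult_right_zero integral_complex_of_real)
  also have "\<dots> \<le> (LINT y|lborel. cmod (?W y * of_real (?\<psi> y) - of_real (t ^ (m + 3)) * c * of_real (?\<psi> y)))"
    by (rule integral_norm_bound)
  also have "\<dots> \<le> (LINT y|lborel. t ^ (m + 3) * (cmod c / 2) * ?\<psi> y)"
  proof (rule integral_mono')
    show "integrable lborel (\<lambda>y. t ^ (m + 3) * (cmod c / 2) * ?\<psi> y)" by (intro integrable_mult_right \<psi>i)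
    show "0 \<le> t ^ (m + 3) * (cmod c / 2) * ?\<psi> y" for y
      using cutoff_bounds(3)[OF x1(2)] t by (intro mult_nonneg_nonneg) auto
    show "cmod (?W y * of_real (?\<psi> y) - of_real (t ^ (m + 3)) * c * of_real (?\<psi> y)) \<le> t ^ (m + 3) * (cmod c / 2) * ?\<psi> y" for y
    proof (cases "y \<in> bump_supp \<epsilon> x1 t")
      case True
      have "cmod (?W y * of_real (?\<psi> y) - of_real (t ^ (m + 3)) * c * of_real (?\<psi> y)) = cmod (?W y - of_real (t ^ (m + 3)) * c) * ?\<psi> y"
        unfolding left_diff_distrib[symmetric] norm_mult norm_of_real using cutoff_bounds(3)[OF x1(2)] by simp
      also have "\<dots> \<le> t ^ (m + 3) * (cmod c / 2) * ?\<psi> y"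
        using c[OF True] cutoff_bounds(3)[OF x1(2)] by (intro mult_right_mono) auto
      finally show ?thesis .
    qed (use bump_outside(1)[OF _ x1(2)] in simp)
  qed
  also have "\<dots> = t ^ (m + 3) * (cmod c / 2) * I" unfolding I_def by simp
  finally have 1: "cmod (bump_integral \<epsilon> x1 t - of_real (t ^ (m + 3)) * c * of_real I) \<le> t ^ (m + 3) * (cmod c / 2) * I" .
  have "cmod (of_real (t ^ (m + 3)) * c * of_real I) = t ^ (m + 3) * cmod c * I"
    using t I0 by (simp add: norm_mult norm_power)
  then have "cmod (bump_integral \<epsilon> x1 t) \<ge> t ^ (m + 3) * cmod c * I - t ^ (m + 3) * (cmod c / 2) * I"
    using 1 norm_triangle_ineq3[of "bump_integral \<epsilon> x1 t" "of_real (t ^ (m + 3)) * c * of_real I"] by linarith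
  also have "t ^ (m + 3) * cmod c * I - t ^ (m + 3) * (cmod c / 2) * I = t ^ (m + 3) * (cmod c / 2) * I" by simp
  finally have "cmod (bump_integral \<epsilon> x1 t) \<ge> t ^ (m + 3) * (cmod c / 2) * I" .
  moreover have "t ^ (m + 3) * (cmod c / 2) * (measure lborel (cball (0::real^3) 1) * (\<epsilon> / t)^3) \<le> t ^ (m + 3) * (cmod c / 2) * I"
    using I t by (intro mult_left_mono) auto
  moreover have "t ^ (m + 3) * (cmod c / 2) * (measure lborel (cball (0::real^3) 1) * (\<epsilon> / t)^3) = t ^ m * (cmod c / 2) * (measure lborel (cball (0::real^3) 1) * \<epsilon>^3)"
    using t by (simp add: power_add power_divide)
  ultimately show ?thesis by linarith
qed

text \<open>A nonzero coefficient of order \<open>m\<close> makes \<open>bump_integral\<close> at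
  least of order \<open>t^m\<close> for bumps around its direction, while the vanishing of all lower
  coefficients makes it at most of order \<open>t^(m+1)\<close>.\<close>

lemma coefficient_vanishes:
  assumes r0: "r0 > 0" "r0 < 1 / R"
    and G: "\<And>\<theta>. \<theta> \<in> upper_sphere \<Longrightarrow> G \<theta> holomorphic_on ball 0 r0"
      "\<And>\<theta> z. \<theta> \<in> upper_sphere \<Longrightarrow> z \<in> ball 0 r0 \<Longrightarrow> cmod (G \<theta> z) \<le> M"
      "\<And>\<theta> t. \<theta> \<in> upper_sphere \<Longrightarrow> 0 < t \<Longrightarrow> t < r0 \<Longrightarrow>
       G \<theta> (complex_of_real t) = of_real (1 / t) * exp (- \<i> * of_real (k / t)) * w ((1 / t) *\<^sub>R \<theta>)"
    and m: "m \<ge> 1" "\<And>\<theta> j. \<theta> \<in> upper_sphere \<Longrightarrow> j < m \<Longrightarrow> (deriv ^^ j) (G \<theta>) 0 = 0"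
    and \<theta>1: "\<theta>1 \<in> upper_sphere"
  shows "(deriv ^^ m) (G \<theta>1) 0 = 0"
proof (rule ccontr)
  assume "(deriv ^^ m) (G \<theta>1) 0 \<noteq> 0"
  define cm where "cm \<theta> = (deriv ^^ m) (G \<theta>) 0 / fact m" for \<theta>
  define c where "c = cm \<theta>1"
  have c0: "cmod c > 0" using \<open>(deriv ^^ m) (G \<theta>1) 0 \<noteq> 0\<close> by (simp add: c_def cm_def)
  have us: "norm \<theta> = 1" "\<theta> $ 3 > 0" if "\<theta> \<in> upper_sphere" for \<theta> using that by (auto simp: upper_sphere_def)
  have M0: "M \<ge> 0" using order_trans[OF norm_ge_zero G(2)[OF \<theta>1, of 0]] r0 by simp
  define D where "D = 2 * M * (2 / r0) ^ m"
  define D2 where "D2 = 2 * M * (2 / r0) ^ (m + 1)"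
  have D0: "D \<ge> 0" "D2 \<ge> 0" using M0 r0 by (auto simp: D_def D2_def)
  have gb: "cmod (G \<theta> (of_real s)) \<le> D * s ^ m" "cmod (G \<theta> (of_real s) - cm \<theta> * of_real s ^ m) \<le> D2 * s ^ (m + 1)"
    if "\<theta> \<in> upper_sphere" "0 < s" "s \<le> r0 / 4" for \<theta> s
    using taylor_remainder_bound[OF G(1)[OF that(1)] G(2)[OF that(1)] r0(1) m(2)[OF that(1)], of m "of_real s"] that(2,3)
    by (auto simp: D_def D2_def cm_def power_divide power_mult_distrib mult_ac)
  have Gy: "G (sgn y) (of_real (1 / norm y)) = of_real (norm y) * exp (- \<i> * of_real (k * norm y)) * w y" "sgn y \<in> upper_sphere"
    if y: "y \<in> upper_half" "norm y \<ge> 4 / r0" for y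
  proof -
    have ny: "norm y > 0" using y r0 by (meson less_le_trans zero_less_divide_iff zero_less_numeral)
    have "sgn y $ 3 = y $ 3 / norm y" by (simp add: sgn_div_norm divide_inverse_commute)
    then show s: "sgn y \<in> upper_sphere" using y ny by (simp add: upper_sphere_def upper_half_def norm_sgn)
    have "4 / r0 > 1 / r0" using r0 by (simp add: divide_strict_right_mono)
    then have "norm y > 1 / r0" using y by simp
    then have "1 / norm y < r0" using r0 ny by (simp add: field_simps)
    from G(3)[OF s _ this] ny show "G (sgn y) (of_real (1 / norm y)) = of_real (norm y) * exp (- \<i> * of_real (k * norm y)) * w y"
      by (simp add: sgn_div_norm)
  qed
  have inv: "0 < 1 / norm y" "1 / norm y \<le> r0 / 4" if "norm y \<ge> 4 / r0" for y :: "real^3"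
  proof -
    have "4 / r0 > 0" using r0 by simp
    then have "norm y > 0" using that by linarith
    then show "0 < 1 / norm y" "1 / norm y \<le> r0 / 4" using that r0 by (auto simp: field_simps)
  qed
  have decay: "norm y * cmod (w y) \<le> D / norm y ^ m" if y: "y \<in> upper_half" "norm y \<ge> 4 / r0" for y
  proof -
    have "cmod (G (sgn y) (of_real (1 / norm y))) \<le> D * (1 / norm y) ^ m" by (rule gb(1)[OF Gy(2)[OF y] inv[OF y(2)]])
    then show ?thesis unfolding Gy(1)[OF y] norm_mult by (simp add: power_divide)
  qed
  \<comment> \<open>\<open>far_expansion\<close> says nothing about the dependence on the direction.
    Continuity of the coefficient is read off from the values of \<open>w\<close> on one sphere of
    radius \<open>1 / s\<close>, where the Taylor remainder is small uniformly in the
    direction.\<close>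
  have close: "\<exists>\<delta>>0. \<forall>\<theta>\<in>upper_sphere. norm (\<theta> - \<theta>1) < \<delta> \<longrightarrow> cmod (cm \<theta> - c) \<le> cmod c / 8"
  proof -
    define \<eta> where "\<eta> = cmod c / 8"
    have \<eta>: "\<eta> > 0" using c0 by (simp add: \<eta>_def)
    \<comment> \<open>Makes each of the two remainders \<open>D2 * s\<close> at most
      \<open>\<eta> / 4\<close>; another \<open>\<eta> / 4\<close> is spent on the continuity of
      \<open>w\<close>.\<close>
    define s where "s = min (r0 / 4) (\<eta> / (4 * (D2 + 1)))"
    have "0 < s" using r0 \<eta> D0 by (simp add: s_def)
    moreover have "s \<le> r0 / 4" unfolding s_def by (rule min.cobounded1)
    ultimately have s: "0 < s" "s \<le> r0 / 4" "s < r0" using r0 by auto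
    have "s \<le> \<eta> / (4 * (D2 + 1))" by (simp add: s_def)
    then have "s * (4 * (D2 + 1)) \<le> \<eta>" using D0 by (subst (asm) pos_le_divide_eq) auto
    then have sD: "D2 * s \<le> \<eta> / 4" using s(1) by (simp add: algebra_simps)
    define g where "g \<theta> = of_real (1 / s) * exp (- \<i> * of_real (k / s)) * w ((1 / s) *\<^sub>R \<theta>)" for \<theta>
    have o: "open (upper_half \<inter> {x. norm x > R})"
      using open_upper_half by (intro open_Int open_Collect_less continuous_intros) auto
    have "s < 1 / R" using s r0 by linarith
    then have "R < 1 / s" using s(1) R by (simp add: field_simps)
    then have "(1 / s) *\<^sub>R \<theta>1 \<in> upper_half \<inter> {x. norm x > R}" using us[OF \<theta>1] s by (simp add: upper_half_def)
    then have "isCont w ((1 / s) *\<^sub>R \<theta>1)" using w_C1(1) o by (simp add: continuous_on_eq_continuous_at)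
    then have "isCont (\<lambda>\<theta>. w ((1 / s) *\<^sub>R \<theta>)) \<theta>1"
      by (intro isCont_o2[where f="\<lambda>\<theta>. (1 / s) *\<^sub>R \<theta>" and g=w] isCont_scaleR continuous_const continuous_ident)
    then have "isCont g \<theta>1" unfolding g_def by (rule isCont_mult[OF continuous_const])
    then obtain \<delta> where \<delta>: "\<delta> > 0" "\<And>\<theta>. norm (\<theta> - \<theta>1) < \<delta> \<Longrightarrow> cmod (g \<theta> - g \<theta>1) < \<eta> / 4 * s ^ m"
      unfolding continuous_at_eps_delta using \<eta> s(1) by (auto simp: dist_norm dest!: spec[of _ "\<eta> / 4 * s ^ m"])
    have "cmod (cm \<theta> - c) \<le> \<eta>" if \<theta>: "\<theta> \<in> upper_sphere" "norm (\<theta> - \<theta>1) < \<delta>" for \<theta>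
    proof -
      have 1: "cmod (g \<theta> - cm \<theta> * of_real s ^ m) \<le> D2 * s ^ (m + 1)" using gb(2)[OF \<theta>(1) s(1,2)] G(3)[OF \<theta>(1) s(1,3)] by (simp add: g_def)
      have 2: "cmod (g \<theta>1 - c * of_real s ^ m) \<le> D2 * s ^ (m + 1)" using gb(2)[OF \<theta>1 s(1,2)] G(3)[OF \<theta>1 s(1,3)] by (simp add: g_def c_def)
      have e: "(cm \<theta> - c) * of_real s ^ m = (g \<theta> - g \<theta>1) - (g \<theta> - cm \<theta> * of_real s ^ m) + (g \<theta>1 - c * of_real s ^ m)" by (simp add: algebra_simps)
      have "cmod ((cm \<theta> - c) * of_real s ^ m) \<le> cmod (g \<theta> - g \<theta>1) + cmod (g \<theta> - cm \<theta> * of_real s ^ m) + cmod (g \<theta>1 - c * of_real s ^ m)"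
        unfolding e using norm_triangle_ineq[of "(g \<theta> - g \<theta>1) - (g \<theta> - cm \<theta> * of_real s ^ m)" "g \<theta>1 - c * of_real s ^ m"]
          norm_triangle_ineq4[of "g \<theta> - g \<theta>1" "g \<theta> - cm \<theta> * of_real s ^ m"] by linarith
      also have "\<dots> \<le> \<eta> / 4 * s ^ m + D2 * s ^ (m + 1) + D2 * s ^ (m + 1)" using \<delta>(2)[OF \<theta>(2)] 1 2 by linarith
      also have "\<dots> = (\<eta> / 4 + 2 * (D2 * s)) * s ^ m" by (simp add: algebra_simps)
      also have "\<dots> \<le> \<eta> * s ^ m" using sD s \<eta> by (intro mult_right_mono) auto
      finally have "cmod (cm \<theta> - c) * s ^ m \<le> \<eta> * s ^ m" using s by (simp add: norm_mult norm_power)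
      then show ?thesis using s by simp
    qed
    then show ?thesis using \<delta>(1) unfolding \<eta>_def by blast
  qed
  then obtain \<delta> where \<delta>: "\<delta> > 0" "\<And>\<theta>. \<theta> \<in> upper_sphere \<Longrightarrow> norm (\<theta> - \<theta>1) < \<delta> \<Longrightarrow> cmod (cm \<theta> - c) \<le> cmod c / 8" by blast
  obtain \<delta>2 where \<delta>2: "\<delta>2 > 0" "\<And>x::real^3. norm (x - \<theta>1) < \<delta>2 \<Longrightarrow> \<bar>1 / norm x ^ (m + 3) - 1\<bar> < 1/8"
  proof -
    have "isCont (\<lambda>x::real^3. 1 / norm x ^ (m + 3)) \<theta>1" using us[OF \<theta>1] by (intro continuous_intros) auto
    then obtain s where "s > 0" "\<And>x. norm (x - \<theta>1) < s \<Longrightarrow> \<bar>1 / norm x ^ (m + 3) - 1 / norm \<theta>1 ^ (m + 3)\<bar> < 1/8"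
      unfolding continuous_at_eps_delta by (auto simp: dist_norm dest!: spec[of _ "1/8"])
    then show ?thesis using that[of s] us(1)[OF \<theta>1] by simp
  qed
  \<comment> \<open>The first two bounds are those of \<open>bump_suppD\<close>. Scaled points of
    the bump are within \<open>2 * \<epsilon>\<close> of \<open>\<theta>1\<close>, so their
    directions are within \<open>6 * \<epsilon> < \<delta>\<close> by the third bound, and the
    powers of their norms are close to 1 by the fourth.\<close>
  define \<epsilon> where "\<epsilon> = Min {1/8, \<theta>1 $ 3 / 4, \<delta> / 12, \<delta>2 / 4}"
  have \<epsilon>: "0 < \<epsilon>" "\<epsilon> \<le> 1/8" "\<epsilon> \<le> \<theta>1 $ 3 / 4" "\<epsilon> \<le> \<delta> / 12" "\<epsilon> \<le> \<delta>2 / 4"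
  proof -
    show "0 < \<epsilon>" unfolding \<epsilon>_def using us[OF \<theta>1] \<delta>(1) \<delta>2(1) by (subst Min_gr_iff) auto
  qed (unfold \<epsilon>_def, (rule Min_le; simp)+)
  have x1: "norm \<theta>1 = 1" "0 < \<epsilon>" "\<epsilon> \<le> 1/8" "4 * \<epsilon> \<le> \<theta>1 $ 3" using us[OF \<theta>1] \<epsilon> by auto
  have L: "4 / r0 > 0" using r0 by simp
  obtain C T where C: "T > 0" "\<And>t. 0 < t \<Longrightarrow> t < T \<Longrightarrow> cmod (bump_integral \<epsilon> \<theta>1 t) \<le> C * t ^ (m + 1)"
    using bump_integral_small[OF x1 m(1) L D0(1) decay] by blast
  define v where "v = cmod c / 2 * (measure lborel (cball (0::real^3) 1) * \<epsilon>^3)"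
  have v: "v > 0" using c0 vol1_pos \<epsilon> by (simp add: v_def)
  \<comment> \<open>In order: the range of the upper estimate, the exterior of the ball, the range
    \<open>norm y \<ge> 4 / r0\<close> of the Taylor estimates, a remainder of at most
    \<open>cmod c / 8\<close>, and the final contradiction
    \<open>v \<le> C * t \<le> v / 2\<close>.\<close>
  define t where "t = Min {T / 2, 1 / (4 * R), 3 * r0 / 16, 3 * cmod c / (32 * (D2 + 1)), v / (2 * (\<bar>C\<bar> + 1))}"
  have t: "0 < t" "t \<le> T / 2" "t \<le> 1 / (4 * R)" "t \<le> 3 * r0 / 16" "t \<le> 3 * cmod c / (32 * (D2 + 1))" "t \<le> v / (2 * (\<bar>C\<bar> + 1))"
  proof -
    show "0 < t" unfolding t_def using C(1) R r0 c0 D0 v by (subst Min_gr_iff) (auto intro!: divide_pos_pos)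
  qed (unfold t_def, (rule Min_le; simp)+)
  have t2: "t < 1 / (2 * R)"
  proof -
    have "1 / (4 * R) < 1 / (2 * R)" using R by (intro divide_strict_left_mono) auto
    then show ?thesis using t by linarith
  qed
  have "cmod (w y * ff y / of_real (norm y) - of_real (t ^ (m + 3)) * c) \<le> t ^ (m + 3) * (cmod c / 2)"
    if y: "y \<in> bump_supp \<epsilon> \<theta>1 t" for y
  proof -
    note b = bump_suppD[OF y x1 t(1)]
    define x where "x = t *\<^sub>R y"
    have nx: "norm x = t * norm y" using t by (simp add: x_def)
    have nx0: "norm x > 0" using b(2) nx by linarith
    have "4 / r0 \<le> 3 / 4 / t" using t r0 by (simp add: field_simps)
    then have far: "norm y \<ge> 4 / r0" using b(7) by linarith
    define s where "s = 1 / norm y"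
    have s: "0 < s" "s \<le> r0 / 4" using inv[OF far] by (auto simp: s_def)
    have st: "s = t / norm x" using b(6) t by (simp add: s_def nx)
    have "s \<le> 4/3 * t" unfolding s_def using b(2,6) by (simp add: field_simps)
    moreover have "t * (32 * (D2 + 1)) \<le> 3 * cmod c" using t(5) D0 by (subst (asm) pos_le_divide_eq) auto
    ultimately have D2s: "D2 * s \<le> cmod c / 8"
    proof -
      have "D2 * s \<le> (D2 + 1) * (4/3 * t)" using D0 s \<open>s \<le> 4/3 * t\<close> by (intro mult_mono) auto
      also have "\<dots> \<le> cmod c / 8" using \<open>t * (32 * (D2 + 1)) \<le> 3 * cmod c\<close> by (simp add: field_simps)
      finally show ?thesis .
    qed
    let ?\<theta> = "sgn y"
    have \<theta>: "?\<theta> \<in> upper_sphere" by (rule Gy(2)[OF b(5) far])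
    have sx: "sgn x = sgn y" using t by (simp add: x_def sgn_scaleR)
    have xd: "norm (x - \<theta>1) \<le> 2 * \<epsilon>" using b(1) by (simp add: x_def)
    have "norm (sgn x - \<theta>1) \<le> 3 * norm (x - \<theta>1)" by (rule norm_sgn_diff_le[OF x1(1)]) (use xd \<epsilon> in linarith)
    then have "norm (?\<theta> - \<theta>1) < \<delta>" using xd \<epsilon> \<delta>(1) unfolding sx by linarith
    then have 1: "cmod (cm ?\<theta> - c) \<le> cmod c / 8" by (rule \<delta>(2)[OF \<theta>])
    have 2: "\<bar>1 / norm x ^ (m + 3) - 1\<bar> < 1/8" by (rule \<delta>2(2)) (use xd \<epsilon> \<delta>2(1) in linarith)
    \<comment> \<open>The coefficient as seen at distance \<open>1 / s\<close>. Relative to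
      \<open>cmod c\<close> the errors add up to \<open>9/8 * 1/4 + 1/8\<close>, which is below
      1/2.\<close>
    define q where "q = G ?\<theta> (of_real s) / of_real s ^ m"
    have g1: "cmod (G ?\<theta> (of_real s) - cm ?\<theta> * of_real s ^ m) \<le> D2 * s ^ (m + 1)" by (rule gb(2)[OF \<theta> s])
    have g2: "q - cm ?\<theta> = (G ?\<theta> (of_real s) - cm ?\<theta> * of_real s ^ m) / of_real s ^ m" using s by (simp add: q_def diff_divide_distrib)
    have "cmod (q - cm ?\<theta>) = cmod (G ?\<theta> (of_real s) - cm ?\<theta> * of_real s ^ m) / s ^ m"
      unfolding g2 norm_divide norm_power using s by simp
    also have "\<dots> \<le> D2 * s ^ (m + 1) / s ^ m" using s g1 by (intro divide_right_mono) auto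
    also have "\<dots> = D2 * s" using s by simp
    finally have "cmod (q - cm ?\<theta>) \<le> cmod c / 8" using D2s by simp
    then have qc: "cmod (q - c) \<le> cmod c / 4" using 1 norm_triangle_ineq[of "q - cm ?\<theta>" "cm ?\<theta> - c"] by simp
    have exp: "exp (- \<i> * of_real (k * norm y)) = of_real (norm y) * ff y"
      unfolding ff_def fund_def Let_def sqrt_dsq using b(6) by (simp add: mult_ac)
    have "w y * ff y / of_real (norm y) = G ?\<theta> (of_real s) / of_real (norm y ^ 3)"
      unfolding s_def Gy(1)[OF b(5) far] exp using b(6) by (simp add: power3_eq_cube)
    also have "\<dots> = of_real (t ^ (m + 3)) * (of_real (1 / norm x ^ (m + 3)) * q)"
    proof -
      have "norm y = norm x / t" using t nx by simp
      moreover have "s ^ m = t ^ m / norm x ^ m" by (simp add: st power_divide)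
      ultimately show ?thesis unfolding q_def using t(1) nx0 s(1)
        by (simp add: power_add power_divide of_real_power[symmetric] del: of_real_power)
    qed
    finally have W: "w y * ff y / of_real (norm y) = of_real (t ^ (m + 3)) * (of_real (1 / norm x ^ (m + 3)) * q)" .
    define \<nu> where "\<nu> = 1 / norm x ^ (m + 3)"
    have \<nu>: "\<bar>\<nu> - 1\<bar> < 1/8" using 2 by (simp add: \<nu>_def)
    have "of_real \<nu> * q - c = of_real \<nu> * (q - c) + of_real (\<nu> - 1) * c" by (simp add: algebra_simps)
    then have "cmod (of_real \<nu> * q - c) \<le> \<bar>\<nu>\<bar> * cmod (q - c) + \<bar>\<nu> - 1\<bar> * cmod c"
      using norm_triangle_ineq[of "of_real \<nu> * (q - c)" "of_real (\<nu> - 1) * c"] by (simp only: norm_mult norm_of_real)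
    also have "\<dots> \<le> 9/8 * (cmod c / 4) + 1/8 * cmod c"
    proof (intro add_mono mult_mono)
      show "\<bar>\<nu>\<bar> \<le> 9/8" "\<bar>\<nu> - 1\<bar> \<le> 1/8" using \<nu> by linarith+
    qed (use qc in auto)
    also have "\<dots> \<le> cmod c / 2" using c0 by simp
    finally have "cmod (of_real \<nu> * q - c) \<le> cmod c / 2" .
    then have "t ^ (m + 3) * cmod (of_real \<nu> * q - c) \<le> t ^ (m + 3) * (cmod c / 2)" using t(1) by (intro mult_left_mono) auto
    moreover have "cmod (w y * ff y / of_real (norm y) - of_real (t ^ (m + 3)) * c) = t ^ (m + 3) * cmod (of_real \<nu> * q - c)"
      unfolding W \<nu>_def[symmetric] right_diff_distrib[symmetric] norm_mult[of "of_real (t ^ (m + 3))"] norm_of_real using t(1) by simp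
    ultimately show ?thesis by simp
  qed
  from bump_integral_large[OF x1 t(1) t2 this]
  have "t ^ m * v \<le> cmod (bump_integral \<epsilon> \<theta>1 t)" by (simp add: v_def mult_ac)
  also have "\<dots> \<le> C * t ^ (m + 1)" using C(2)[OF t(1)] t(2) C(1) by simp
  finally have "t ^ m * v \<le> t ^ m * (C * t)" by (simp add: mult_ac)
  then have "v \<le> C * t" using t(1) by simp
  also have "\<dots> \<le> (\<bar>C\<bar> + 1) * t" using t(1) by (intro mult_right_mono) auto
  also have "\<dots> \<le> v / 2"
  proof -
    have "t * (2 * (\<bar>C\<bar> + 1)) \<le> v" using t(6) by (subst (asm) pos_le_divide_eq) auto
    then show ?thesis by (simp add: algebra_simps)
  qed
  finally show False using v by simp
qed

text \<open>The induction on the order runs over all directions at once, because its step uses the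
  decay of \<open>w\<close> on a whole cone around a direction. Order 0 is the value of
  \<open>G \<theta>\<close> at 0, which continuity identifies with the limit along the ray.\<close>

lemma vanishing_at_infinity:
  assumes far: "\<And>\<theta>. \<theta> \<in> upper_sphere \<Longrightarrow>
      ((\<lambda>r. of_real r * exp (- \<i> * of_real (k * r)) * w (r *\<^sub>R \<theta>)) \<longlongrightarrow> 0) at_top"
  obtains \<rho> where "\<And>x. x \<in> upper_half \<Longrightarrow> norm x > \<rho> \<Longrightarrow> w x = 0"
proof -
  obtain r0 M G where r0: "r0 > 0" and G: "\<And>\<theta>. \<theta> \<in> upper_sphere \<Longrightarrow> G \<theta> holomorphic_on ball 0 r0"
    "\<And>\<theta> z. \<theta> \<in> upper_sphere \<Longrightarrow> z \<in> ball 0 r0 \<Longrightarrow> cmod (G \<theta> z) \<le> M"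
    "\<And>\<theta> t. \<theta> \<in> upper_sphere \<Longrightarrow> 0 < t \<Longrightarrow> t < r0 \<Longrightarrow>
       G \<theta> (complex_of_real t) = of_real (1 / t) * exp (- \<i> * of_real (k / t)) * w ((1 / t) *\<^sub>R \<theta>)"
    and r0R: "r0 < 1 / R"
    using far_expansion by metis
  have zero: "(deriv ^^ m) (G \<theta>) 0 = 0" if "\<theta> \<in> upper_sphere" for m \<theta>
    using that
  proof (induction m arbitrary: \<theta> rule: less_induct)
    case (less m)
    show ?case
    proof (cases "m = 0")
      case False
      then show ?thesis using coefficient_vanishes[OF r0 r0R G _ less.IH less.prems] by simp
    next
      case True
      have inv: "filterlim (\<lambda>t::real. 1 / t) at_top (at_right 0)"
        using filterlim_inverse_at_top_right by (simp add: inverse_eq_divide)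
      have "((\<lambda>t. of_real (1 / t) * exp (- \<i> * of_real (k * (1 / t))) * w ((1 / t) *\<^sub>R \<theta>)) \<longlongrightarrow> 0) (at_right 0)"
        by (rule filterlim_compose[OF far[OF less.prems] inv])
      moreover have "\<forall>\<^sub>F t in at_right 0. of_real (1 / t) * exp (- \<i> * of_real (k * (1 / t))) * w ((1 / t) *\<^sub>R \<theta>) = G \<theta> (of_real t)"
        unfolding eventually_at_right_field
      proof (intro exI[of _ r0] conjI r0 allI impI)
        fix t assume "0 < t" "t < r0"
        then show "of_real (1 / t) * exp (- \<i> * of_real (k * (1 / t))) * w ((1 / t) *\<^sub>R \<theta>) = G \<theta> (of_real t)"
          using G(3)[OF less.prems, of t] by simp
      qed
      ultimately have "((\<lambda>t. G \<theta> (of_real t)) \<longlongrightarrow> 0) (at_right (0::real))" by (rule Lim_transform_eventually)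
      moreover have "((\<lambda>t. G \<theta> (of_real t)) \<longlongrightarrow> G \<theta> 0) (at_right (0::real))"
      proof -
        have "isCont (G \<theta>) (of_real 0)"
          using holomorphic_on_imp_continuous_on[OF G(1)[OF less.prems]] r0 by (simp add: continuous_on_eq_continuous_at)
        moreover have "((\<lambda>t. complex_of_real t) \<longlongrightarrow> of_real 0) (at_right 0)" by (intro tendsto_intros)
        ultimately show ?thesis using isCont_tendsto_compose by fastforce
      qed
      ultimately have "G \<theta> 0 = 0" using tendsto_unique[OF trivial_limit_at_right_real, of "\<lambda>t. G \<theta> (of_real t)"] by blast
      then show ?thesis using True by simp
    qed
  qed
  have "w x = 0" if x: "x \<in> upper_half" "norm x > 1 / r0" for x
  proof -
    have nx: "norm x > 0" using x r0 by (meson less_trans zero_less_divide_1_iff)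
    have "sgn x $ 3 = x $ 3 / norm x" by (simp add: sgn_div_norm divide_inverse_commute)
    then have s: "sgn x \<in> upper_sphere" using x nx by (simp add: upper_sphere_def upper_half_def norm_sgn)
    have t: "0 < 1 / norm x" "1 / norm x < r0" using nx x r0 by (auto simp: field_simps)
    have "of_real (1 / norm x) \<in> ball (0::complex) r0" using t by (simp add: norm_divide)
    from holomorphic_power_series[OF G(1)[OF s] this] have "(\<lambda>n. 0) sums G (sgn x) (of_real (1 / norm x))" by (simp add: zero[OF s])
    then have "G (sgn x) (of_real (1 / norm x)) = 0" using sums_unique2 sums_zero by blast
    then show ?thesis using G(3)[OF s t] nx by (simp add: sgn_div_norm)
  qed
  then show ?thesis using that by blast
qed

end

section \<open>Analyticity along vertical lines\<close>

text \<open>The squared distance from \<open>y\<close> to the point at height \<open>z\<close> over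
  \<open>x0\<close>, continued to complex \<open>z\<close>.\<close>

definition vq :: "real^3 \<Rightarrow> complex \<Rightarrow> real^3 \<Rightarrow> complex" where
  "vq x0 z y = of_real (dsq x0 y) - 2 * z * of_real ((y - x0) $ 3) + z^2"

lemma vq_real: "vq x0 (of_real t) y = of_real (dsq (x0 + t *\<^sub>R axis 3 1) y)"
proof -
  have "dsq (x0 + t *\<^sub>R axis 3 1) y = dsq x0 y - 2 * t * ((y - x0) $ 3) + t^2"
    unfolding dsq_eq_sum by (simp add: sum_3 axis_def power2_eq_square algebra_simps)
  then show ?thesis by (simp add: vq_def)
qed

text \<open>Here \<open>cmod z\<close> is below a quarter of the distance from \<open>y\<close> to
  \<open>x0\<close>, so \<open>vq\<close> deviates from the squared distance by at most
  \<open>1/16 + 1/2\<close> of it and stays in the right half plane.\<close>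

lemma vq_bounds:
  assumes n: "\<delta> \<le> norm (y - x0)" "norm (y - x0) \<le> 2 * \<delta>" "\<delta> > 0" and z: "cmod z < \<delta> / 4"
  shows "vq x0 z y \<notin> \<real>\<^sub>\<le>\<^sub>0" "vq x0 z y \<noteq> 0" "cmod (csqrt (vq x0 z y)) \<ge> \<delta> / 2" "cmod (csqrt (vq x0 z y)) \<le> 3 * \<delta>"
proof -
  let ?n = "norm (y - x0)"
  have "cmod (vq x0 z y - of_real (?n^2)) = cmod (z^2 - 2 * z * of_real ((y - x0) $ 3))"
    by (simp add: vq_def dsq_def algebra_simps)
  also have "\<dots> \<le> (cmod z)^2 + 2 * (cmod z * \<bar>(y - x0) $ 3\<bar>)"
    using norm_triangle_ineq4[of "z^2" "2 * z * of_real ((y - x0) $ 3)"] by (simp add: norm_mult norm_power del: of_real_diff)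
  also have "\<dots> \<le> (?n / 4)^2 + 2 * (?n / 4 * ?n)"
    using z n component_le_norm_cart[of "y - x0" 3] by (intro add_mono power_mono mult_left_mono mult_mono) auto
  also have "\<dots> = 9/16 * ?n^2" by (simp add: power2_eq_square)
  finally have d: "cmod (vq x0 z y - of_real (?n^2)) \<le> 9/16 * ?n^2" .
  have n2: "?n^2 \<ge> \<delta>^2" "?n^2 \<le> 4 * \<delta>^2" "\<delta>^2 > 0"
    using power_mono[of \<delta> ?n 2] power_mono[of ?n "2 * \<delta>" 2] n by (auto simp: power_mult_distrib)
  have "\<bar>Re (vq x0 z y - of_real (?n^2))\<bar> \<le> 9/16 * ?n^2" using order_trans[OF abs_Re_le_cmod d] .
  then have "Re (vq x0 z y) \<ge> ?n^2 - 9/16 * ?n^2" by (simp only: minus_complex.sel Re_complex_of_real)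
  then have re: "Re (vq x0 z y) > 0" using n2 by linarith
  then show "vq x0 z y \<notin> \<real>\<^sub>\<le>\<^sub>0" "vq x0 z y \<noteq> 0" by (auto simp: complex_nonpos_Reals_iff)
  have nn: "cmod (of_real (?n^2)) = ?n^2" by (simp add: norm_power)
  have "\<bar>cmod (vq x0 z y) - ?n^2\<bar> \<le> 9/16 * ?n^2" using order_trans[OF norm_triangle_ineq3 d] unfolding nn .
  then have b: "cmod (vq x0 z y) \<ge> \<delta>^2 / 4" "cmod (vq x0 z y) \<le> 9 * \<delta>^2" using n2 by linarith+
  have sq: "(cmod (csqrt (vq x0 z y)))^2 = cmod (vq x0 z y)" by (metis norm_power power2_csqrt)
  show "cmod (csqrt (vq x0 z y)) \<ge> \<delta> / 2"
    by (rule power2_le_imp_le) (use b sq in \<open>auto simp: power_divide\<close>)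
  show "cmod (csqrt (vq x0 z y)) \<le> 3 * \<delta>"
    by (rule power2_le_imp_le) (use b sq n in \<open>auto simp: power_mult_distrib\<close>)
qed

text \<open>In \<open>representation\<close> the cutoff around \<open>x0\<close> can stay fixed
  while the evaluation point moves on a short vertical segment, since the gradient of the cutoff
  lives on an annulus away from that segment. The height then enters only through the kernel, which
  is holomorphic in it.\<close>

lemma holomorphic_along_vertical:
  assumes D: "open D" and h: "helmholtz_C2 k D w p" and k: "k > 0" and \<delta>: "\<delta> > 0" "cball x0 (2 * \<delta>) \<subseteq> D"
  obtains F where "F holomorphic_on ball 0 (\<delta> / 4)"
    "\<And>t. \<bar>t\<bar> < \<delta> / 4 \<Longrightarrow> w (x0 + t *\<^sub>R axis 3 1) = F (complex_of_real t)"
proof -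
  interpret weak_helmholtz k D w p False by (rule weak_helmholtz_classical[OF D h])
  have wc: "continuous_on D w" using h by (simp add: helmholtz_C2_def)
  let ?K = "cball x0 (2 * \<delta>)" and ?B = "ball 0 (\<delta> / 4) :: complex set"
  define A where "A = cball x0 (2 * \<delta>) - ball x0 \<delta>"
  have A: "compact A" by (simp add: A_def compact_diff)
  have An: "\<delta> \<le> norm (y - x0)" "norm (y - x0) \<le> 2 * \<delta>" if "y \<in> A" for y
    using that by (auto simp: A_def dist_norm norm_minus_commute)
  define h0 h1 where "h0 s = complex_of_real (1 - cutoff \<delta> s)" and "h1 s = complex_of_real (- cutoff1 \<delta> s)" for s
  have hd: "(h0 has_vector_derivative h1 s) (at s)" for s
    unfolding h0_def[abs_def] h1_def
    by (intro has_vector_derivative_of_real, use cutoff_derivs(1)[OF \<delta>(1)] in \<open>auto intro!: derivative_eq_intros\<close>)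
  have h1c: "continuous_on UNIV h1" unfolding h1_def[abs_def] by (intro continuous_intros cutoff_cont \<delta>(1))
  define D\<eta> where "D\<eta> i y = of_real (2 * (y - x0) $ i) * h1 (dsq x0 y)" for i and y :: "real^3"
  have \<eta>: "C1_fun (\<lambda>y. h0 (dsq x0 y)) D\<eta>" unfolding D\<eta>_def by (rule C1_fun_radial[OF hd h1c])
  have h00: "h0 (dsq x0 y) = 0" if "y \<notin> ?K" for y
  proof -
    have "\<not> dsq x0 y \<le> (2 * \<delta>)^2" using that \<delta>(1) by (subst dsq_le_iff_dist) auto
    then have "dsq x0 y > 4 * \<delta>^2" by (simp add: power_mult_distrib)
    then have "dsq x0 y \<ge> 2 * \<delta>^2" using zero_le_power2[of \<delta>] by linarith
    then show ?thesis unfolding h0_def using cutoff_right(1)[OF \<delta>(1)] by simp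
  qed
  have D0: "D\<eta> i y = 0" if "y \<notin> A" for i y
  proof (cases "y \<in> ?K")
    case True
    then have "dsq x0 y \<le> \<delta>^2" using that \<delta>(1) by (subst dsq_le_iff_dist) (auto simp: A_def)
    then show ?thesis unfolding D\<eta>_def h1_def using cutoff_left(2)[OF \<delta>(1)] by simp
  next
    case False
    then show ?thesis using C1_fun_zero_outside[OF \<eta> closed_cball h00] by blast
  qed
  have AD: "A \<subseteq> D" using \<delta>(2) by (auto simp: A_def)
  have pi: "integrable lborel (\<lambda>y. p i y * D\<eta> i y)" for i
    by (rule integrable_mult_compact_support[OF p_int[OF A AD] C1_funD(3)[OF \<eta>] A D0])
  have wi: "integrable lborel (\<lambda>y. w y * D\<eta> i y)" for i
    by (rule integrable_mult_compact_support[OF w_int[OF A AD] C1_funD(3)[OF \<eta>] A D0])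
  define E0 where "E0 z y = indicator A y *\<^sub>R (exp (\<i> * k * csqrt (vq x0 z y)) / csqrt (vq x0 z y))" for z y
  define E1 where "E1 i z y = indicator A y *\<^sub>R (2 * (of_real ((y - x0) $ i) - (if i = 3 then z else 0)) *
     (exp (\<i> * k * csqrt (vq x0 z y)) * (\<i> * k * csqrt (vq x0 z y) - 1) / (2 * csqrt (vq x0 z y) ^ 3)))" for i :: 3 and z y
  have cs0: "csqrt (vq x0 z y) \<noteq> 0" if "y \<in> A" "z \<in> ?B" for y z
    using vq_bounds(2)[OF An[OF that(1)] \<delta>(1)] that(2) by simp
  have hol: "(\<lambda>z. csqrt (vq x0 z y)) holomorphic_on ?B" if "y \<in> A" for y
  proof -
    have q: "(\<lambda>z. vq x0 z y) holomorphic_on ?B" unfolding vq_def by (intro holomorphic_intros)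
    have "(\<lambda>z. vq x0 z y) ` ?B \<subseteq> - \<real>\<^sub>\<le>\<^sub>0" using vq_bounds(1)[OF An[OF that] \<delta>(1)] by auto
    from holomorphic_on_compose_gen[OF q holomorphic_on_csqrt this] show ?thesis by (simp add: o_def)
  qed
  have E0h: "(\<lambda>z. E0 z y) holomorphic_on ?B" for y
    using cs0[of y] hol[of y] unfolding E0_def by (cases "y \<in> A") (auto intro!: holomorphic_intros)
  have E1h: "(\<lambda>z. E1 i z y) holomorphic_on ?B" for i y
    using cs0[of y] hol[of y] unfolding E1_def by (cases "y \<in> A"; cases "i = 3") (auto intro!: holomorphic_intros)
  have csc: "continuous_on A (\<lambda>y. csqrt (vq x0 z y))" if "z \<in> ?B" for z
  proof (rule continuous_on_compose2[of "- \<real>\<^sub>\<le>\<^sub>0" csqrt])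
    show "continuous_on A (\<lambda>y. vq x0 z y)" unfolding vq_def by (intro continuous_intros)
    show "(\<lambda>y. vq x0 z y) ` A \<subseteq> - \<real>\<^sub>\<le>\<^sub>0" using vq_bounds(1)[OF An \<delta>(1)] that by auto
  qed (rule continuous_on_csqrt)
  have As: "A \<in> sets borel" using A by (simp add: borel_compact)
  have E0m: "E0 z \<in> borel_measurable lborel" if "z \<in> ?B" for z
    unfolding E0_def measurable_lborel2
    by (rule borel_measurable_continuous_on_indicator[OF As]) (use cs0 that csc[OF that] in \<open>auto intro!: continuous_intros\<close>)
  have E1m: "E1 i z \<in> borel_measurable lborel" if "z \<in> ?B" for z i
    unfolding E1_def measurable_lborel2
    by (rule borel_measurable_continuous_on_indicator[OF As]) (use cs0 that csc[OF that] in \<open>auto intro!: continuous_intros\<close>)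
  define X where "X = exp (k * (3 * \<delta>))"
  have ex: "cmod (exp (\<i> * k * csqrt (vq x0 z y))) \<le> X" if "y \<in> A" "z \<in> ?B" for y z
  proof -
    have "cmod (exp (\<i> * k * csqrt (vq x0 z y))) \<le> exp (cmod (\<i> * k * csqrt (vq x0 z y)))" by (rule norm_exp)
    also have "\<dots> \<le> X" unfolding X_def using vq_bounds(4)[OF An[OF that(1)] \<delta>(1)] that(2) k by (simp add: norm_mult)
    finally show ?thesis .
  qed
  define B0 where "B0 = X / (\<delta> / 2)"
  define B1 where "B1 = 2 * (3 * \<delta>) * (X * (k * (3 * \<delta>) + 1) / (2 * (\<delta> / 2)^3))"
  have X0: "X > 0" by (simp add: X_def)
  have B0: "B0 \<ge> 0" "B1 \<ge> 0" using X0 \<delta>(1) k by (auto simp: B0_def B1_def)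
  have E0b: "cmod (E0 z y) \<le> B0" if "z \<in> ?B" for z y
  proof (cases "y \<in> A")
    case True
    have "cmod (E0 z y) = cmod (exp (\<i> * k * csqrt (vq x0 z y))) / cmod (csqrt (vq x0 z y))" using True by (simp add: E0_def norm_divide)
    also have "\<dots> \<le> B0" unfolding B0_def using ex[OF True that] vq_bounds(3)[OF An[OF True] \<delta>(1)] that \<delta>(1) X0 by (intro frac_le) auto
    finally show ?thesis .
  qed (simp add: E0_def B0)
  have E1b: "cmod (E1 i z y) \<le> B1" if "z \<in> ?B" for i z y
  proof (cases "y \<in> A")
    case True
    let ?s = "csqrt (vq x0 z y)"
    have s: "cmod ?s \<ge> \<delta> / 2" "cmod ?s \<le> 3 * \<delta>" using vq_bounds(3,4)[OF An[OF True] \<delta>(1)] that by auto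
    have "\<bar>(y - x0) $ i\<bar> \<le> 2 * \<delta>" using order_trans[OF component_le_norm_cart An(2)[OF True]] .
    moreover have "cmod (if i = 3 then z else 0) \<le> \<delta>" using that \<delta>(1) by auto
    ultimately have 1: "cmod (of_real ((y - x0) $ i) - (if i = 3 then z else 0)) \<le> 3 * \<delta>"
      using norm_triangle_ineq4[of "complex_of_real ((y - x0) $ i)" "if i = 3 then z else 0"] unfolding norm_of_real by linarith
    have 2: "cmod (\<i> * k * ?s - 1) \<le> k * (3 * \<delta>) + 1"
    proof -
      have "cmod (\<i> * k * ?s - 1) \<le> k * cmod ?s + 1"
        using norm_triangle_ineq4[of "\<i> * k * ?s" 1] k unfolding norm_mult by simp
      moreover have "k * cmod ?s \<le> k * (3 * \<delta>)" using s(2) k by (intro mult_left_mono) auto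
      ultimately show ?thesis by linarith
    qed
    have "cmod (E1 i z y) = 2 * cmod (of_real ((y - x0) $ i) - (if i = 3 then z else 0)) * (cmod (exp (\<i> * k * ?s)) * cmod (\<i> * k * ?s - 1) / (2 * cmod ?s ^ 3))"
      using True unfolding E1_def by (simp only: indicator_simps scaleR_one norm_mult norm_divide norm_power norm_numeral)
    also have "\<dots> \<le> B1" unfolding B1_def using 1 2 s ex[OF True that] \<delta>(1) X0 k
      by (intro mult_mono frac_le power_mono mult_left_mono) (auto intro!: mult_nonneg_nonneg divide_nonneg_nonneg)
    finally show ?thesis .
  qed (simp add: E1_def B0)
  define f where "f z y = (\<Sum>i\<in>UNIV. E0 z y * (p i y * D\<eta> i y) - E1 i z y * (w y * D\<eta> i y))" for z y
  define g where "g y = (\<Sum>i\<in>UNIV. B0 * cmod (p i y * D\<eta> i y) + B1 * cmod (w y * D\<eta> i y))" for y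
  have gi: "integrable lborel g" unfolding g_def using pi wi
    by (intro Bochner_Integration.integrable_sum Bochner_Integration.integrable_add integrable_mult_right integrable_norm)
  have fm: "f z \<in> borel_measurable lborel" if "z \<in> ?B" for z
    unfolding f_def
    by (intro borel_measurable_sum borel_measurable_diff borel_measurable_times[OF E0m[OF that] borel_measurable_integrable[OF pi]]
        borel_measurable_times[OF E1m[OF that] borel_measurable_integrable[OF wi]])
  have fh: "(\<lambda>z. f z y) holomorphic_on ?B" for y
    unfolding f_def by (intro holomorphic_intros E0h E1h)
  have fb: "cmod (f z y) \<le> g y" if "z \<in> ?B" for z y
    unfolding f_def g_def
  proof (rule sum_norm_le)
    fix i
    have "cmod (E0 z y * (p i y * D\<eta> i y) - E1 i z y * (w y * D\<eta> i y)) \<le> cmod (E0 z y) * cmod (p i y * D\<eta> i y) + cmod (E1 i z y) * cmod (w y * D\<eta> i y)"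
      using norm_triangle_ineq4[of "E0 z y * (p i y * D\<eta> i y)" "E1 i z y * (w y * D\<eta> i y)"] by (simp only: norm_mult)
    also have "\<dots> \<le> B0 * cmod (p i y * D\<eta> i y) + B1 * cmod (w y * D\<eta> i y)"
      using E0b[OF that] E1b[OF that] by (intro add_mono mult_right_mono) auto
    finally show "cmod (E0 z y * (p i y * D\<eta> i y) - E1 i z y * (w y * D\<eta> i y)) \<le> B0 * cmod (p i y * D\<eta> i y) + B1 * cmod (w y * D\<eta> i y)" .
  qed
  define F where "F z = (LINT y|lborel. f z y) / of_real kappa" for z
  have "F holomorphic_on ?B" unfolding F_def using kappa_neg
    by (intro holomorphic_intros holomorphic_integral(1)[OF gi fm fh fb]) auto
  moreover have "w (x0 + t *\<^sub>R axis 3 1) = F (complex_of_real t)" if t: "\<bar>t\<bar> < \<delta> / 4" for t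
  proof -
    let ?x = "x0 + t *\<^sub>R axis 3 1"
    have tB: "complex_of_real t \<in> ?B" using t by simp
    \<comment> \<open>A point moved by less than \<open>\<delta> / 4\<close> keeps a ball of radius
      \<open>\<delta> / 2\<close> within the region where the cutoff equals 1.\<close>
    have sub: "dist x0 y < \<delta>" if "y \<in> ball ?x (\<delta> / 2)" for y
    proof -
      have "dist x0 y \<le> dist x0 ?x + dist ?x y" by (rule dist_triangle)
      moreover have "dist x0 ?x = \<bar>t\<bar>" by (simp add: dist_norm)
      ultimately show ?thesis using that t by simp
    qed
    have "of_real kappa * w ?x = (LINT y|lborel. (\<Sum>i\<in>UNIV. ((\<Sum>c\<in>sources False ?x. fund k (dsq c y)) * p i y
        - w y * (\<Sum>c\<in>sources False ?x. of_real (2 * (y - c) $ i) * fund1 k (dsq c y))) * D\<eta> i y))"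
    proof (rule representation[OF _ _ _ _ _ \<eta> compact_cball \<delta>(2) h00])
      show "\<delta> / 2 > 0" using \<delta>(1) by simp
      have "ball ?x (\<delta> / 2) \<subseteq> D" using sub \<delta> by force
      then show "continuous_on (ball ?x (\<delta> / 2)) w" by (rule continuous_on_subset[OF wc])
      show "h0 (dsq x0 y) = 1" if "y \<in> ball ?x (\<delta> / 2)" for y
      proof -
        have "dsq x0 y \<le> \<delta>^2" using sub[OF that] \<delta>(1) by (subst dsq_le_iff_dist) auto
        then show ?thesis unfolding h0_def using cutoff_left(1)[OF \<delta>(1)] by simp
      qed
    qed (auto simp: sources_def)
    also have "\<dots> = (LINT y|lborel. f (of_real t) y)"
    proof (rule Bochner_Integration.integral_cong[OF refl])
      fix y
      show "(\<Sum>i\<in>UNIV. ((\<Sum>c\<in>sources False ?x. fund k (dsq c y)) * p i y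
        - w y * (\<Sum>c\<in>sources False ?x. of_real (2 * (y - c) $ i) * fund1 k (dsq c y))) * D\<eta> i y) = f (of_real t) y"
      proof (cases "y \<in> A")
        case False
        then show ?thesis by (simp add: D0 f_def)
      next
        case True
        have cs: "csqrt (vq x0 (of_real t) y) = of_real (sqrt (dsq ?x y))" unfolding vq_real by (simp add: csqrt_of_real_nonneg)
        have e0: "E0 (of_real t) y = fund k (dsq ?x y)" using True by (simp add: E0_def cs fund_def Let_def)
        have e1: "E1 i (of_real t) y = of_real (2 * (y - ?x) $ i) * fund1 k (dsq ?x y)" for i
          using True unfolding E1_def cs fund1_def Let_def by (simp add: axis_def)
        show ?thesis unfolding f_def e0 e1 by (simp add: sources_def sum_3 algebra_simps)
      qed
    qed
    finally have "of_real kappa * w ?x = (LINT y|lborel. f (of_real t) y)" .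
    then show ?thesis unfolding F_def using kappa_neg by (simp add: field_simps)
  qed
  ultimately show ?thesis using that by blast
qed

text \<open>Let \<open>a\<close> be the infimum of the heights above which \<open>w\<close> vanishes
  on the ray. Analyticity at height \<open>a\<close> carries the zeros below \<open>a\<close>, so
  that \<open>a = 0\<close>, and to the height \<open>a\<close> itself.\<close>

lemma vertical_unique_continuation:
  assumes D: "open D" and h: "helmholtz_C2 k D w p" and k: "k > 0"
    and ray: "\<And>s. s \<ge> 0 \<Longrightarrow> x + s *\<^sub>R axis 3 1 \<in> D"
    and far: "\<And>s. s \<ge> S \<Longrightarrow> w (x + s *\<^sub>R axis 3 1) = 0"
  shows "w x = 0"
proof -
  define Z where "Z = {s. s \<ge> 0 \<and> (\<forall>s'\<ge>s. w (x + s' *\<^sub>R axis 3 1) = 0)}"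
  have "max 0 S \<in> Z" using far by (simp add: Z_def)
  then have Zne: "Z \<noteq> {}" by blast
  have Zb: "bdd_below Z" by (rule bdd_belowI[of _ 0]) (simp add: Z_def)
  define a where "a = Inf Z"
  have a0: "a \<ge> 0" unfolding a_def by (rule cInf_greatest[OF Zne]) (simp add: Z_def)
  have above: "w (x + s *\<^sub>R axis 3 1) = 0" if sa: "s > a" for s
  proof -
    obtain z where "z \<in> Z" "z < s" using cInf_lessD[OF Zne, of s] sa unfolding a_def by blast
    then show ?thesis by (simp add: Z_def)
  qed
  define x0 where "x0 = x + a *\<^sub>R axis 3 1"
  have "x0 \<in> D" unfolding x0_def by (rule ray[OF a0])
  then obtain e where e: "e > 0" "cball x0 e \<subseteq> D" using D open_contains_cball by blast
  define \<delta> where "\<delta> = e / 2"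
  have \<delta>: "\<delta> > 0" "cball x0 (2 * \<delta>) \<subseteq> D" using e by (auto simp: \<delta>_def)
  obtain F where F: "F holomorphic_on ball 0 (\<delta> / 4)" "\<And>t. \<bar>t\<bar> < \<delta> / 4 \<Longrightarrow> w (x0 + t *\<^sub>R axis 3 1) = F (complex_of_real t)"
    using holomorphic_along_vertical[OF D h k \<delta>] by blast
  have x0t: "x0 + t *\<^sub>R axis 3 1 = x + (a + t) *\<^sub>R axis 3 1" for t by (simp add: x0_def algebra_simps)
  let ?U = "complex_of_real ` {0<..<\<delta> / 4}"
  have F0: "F z = 0" if "z \<in> ball 0 (\<delta> / 4)" for z
  proof (rule analytic_continuation[OF F(1), of ?U 0])
    show "?U \<subseteq> ball 0 (\<delta> / 4)" by auto
    show "0 islimpt ?U"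
      unfolding islimpt_approachable
    proof (intro allI impI)
      fix r :: real assume r: "r > 0"
      have "complex_of_real (min (r / 2) (\<delta> / 8)) \<in> ?U" using r \<delta> by (intro imageI) auto
      moreover have "complex_of_real (min (r / 2) (\<delta> / 8)) \<noteq> 0" "dist (complex_of_real (min (r / 2) (\<delta> / 8))) 0 < r"
        using r \<delta> by (auto simp: min_def)
      ultimately show "\<exists>x'\<in>?U. x' \<noteq> 0 \<and> dist x' 0 < r" by blast
    qed
    show "F z = 0" if zU: "z \<in> ?U" for z
    proof -
      obtain t where t: "z = of_real t" "0 < t" "t < \<delta> / 4" using zU by auto
      then show ?thesis using F(2)[of t] above[of "a + t"] x0t[of t] by simp
    qed
  qed (use \<delta> that in auto)
  have near: "w (x + (a + t) *\<^sub>R axis 3 1) = 0" if "\<bar>t\<bar> < \<delta> / 4" for t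
    using F(2)[OF that] F0[of "of_real t"] that x0t[of t] by simp
  show ?thesis
  proof (cases "a = 0")
    case True
    then show ?thesis using near[of 0] \<delta> by simp
  next
    case False
    \<comment> \<open>A smaller height inside the disc of analyticity, clipped at 0 to stay on the
      ray.\<close>
    define b where "b = max 0 (a - \<delta> / 8)"
    have b: "b \<ge> 0" "b < a" "b \<ge> a - \<delta> / 8" using False a0 \<delta> by (auto simp: b_def)
    have "w (x + s *\<^sub>R axis 3 1) = 0" if "s \<ge> b" for s
    proof (cases "s > a")
      case False
      then have "\<bar>s - a\<bar> < \<delta> / 4" using that b \<delta> by (auto simp: abs_less_iff)
      from near[OF this] show ?thesis by simp
    qed (rule above)
    then have "b \<in> Z" using b by (simp add: Z_def)
    then have "a \<le> b" unfolding a_def by (rule cInf_lower[OF _ Zb])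
    then show ?thesis using b by simp
  qed
qed

section \<open>Directional derivatives\<close>

lemma partial_increment:
  fixes u :: "real^3 \<Rightarrow> complex"
  assumes u: "has_partial_on u i q S" and c: "\<And>s. \<bar>s\<bar> \<le> \<bar>b\<bar> \<Longrightarrow> z + s *\<^sub>R axis i 1 \<in> S \<and> cmod (q (z + s *\<^sub>R axis i 1) - c) \<le> e"
  shows "cmod (u (z + b *\<^sub>R axis i 1) - u z - b *\<^sub>R c) \<le> e * \<bar>b\<bar>"
proof -
  let ?f = "\<lambda>s. u (z + s *\<^sub>R axis i 1) - s *\<^sub>R c"
  have d: "(?f has_vector_derivative q (z + s *\<^sub>R axis i 1) - c) (at s)" if "\<bar>s\<bar> \<le> \<bar>b\<bar>" for s
    using has_partial_on_line[OF u, of z s] c[OF that] by (auto intro!: derivative_eq_intros)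
  show ?thesis
  proof (cases "b \<ge> 0")
    case True
    have "norm (?f b - ?f 0) \<le> e * (b - 0)"
      by (rule norm_diff_le_of_vector_derivative[OF True d]) (use c True in auto)
    then show ?thesis using True by (simp add: algebra_simps)
  next
    case False
    then have b: "b \<le> 0" by simp
    have "norm (?f 0 - ?f b) \<le> e * (0 - b)"
      by (rule norm_diff_le_of_vector_derivative[OF b d]) (use c False in auto)
    then show ?thesis using False by (simp add: norm_minus_commute algebra_simps)
  qed
qed

text \<open>\<open>helmholtz_C2\<close> provides partial derivatives only, while the Sommerfeld
  condition concerns a radial one. Since the partial derivatives are continuous, the increment can
  be split into three moves along the axes, each estimated by the mean value inequality.\<close>

lemma directional_derivative:
  fixes u :: "real^3 \<Rightarrow> complex"
  assumes S: "open S" and u: "\<And>i. has_partial_on u i (p i) S" "\<And>i. continuous_on S (p i)" and x: "x \<in> S"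
  shows "((\<lambda>t. u (x + t *\<^sub>R v)) has_vector_derivative (\<Sum>i\<in>UNIV. of_real (v $ i) * p i x)) (at 0)"
proof (rule has_vector_derivative_of_quotient)
  \<comment> \<open>The sum of the components bounds the total length of the three moves; the
    summand 1 covers the case \<open>v = 0\<close>.\<close>
  define N where "N = \<bar>v $ 1\<bar> + \<bar>v $ 2\<bar> + \<bar>v $ 3\<bar> + 1"
  have N: "N > 0" by (simp add: N_def add_nonneg_pos)
  let ?L = "\<Sum>i\<in>UNIV. of_real (v $ i) * p i x"
  show "((\<lambda>t. (u (x + t *\<^sub>R v) - u (x + 0 *\<^sub>R v)) /\<^sub>R t) \<longlongrightarrow> ?L) (at 0)"
    unfolding LIM_eq
  proof (intro allI impI)
    fix r :: real assume r: "r > 0"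
    define e where "e = r / (2 * N)"
    have e: "e > 0" using r N by (simp add: e_def)
    have "\<forall>i. \<exists>d>0. \<forall>y. dist y x < d \<longrightarrow> y \<in> S \<and> dist (p i y) (p i x) < e"
    proof
      fix i
      have "isCont (p i) x" using u(2) S x by (simp add: continuous_on_eq_continuous_at)
      then obtain d1 where d1: "d1 > 0" "\<And>y. dist y x < d1 \<Longrightarrow> dist (p i y) (p i x) < e"
        unfolding continuous_at_eps_delta using e by blast
      obtain d2 where d2: "d2 > 0" "\<And>y. dist y x < d2 \<Longrightarrow> y \<in> S" using S x unfolding open_dist by blast
      show "\<exists>d>0. \<forall>y. dist y x < d \<longrightarrow> y \<in> S \<and> dist (p i y) (p i x) < e"
        using d1 d2 by (intro exI[of _ "min d1 d2"]) auto
    qed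
    then obtain d where d: "\<And>i. d i > 0" "\<And>i y. dist y x < d i \<Longrightarrow> y \<in> S \<and> dist (p i y) (p i x) < e" by metis
    define d0 where "d0 = Min (range d)"
    have d0: "d0 > 0" "\<And>i. d0 \<le> d i" using d(1) by (auto simp: d0_def)
    have "norm ((u (x + t *\<^sub>R v) - u (x + 0 *\<^sub>R v)) /\<^sub>R t - ?L) < r" if t: "t \<noteq> 0" "norm (t - 0) < d0 / N" for t
    proof -
      have tN: "\<bar>t\<bar> * N < d0" using t(2) N by (simp add: pos_less_divide_eq)
      let ?z1 = "x" and ?z2 = "x + (t * v $ 1) *\<^sub>R axis 1 1" and ?z3 = "x + (t * v $ 1) *\<^sub>R axis 1 1 + (t * v $ 2) *\<^sub>R axis 2 1"
      have step: "z + s *\<^sub>R axis i 1 \<in> S \<and> cmod (p i (z + s *\<^sub>R axis i 1) - p i x) \<le> e"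
        if "norm (z + s *\<^sub>R axis i 1 - x) \<le> \<bar>t\<bar> * N" for z s i
        using d(2)[of "z + s *\<^sub>R axis i 1" i] that tN d0(2)[of i] by (force simp: dist_norm)
      have n1: "norm (a *\<^sub>R axis i (1::real) :: real^3) = \<bar>a\<bar>" for a i by simp
      have N1: "\<bar>t\<bar> * \<bar>v $ 1\<bar> + \<bar>t\<bar> * \<bar>v $ 2\<bar> + \<bar>t\<bar> * \<bar>v $ 3\<bar> \<le> \<bar>t\<bar> * N" by (simp add: N_def algebra_simps)
      have p3: "0 \<le> \<bar>t\<bar> * \<bar>v $ i\<bar>" for i by simp
      have 1: "cmod (u (?z1 + (t * v $ 1) *\<^sub>R axis 1 1) - u ?z1 - (t * v $ 1) *\<^sub>R p 1 x) \<le> e * \<bar>t * v $ 1\<bar>"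
      proof (rule partial_increment[OF u(1)], rule step)
        fix s assume "\<bar>s\<bar> \<le> \<bar>t * v $ 1\<bar>"
        then have "\<bar>s\<bar> \<le> \<bar>t\<bar> * \<bar>v $ 1\<bar>" by (simp add: abs_mult)
        moreover have "norm (?z1 + s *\<^sub>R axis 1 1 - x) = \<bar>s\<bar>" using n1[of s 1] by simp
        ultimately show "norm (?z1 + s *\<^sub>R axis 1 1 - x) \<le> \<bar>t\<bar> * N" using N1 p3[of 2] p3[of 3] by linarith
      qed
      have 2: "cmod (u (?z2 + (t * v $ 2) *\<^sub>R axis 2 1) - u ?z2 - (t * v $ 2) *\<^sub>R p 2 x) \<le> e * \<bar>t * v $ 2\<bar>"
      proof (rule partial_increment[OF u(1)], rule step)
        fix s assume "\<bar>s\<bar> \<le> \<bar>t * v $ 2\<bar>"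
        then have "\<bar>s\<bar> \<le> \<bar>t\<bar> * \<bar>v $ 2\<bar>" by (simp add: abs_mult)
        moreover have "norm (?z2 + s *\<^sub>R axis 2 1 - x) \<le> \<bar>t\<bar> * \<bar>v $ 1\<bar> + \<bar>s\<bar>"
          using norm_triangle_ineq[of "(t * v $ 1) *\<^sub>R axis 1 (1::real) :: real^3" "s *\<^sub>R axis 2 1"] n1[of s 2] n1[of "t * v $ 1" 1] by (simp add: abs_mult)
        ultimately show "norm (?z2 + s *\<^sub>R axis 2 1 - x) \<le> \<bar>t\<bar> * N" using N1 p3[of 3] by linarith
      qed
      have 3: "cmod (u (?z3 + (t * v $ 3) *\<^sub>R axis 3 1) - u ?z3 - (t * v $ 3) *\<^sub>R p 3 x) \<le> e * \<bar>t * v $ 3\<bar>"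
      proof (rule partial_increment[OF u(1)], rule step)
        fix s assume "\<bar>s\<bar> \<le> \<bar>t * v $ 3\<bar>"
        then have "\<bar>s\<bar> \<le> \<bar>t\<bar> * \<bar>v $ 3\<bar>" by (simp add: abs_mult)
        moreover have "norm (?z3 + s *\<^sub>R axis 3 1 - x) \<le> \<bar>t\<bar> * \<bar>v $ 1\<bar> + \<bar>t\<bar> * \<bar>v $ 2\<bar> + \<bar>s\<bar>"
          using norm_triangle_ineq[of "(t * v $ 1) *\<^sub>R axis 1 (1::real) + (t * v $ 2) *\<^sub>R axis 2 1 :: real^3" "s *\<^sub>R axis 3 1"]
            norm_triangle_ineq[of "(t * v $ 1) *\<^sub>R axis 1 (1::real) :: real^3" "(t * v $ 2) *\<^sub>R axis 2 1"]
            n1[of s 3] n1[of "t * v $ 1" 1] n1[of "t * v $ 2" 2] by (simp add: abs_mult add.assoc)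
        ultimately show "norm (?z3 + s *\<^sub>R axis 3 1 - x) \<le> \<bar>t\<bar> * N" using N1 by linarith
      qed
      have xv: "x + t *\<^sub>R v = ?z3 + (t * v $ 3) *\<^sub>R axis 3 1" by (simp add: vec_eq_iff forall_3 axis_def)
      have dec: "u (x + t *\<^sub>R v) - u x - t *\<^sub>R ?L =
        (u (?z1 + (t * v $ 1) *\<^sub>R axis 1 1) - u ?z1 - (t * v $ 1) *\<^sub>R p 1 x)
        + (u (?z2 + (t * v $ 2) *\<^sub>R axis 2 1) - u ?z2 - (t * v $ 2) *\<^sub>R p 2 x)
        + (u (?z3 + (t * v $ 3) *\<^sub>R axis 3 1) - u ?z3 - (t * v $ 3) *\<^sub>R p 3 x)"
        unfolding xv by (simp add: sum_3 scaleR_conv_of_real algebra_simps)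
      have "cmod (u (x + t *\<^sub>R v) - u x - t *\<^sub>R ?L) \<le> e * \<bar>t * v $ 1\<bar> + e * \<bar>t * v $ 2\<bar> + e * \<bar>t * v $ 3\<bar>"
        unfolding dec by (rule norm_triangle_mono[OF norm_triangle_mono[OF 1 2] 3])
      also have "\<dots> = e * (\<bar>t\<bar> * \<bar>v $ 1\<bar> + \<bar>t\<bar> * \<bar>v $ 2\<bar> + \<bar>t\<bar> * \<bar>v $ 3\<bar>)" by (simp add: abs_mult algebra_simps)
      also have "\<dots> \<le> e * (\<bar>t\<bar> * N)" using N1 e by (intro mult_left_mono) auto
      finally have b: "cmod (u (x + t *\<^sub>R v) - u x - t *\<^sub>R ?L) \<le> \<bar>t\<bar> * (e * N)" by (simp add: mult_ac)
      have "(u (x + t *\<^sub>R v) - u (x + 0 *\<^sub>R v)) /\<^sub>R t - ?L = inverse t *\<^sub>R (u (x + t *\<^sub>R v) - u x - t *\<^sub>R ?L)"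
        using t(1) by (simp add: scaleR_diff_right)
      then have "norm ((u (x + t *\<^sub>R v) - u (x + 0 *\<^sub>R v)) /\<^sub>R t - ?L) = cmod (u (x + t *\<^sub>R v) - u x - t *\<^sub>R ?L) / \<bar>t\<bar>"
        by (simp only: norm_scaleR abs_inverse divide_inverse_commute)
      also have "\<dots> \<le> e * N" using b t(1) by (simp add: pos_divide_le_eq mult.commute)
      also have "\<dots> < r" using r N by (simp add: e_def)
      finally show ?thesis .
    qed
    then show "\<exists>s>0. \<forall>x'. x' \<noteq> 0 \<and> norm (x' - 0) < s \<longrightarrow> norm ((u (x + x' *\<^sub>R v) - u (x + 0 *\<^sub>R v)) /\<^sub>R x' - ?L) < r"
      using d0(1) N by (intro exI[of _ "d0 / N"]) auto
  qed
qed

section \<open>Surfaces and the difference of two scattered fields\<close>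

lemma continuous_on_horiz: "continuous_on S horiz"
  unfolding horiz_def vector_def
proof (rule continuous_on_vec_lambda)
  fix i :: 2
  show "continuous_on S (\<lambda>x::real^3. foldr (\<lambda>x f n. (f (n + 1))(n := x)) [x $ 1, x $ 2] (\<lambda>n x. 0) 1 i)"
    by (cases "i = 1"; cases "i = 2") (simp_all add: fun_upd_def continuous_intros)
qed

lemma norm_horiz: "(norm x)\<^sup>2 = (norm (horiz x))\<^sup>2 + (x $ 3)\<^sup>2"
  by (simp add: horiz_def norm_vec_def L2_set_def sum_2 sum_3 sum_nonneg)

lemma horiz_vertical [simp]: "horiz (x + s *\<^sub>R axis 3 1) = horiz x"
  by (simp add: horiz_def axis_def)

lemma open_region:
  assumes "locally_perturbed f"
  shows "open (region f)"
proof -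
  obtain L where "L-lipschitz_on UNIV f" using assms by (auto simp: locally_perturbed_def)
  then have "continuous_on UNIV f" by (rule lipschitz_on_continuous_on)
  then have "continuous_on UNIV (\<lambda>x. f (horiz x))"
    by (rule continuous_on_compose2[OF _ continuous_on_horiz]) auto
  then show ?thesis unfolding region_def by (intro open_Collect_less continuous_intros)
qed

text \<open>Beyond \<open>2 * R\<close> either the horizontal part exceeds \<open>R\<close>, where
  \<open>f\<close> vanishes, or the height exceeds \<open>R\<close> in absolute value, so that
  \<open>f\<close> cannot change the side.\<close>

lemma region_exterior:
  assumes "locally_perturbed f"
  obtains R where "R > 0" "\<And>x. norm x > R \<Longrightarrow> x \<in> region f \<longleftrightarrow> x \<in> upper_half"
proof -
  obtain R where R: "\<And>y. \<bar>f y\<bar> < R" "\<And>y. norm y > R \<Longrightarrow> f y = 0"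
    using assms by (auto simp: locally_perturbed_def)
  have R0: "R > 0" using R(1)[of 0] by linarith
  have "x \<in> region f \<longleftrightarrow> x \<in> upper_half" if x: "norm x > 2 * R" for x
  proof (cases "norm (horiz x) > R")
    case True
    then show ?thesis using R(2) by (simp add: region_def upper_half_def)
  next
    case False
    have "(norm (horiz x))\<^sup>2 \<le> R\<^sup>2" using False by (intro power_mono) auto
    moreover have "(2 * R)\<^sup>2 < (norm x)\<^sup>2" using x R0 by (intro power_strict_mono) auto
    moreover have "(2 * R)\<^sup>2 = 4 * R\<^sup>2" "R\<^sup>2 > 0" using R0 by (auto simp: power_mult_distrib)
    ultimately have "R\<^sup>2 < (x $ 3)\<^sup>2" using norm_horiz[of x] by linarith
    then have "R < \<bar>x $ 3\<bar>" using R0 by (metis abs_of_pos abs_le_square_iff linorder_not_le)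
    then show ?thesis using R(1)[of "horiz x"] by (auto simp: region_def upper_half_def)
  qed
  with R0 show ?thesis by (intro that[of "2 * R"]) auto
qed

lemma helmholtz_C2_diff:
  assumes "helmholtz_C2 k S u p" "helmholtz_C2 k T v q"
  shows "helmholtz_C2 k (S \<inter> T) (\<lambda>x. u x - v x) (\<lambda>i x. p i x - q i x)"
proof -
  obtain a where a: "\<And>i j. has_partial_on (p i) j (a i j) S" "\<And>i j. continuous_on S (a i j)"
    "\<And>x. x \<in> S \<Longrightarrow> (\<Sum>i\<in>UNIV. a i i x) + of_real (k^2) * u x = 0"
    using assms(1) unfolding helmholtz_C2_def by blast
  obtain b where b: "\<And>i j. has_partial_on (q i) j (b i j) T" "\<And>i j. continuous_on T (b i j)"
    "\<And>x. x \<in> T \<Longrightarrow> (\<Sum>i\<in>UNIV. b i i x) + of_real (k^2) * v x = 0"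
    using assms(2) unfolding helmholtz_C2_def by blast
  have ic: "continuous_on (S \<inter> T) (\<lambda>x. f x - g x)" if "continuous_on S f" "continuous_on T g" for f g :: "real^3 \<Rightarrow> complex"
    using that by (intro continuous_on_diff) (auto intro: continuous_on_subset)
  have ip: "has_partial_on (\<lambda>x. f x - g x) i (\<lambda>x. f' x - g' x) (S \<inter> T)"
    if "has_partial_on f i f' S" "has_partial_on g i g' T" for f g f' g' :: "real^3 \<Rightarrow> complex" and i
    using that by (intro has_partial_on_diff) (auto intro: has_partial_on_subset)
  have "(\<Sum>i\<in>UNIV. a i i x - b i i x) + of_real (k^2) * (u x - v x) = 0" if "x \<in> S \<inter> T" for x
  proof -
    have "(\<Sum>i\<in>UNIV. a i i x - b i i x) + of_real (k^2) * (u x - v x)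
        = ((\<Sum>i\<in>UNIV. a i i x) + of_real (k^2) * u x) - ((\<Sum>i\<in>UNIV. b i i x) + of_real (k^2) * v x)"
      unfolding sum_subtractf right_diff_distrib by (simp only: diff_conv_add_uminus minus_add_distrib ac_simps)
    then show ?thesis using a(3)[of x] b(3)[of x] that by simp
  qed
  then show ?thesis
    unfolding helmholtz_C2_def using assms a b
    by (intro conjI allI exI[of _ "\<lambda>i j x. a i j x - b i j x"] ballI ic ip) (auto simp: helmholtz_C2_def)
qed

lemma set_integrable_cmod_diff_sq:
  fixes f g :: "real^3 \<Rightarrow> complex"
  assumes S: "S \<in> sets lborel" "S \<subseteq> A" "S \<subseteq> B" and c: "continuous_on S f" "continuous_on S g"
    and A: "set_integrable lborel A (\<lambda>x. (cmod (f x))\<^sup>2)" and B: "set_integrable lborel B (\<lambda>x. (cmod (g x))\<^sup>2)"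
  shows "set_integrable lborel S (\<lambda>x. (cmod (f x - g x))\<^sup>2)"
proof (rule set_integrable_bound)
  show "set_integrable lborel S (\<lambda>x. 2 * (cmod (f x))\<^sup>2 + 2 * (cmod (g x))\<^sup>2)"
    using set_integrable_subset[OF A S(1,2)] set_integrable_subset[OF B S(1,3)]
    by (intro set_integral_add set_integrable_mult_right) auto
  have "continuous_on S (\<lambda>x. (cmod (f x - g x))\<^sup>2)" by (intro continuous_intros c)
  then show "set_borel_measurable lborel S (\<lambda>x. (cmod (f x - g x))\<^sup>2)"
    using borel_measurable_continuous_on_indicator[of S "\<lambda>x. (cmod (f x - g x))\<^sup>2"] S(1)
    by (simp add: set_borel_measurable_def del: real_scaleR_def)
  have "(cmod (f x - g x))\<^sup>2 \<le> 2 * (cmod (f x))\<^sup>2 + 2 * (cmod (g x))\<^sup>2" for x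
  proof -
    have "(cmod (f x - g x))\<^sup>2 \<le> (cmod (f x) + cmod (g x))\<^sup>2" by (intro power_mono norm_triangle_ineq4) auto
    then show ?thesis using sum_squares_bound[of "cmod (f x)" "cmod (g x)"] by (simp add: power2_sum)
  qed
  then show "AE x in lborel. x \<in> S \<longrightarrow> norm ((cmod (f x - g x))\<^sup>2) \<le> norm (2 * (cmod (f x))\<^sup>2 + 2 * (cmod (g x))\<^sup>2)"
    by (intro AE_I2) auto
qed

text \<open>\<open>radial_deriv\<close> is defined by \<open>vector_derivative\<close>, which is
  meaningful only once differentiability is known. It is obtained here from the total fields, which
  are C1, and from the common part \<open>h\<close>, whose derivative cancels in the
  difference.\<close>

lemma radial_deriv_diff:
  assumes k: "open S" "\<And>i. has_partial_on u1 i (p1 i) S" "\<And>i. continuous_on S (p1 i)"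
     "\<And>i. has_partial_on u2 i (p2 i) S" "\<And>i. continuous_on S (p2 i)" and x: "x \<in> S" "x \<noteq> 0"
    and u: "\<And>y. u1 y = h y + v1 y" "\<And>y. u2 y = h y + v2 y"
    and h: "(\<lambda>t. h (t *\<^sub>R sgn x)) differentiable at (norm x)"
  shows "of_real (norm x) * (radial_deriv v1 x - radial_deriv v2 x) = (\<Sum>i\<in>UNIV. of_real (x $ i) * (p1 i x - p2 i x))"
proof -
  have sx: "norm x *\<^sub>R sgn x = x" using x(2) by (simp add: sgn_div_norm)
  obtain h' where h': "((\<lambda>t. h (t *\<^sub>R sgn x)) has_vector_derivative h') (at (norm x))"
    using h vector_derivative_works by blast
  have ray: "((\<lambda>t. a (t *\<^sub>R sgn x)) has_vector_derivative (\<Sum>i\<in>UNIV. of_real (sgn x $ i) * q i x)) (at (norm x))"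
    if "\<And>i. has_partial_on a i (q i) S" "\<And>i. continuous_on S (q i)" for a :: "real^3 \<Rightarrow> complex" and q
  proof -
    have "((\<lambda>t. a (x + t *\<^sub>R sgn x)) has_vector_derivative (\<Sum>i\<in>UNIV. of_real (sgn x $ i) * q i x)) (at (norm x - norm x))"
      using directional_derivative[OF k(1) that x(1)] by simp
    then have "(((\<lambda>t. a (x + t *\<^sub>R sgn x)) \<circ> (\<lambda>t. t - norm x)) has_vector_derivative 1 *\<^sub>R (\<Sum>i\<in>UNIV. of_real (sgn x $ i) * q i x)) (at (norm x))"
      by (intro vector_diff_chain_at) (auto intro!: derivative_eq_intros)
    moreover have "x + (t - norm x) *\<^sub>R sgn x = t *\<^sub>R sgn x" for t using sx by (simp add: algebra_simps)
    ultimately show ?thesis by (simp add: o_def)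
  qed
  have rd: "radial_deriv v x = (\<Sum>i\<in>UNIV. of_real (sgn x $ i) * q i x) - h'"
    if "\<And>i. has_partial_on a i (q i) S" "\<And>i. continuous_on S (q i)" "\<And>y. a y = h y + v y" for a :: "real^3 \<Rightarrow> complex" and q v
  proof -
    have "((\<lambda>t. a (t *\<^sub>R sgn x) - h (t *\<^sub>R sgn x)) has_vector_derivative (\<Sum>i\<in>UNIV. of_real (sgn x $ i) * q i x) - h') (at (norm x))"
      by (intro has_vector_derivative_diff ray that(1,2) h')
    then show ?thesis unfolding radial_deriv_def by (intro vector_derivative_at) (simp add: that(3))
  qed
  have "of_real (norm x) * of_real (sgn x $ i) = (of_real (x $ i) :: complex)" for i
    using x(2) by (simp add: sgn_div_norm flip: of_real_mult)
  then show ?thesis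
    unfolding rd[OF k(2,3) u(1)] rd[OF k(4,5) u(2)]
    by (simp add: sum_subtractf right_diff_distrib sum_distrib_left mult.assoc[symmetric])
qed

text \<open>Beyond \<open>R\<close> both regions coincide with the upper half space. For test
  functions supported there the two variational identities are integrals over the same set and can
  be subtracted.\<close>

lemma half_exterior_diff:
  fixes u1 u2 :: "real^3 \<Rightarrow> complex" and p1 p2 :: "3 \<Rightarrow> real^3 \<Rightarrow> complex"
  defines "w x \<equiv> if x \<in> upper_half then u1 x - u2 x else 0"
    and "p i x \<equiv> if x \<in> upper_half then p1 i x - p2 i x else 0"
  assumes k: "k > 0" "R > 0"
    and S: "\<And>x. norm x > R \<Longrightarrow> x \<in> S1 \<longleftrightarrow> x \<in> upper_half" "\<And>x. norm x > R \<Longrightarrow> x \<in> S2 \<longleftrightarrow> x \<in> upper_half"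
    and 1: "helmholtz_C2 k S1 u1 p1" "weak_neumann k S1 u1 p1"
    and 2: "helmholtz_C2 k S2 u2 p2" "weak_neumann k S2 u2 p2"
    and rad: "\<And>e. e > 0 \<Longrightarrow> \<exists>\<rho>. \<forall>x\<in>upper_half. norm x > \<rho> \<longrightarrow>
       cmod ((\<Sum>i\<in>UNIV. of_real (x $ i) * (p1 i x - p2 i x)) - \<i> * of_real (k * norm x) * (u1 x - u2 x)) < e"
  shows "half_exterior k R w p"
proof -
  let ?E = "{x::real^3. norm x > R}"
  have E: "open ?E" by (intro open_Collect_less continuous_intros)
  then have UE: "open (upper_half \<inter> ?E)" using open_upper_half by auto
  have sub: "upper_half \<inter> ?E \<subseteq> S1" "upper_half \<inter> ?E \<subseteq> S2" using S by auto
  note h1 = 1(1)[unfolded helmholtz_C2_def] and h2 = 2(1)[unfolded helmholtz_C2_def]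
  have c: "continuous_on (upper_half \<inter> ?E) u1" "continuous_on (upper_half \<inter> ?E) u2"
      "\<And>i. continuous_on (upper_half \<inter> ?E) (p1 i)" "\<And>i. continuous_on (upper_half \<inter> ?E) (p2 i)"
    using h1 h2 sub by (auto intro: continuous_on_subset)
  have hp: "has_partial_on u1 i (p1 i) (upper_half \<inter> ?E)" "has_partial_on u2 i (p2 i) (upper_half \<inter> ?E)" for i
    using h1 h2 sub by (auto intro: has_partial_on_subset)
  have u: "continuous_on (upper_half \<inter> ?E) (\<lambda>x. u1 x - u2 x)" "\<And>i. continuous_on (upper_half \<inter> ?E) (\<lambda>x. p1 i x - p2 i x)"
    "\<And>i. has_partial_on (\<lambda>x. u1 x - u2 x) i (\<lambda>x. p1 i x - p2 i x) (upper_half \<inter> ?E)"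
    by (auto intro!: continuous_intros c has_partial_on_diff hp)
  have sq: "set_integrable lborel (upper_half \<inter> ?E \<inter> ball 0 r) (\<lambda>x. (cmod (a x - b x))\<^sup>2)"
    if "continuous_on (upper_half \<inter> ?E) a" "continuous_on (upper_half \<inter> ?E) b"
      "set_integrable lborel (S1 \<inter> ball 0 r) (\<lambda>x. (cmod (a x))\<^sup>2)" "set_integrable lborel (S2 \<inter> ball 0 r) (\<lambda>x. (cmod (b x))\<^sup>2)"
    for a b :: "real^3 \<Rightarrow> complex" and r
    using that(1,2) sub UE
    by (intro set_integrable_cmod_diff_sq[OF _ _ _ _ _ that(3,4)]) (auto intro: continuous_on_subset)
  have L2: "set_integrable lborel (upper_half \<inter> ?E \<inter> ball 0 r) (\<lambda>x. (cmod (u1 x - u2 x))\<^sup>2)"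
    "set_integrable lborel (upper_half \<inter> ?E \<inter> ball 0 r) (\<lambda>x. (cmod (p1 i x - p2 i x))\<^sup>2)" if "r > 0" for r i
    using 1(2) 2(2) that unfolding weak_neumann_def by (auto intro!: sq c)
  have ext: "(LINT x:T|lborel. (\<Sum>i\<in>UNIV. q i x * of_real (D\<phi> i x)) - of_real (k^2) * v x * of_real (\<phi> x))
      = (LINT x:upper_half|lborel. (\<Sum>i\<in>UNIV. q i x * of_real (D\<phi> i x)) - of_real (k^2) * v x * of_real (\<phi> x))"
    "set_integrable lborel T (\<lambda>x. (\<Sum>i\<in>UNIV. q i x * of_real (D\<phi> i x)) - of_real (k^2) * v x * of_real (\<phi> x)) \<longleftrightarrow>
     set_integrable lborel upper_half (\<lambda>x. (\<Sum>i\<in>UNIV. q i x * of_real (D\<phi> i x)) - of_real (k^2) * v x * of_real (\<phi> x))"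
    if \<phi>: "test_fun \<phi> D\<phi>" and K: "compact K" "K \<subseteq> ?E" "\<And>x. x \<notin> K \<Longrightarrow> \<phi> x = 0"
      and T: "\<And>x. norm x > R \<Longrightarrow> x \<in> T \<longleftrightarrow> x \<in> upper_half" for \<phi> D\<phi> K T and v :: "real^3 \<Rightarrow> complex" and q
  proof -
    let ?g = "\<lambda>x. (\<Sum>i\<in>UNIV. q i x * of_real (D\<phi> i x)) - of_real (k^2) * v x * of_real (\<phi> x)"
    have "D\<phi> i x = 0" if "x \<notin> K" for i x
      using \<phi> partial_zero_outside[of \<phi> i "D\<phi> i" K x] compact_imp_closed[OF K(1)] K(3) that by (auto simp: test_fun_def)
    then have "?g x = 0" if "x \<notin> K" for x using K(3) that by simp
    then have "indicator T x *\<^sub>R ?g x = indicator upper_half x *\<^sub>R ?g x" for x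
      using T[of x] K(2) by (cases "x \<in> K") (auto simp: indicator_def)
    then show "(LINT x:T|lborel. ?g x) = (LINT x:upper_half|lborel. ?g x)"
      "set_integrable lborel T ?g \<longleftrightarrow> set_integrable lborel upper_half ?g"
      unfolding set_lebesgue_integral_def set_integrable_def by presburger+
  qed
  interpret weak_helmholtz k ?E w p True
  proof (rule weak_helmholtz_half_space[OF E u(1) u(3) u(2) _ _ L2])
    fix \<phi> D\<phi> K assume \<phi>: "test_fun \<phi> D\<phi>" and K: "compact K" "K \<subseteq> ?E" "\<And>x. x \<notin> K \<Longrightarrow> \<phi> x = 0"
    let ?g1 = "\<lambda>x. (\<Sum>i\<in>UNIV. p1 i x * of_real (D\<phi> i x)) - of_real (k^2) * u1 x * of_real (\<phi> x)"
    let ?g2 = "\<lambda>x. (\<Sum>i\<in>UNIV. p2 i x * of_real (D\<phi> i x)) - of_real (k^2) * u2 x * of_real (\<phi> x)"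
    have g1: "set_integrable lborel S1 ?g1" "(LINT x:S1|lborel. ?g1 x) = 0"
      using 1(2) \<phi> unfolding weak_neumann_def Let_def by blast+
    have g2: "set_integrable lborel S2 ?g2" "(LINT x:S2|lborel. ?g2 x) = 0"
      using 2(2) \<phi> unfolding weak_neumann_def Let_def by blast+
    have e1: "(LINT x:S1|lborel. ?g1 x) = (LINT x:upper_half|lborel. ?g1 x)"
        "set_integrable lborel S1 ?g1 \<longleftrightarrow> set_integrable lborel upper_half ?g1"
      by (rule ext[OF \<phi> K(1,2)], erule K(3), erule S(1))+
    have e2: "(LINT x:S2|lborel. ?g2 x) = (LINT x:upper_half|lborel. ?g2 x)"
        "set_integrable lborel S2 ?g2 \<longleftrightarrow> set_integrable lborel upper_half ?g2"
      by (rule ext[OF \<phi> K(1,2)], erule K(3), erule S(2))+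
    have "(\<Sum>i\<in>UNIV. p i x * of_real (D\<phi> i x)) - of_real (k^2) * w x * of_real (\<phi> x) = indicator upper_half x *\<^sub>R (?g1 x - ?g2 x)" for x
    proof (cases "x \<in> upper_half")
      case True
      have "(\<Sum>i\<in>UNIV. (p1 i x - p2 i x) * of_real (D\<phi> i x)) = (\<Sum>i\<in>UNIV. p1 i x * of_real (D\<phi> i x)) - (\<Sum>i\<in>UNIV. p2 i x * of_real (D\<phi> i x))"
        by (simp add: left_diff_distrib sum_subtractf)
      then show ?thesis using True by (simp add: w_def p_def) (simp add: algebra_simps)
    qed (simp add: w_def p_def)
    then have "(LINT x|lborel. (\<Sum>i\<in>UNIV. p i x * of_real (D\<phi> i x)) - of_real (k^2) * w x * of_real (\<phi> x))
        = (LINT x:upper_half|lborel. ?g1 x - ?g2 x)"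
      unfolding set_lebesgue_integral_def by presburger
    also have "\<dots> = (LINT x:upper_half|lborel. ?g1 x) - (LINT x:upper_half|lborel. ?g2 x)"
      by (rule set_integral_diff(2)[OF e1(2)[THEN iffD1, OF g1(1)] e2(2)[THEN iffD1, OF g2(1)]])
    also have "\<dots> = 0" unfolding e1(1)[symmetric] e2(1)[symmetric] g1(2) g2(2) by simp
    finally show "(LINT x|lborel. (\<Sum>i\<in>UNIV. p i x * of_real (D\<phi> i x)) - of_real (k^2) * w x * of_real (\<phi> x)) = 0" .
  qed (auto simp: w_def p_def)
  have Ksq: "set_integrable lborel K (\<lambda>x. (cmod (v x))\<^sup>2)"
    if K: "compact K" "K \<subseteq> ?E" and v: "\<And>x. v x = (if x \<in> upper_half then a x else 0)"
      "\<And>r. r > 0 \<Longrightarrow> set_integrable lborel (upper_half \<inter> ?E \<inter> ball 0 r) (\<lambda>x. (cmod (a x))\<^sup>2)" for K v and a :: "real^3 \<Rightarrow> complex"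
  proof -
    obtain r where r: "r > 0" "K \<subseteq> ball 0 r"
      using bounded_subset_ballD[OF compact_imp_bounded[OF K(1)], of 0] by blast
    have m: "upper_half \<inter> K \<in> sets lborel"
      using borel_open[OF open_upper_half] borel_compact[OF K(1)] by (simp add: sets.Int)
    have "set_integrable lborel (upper_half \<inter> K) (\<lambda>x. (cmod (a x))\<^sup>2)"
      by (rule set_integrable_subset[OF v(2)[OF r(1)] m]) (use r K in auto)
    moreover have "indicator K x *\<^sub>R (cmod (v x))\<^sup>2 = indicator (upper_half \<inter> K) x *\<^sub>R (cmod (a x))\<^sup>2" for x
      using v(1)[of x] by (auto simp: indicator_def)
    ultimately show ?thesis unfolding set_integrable_def by presburger
  qed
  show ?thesis
  proof
    show "continuous_on (upper_half \<inter> ?E) w" by (rule continuous_on_eq[OF u(1)]) (simp add: w_def)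
    show "continuous_on (upper_half \<inter> ?E) (p i)" for i by (rule continuous_on_eq[OF u(2)[of i]]) (simp add: p_def)
    show "has_partial_on w i (p i) (upper_half \<inter> ?E)" for i
      by (rule has_partial_on_cong[OF UE _ _ u(3)[of i]]) (auto simp: w_def p_def)
    show "set_integrable lborel K (\<lambda>x. (cmod (w x))\<^sup>2)" if "compact K" "K \<subseteq> ?E" for K
      by (rule Ksq[OF that w_def[THEN meta_eq_to_obj_eq] L2(1)])
    show "set_integrable lborel K (\<lambda>x. (cmod (p i x))\<^sup>2)" if "compact K" "K \<subseteq> ?E" for K i
      by (rule Ksq[OF that p_def[THEN meta_eq_to_obj_eq] L2(2)])
    fix e :: real assume "e > 0"
    from rad[OF this] show "\<exists>\<rho>. \<forall>x\<in>upper_half. norm x > \<rho> \<longrightarrow>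
        cmod ((\<Sum>i\<in>UNIV. of_real (x $ i) * p i x) - \<i> * of_real (k * norm x) * w x) < e"
      by (simp add: w_def p_def)
  qed (use k in \<open>auto simp: w_def p_def\<close>)
qed

lemma plane_waves_differentiable_ray:
  "(\<lambda>t. u_in k d (t *\<^sub>R v) + u_re_neumann k d (t *\<^sub>R v)) differentiable at r"
proof -
  have "((\<lambda>t. exp (\<i> * complex_of_real (k * (t * a)))) has_vector_derivative \<i> * of_real (k * a) * exp (\<i> * of_real (k * (r * a)))) (at r)" for a
  proof -
    have "((\<lambda>z. exp (\<i> * (of_real k * (z * of_real a)))) has_field_derivative \<i> * of_real (k * a) * exp (\<i> * of_real (k * (r * a)))) (at (complex_of_real r))"
      by (auto intro!: derivative_eq_intros)
    from has_vector_derivative_real_field[OF this] show ?thesis by simp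
  qed
  from differentiableI_vector[OF this]
  have "(\<lambda>t. exp (\<i> * complex_of_real (k * (t * (v \<bullet> d)))) + exp (\<i> * complex_of_real (k * (t * (d$1 * v$1 + d$2 * v$2 - d$3 * v$3))))) differentiable at r"
    by (intro differentiable_add)
  then show ?thesis by (simp add: u_in_def u_re_neumann_def algebra_simps)
qed

theorem mainTheorem7:
  fixes k :: real and f1 f2 :: "real^2 \<Rightarrow> real" and d :: "real^3"
    and usc1 usc2 F1 F2 :: "real^3 \<Rightarrow> complex"
  assumes "k > 0"
    and "locally_perturbed f1" and "locally_perturbed f2"
    and "d \<in> lower_sphere"
    and "neumann_scattered k f1 d usc1" and "neumann_scattered k f2 d usc2"
    and "has_far_field k usc1 F1" and "has_far_field k usc2 F2"
    and "\<forall>xh\<in>upper_sphere. F1 xh = F2 xh"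
  shows "\<forall>x\<in>region f1 \<inter> region f2. usc1 x = usc2 x"
proof
  fix x assume x: "x \<in> region f1 \<inter> region f2"
  \<comment> \<open>Equation and boundary condition are stated for the total fields. Both contain
    the same incident and reflected waves, so the difference of the total fields is that of the
    scattered ones.\<close>
  define h where "h x = u_in k d x + u_re_neumann k d x" for x
  define u1 u2 where "u1 x = h x + usc1 x" and "u2 x = h x + usc2 x" for x
  obtain p1 where 1: "helmholtz_C2 k (region f1) u1 p1" "weak_neumann k (region f1) u1 p1"
    using assms(5) unfolding neumann_scattered_def Let_def u1_def[abs_def] h_def by blast
  obtain p2 where 2: "helmholtz_C2 k (region f2) u2 p2" "weak_neumann k (region f2) u2 p2"
    using assms(6) unfolding neumann_scattered_def Let_def u2_def[abs_def] h_def by blast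
  have S1: "sommerfeld k (region f1) usc1" and S2: "sommerfeld k (region f2) usc2"
    using assms(5,6) by (simp_all add: neumann_scattered_def Let_def)
  obtain R1 where R1: "R1 > 0" "\<And>x. norm x > R1 \<Longrightarrow> x \<in> region f1 \<longleftrightarrow> x \<in> upper_half"
    using region_exterior[OF assms(2)] by blast
  obtain R2 where R2: "R2 > 0" "\<And>x. norm x > R2 \<Longrightarrow> x \<in> region f2 \<longleftrightarrow> x \<in> upper_half"
    using region_exterior[OF assms(3)] by blast
  define R where "R = max R1 R2"
  have R: "R > 0" "\<And>x. norm x > R \<Longrightarrow> x \<in> region f1 \<longleftrightarrow> x \<in> upper_half"
    "\<And>x. norm x > R \<Longrightarrow> x \<in> region f2 \<longleftrightarrow> x \<in> upper_half"
    using R1 R2 by (auto simp: R_def)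
  define D where "D = region f1 \<inter> region f2"
  have D: "open D" unfolding D_def using open_region assms(2,3) by blast
  have H: "helmholtz_C2 k D (\<lambda>x. u1 x - u2 x) (\<lambda>i x. p1 i x - p2 i x)"
    unfolding D_def by (rule helmholtz_C2_diff[OF 1(1) 2(1)])
  have pD: "has_partial_on u1 i (p1 i) D" "continuous_on D (p1 i)" "has_partial_on u2 i (p2 i) D" "continuous_on D (p2 i)" for i
    using 1(1) 2(1) unfolding helmholtz_C2_def D_def by (auto intro: continuous_on_subset has_partial_on_subset)
  have rad: "\<exists>\<rho>. \<forall>x\<in>upper_half. norm x > \<rho> \<longrightarrow>
       cmod ((\<Sum>i\<in>UNIV. of_real (x $ i) * (p1 i x - p2 i x)) - \<i> * of_real (k * norm x) * (u1 x - u2 x)) < e" if e: "e > 0" for e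
  proof -
    obtain \<rho>1 where \<rho>1: "\<And>x. x \<in> region f1 \<Longrightarrow> norm x > \<rho>1 \<Longrightarrow> norm x * cmod (radial_deriv usc1 x - \<i> * of_real k * usc1 x) < e / 2"
      using S1 e unfolding sommerfeld_def by (meson half_gt_zero)
    obtain \<rho>2 where \<rho>2: "\<And>x. x \<in> region f2 \<Longrightarrow> norm x > \<rho>2 \<Longrightarrow> norm x * cmod (radial_deriv usc2 x - \<i> * of_real k * usc2 x) < e / 2"
      using S2 e unfolding sommerfeld_def by (meson half_gt_zero)
    have "cmod ((\<Sum>i\<in>UNIV. of_real (y $ i) * (p1 i y - p2 i y)) - \<i> * of_real (k * norm y) * (u1 y - u2 y)) < e"
      if y: "y \<in> upper_half" "norm y > max R (max \<rho>1 \<rho>2)" for y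
    proof -
      have yr: "y \<in> region f1" "y \<in> region f2" "norm y > \<rho>1" "norm y > \<rho>2" using R(2,3)[of y] y by auto
      have y0: "y \<noteq> 0" "y \<in> D" using y R(1) yr by (auto simp: D_def)
      let ?a1 = "radial_deriv usc1 y - \<i> * of_real k * usc1 y" and ?a2 = "radial_deriv usc2 y - \<i> * of_real k * usc2 y"
      have hd: "(\<lambda>t. h (t *\<^sub>R sgn y)) differentiable at (norm y)"
        unfolding h_def by (rule plane_waves_differentiable_ray)
      have "(\<Sum>i\<in>UNIV. of_real (y $ i) * (p1 i y - p2 i y)) - \<i> * of_real (k * norm y) * (u1 y - u2 y)
          = of_real (norm y) * ?a1 - of_real (norm y) * ?a2"
        unfolding radial_deriv_diff[OF D pD y0(2,1) u1_def u2_def hd, symmetric] by (simp add: u1_def u2_def algebra_simps)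
      also have "cmod \<dots> \<le> norm y * cmod ?a1 + norm y * cmod ?a2"
        using norm_triangle_ineq4[of "of_real (norm y) * ?a1" "of_real (norm y) * ?a2"] unfolding norm_mult norm_of_real abs_norm_cancel .
      also have "\<dots> < e" using \<rho>1[OF yr(1,3)] \<rho>2[OF yr(2,4)] by simp
      finally show ?thesis .
    qed
    then show ?thesis by blast
  qed
  interpret half_exterior k R "\<lambda>x. if x \<in> upper_half then u1 x - u2 x else 0" "\<lambda>i x. if x \<in> upper_half then p1 i x - p2 i x else 0"
    by (rule half_exterior_diff[OF assms(1) R 1 2 rad])
  have far: "((\<lambda>r. of_real r * exp (- \<i> * of_real (k * r)) * (if r *\<^sub>R \<theta> \<in> upper_half then u1 (r *\<^sub>R \<theta>) - u2 (r *\<^sub>R \<theta>) else 0)) \<longlongrightarrow> 0) at_top"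
    if \<theta>: "\<theta> \<in> upper_sphere" for \<theta>
  proof -
    have "((\<lambda>r. of_real r * exp (- \<i> * of_real (k * r)) * usc1 (r *\<^sub>R \<theta>) - of_real r * exp (- \<i> * of_real (k * r)) * usc2 (r *\<^sub>R \<theta>)) \<longlongrightarrow> F1 \<theta> - F2 \<theta>) at_top"
      using assms(7,8) \<theta> unfolding has_far_field_def by (intro tendsto_diff) auto
    then have "((\<lambda>r. of_real r * exp (- \<i> * of_real (k * r)) * usc1 (r *\<^sub>R \<theta>) - of_real r * exp (- \<i> * of_real (k * r)) * usc2 (r *\<^sub>R \<theta>)) \<longlongrightarrow> 0) at_top"
      using assms(9) \<theta> by simp
    then show ?thesis
    proof (rule Lim_transform_eventually)
      show "\<forall>\<^sub>F r in at_top. of_real r * exp (- \<i> * of_real (k * r)) * usc1 (r *\<^sub>R \<theta>) - of_real r * exp (- \<i> * of_real (k * r)) * usc2 (r *\<^sub>R \<theta>)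
          = of_real r * exp (- \<i> * of_real (k * r)) * (if r *\<^sub>R \<theta> \<in> upper_half then u1 (r *\<^sub>R \<theta>) - u2 (r *\<^sub>R \<theta>) else 0)"
        using eventually_gt_at_top[of 0]
      proof eventually_elim
        case (elim r)
        then have "r *\<^sub>R \<theta> \<in> upper_half" using \<theta> by (simp add: upper_half_def upper_sphere_def)
        then show ?case by (simp add: u1_def u2_def right_diff_distrib)
      qed
    qed
  qed
  obtain \<rho> where \<rho>: "\<And>y. y \<in> upper_half \<Longrightarrow> norm y > \<rho> \<Longrightarrow> (if y \<in> upper_half then u1 y - u2 y else 0) = 0"
    using vanishing_at_infinity[OF far] by blast
  have "u1 x - u2 x = 0"
  proof (rule vertical_unique_continuation[OF D H assms(1)])
    show "x + s *\<^sub>R axis 3 1 \<in> D" if "s \<ge> 0" for s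
      using x that by (simp add: D_def region_def axis_nth)
    \<comment> \<open>The threshold makes the third coordinate exceed both 0 and
      \<open>\<rho>\<close>, so the point lies in the upper half and its norm exceeds
      \<open>\<rho>\<close>.\<close>
    show "u1 (x + s *\<^sub>R axis 3 1) - u2 (x + s *\<^sub>R axis 3 1) = 0" if s: "s \<ge> \<bar>\<rho>\<bar> + \<bar>x $ 3\<bar> + 1" for s
    proof -
      have "(x + s *\<^sub>R axis 3 1) $ 3 = x $ 3 + s" by (simp add: axis_def)
      then have "(x + s *\<^sub>R axis 3 1) $ 3 > 0" "(x + s *\<^sub>R axis 3 1) $ 3 > \<rho>" using s by linarith+
      moreover have "norm (x + s *\<^sub>R axis 3 1) \<ge> (x + s *\<^sub>R axis 3 1) $ 3"
        using component_le_norm_cart[of "x + s *\<^sub>R axis 3 1" 3] by linarith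
      ultimately show ?thesis using \<rho>[of "x + s *\<^sub>R axis 3 1"] by (simp add: upper_half_def)
    qed
  qed
  then show "usc1 x = usc2 x" by (simp add: u1_def u2_def)
qed

end
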